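(* Let $X$ be a quasi-diffusion process corresponding to $L$ and $T_tf(x)=E_xf(x_t)$. For $p\ge d_0$ and $f\in L_p(\mathbb R^d)$, $$\lim_{t\downarrow0}\|T_tf-f\|_{L_p(\mathbb R^d)}=0.$$
   Context: Fix the dimension $d$, $\delta\in(0,1)$ and a number denoted $\|b\|\in(0,\infty)$. $\mathbb S_\delta$ is the set of symmetric $d\times d$ matrices with eigenvalues in $[\delta,\delta^{-1}]$. $a:\mathbb R^d\to\mathbb S_\delta$ and $b:\mathbb R^d\to\mathbb R^d$ are Borel with $\|b\|_{L_d(\mathbb R^d)}\le\|b\|$ (the right side is the fixed number). $L=(1/2)a^{ij}(x)D_{ij}+b^i(x)D_i$, where $D_i=\partial/\partial x^i$, $D_{ij}=D_iD_j$, with summation over repeated indices. A quasi-diffusion process corresponding to $L$ is a continuous time-homogeneous Markov process $X=(x_t,\infty,\mathcal M_t,P_x)$ in $\mathbb R^d$ with infinite lifetime (in Dynkin's sense; $P_x$ is the law for the starting point $x$, $E_x$ the expectation) such that for any $x\in\mathbb R^d$, $t\ge0$, $E_x\int_0^t|b(x_s)|\,ds<\infty$ and, for any twice continuously differentiable compactly supported $u$, $u(x)=E_xu(x_t)-E_x\int_0^tLu(x_s)\,ds$. The constant $d_0=d_0(d,\delta,\|b\|)\in(d/2,d)$ is a fixed constant, known from earlier work of Krylov, with the following two properties for every (finite) $p\ge d_0$, every Borel $a:\mathbb R^d\to\mathbb S_\delta$, every Borel $b:\mathbb R^d\to\mathbb R^d$ with $\|b\|_{L_d(\mathbb R^d)}$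 not exceeding the fixed number $\|b\|$, every quasi-diffusion process $X$ corresponding to the operator $L$ with these coefficients, and every Borel $f\ge0$ on $\mathbb R^d$. Let $B_R=\{|x|<R\}$ and let $\tau_R$ be the first exit time of $x_t$ from $B_R$. (i) For all $R\in(0,\infty)$, $E_0\int_0^{\tau_R}f(x_t)\,dt\le NR^{2-d/p}\|f\|_{L_p(B_R)}$ with $N=N(p,d,\delta,\|b\|)$. (ii) There are $N,\mu'>0$ and $R_0\ge2$, depending only on $p,d,\delta,\|b\|$, such that for all $\lambda>0$, $R\in[0,\infty)$, $E_0\int_0^\infty e^{-\lambda\phi_t(B_R^c)}f(x_t)\,dt\le N(R\sqrt\lambda+R_0)^{2-d/p}\lambda^{d/(2p)-1}\|\Psi_{R,\lambda}^{-1}f\|_{L_p(\mathbb R^d)}$, where $\phi_t(\Gamma)=\int_0^tI_\Gamma(x_s)\,ds$ and $\Psi_{R,\lambda}(x)=\exp(\sqrt\lambda\,\mu'\,\mathrm{dist}(x,B_{R+R_0/\sqrt\lambda}))$. *)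

theory Defs
  imports "HOL-Probability.Probability"
begin

section \<open>Lebesgue norms\<close>

text \<open>
  The norm takes values in \<open>ennreal\<close>, so that an infinite norm is \<open>\<infinity>\<close> rather than a junk
  real. It is used for \<open>0 < p < \<infinity>\<close>.
\<close>

definition ennreal_powr :: "ennreal \<Rightarrow> real \<Rightarrow> ennreal" where
  "ennreal_powr c r = (if c = \<infinity> then \<infinity> else ennreal (enn2real c powr r))"

definition Lp_norm :: "real \<Rightarrow> 'a::euclidean_space set \<Rightarrow> ('a \<Rightarrow> 'b::real_normed_vector) \<Rightarrow> ennreal" where
  "Lp_norm p A f = ennreal_powr (\<integral>\<^sup>+x\<in>A. ennreal (norm (f x) powr p) \<partial>lborel) (1 / p)"


section \<open>The differential operator\<close>

definition partial_D :: "'n::finite \<Rightarrow> (real^'n \<Rightarrow> real) \<Rightarrow> real^'n \<Rightarrow> real" where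
  "partial_D i u x = frechet_derivative u (at x) (axis i 1)"

definition C2_compact_support :: "(real^'n::finite \<Rightarrow> real) \<Rightarrow> bool" where
  "C2_compact_support u \<longleftrightarrow>
     u differentiable_on UNIV \<and>
     (\<forall>i. partial_D i u differentiable_on UNIV) \<and>
     (\<forall>i j. continuous_on UNIV (partial_D i (partial_D j u))) \<and>
     compact (closure {x. u x \<noteq> 0})"

definition diffusion_operator ::
    "(real^'n::finite \<Rightarrow> real^'n^'n) \<Rightarrow> (real^'n \<Rightarrow> real^'n) \<Rightarrow> (real^'n \<Rightarrow> real) \<Rightarrow> real^'n \<Rightarrow> real" where
  "diffusion_operator a b u x =
     1/2 * (\<Sum>i\<in>UNIV. \<Sum>j\<in>UNIV. a x $ i $ j * partial_D i (partial_D j u) x)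
     + (\<Sum>i\<in>UNIV. b x $ i * partial_D i u x)"

definition sym_eigenvalues_in :: "real \<Rightarrow> (real^'n::finite^'n) set" where
  "sym_eigenvalues_in \<delta> =
     {A. transpose A = A \<and> (\<forall>\<mu> v. v \<noteq> 0 \<and> A *v v = \<mu> *\<^sub>R v \<longrightarrow> \<delta> \<le> \<mu> \<and> \<mu> \<le> 1 / \<delta>)}"

text \<open>The parameter \<open>\<beta>\<close> is the fixed bound for the norm of the drift in \<open>L\<^sub>d\<close>.\<close>

definition admissible_coefficients ::
    "real \<Rightarrow> real \<Rightarrow> (real^'n::finite \<Rightarrow> real^'n^'n) \<Rightarrow> (real^'n \<Rightarrow> real^'n) \<Rightarrow> bool" where
  "admissible_coefficients \<delta> \<beta> a b \<longleftrightarrow>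
     a \<in> borel_measurable borel \<and> (\<forall>x. a x \<in> sym_eigenvalues_in \<delta>) \<and>
     b \<in> borel_measurable borel \<and> Lp_norm (real CARD('n)) UNIV b \<le> ennreal \<beta>"


section \<open>Quasi-diffusion processes\<close>

text \<open>
  A continuous time-homogeneous Markov process with infinite lifetime in the sense of Dynkin. The
  laws \<open>P x\<close> live on a common measurable space; of \<open>M t\<close> only the sigma-algebra matters.
  All conditions are restricted to times \<open>t \<ge> 0\<close>. The conditional probability in \<open>markov\<close>
  is expressed by the conditional expectation of an indicator. Condition \<open>shift\<close> is Dynkin's
  requirement that the shifted trajectories be trajectories of the process.
\<close>

locale continuous_markov_process =
  fixes X :: "real \<Rightarrow> 'w \<Rightarrow> real^'n::finite"
    and M :: "real \<Rightarrow> 'w measure"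
    and P :: "real^'n \<Rightarrow> 'w measure"
  assumes prob_space_P: "prob_space (P x)"
    and sets_P: "sets (P x) = sets (P y)"
    and subalgebra_M: "0 \<le> t \<Longrightarrow> subalgebra (P x) (M t)"
    and filtration_M: "0 \<le> s \<Longrightarrow> s \<le> t \<Longrightarrow> subalgebra (M t) (M s)"
    and adapted: "0 \<le> t \<Longrightarrow> X t \<in> borel_measurable (M t)"
    and measurable_transition: "0 \<le> t \<Longrightarrow> \<Gamma> \<in> sets borel \<Longrightarrow>
      (\<lambda>x. measure (P x) {\<omega> \<in> space (P x). X t \<omega> \<in> \<Gamma>}) \<in> borel_measurable borel"
    and start: "AE \<omega> in P x. X 0 \<omega> = x"
    and markov: "0 \<le> s \<Longrightarrow> 0 \<le> h \<Longrightarrow> \<Gamma> \<in> sets borel \<Longrightarrow>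
      AE \<omega> in P x. real_cond_exp (P x) (M s) (\<lambda>\<omega>'. indicator \<Gamma> (X (s + h) \<omega>')) \<omega>
        = measure (P (X s \<omega>)) {\<omega>' \<in> space (P (X s \<omega>)). X h \<omega>' \<in> \<Gamma>}"
    and shift: "0 \<le> t \<Longrightarrow> \<omega> \<in> space (P x) \<Longrightarrow>
      \<exists>\<omega>'\<in>space (P x). \<forall>s\<ge>0. X s \<omega>' = X (s + t) \<omega>"
    and continuous_paths: "\<omega> \<in> space (P x) \<Longrightarrow> continuous_on {0..} (\<lambda>t. X t \<omega>)"

definition quasi_diffusion ::
    "(real^'n::finite \<Rightarrow> real^'n^'n) \<Rightarrow> (real^'n \<Rightarrow> real^'n) \<Rightarrow>
     (real \<Rightarrow> 'w \<Rightarrow> real^'n) \<Rightarrow> (real \<Rightarrow> 'w measure) \<Rightarrow> (real^'n \<Rightarrow> 'w measure) \<Rightarrow> bool" where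
  "quasi_diffusion a b X M P \<longleftrightarrow>
     continuous_markov_process X M P \<and>
     (\<forall>x. \<forall>t\<ge>0. (\<integral>\<^sup>+\<omega>. (\<integral>\<^sup>+s\<in>{0..t}. ennreal (norm (b (X s \<omega>))) \<partial>lborel) \<partial>P x) < \<infinity>) \<and>
     (\<forall>x. \<forall>t\<ge>0. \<forall>u. C2_compact_support u \<longrightarrow>
        u x = (\<integral>\<omega>. u (X t \<omega>) \<partial>P x)
              - (\<integral>\<omega>. (LINT s:{0..t}|lborel. diffusion_operator a b u (X s \<omega>)) \<partial>P x))"

definition transition_op ::
    "(real \<Rightarrow> 'w \<Rightarrow> real^'n::finite) \<Rightarrow> (real^'n \<Rightarrow> 'w measure) \<Rightarrow> real \<Rightarrow> (real^'n \<Rightarrow> real) \<Rightarrow> real^'n \<Rightarrow> real" where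
  "transition_op X P t f x = (\<integral>\<omega>. f (X t \<omega>) \<partial>P x)"


section \<open>The exponent $d_0$\<close>

definition exit_time :: "(real \<Rightarrow> 'a::real_normed_vector) \<Rightarrow> real \<Rightarrow> ereal" where
  "exit_time x R = Inf {ereal t | t. 0 \<le> t \<and> x t \<notin> ball 0 R}"

definition occupation_time :: "(real \<Rightarrow> 'a) \<Rightarrow> 'a set \<Rightarrow> real \<Rightarrow> real" where
  "occupation_time x \<Gamma> t = (LINT s:{0..t}|lborel. indicator \<Gamma> (x s))"

definition exp_weight :: "real \<Rightarrow> real \<Rightarrow> real \<Rightarrow> real \<Rightarrow> 'a::real_normed_vector \<Rightarrow> real" where
  "exp_weight \<mu> R\<^sub>0 R \<kappa> x = exp (sqrt \<kappa> * \<mu> * infdist x (ball 0 (R + R\<^sub>0 / sqrt \<kappa>)))"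

definition exit_estimate ::
    "real \<Rightarrow> real \<Rightarrow> (real \<Rightarrow> 'w \<Rightarrow> real^'n::finite) \<Rightarrow> (real^'n \<Rightarrow> 'w measure) \<Rightarrow> bool" where
  "exit_estimate p N X P \<longleftrightarrow>
     (\<forall>f\<in>borel_measurable borel. (\<forall>x. 0 \<le> f x) \<longrightarrow> (\<forall>R>0.
        (\<integral>\<^sup>+\<omega>. (\<integral>\<^sup>+t\<in>{t. 0 \<le> t \<and> ereal t < exit_time (\<lambda>s. X s \<omega>) R}. ennreal (f (X t \<omega>)) \<partial>lborel) \<partial>P 0)
        \<le> ennreal (N * R powr (2 - real CARD('n) / p)) * Lp_norm p (ball 0 R) f))"

definition resolvent_estimate ::
    "real \<Rightarrow> real \<Rightarrow> real \<Rightarrow> real \<Rightarrow> (real \<Rightarrow> 'w \<Rightarrow> real^'n::finite) \<Rightarrow> (real^'n \<Rightarrow> 'w measure) \<Rightarrow> bool" where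
  "resolvent_estimate p N \<mu> R\<^sub>0 X P \<longleftrightarrow>
     (\<forall>f\<in>borel_measurable borel. (\<forall>x. 0 \<le> f x) \<longrightarrow> (\<forall>\<kappa>>0. \<forall>R\<ge>0.
        (\<integral>\<^sup>+\<omega>. (\<integral>\<^sup>+t\<in>{0..}.
            ennreal (exp (- \<kappa> * occupation_time (\<lambda>s. X s \<omega>) (- ball 0 R) t) * f (X t \<omega>)) \<partial>lborel) \<partial>P 0)
        \<le> ennreal (N * (R * sqrt \<kappa> + R\<^sub>0) powr (2 - real CARD('n) / p) * \<kappa> powr (real CARD('n) / (2 * p) - 1))
           * Lp_norm p UNIV (\<lambda>x. inverse (exp_weight \<mu> R\<^sub>0 R \<kappa> x) * f x)))"

text \<open>
  The properties by which the constant \<open>d\<^sub>0 = d\<^sub>0(d, \<delta>, \<beta>)\<close> is known: the constants in the two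
  estimates depend only on \<open>p\<close>, \<open>d\<close>, \<open>\<delta>\<close> and \<open>\<beta>\<close>, since they are chosen before the
  coefficients, the process, the function and the radii. As HOL has no quantification over types,
  the processes range over those with sample points of a given type \<open>'w\<close>, supplied by the first
  argument. A number with these properties for processes on all sample spaces has them in particular
  for \<open>'w\<close>, so that a theorem assuming only the latter is the stronger one.
\<close>

definition krylov_exponent ::
    "'w itself \<Rightarrow> 'n::finite itself \<Rightarrow> real \<Rightarrow> real \<Rightarrow> real \<Rightarrow> bool" where
  "krylov_exponent W D \<delta> \<beta> d\<^sub>0 \<longleftrightarrow>
     real CARD('n) / 2 < d\<^sub>0 \<and> d\<^sub>0 < real CARD('n) \<and>
     (\<forall>p\<ge>d\<^sub>0. \<exists>N>0.
        \<forall>a b (X :: real \<Rightarrow> 'w \<Rightarrow> real^'n) M P.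
          admissible_coefficients \<delta> \<beta> a b \<longrightarrow> quasi_diffusion a b X M P \<longrightarrow>
          exit_estimate p N X P) \<and>
     (\<forall>p\<ge>d\<^sub>0. \<exists>N>0. \<exists>\<mu>>0. \<exists>R\<^sub>0\<ge>2.
        \<forall>a b (X :: real \<Rightarrow> 'w \<Rightarrow> real^'n) M P.
          admissible_coefficients \<delta> \<beta> a b \<longrightarrow> quasi_diffusion a b X M P \<longrightarrow>
          resolvent_estimate p N \<mu> R\<^sub>0 X P)"

end

theory Submission
  imports Defs
begin

text \<open>
  Estimate (ii) with \<open>R = 0\<close>, translated to any starting point, bounds \<open>L\<^sub>p\<close> potentials. The heart of
  the proof is to pass from these to the operators \<open>T\<^sub>t\<close> at a fixed time. For complex \<open>z = \<lambda> + i\<eta>\<close> the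
  resolvent satisfies \<open>|R\<^sub>z g| \<le> C |z|\<^sup>-\<^sup>1 \<surd>v\<close> whenever \<open>|g| \<le> \<surd>v\<close> with \<open>v\<close> \<open>\<lambda>\<close>-excessive. Otherwise
  \<open>u = R\<^sub>z g\<close> nearly attains its extremal size at some point \<open>x\<close>, which forces \<open>u(x\<^sub>t)\<close> to stay close to
  \<open>e\<^bsup>i\<eta>t\<^esup> u(x)\<close> in mean square: it is a clock. Yet, started at \<open>x\<close>, the process is found near \<open>x\<close> with
  probability bounded below at each of \<open>m\<close> times, after which it spends a definite time in the set where
  the clock shows the right value. By the potential bound these \<open>m\<close> disjoint sets each fill a fixed
  proportion of a ball, which is impossible for large \<open>m\<close>. The lower bound on the probability of staying
  in a small ball comes from a bump function \<open>\<phi>\<close> with \<open>L\<phi> \<ge> - K\<phi> - N|b|\<close> and from (ii) with \<open>p = d\<close> applied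
  to \<open>|b|\<close>, whose \<open>L\<^sub>d\<close> norm over small balls is uniformly small.

  Iterating the resolvent bound and inverting the Fourier transform of a Gamma-weighted \<open>T\<^sub>s f(x)\<close>
  gives \<open>T\<^sub>t f(x) \<le> N t\<^bsup>-d/(2p)\<^esup> \<parallel>e\<^bsup>-\<gamma>|\<cdot> - x|/\<surd>t\<^esup> f\<parallel>\<^sub>p\<close> for small \<open>t\<close>. Hence \<open>T\<^sub>t\<close> is bounded in \<open>L\<^sub>p\<close>
  uniformly in \<open>t \<le> 1\<close>, and strong continuity follows from that for continuous functions with compact support.
\<close>

section \<open>Semigroups of transition kernels\<close>

text \<open>The difficulty is that (i) and (ii) bound only integrals over time: neither a density
  nor a Feller property of the law of \<open>x\<^sub>t\<close> at a fixed \<open>t\<close> is given,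
  and time averages do not control the value at one time. The gap is closed by a decay of the
  resolvent along vertical lines, of the kind known for analytic semigroups. It is needed in a
  weighted form, since \<open>f\<close> is controlled in \<open>L\<^sub>p\<close> only; the majorant
  \<open>v\<close> may grow away from the starting point but is bounded there independently of the
  scale. Its square root is taken because excessivity of \<open>v\<close> then controls second
  moments, hence variances. Two resolvents bring \<open>f\<close> below such a majorant, two more
  give a factor integrable in \<eta>. In the clock argument the order of choices matters: the number
  \<open>m\<close> of readings must not depend on the lower bound for the probability of being near
  \<open>x\<close> at those times. Finally, the \<open>L\<^sub>d\<close> norm of a drift is
  invariant under parabolic scaling, so smallness comes only from the integral of
  \<open>|b|^d\<close> over small balls. The estimates are thus first obtained for small times, and
  the semigroup property extends them.\<close>

text \<open>Rounding the time down to a multiple of \<open>1 / Suc n\<close> leaves countably many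
  functions, each measurable in \<open>x\<close>; continuity in time makes \<open>F\<close> the
  pointwise limit. It serves both for the kernels and for the paths.\<close>

lemma measurable_pair_of_continuous_in_time:
  fixes F :: "real \<Rightarrow> 'a \<Rightarrow> 'b::metric_space"
  assumes meas: "\<And>t. F t \<in> borel_measurable M"
    and cont: "\<And>x. x \<in> space M \<Longrightarrow> continuous_on UNIV (\<lambda>t. F t x)"
  shows "(\<lambda>(t, x). F t x) \<in> borel_measurable (borel \<Otimes>\<^sub>M M)"
proof -
  define \<tau> where "\<tau> n t = real_of_int \<lfloor>real (Suc n) * t\<rfloor> / real (Suc n)" for n t
  have \<tau>_lim: "(\<lambda>n. \<tau> n t) \<longlonglongrightarrow> t" for t
  proof (rule LIMSEQ_I)
    fix e :: real assume "e > 0"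
    then obtain N where N: "1 / real (Suc N) < e"
      using nat_approx_posE by blast
    show "\<exists>no. \<forall>n\<ge>no. norm (\<tau> n t - t) < e"
    proof (intro exI allI impI)
      fix n assume "n \<ge> N"
      have "\<bar>real_of_int \<lfloor>real (Suc n) * t\<rfloor> - real (Suc n) * t\<bar> \<le> 1"
        by linarith
      moreover have "\<tau> n t - t = (real_of_int \<lfloor>real (Suc n) * t\<rfloor> - real (Suc n) * t) / real (Suc n)"
        unfolding \<tau>_def by (simp add: field_simps del: of_nat_Suc)
      ultimately have "\<bar>\<tau> n t - t\<bar> \<le> 1 / real (Suc n)"
        by (simp add: abs_divide divide_right_mono del: of_nat_Suc)
      also have "\<dots> \<le> 1 / real (Suc N)" using \<open>n \<ge> N\<close> by (simp add: field_simps)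
      finally show "norm (\<tau> n t - t) < e" using N by simp
    qed
  qed
  have 1: "(\<lambda>z. F (\<tau> n (fst z)) (snd z)) \<in> borel_measurable (borel \<Otimes>\<^sub>M M)" for n
  proof -
    have "(\<lambda>z. F (real_of_int i / real (Suc n)) (snd z)) \<in> borel_measurable (borel \<Otimes>\<^sub>M M)" for i
      by (rule measurable_compose[OF measurable_snd meas])
    moreover have "(\<lambda>z. \<lfloor>real (Suc n) * fst z\<rfloor>) \<in> (borel \<Otimes>\<^sub>M M) \<rightarrow>\<^sub>M count_space UNIV"
      by measurable
    ultimately show ?thesis
      unfolding \<tau>_def
      by (rule measurable_compose_countable)
  qed
  have "(\<lambda>z. F (fst z) (snd z)) \<in> borel_measurable (borel \<Otimes>\<^sub>M M)"
  proof (rule borel_measurable_LIMSEQ_metric[OF 1])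
    fix z :: "real \<times> 'a" assume "z \<in> space (borel \<Otimes>\<^sub>M M)"
    then have "snd z \<in> space M" by (auto simp: space_pair_measure)
    then have "continuous_on UNIV (\<lambda>t. F t (snd z))" by (rule cont)
    then have "isCont (\<lambda>t. F t (snd z)) (fst z)"
      by (simp add: continuous_on_eq_continuous_at)
    from isCont_tendsto_compose[OF this \<tau>_lim]
    show "(\<lambda>n. F (\<tau> n (fst z)) (snd z)) \<longlonglongrightarrow> F (fst z) (snd z)" .
  qed
  then show ?thesis by (simp add: case_prod_beta')
qed

text \<open>The Lipschitz functions \<open>min 1 (real n * infdist y (-U))\<close> increase to the
  indicator of \<open>U\<close>, so monotone convergence applies. The whole space is excluded
  because \<open>infdist\<close> to the empty set is \<open>0\<close>.\<close>

lemma emeasure_open_SUP_continuous: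
  fixes U :: "'a::metric_space set"
  assumes "open U" "U \<noteq> UNIV" "prob_space M" "sets M = sets borel"
  shows "emeasure M U = (SUP n. ennreal (\<integral>y. min 1 (real n * infdist y (-U)) \<partial>M))"
proof -
  interpret prob_space M by fact
  note [measurable_cong] = assms(4)
  have meas: "(\<lambda>y. min 1 (real n * infdist y (-U))) \<in> borel_measurable M" for n
    unfolding measurable_cong_sets[OF assms(4) refl]
    by (intro borel_measurable_continuous_onI continuous_intros)
  have "emeasure M U = (\<integral>\<^sup>+y. indicator U y \<partial>M)"
    using assms by simp
  also have "\<dots> = (\<integral>\<^sup>+y. (SUP n. ennreal (min 1 (real n * infdist y (-U)))) \<partial>M)"
  proof (rule nn_integral_cong)
    fix y
    show "indicator U y = (SUP n. ennreal (min 1 (real n * infdist y (-U))))"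
    proof (cases "y \<in> U")
      case True
      have "infdist y (-U) > 0"
        using True \<open>U \<noteq> UNIV\<close> \<open>open U\<close> infdist_pos_not_in_closed[of "-U" y] by auto
      then obtain n where "1 / infdist y (-U) < real n" using reals_Archimedean2 by blast
      then have n: "min 1 (real n * infdist y (-U)) = 1"
        using \<open>infdist y (-U) > 0\<close> by (simp add: field_simps)
      show ?thesis
      proof (rule antisym)
        show "indicator U y \<le> (SUP n. ennreal (min 1 (real n * infdist y (-U))))"
          by (rule SUP_upper2[of n]) (use n True in auto)
        show "(SUP n. ennreal (min 1 (real n * infdist y (-U)))) \<le> indicator U y"
          by (rule SUP_least) (use True in \<open>auto simp: ennreal_le_1\<close>)
      qed
    next
      case False
      then have "infdist y (-U) = 0" by simp
      then show ?thesis using False by simp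
    qed
  qed
  also have "\<dots> = (SUP n. \<integral>\<^sup>+y. ennreal (min 1 (real n * infdist y (-U))) \<partial>M)"
  proof (rule nn_integral_monotone_convergence_SUP)
    show "incseq (\<lambda>n y. ennreal (min 1 (real n * infdist y (-U))))"
      by (intro incseq_SucI le_funI ennreal_leI min.mono mult_right_mono infdist_nonneg) auto
  qed (use meas in auto)
  also have "\<dots> = (SUP n. ennreal (\<integral>y. min 1 (real n * infdist y (-U)) \<partial>M))"
  proof (intro SUP_cong refl nn_integral_eq_integral)
    fix n show "integrable M (\<lambda>y. min 1 (real n * infdist y (-U)))"
      by (rule integrable_const_bound[where B=1]) (use meas in \<open>auto simp: infdist_nonneg\<close>)
  qed (auto simp: infdist_nonneg)
  finally show ?thesis .
qed

text \<open>Continuity is demanded in time for each fixed starting point, never in the starting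
  point. It is stated on the whole real line, which makes the integrands over \<open>lborel\<close>
  jointly measurable; what the kernels mean at negative times is immaterial, because the densities
  in the integrals below vanish there.\<close>

locale markov_semigroup =
  fixes K :: "real \<Rightarrow> 'a::euclidean_space \<Rightarrow> 'a measure"
  assumes kernel: "K t \<in> borel \<rightarrow>\<^sub>M prob_algebra borel"
    and chapman: "0 \<le> s \<Longrightarrow> 0 \<le> t \<Longrightarrow> K (s + t) x = K s x \<bind> K t"
    and initial: "K 0 x = return borel x"
    and weakly_continuous: "continuous_on UNIV f \<Longrightarrow> bounded (range f) \<Longrightarrow>
      continuous_on UNIV (\<lambda>t. \<integral>y. (f y :: real) \<partial>K t x)"
begin

lemma prob_space_kernel: "prob_space (K t x)"
  and sets_kernel[measurable_cong, simp]: "sets (K t x) = sets borel"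
  and space_kernel[simp]: "space (K t x) = UNIV"
proof -
  have "K t x \<in> space (prob_algebra borel)"
    using kernel[of t] by (rule measurable_space) simp
  then show "prob_space (K t x)" and *: "sets (K t x) = sets borel"
    by (auto simp: space_prob_algebra)
  show "space (K t x) = UNIV"
    using sets_eq_imp_space_eq[OF *] by simp
qed

sublocale kernel: prob_space "K t x" for t x
  by (rule prob_space_kernel)

text \<open>Open sets form a generator stable under intersections. The mass of such a set is a
  countable supremum of integrals of continuous functions, each of them measurable in
  \<open>x\<close> and continuous in \<open>t\<close>, hence jointly measurable.\<close>

lemma kernel_joint: "(\<lambda>(t, x). K t x) \<in> borel \<Otimes>\<^sub>M borel \<rightarrow>\<^sub>M prob_algebra borel"
proof (rule measurable_prob_algebra_generated[where \<Omega>=UNIV and G="{U. open U}"])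
  show "sets borel = sigma_sets UNIV {U::'a set. open U}"
    by (simp add: borel_def)
  show "Int_stable {U::'a set. open U}" by (auto simp: Int_stable_def)
  show "(\<lambda>a. emeasure (case a of (t, x) \<Rightarrow> K t x) U) \<in> borel_measurable (borel \<Otimes>\<^sub>M borel)"
    if "U \<in> {U. open U}" for U
  proof (cases "U = UNIV")
    case True
    have "emeasure (K t x) UNIV = 1" for t x
      using kernel.emeasure_space_1[of t x] by simp
    then show ?thesis using True by (simp add: case_prod_beta')
  next
    case False
    define g where "g n y = min 1 (real n * infdist y (-U))" for n :: nat and y :: 'a
    have g: "continuous_on UNIV (g n)" "bounded (range (g n))" for n
    proof -
      show "continuous_on UNIV (g n)" unfolding g_def by (intro continuous_intros)
      show "bounded (range (g n))"
        by (rule boundedI[where B=1]) (auto simp: g_def infdist_nonneg)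
    qed
    have gm: "g n \<in> borel_measurable borel" for n
      by (rule borel_measurable_continuous_onI[OF g(1)])
    have "(\<lambda>(t, x). \<integral>y. g n y \<partial>K t x) \<in> borel_measurable (borel \<Otimes>\<^sub>M borel)" for n
    proof (rule measurable_pair_of_continuous_in_time)
      show "(\<lambda>x. \<integral>y. g n y \<partial>K t x) \<in> borel_measurable borel" for t
        by (rule measurable_compose[OF measurable_prob_algebraD[OF kernel] integral_measurable_subprob_algebra[OF gm]])
    qed (rule weakly_continuous[OF g])
    then have "(\<lambda>a. SUP n. ennreal (\<integral>y. g n y \<partial>K (fst a) (snd a))) \<in> borel_measurable (borel \<Otimes>\<^sub>M borel)"
      unfolding case_prod_beta' by measurable
    moreover have "emeasure (K t x) U = (SUP n. ennreal (\<integral>y. g n y \<partial>K t x))" for t x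
      unfolding g_def
      by (rule emeasure_open_SUP_continuous) (use that False prob_space_kernel in auto)
    ultimately show ?thesis by (simp add: case_prod_beta')
  qed
qed (auto simp: prob_space_kernel)

lemma kernel_joint_compose[measurable (raw)]:
  assumes "f \<in> M \<rightarrow>\<^sub>M borel" "g \<in> M \<rightarrow>\<^sub>M borel"
  shows "(\<lambda>z. K (f z) (g z)) \<in> M \<rightarrow>\<^sub>M subprob_algebra borel"
  using measurable_compose[OF measurable_Pair[OF assms] measurable_prob_algebraD[OF kernel_joint]]
  by simp

text \<open>Pushing the kernel forward under \<open>Pair z\<close> absorbs the dependence of the
  integrand on \<open>z\<close>: one fixed function is integrated against measures that depend
  measurably on \<open>z\<close>.\<close>

lemma integral_kernel_measurable[measurable (raw)]:
  fixes h :: "'c \<Rightarrow> 'a \<Rightarrow> 'b::{banach, second_countable_topology}"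
  assumes "f \<in> M \<rightarrow>\<^sub>M borel" "g \<in> M \<rightarrow>\<^sub>M borel" "(\<lambda>(z, y). h z y) \<in> borel_measurable (M \<Otimes>\<^sub>M borel)"
  shows "(\<lambda>z. \<integral>y. h z y \<partial>K (f z) (g z)) \<in> borel_measurable M"
proof -
  note [measurable] = kernel_joint_compose[OF assms(1,2)] assms(3)
  note measurable_distr2[measurable] integral_measurable_subprob_algebra[measurable]
  have "(\<lambda>z. \<integral>q. (\<lambda>(z, y). h z y) q \<partial>distr (K (f z) (g z)) (M \<Otimes>\<^sub>M borel) (Pair z)) \<in> borel_measurable M"
    by measurable
  then show ?thesis
    by (rule measurable_cong[THEN iffD1, rotated]) (subst integral_distr, auto)
qed

lemma nn_integral_kernel_measurable[measurable (raw)]: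
  assumes "f \<in> M \<rightarrow>\<^sub>M borel" "g \<in> M \<rightarrow>\<^sub>M borel" "(\<lambda>(z, y). h z y) \<in> borel_measurable (M \<Otimes>\<^sub>M borel)"
  shows "(\<lambda>z. \<integral>\<^sup>+y. h z y \<partial>K (f z) (g z)) \<in> borel_measurable M"
  by (rule nn_integral_measurable_subprob_algebra2[OF assms(3) kernel_joint_compose[OF assms(1,2)]])

section \<open>Bounded integrands and the Chapman-Kolmogorov equation\<close>

lemma integrable_kernel_bounded:
  fixes f :: "'a \<Rightarrow> 'b::{banach, second_countable_topology}"
  assumes "f \<in> borel_measurable borel" "\<And>y. norm (f y) \<le> B"
  shows "integrable (K t x) f"
  by (rule kernel.integrable_const_bound[where B=B]) (use assms in auto)

lemma norm_integral_kernel_le: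
  fixes f :: "'a \<Rightarrow> 'b::{banach, second_countable_topology}"
  assumes "f \<in> borel_measurable borel" "\<And>y. norm (f y) \<le> B"
  shows "norm (\<integral>y. f y \<partial>K t x) \<le> B"
proof -
  have "norm (\<integral>y. f y \<partial>K t x) \<le> (\<integral>y. norm (f y) \<partial>K t x)" by simp
  also have "\<dots> \<le> (\<integral>y. B \<partial>K t x)"
    by (rule integral_mono) (use assms in \<open>auto intro!: integrable_kernel_bounded[where B=B]\<close>)
  finally show ?thesis using kernel.prob_space by simp
qed

lemma integral_chapman_real:
  fixes f :: "'a \<Rightarrow> real"
  assumes [measurable]: "f \<in> borel_measurable borel" and "\<And>y. \<bar>f y\<bar> \<le> B" and "0 \<le> s" "0 \<le> t"
  shows "(\<integral>y. f y \<partial>K (s + t) x) = (\<integral>y. (\<integral>w. f w \<partial>K t y) \<partial>K s x)"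
  unfolding chapman[OF assms(3,4)]
  by (rule integral_bind[where K=borel and B=B and B'=1])
     (use assms in \<open>auto simp: kernel.finite_measure_axioms kernel.emeasure_space_1[simplified]\<close>)

lemma integral_chapman:
  fixes f :: "'a \<Rightarrow> complex"
  assumes [measurable]: "f \<in> borel_measurable borel" and B: "\<And>y. norm (f y) \<le> B" and "0 \<le> s" "0 \<le> t"
  shows "(\<integral>y. f y \<partial>K (s + t) x) = (\<integral>y. (\<integral>w. f w \<partial>K t y) \<partial>K s x)"
proof (rule complex_eqI)
  have 1: "integrable (K r x) f" for r x
    by (rule integrable_kernel_bounded[OF _ B]) simp
  have 2: "integrable (K r x) (\<lambda>y. \<integral>w. f w \<partial>K t y)" for r x
    by (rule integrable_kernel_bounded[where B=B]) (use B in \<open>auto intro!: norm_integral_kernel_le\<close>)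
  have B': "\<bar>Re (f y)\<bar> \<le> B" "\<bar>Im (f y)\<bar> \<le> B" for y
    using abs_Re_le_cmod[of "f y"] abs_Im_le_cmod[of "f y"] B[of y] by linarith+
  have 3: "(\<lambda>y. Re (f y)) \<in> borel_measurable borel" "(\<lambda>y. Im (f y)) \<in> borel_measurable borel"
    by measurable
  show "Re (\<integral>y. f y \<partial>K (s + t) x) = Re (\<integral>y. (\<integral>w. f w \<partial>K t y) \<partial>K s x)"
    using integral_chapman_real[OF 3(1) B'(1) assms(3,4)]
    by (simp add: integral_Re[OF 1, symmetric] integral_Re[OF 2, symmetric])
  show "Im (\<integral>y. f y \<partial>K (s + t) x) = Im (\<integral>y. (\<integral>w. f w \<partial>K t y) \<partial>K s x)"
    using integral_chapman_real[OF 3(2) B'(2) assms(3,4)]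
    by (simp add: integral_Im[OF 1, symmetric] integral_Im[OF 2, symmetric])
qed

end


section \<open>Weighted transforms and the clock\<close>

lemma integrable_erlang_density:
  assumes "0 < l" shows "integrable lborel (erlang_density k l)" "(\<integral>x. erlang_density k l x \<partial>lborel) = 1"
proof -
  have *: "(\<integral>\<^sup>+x. ennreal (erlang_density k l x) \<partial>lborel) = ennreal 1"
    using nn_integral_erlang_ith_moment[OF assms, of k 0] by simp
  show "integrable lborel (erlang_density k l)" "(\<integral>x. erlang_density k l x \<partial>lborel) = 1"
    using nn_integral_eq_integrable[of "erlang_density k l" lborel 1] * assms by auto
qed

lemma (in prob_space) square_integral_le:
  fixes f :: "'a \<Rightarrow> real"
  assumes "integrable M f" "integrable M (\<lambda>x. (f x)\<^sup>2)"
  shows "(\<integral>x. f x \<partial>M)\<^sup>2 \<le> (\<integral>x. (f x)\<^sup>2 \<partial>M)"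
  using variance_eq[OF assms] variance_positive[of f] by simp

context markov_semigroup
begin

lemma integral_kernel_Fubini:
  fixes F :: "real \<Rightarrow> 'a \<Rightarrow> 'b::{banach, second_countable_topology}"
  assumes [measurable]: "(\<lambda>(s, y). F s y) \<in> borel_measurable (borel \<Otimes>\<^sub>M borel)"
    and w: "integrable lborel w" and le: "\<And>s y. norm (F s y) \<le> w s"
  shows "(\<integral>y. (\<integral>s. F s y \<partial>lborel) \<partial>K t x) = (\<integral>s. (\<integral>y. F s y \<partial>K t x) \<partial>lborel)"
    and "integrable lborel (\<lambda>s. \<integral>y. F s y \<partial>K t x)"
proof -
  interpret P: pair_sigma_finite lborel "K t x" ..
  have i: "integrable (lborel \<Otimes>\<^sub>M K t x) (\<lambda>(s, y). F s y)"
  proof (rule P.Fubini_integrable)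
    show "AE s in lborel. integrable (K t x) (\<lambda>y. case (s, y) of (s, y) \<Rightarrow> F s y)"
    proof (rule AE_I2)
      fix s :: real
      show "integrable (K t x) (\<lambda>y. case (s, y) of (s, y) \<Rightarrow> F s y)"
        using le[of s] by (auto intro!: integrable_kernel_bounded[where B="w s"])
    qed
    show "integrable lborel (\<lambda>s. \<integral>y. norm (case (s, y) of (s, y) \<Rightarrow> F s y) \<partial>K t x)"
    proof (rule Bochner_Integration.integrable_bound[OF w])
      show "AE s in lborel. norm (\<integral>y. norm (case (s, y) of (s, y) \<Rightarrow> F s y) \<partial>K t x) \<le> norm (w s)"
      proof (rule AE_I2)
        fix s
        have "norm (\<integral>y. norm (F s y) \<partial>K t x) \<le> w s"
          by (rule norm_integral_kernel_le) (use le in auto)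
        then show "norm (\<integral>y. norm (case (s, y) of (s, y) \<Rightarrow> F s y) \<partial>K t x) \<le> norm (w s)" by simp
      qed
    qed measurable
  qed measurable
  show "(\<integral>y. (\<integral>s. F s y \<partial>lborel) \<partial>K t x) = (\<integral>s. (\<integral>y. F s y \<partial>K t x) \<partial>lborel)"
    using P.Fubini_integral[OF i] by simp
  show "integrable lborel (\<lambda>s. \<integral>y. F s y \<partial>K t x)"
    using P.integrable_fst'[OF i] by simp
qed

text \<open>
  This is \<open>(l R\<^sub>z)\<^bsup>k+1\<^esup> g\<close> with \<open>z = l + i\<eta>\<close> and \<open>R\<^sub>z\<close> the resolvent; the Gamma density normalises it so
  that it does not increase the supremum norm.
\<close>

definition transform :: "nat \<Rightarrow> real \<Rightarrow> real \<Rightarrow> ('a \<Rightarrow> complex) \<Rightarrow> 'a \<Rightarrow> complex" where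
  "transform k l \<eta> g x = (\<integral>s. erlang_density k l s *\<^sub>R (iexp (- (\<eta> * s)) * (\<integral>y. g y \<partial>K s x)) \<partial>lborel)"

lemma transform_measurable[measurable (raw)]:
  assumes [measurable]: "g \<in> borel_measurable borel"
  shows "transform k l \<eta> g \<in> borel_measurable borel"
proof -
  have [measurable]: "(\<lambda>(x, s). erlang_density k l s *\<^sub>R (iexp (- (\<eta> * s)) * (\<integral>y. g y \<partial>K s x)))
      \<in> borel_measurable (borel \<Otimes>\<^sub>M lborel)"
    by measurable
  show ?thesis unfolding transform_def[abs_def]
    by (rule sigma_finite_measure.borel_measurable_lebesgue_integral) (auto intro: lborel.sigma_finite_measure_axioms)
qed

lemma transform_integrable:
  assumes [measurable]: "g \<in> borel_measurable borel" and B: "\<And>y. norm (g y) \<le> B" and l: "0 < l"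
  shows "integrable lborel (\<lambda>s. erlang_density k l s *\<^sub>R (iexp (- (\<eta> * s)) * (\<integral>y. g y \<partial>K s x)))"
proof (rule Bochner_Integration.integrable_bound)
  show "integrable lborel (\<lambda>s. erlang_density k l s * B)"
    using integrable_erlang_density[OF l] by simp
  have "0 \<le> B" using B[of undefined] norm_ge_zero order_trans by blast
  moreover have "norm (\<integral>y. g y \<partial>K s x) \<le> B" for s
    by (rule norm_integral_kernel_le[OF _ B]) simp
  ultimately show "AE s in lborel. norm (erlang_density k l s *\<^sub>R (iexp (- (\<eta> * s)) * (\<integral>y. g y \<partial>K s x)))
      \<le> norm (erlang_density k l s * B)"
    using l by (intro AE_I2) (auto simp: norm_mult abs_mult intro!: mult_left_mono)
qed measurable

lemma norm_transform_le_integral: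
  assumes [measurable]: "g \<in> borel_measurable borel" and B: "\<And>y. norm (g y) \<le> B" and l: "0 < l"
    and h: "\<And>s. 0 \<le> s \<Longrightarrow> norm (\<integral>y. g y \<partial>K s x) \<le> h s"
    and i: "integrable lborel (\<lambda>s. erlang_density k l s * h s)"
  shows "norm (transform k l \<eta> g x) \<le> (\<integral>s. erlang_density k l s * h s \<partial>lborel)"
proof -
  have "norm (transform k l \<eta> g x) \<le> (\<integral>s. norm (erlang_density k l s *\<^sub>R (iexp (- (\<eta> * s)) * (\<integral>y. g y \<partial>K s x))) \<partial>lborel)"
    unfolding transform_def by (rule integral_norm_bound)
  also have "\<dots> \<le> (\<integral>s. erlang_density k l s * h s \<partial>lborel)"
  proof (rule integral_mono[OF _ i])
    fix s
    have "erlang_density k l s = 0" if "s < 0" using that by (simp add: erlang_density_def)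
    then show "norm (erlang_density k l s *\<^sub>R (iexp (- (\<eta> * s)) * (\<integral>y. g y \<partial>K s x))) \<le> erlang_density k l s * h s"
      using h[of s] l by (cases "s < 0") (auto simp: norm_mult intro!: mult_left_mono)
  qed (rule integrable_norm, rule transform_integrable[OF assms(1) B l])
  finally show ?thesis .
qed

lemma norm_transform_le:
  assumes [measurable]: "g \<in> borel_measurable borel" and B: "\<And>y. norm (g y) \<le> B" and l: "0 < l"
  shows "norm (transform k l \<eta> g x) \<le> B"
proof -
  have "norm (transform k l \<eta> g x) \<le> (\<integral>s. erlang_density k l s * B \<partial>lborel)"
    by (rule norm_transform_le_integral[OF _ B l norm_integral_kernel_le[OF _ B]])
       (use integrable_erlang_density[OF l] in auto)
  then show ?thesis using integrable_erlang_density[OF l] by simp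
qed

text \<open>Fubini's theorem and Chapman-Kolmogorov move the additional time into the kernel;
  negative \<open>s\<close> contribute nothing because the density vanishes there.\<close>

lemma kernel_transform:
  assumes [measurable]: "g \<in> borel_measurable borel" and B: "\<And>y. norm (g y) \<le> B" and l: "0 < l"
    and t: "0 \<le> t"
  shows "(\<integral>y. transform k l \<eta> g y \<partial>K t x)
    = (\<integral>s. erlang_density k l s *\<^sub>R (iexp (- (\<eta> * s)) * (\<integral>y. g y \<partial>K (t + s) x)) \<partial>lborel)"
proof -
  have "0 \<le> B" using B[of undefined] norm_ge_zero order_trans by blast
  have "(\<integral>y. transform k l \<eta> g y \<partial>K t x) =
    (\<integral>s. (\<integral>y. erlang_density k l s *\<^sub>R (iexp (- (\<eta> * s)) * (\<integral>w. g w \<partial>K s y)) \<partial>K t x) \<partial>lborel)"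
    unfolding transform_def
  proof (rule integral_kernel_Fubini(1))
    show "integrable lborel (\<lambda>s. erlang_density k l s * B)"
      using integrable_erlang_density[OF l] by simp
    have "norm (\<integral>w. g w \<partial>K s y) \<le> B" for s y
      by (rule norm_integral_kernel_le[OF _ B]) simp
    then show "norm (erlang_density k l s *\<^sub>R (iexp (- (\<eta> * s)) * (\<integral>w. g w \<partial>K s y))) \<le> erlang_density k l s * B" for s y
      using l \<open>0 \<le> B\<close> by (auto simp: norm_mult intro!: mult_left_mono)
  qed measurable
  also have "\<dots> = (\<integral>s. erlang_density k l s *\<^sub>R (iexp (- (\<eta> * s)) * (\<integral>y. g y \<partial>K (t + s) x)) \<partial>lborel)"
  proof (rule Bochner_Integration.integral_cong[OF refl])
    fix s
    have "(\<integral>y. (\<integral>w. g w \<partial>K s y) \<partial>K t x) = (\<integral>y. g y \<partial>K (t + s) x)" if "0 \<le> s"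
      using integral_chapman[OF assms(1) B t that, where x=x] by simp
    moreover have "erlang_density k l s = 0" if "s < 0" using that by (simp add: erlang_density_def)
    ultimately show "(\<integral>y. erlang_density k l s *\<^sub>R (iexp (- (\<eta> * s)) * (\<integral>w. g w \<partial>K s y)) \<partial>K t x) =
        erlang_density k l s *\<^sub>R (iexp (- (\<eta> * s)) * (\<integral>y. g y \<partial>K (t + s) x))"
      by (cases "s < 0") auto
  qed
  finally show ?thesis .
qed

text \<open>The exponential density is memoryless: after the shift by \<open>t\<close> the integrand
  of the transform reappears with the factor exp(-(l + i \<eta>) t), and only the part of the
  integral over times before \<open>t\<close> is lost. The other Gamma densities have no such
  identity, so the decay estimate is proved for \<open>k = 0\<close> and then iterated.\<close>

lemma kernel_transform_0:
  assumes [measurable]: "g \<in> borel_measurable borel" and B: "\<And>y. norm (g y) \<le> B" and l: "0 < l"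
    and t: "0 \<le> t"
  shows "(\<integral>y. transform 0 l \<eta> g y \<partial>K t x) = exp (l * t) *\<^sub>R (iexp (\<eta> * t) * (transform 0 l \<eta> g x
    - (\<integral>s. (indicator {..<t} s * erlang_density 0 l s) *\<^sub>R (iexp (- (\<eta> * s)) * (\<integral>y. g y \<partial>K s x)) \<partial>lborel)))"
proof -
  define F where "F s = iexp (- (\<eta> * s)) * (\<integral>y. g y \<partial>K s x)" for s
  have iF: "integrable lborel (\<lambda>s. erlang_density 0 l s *\<^sub>R F s)"
    unfolding F_def by (rule transform_integrable[OF _ B l]) simp
  have iF1: "integrable lborel (\<lambda>s. indicator A s *\<^sub>R (erlang_density 0 l s *\<^sub>R F s))" if "A \<in> sets borel" for A
    by (rule integrable_mult_indicator[OF _ iF]) (use that in simp)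
  have "transform 0 l \<eta> g x = (\<integral>s. indicator {..<t} s *\<^sub>R (erlang_density 0 l s *\<^sub>R F s) + indicator {t..} s *\<^sub>R (erlang_density 0 l s *\<^sub>R F s) \<partial>lborel)"
    unfolding transform_def F_def[symmetric]
    by (rule Bochner_Integration.integral_cong) (auto simp: indicator_def)
  also have "\<dots> = (\<integral>s. indicator {..<t} s *\<^sub>R (erlang_density 0 l s *\<^sub>R F s) \<partial>lborel) + (\<integral>s. indicator {t..} s *\<^sub>R (erlang_density 0 l s *\<^sub>R F s) \<partial>lborel)"
    by (rule Bochner_Integration.integral_add; rule iF1; simp)
  also have "(\<integral>s. indicator {t..} s *\<^sub>R (erlang_density 0 l s *\<^sub>R F s) \<partial>lborel)
      = (\<integral>s. indicator {t..} (t + 1 * s) *\<^sub>R (erlang_density 0 l (t + 1 * s) *\<^sub>R F (t + 1 * s)) \<partial>lborel)"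
    by (subst lborel_integral_real_affine[where c=1 and t=t]) auto
  also have "\<dots> = (\<integral>s. (exp (- l * t) *\<^sub>R iexp (- (\<eta> * t))) * (erlang_density 0 l s *\<^sub>R (iexp (- (\<eta> * s)) * (\<integral>y. g y \<partial>K (t + s) x))) \<partial>lborel)"
  proof (rule Bochner_Integration.integral_cong[OF refl])
    fix s :: real
    show "indicator {t..} (t + 1 * s) *\<^sub>R (erlang_density 0 l (t + 1 * s) *\<^sub>R F (t + 1 * s)) =
      (exp (- l * t) *\<^sub>R iexp (- (\<eta> * t))) * (erlang_density 0 l s *\<^sub>R (iexp (- (\<eta> * s)) * (\<integral>y. g y \<partial>K (t + s) x)))"
    proof (cases "0 \<le> s")
      case True
      have "iexp (- (\<eta> * (t + s))) = iexp (- (\<eta> * t)) * iexp (- (\<eta> * s))"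
        by (simp add: exp_add[symmetric] algebra_simps)
      moreover have "erlang_density 0 l (t + s) = exp (- l * t) * erlang_density 0 l s"
        using True t by (simp add: erlang_density_def exp_add[symmetric] algebra_simps)
      ultimately show ?thesis using True by (simp add: F_def mult_ac)
    qed (simp add: erlang_density_def)
  qed
  also have "\<dots> = (exp (- l * t) *\<^sub>R iexp (- (\<eta> * t))) * (\<integral>y. transform 0 l \<eta> g y \<partial>K t x)"
    unfolding kernel_transform[OF assms] by (rule integral_mult_right_zero)
  finally have "transform 0 l \<eta> g x = (\<integral>s. indicator {..<t} s *\<^sub>R erlang_density 0 l s *\<^sub>R F s \<partial>lborel)
     + (exp (- l * t) *\<^sub>R iexp (- (\<eta> * t))) * (\<integral>y. transform 0 l \<eta> g y \<partial>K t x)" .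
  then have "transform 0 l \<eta> g x - (\<integral>s. (indicator {..<t} s * erlang_density 0 l s) *\<^sub>R F s \<partial>lborel)
    = (exp (- l * t) *\<^sub>R iexp (- (\<eta> * t))) * (\<integral>y. transform 0 l \<eta> g y \<partial>K t x)"
    by simp
  then have "exp (l * t) *\<^sub>R (iexp (\<eta> * t) * (transform 0 l \<eta> g x - (\<integral>s. (indicator {..<t} s * erlang_density 0 l s) *\<^sub>R F s \<partial>lborel)))
   = exp (l * t) *\<^sub>R (iexp (\<eta> * t) * ((exp (- l * t) *\<^sub>R iexp (- (\<eta> * t))) * (\<integral>y. transform 0 l \<eta> g y \<partial>K t x)))"
    by simp
  also have "\<dots> = (exp (l * t) * exp (- l * t)) *\<^sub>R ((iexp (\<eta> * t) * iexp (- (\<eta> * t))) * (\<integral>y. transform 0 l \<eta> g y \<partial>K t x))"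
    by (simp add: algebra_simps scaleR_conv_of_real)
  also have "\<dots> = (\<integral>y. transform 0 l \<eta> g y \<partial>K t x)"
    by (simp add: exp_add[symmetric])
  finally show ?thesis by (simp add: F_def)
qed

section \<open>Excessive functions and their square roots\<close>

text \<open>The classical notion for the semigroup \<open>K s\<close> damped by
  \<open>exp (- l * s)\<close>, without the condition on the limit as \<open>s\<close> tends to
  \<open>0\<close>. Boundedness is included so that the integrals of \<open>v\<close>, and of
  functions below a multiple of its square root, converge.\<close>

definition excessive :: "real \<Rightarrow> ('a \<Rightarrow> real) \<Rightarrow> bool" where
  "excessive l v \<longleftrightarrow> v \<in> borel_measurable borel \<and> bounded (range v) \<and> (\<forall>y. 0 \<le> v y) \<and>
    (\<forall>s\<ge>0. \<forall>x. (\<integral>y. v y \<partial>K s x) \<le> exp (l * s) * v x)"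

text \<open>By Jensen's inequality the mean of the square root is at most the square root of the
  mean, which halves the exponential rate. This gain makes the transform of functions below \<surd>v
  converge with a constant independent of \<open>l\<close>.\<close>

lemma kernel_sqrt_excessive_le:
  assumes v: "excessive l v" and [measurable]: "g \<in> borel_measurable borel"
    and gv: "\<And>y. norm (g y :: complex) \<le> sqrt (v y)" and s: "0 \<le> s"
  shows "norm (\<integral>y. g y \<partial>K s x) \<le> exp (l * s / 2) * sqrt (v x)"
proof -
  have [measurable]: "v \<in> borel_measurable borel" and v0: "\<And>y. 0 \<le> v y" using v by (auto simp: excessive_def)
  obtain B where B: "\<And>y. v y \<le> B"
    using v by (fastforce simp: excessive_def bounded_iff abs_le_iff)
  have i1: "integrable (K s x) v"
    by (rule integrable_kernel_bounded[where B=B]) (use B v0 in auto)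
  have i2: "integrable (K s x) (\<lambda>y. sqrt (v y))"
    by (rule integrable_kernel_bounded[where B="sqrt B"]) (use B v0 in auto)
  have i3: "integrable (K s x) g"
    by (rule integrable_kernel_bounded[where B="sqrt B"])
       (use gv order_trans[OF gv real_sqrt_le_mono[OF B]] in auto)
  have "norm (\<integral>y. g y \<partial>K s x) \<le> (\<integral>y. norm (g y) \<partial>K s x)" by (rule integral_norm_bound)
  also have "\<dots> \<le> (\<integral>y. sqrt (v y) \<partial>K s x)"
    by (rule integral_mono) (use i2 i3 gv in auto)
  also have "\<dots> \<le> sqrt (\<integral>y. v y \<partial>K s x)"
  proof (rule real_le_rsqrt)
    show "(\<integral>y. sqrt (v y) \<partial>K s x)\<^sup>2 \<le> (\<integral>y. v y \<partial>K s x)"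
      using kernel.square_integral_le[OF i2] i1 v0 by simp
  qed
  also have "\<dots> \<le> sqrt (exp (l * s) * v x)"
    using v s by (auto simp: excessive_def)
  also have "\<dots> = exp (l * s / 2) * sqrt (v x)"
  proof -
    have "exp (l * s) = (exp (l * s / 2))\<^sup>2" by (simp add: power2_eq_square exp_add[symmetric])
    then show ?thesis by (simp add: real_sqrt_mult)
  qed
  finally show ?thesis .
qed

lemma bounded_of_le_sqrt_excessive:
  assumes "excessive l v" "\<And>y. norm (g y :: complex) \<le> c * sqrt (v y)"
  obtains B where "\<And>y. norm (g y) \<le> B"
proof -
  obtain B where B: "\<And>y. v y \<le> B"
    using assms(1) by (fastforce simp: excessive_def bounded_iff abs_le_iff)
  have "norm (g y) \<le> \<bar>c\<bar> * sqrt B" for y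
  proof -
    have "norm (g y) \<le> c * sqrt (v y)" by fact
    also have "\<dots> \<le> \<bar>c\<bar> * sqrt (v y)"
      using assms(1) by (intro mult_right_mono) (auto simp: excessive_def)
    also have "\<dots> \<le> \<bar>c\<bar> * sqrt B" using B[of y] by (intro mult_left_mono) auto
    finally show ?thesis .
  qed
  then show thesis by (rule that)
qed

text \<open>The density \<open>l * exp (- l * s)\<close> against \<open>exp (l * s / 2)\<close>
  integrates to \<open>2\<close>. For \<open>v\<close> itself in place of its square root the two
  rates would cancel and the integral would diverge. The constant \<open>2\<close> starts the
  descent to the best constant.\<close>

lemma transform_0_le_sqrt_excessive:
  assumes v: "excessive l v" and [measurable]: "g \<in> borel_measurable borel" and l: "0 < l"
    and gv: "\<And>y. norm (g y :: complex) \<le> sqrt (v y)"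
  shows "norm (transform 0 l \<eta> g x) \<le> 2 * sqrt (v x)"
proof -
  obtain B where B: "\<And>y. norm (g y) \<le> B"
    using bounded_of_le_sqrt_excessive[OF v, of g 1] gv by auto
  have eq: "erlang_density 0 l s * (exp (l * s / 2) * sqrt (v x)) = (2 * sqrt (v x)) * erlang_density 0 (l / 2) s" for s
    by (simp add: erlang_density_def exp_minus field_simps exp_add[symmetric])
  have "norm (transform 0 l \<eta> g x) \<le> (\<integral>s. erlang_density 0 l s * (exp (l * s / 2) * sqrt (v x)) \<partial>lborel)"
    using integrable_erlang_density[of "l/2" 0] l
    by (intro norm_transform_le_integral[OF _ B l] kernel_sqrt_excessive_le[OF v _ gv])
       (auto simp: eq simp del: erlang_density_def)
  also have "\<dots> = 2 * sqrt (v x)"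
    unfolding eq using integrable_erlang_density[of "l/2" 0] l by simp
  finally show ?thesis .
qed

text \<open>
  If \<open>u = transform 0 l \<eta> g\<close> almost attains its bound \<open>c \<surd>v\<close> at \<open>x\<close>, then \<open>u(x\<^sub>t)\<close> has mean almost
  \<open>e\<^bsup>i\<eta>t\<^esup> u(x)\<close> and second moment at most \<open>e\<^bsup>lt\<^esup> c\<^sup>2 v(x)\<close>, so its variance is small.
\<close>

lemma clock:
  assumes v: "excessive l v" and [measurable]: "g \<in> borel_measurable borel" and l: "0 < l"
    and gv: "\<And>y. norm (g y) \<le> sqrt (v y)"
    and u: "\<And>y. norm (transform 0 l \<eta> g y) \<le> c * sqrt (v y)" and c: "0 < c"
    and t: "0 \<le> t" "l * t \<le> 1" "l * t \<le> c * \<theta>"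
    and \<epsilon>: "0 \<le> \<epsilon>" "\<epsilon> \<le> 1" and x: "(1 - \<epsilon>) * c * sqrt (v x) \<le> norm (transform 0 l \<eta> g x)"
  shows "(\<integral>y. (norm (transform 0 l \<eta> g y - iexp (\<eta> * t) * transform 0 l \<eta> g x))\<^sup>2 \<partial>K t x) \<le> 6 * (\<epsilon> + \<theta>) * c\<^sup>2 * v x"
proof -
  define w where "w = transform 0 l \<eta> g"
  define V where "V = sqrt (v x)"
  define U where "U = norm (w x)"
  define b where "b = iexp (\<eta> * t) * w x"
  define I where "I = (\<integral>s. (indicator {..<t} s * erlang_density 0 l s) *\<^sub>R (iexp (- (\<eta> * s)) * (\<integral>y. g y \<partial>K s x)) \<partial>lborel)"
  have [measurable]: "v \<in> borel_measurable borel" and v0: "\<And>y. 0 \<le> v y" using v by (auto simp: excessive_def)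
  have [measurable]: "w \<in> borel_measurable borel" unfolding w_def by measurable
  obtain B where B: "\<And>y. norm (g y) \<le> B"
    using bounded_of_le_sqrt_excessive[OF v, of g 1] gv by auto
  obtain B' where B': "\<And>y. v y \<le> B'"
    using v by (fastforce simp: excessive_def bounded_iff abs_le_iff)
  have V: "0 \<le> V" "V\<^sup>2 = v x" using v0[of x] by (auto simp: V_def)
  have wB: "norm (w y) \<le> B" for y unfolding w_def by (rule norm_transform_le[OF _ B l]) simp
  have normb: "norm b = U" by (simp add: b_def U_def norm_mult)
  \<comment> \<open>\<open>I\<close> is the part of the transform lost before time \<open>t\<close>.
    There the density times the growth of the mean is at most \<open>l * V\<close>, so that
    \<open>I\<close> is small against \<open>c * V\<close> as soon as \<open>l * t\<close> is small
    against \<open>c\<close>.\<close>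
  have I: "norm I \<le> l * t * V"
  proof -
    have "norm I \<le> (\<integral>s. l * V * indicator {0..t} s \<partial>lborel)"
      unfolding I_def
    proof (rule Bochner_Integration.integral_norm_bound_integral)
      show "integrable lborel (\<lambda>s. (indicator {..<t} s * erlang_density 0 l s) *\<^sub>R (iexp (- (\<eta> * s)) * (\<integral>y. g y \<partial>K s x)))"
        using integrable_mult_indicator[OF _ transform_integrable[OF \<open>g \<in> _\<close> B l, of 0 \<eta> x], of "{..<t}"] by simp
      show "integrable lborel (\<lambda>s. l * V * indicator {0..t} s)"
        by (intro integrable_mult_right integrable_real_indicator) (simp_all add: emeasure_lborel_Icc_eq)
      fix s
      show "norm ((indicator {..<t} s * erlang_density 0 l s) *\<^sub>R (iexp (- (\<eta> * s)) * (\<integral>y. g y \<partial>K s x))) \<le> l * V * indicator {0..t} s"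
      proof (cases "0 \<le> s \<and> s < t")
        case True
        have "norm (\<integral>y. g y \<partial>K s x) \<le> exp (l * s / 2) * V"
          unfolding V_def by (rule kernel_sqrt_excessive_le[OF v _ gv]) (use True in auto)
        also have "\<dots> \<le> exp (l * s) * V"
          using True l V by (intro mult_right_mono) auto
        finally have "exp (- l * s) * norm (\<integral>y. g y \<partial>K s x) \<le> exp (- l * s) * (exp (l * s) * V)"
          by (intro mult_left_mono) auto
        also have "\<dots> = V" by (simp add: exp_minus)
        finally have "l * (exp (- l * s) * norm (\<integral>y. g y \<partial>K s x)) \<le> l * V"
          using l by (intro mult_left_mono) auto
        then show ?thesis using True l by (simp add: erlang_density_def norm_mult mult_ac)
      qed (use l V in \<open>auto simp: erlang_density_def indicator_def\<close>)
    qed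
    also have "\<dots> = l * t * V" using t by simp
    finally show ?thesis .
  qed
  have Tw: "(\<integral>y. w y \<partial>K t x) = exp (l * t) *\<^sub>R (iexp (\<eta> * t) * (w x - I))"
    unfolding w_def I_def by (rule kernel_transform_0[OF _ B l t(1)]) simp
  have "(\<integral>y. w y \<partial>K t x) * cnj b = exp (l * t) *\<^sub>R ((w x - I) * cnj (w x) * (iexp (\<eta> * t) * cnj (iexp (\<eta> * t))))"
    unfolding Tw b_def by (simp add: mult_ac)
  also have "iexp (\<eta> * t) * cnj (iexp (\<eta> * t)) = 1"
    by (subst complex_norm_square[symmetric]) simp
  finally have "(\<integral>y. w y \<partial>K t x) * cnj b = exp (l * t) *\<^sub>R ((w x - I) * cnj (w x))" by simp
  then have "Re ((\<integral>y. w y \<partial>K t x) * cnj b) = exp (l * t) * Re ((w x - I) * cnj (w x))"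
    by (metis scaleR_complex.sel(1))
  also have "Re ((w x - I) * cnj (w x)) = U\<^sup>2 - Re (I * cnj (w x))"
    unfolding U_def cmod_power2 by (simp add: power2_eq_square algebra_simps)
  finally have "Re ((\<integral>y. w y \<partial>K t x) * cnj b) = exp (l * t) * (U\<^sup>2 - Re (I * cnj (w x)))" .
  moreover have "Re (I * cnj (w x)) \<le> l * t * V * U"
  proof -
    have "Re (I * cnj (w x)) \<le> norm (I * cnj (w x))" by (rule complex_Re_le_cmod)
    also have "\<dots> \<le> l * t * V * U" using I by (simp add: norm_mult U_def mult_right_mono)
    finally show ?thesis .
  qed
  ultimately have Re: "Re ((\<integral>y. w y \<partial>K t x) * cnj b) \<ge> exp (l * t) * (U\<^sup>2 - l * t * V * U)"
    by simp
  \<comment> \<open>Expanding the square turns closeness to \<open>b\<close> into a comparison of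
    the second moment, bounded above by excessivity, with the correlation, bounded below through the
    exact formula for the mean.\<close>
  have sq: "(norm (w y - b))\<^sup>2 = (norm (w y))\<^sup>2 + U\<^sup>2 - 2 * Re (w y * cnj b)" for y
    unfolding normb[symmetric] cmod_power2 by (simp add: power2_eq_square algebra_simps)
  have iw: "integrable (K t x) w" by (rule integrable_kernel_bounded[OF _ wB]) simp
  have iw2: "integrable (K t x) (\<lambda>y. (norm (w y))\<^sup>2)"
    by (rule integrable_kernel_bounded[where B="B\<^sup>2"]) (use wB in \<open>auto intro: power_mono\<close>)
  have iwb: "integrable (K t x) (\<lambda>y. Re (w y * cnj b))" using iw by auto
  have iv: "integrable (K t x) v"
    by (rule integrable_kernel_bounded[where B=B']) (use B' v0 in auto)
  have w2: "(\<integral>y. (norm (w y))\<^sup>2 \<partial>K t x) \<le> exp (l * t) * (c\<^sup>2 * V\<^sup>2)"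
  proof -
    have "(\<integral>y. (norm (w y))\<^sup>2 \<partial>K t x) \<le> (\<integral>y. c\<^sup>2 * v y \<partial>K t x)"
    proof (rule integral_mono[OF iw2])
      show "integrable (K t x) (\<lambda>y. c\<^sup>2 * v y)" using iv by simp
      fix y
      have "(norm (w y))\<^sup>2 \<le> (c * sqrt (v y))\<^sup>2" using u[of y] by (intro power_mono) (auto simp: w_def)
      then show "(norm (w y))\<^sup>2 \<le> c\<^sup>2 * v y" using v0[of y] by (simp add: power_mult_distrib)
    qed
    also have "\<dots> = c\<^sup>2 * (\<integral>y. v y \<partial>K t x)" by simp
    also have "\<dots> \<le> c\<^sup>2 * (exp (l * t) * v x)"
      using v t by (intro mult_left_mono) (auto simp: excessive_def)
    finally show ?thesis using V by (simp add: mult_ac)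
  qed
  have U: "(1 - \<epsilon>) * (c * V) \<le> U" "U \<le> c * V" "0 \<le> U"
    using x u[of x] by (auto simp: U_def w_def V_def mult_ac)
  have e: "1 \<le> exp (l * t)" "exp (l * t) \<le> 3"
    using t l exp_le exp_le_cancel_iff[of "l*t" 1] by (auto intro: order_trans)
  have "(\<integral>y. (norm (w y - b))\<^sup>2 \<partial>K t x) = (\<integral>y. (norm (w y))\<^sup>2 \<partial>K t x) + U\<^sup>2 - 2 * (\<integral>y. Re (w y * cnj b) \<partial>K t x)"
    unfolding sq using iw2 iwb kernel.prob_space by (simp del: times_complex.sel)
  also have "(\<integral>y. Re (w y * cnj b) \<partial>K t x) = Re ((\<integral>y. w y \<partial>K t x) * cnj b)"
    using iw by (subst integral_Re) auto
  also have "(\<integral>y. (norm (w y))\<^sup>2 \<partial>K t x) + U\<^sup>2 - 2 * Re ((\<integral>y. w y \<partial>K t x) * cnj b)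
     \<le> exp (l * t) * (c\<^sup>2 * V\<^sup>2) + exp (l * t) * U\<^sup>2 - 2 * (exp (l * t) * (U\<^sup>2 - l * t * V * U))"
    using w2 Re e mult_right_mono[OF e(1), of "U\<^sup>2"] by simp
  also have "\<dots> = exp (l * t) * ((c * V)\<^sup>2 - U\<^sup>2 + 2 * (l * t * V * U))"
    by (simp add: algebra_simps power_mult_distrib)
  \<comment> \<open>Near-extremality gives
    \<open>U\<^sup>2 \<ge> (1 - 2 * \<epsilon>) * (c * V)\<^sup>2\<close>, and the lost part costs
    at most \<open>2 * \<theta> * (c * V)\<^sup>2\<close>. Together with
    \<open>exp (l * t) \<le> 3\<close> this accounts for the factor \<open>6\<close>.\<close>
  also have "\<dots> \<le> exp (l * t) * (2 * (\<epsilon> + \<theta>) * (c * V)\<^sup>2)"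
  proof (rule mult_left_mono)
    define q where "q = (c * V)\<^sup>2"
    have 1: "((1 - \<epsilon>) * (c * V))\<^sup>2 \<le> U\<^sup>2"
      using U \<epsilon> c V by (intro power_mono) auto
    have 2: "((1 - \<epsilon>) * (c * V))\<^sup>2 = q - 2 * (\<epsilon> * q) + \<epsilon>\<^sup>2 * q"
      unfolding q_def by (simp add: power2_eq_square algebra_simps)
    have 3: "0 \<le> \<epsilon>\<^sup>2 * q" by (simp add: q_def)
    have "(l * t) * (V * U) \<le> (c * \<theta>) * (V * (c * V))"
    proof (rule mult_mono[OF t(3)])
      have "0 \<le> l * t" using l t by simp
      then show "0 \<le> c * \<theta>" using t(3) by linarith
      show "V * U \<le> V * (c * V)" using U V by (intro mult_left_mono) auto
    qed (use U V in auto)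
    then have 4: "l * t * V * U \<le> \<theta> * q"
      by (simp add: q_def power2_eq_square mult_ac)
    have "2 * (\<epsilon> + \<theta>) * q = 2 * (\<epsilon> * q) + 2 * (\<theta> * q)" by (simp add: algebra_simps)
    then show "(c * V)\<^sup>2 - U\<^sup>2 + 2 * (l * t * V * U) \<le> 2 * (\<epsilon> + \<theta>) * (c * V)\<^sup>2"
      using 1 2 3 4 unfolding q_def[symmetric] by linarith
  qed simp
  also have "\<dots> \<le> 3 * (2 * (\<epsilon> + \<theta>) * (c * V)\<^sup>2)"
  proof (rule mult_right_mono[OF e(2)])
    have "0 \<le> l * t" using l t by simp
    then have "0 \<le> c * \<theta>" using t(3) by linarith
    then have "0 \<le> \<theta>" using c by (simp add: zero_le_mult_iff)
    then show "0 \<le> 2 * (\<epsilon> + \<theta>) * (c * V)\<^sup>2" using \<epsilon> by simp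
  qed
  also have "\<dots> = 6 * (\<epsilon> + \<theta>) * c\<^sup>2 * v x"
    using V(2) by (simp add: power_mult_distrib)
  finally show ?thesis by (simp add: w_def b_def)
qed

end


section \<open>Elliptic semigroups\<close>

text \<open>The quadratic Taylor remainder is at most half of the linear term while the phase
  difference is at most \<open>1\<close>. This separates different clock readings;
  \<open>iexp_diff_le\<close> compares nearby times.\<close>

lemma iexp_diff_ge: "\<bar>a - b\<bar> \<le> 1 \<Longrightarrow> \<bar>a - b\<bar> / 2 \<le> norm (iexp a - iexp b)"
proof -
  assume ab: "\<bar>a - b\<bar> \<le> 1"
  have "norm (iexp (a - b) - (1 + \<i> * (a - b))) \<le> \<bar>a - b\<bar>\<^sup>2 / 2"
    using iexp_approx1[of "a - b" 1] by (simp add: power2_eq_square)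
  moreover have "\<bar>a - b\<bar>\<^sup>2 \<le> \<bar>a - b\<bar> * 1"
    unfolding power2_eq_square using ab by (intro mult_left_mono) auto
  moreover have "norm (\<i> * complex_of_real (a - b)) = \<bar>a - b\<bar>"
    unfolding norm_mult by (simp del: of_real_diff)
  moreover have "norm (\<i> * complex_of_real (a - b)) \<le> norm (iexp (a - b) - 1) + norm (iexp (a - b) - (1 + \<i> * (a - b)))"
    using norm_triangle_ineq4[of "iexp (a - b) - 1" "iexp (a - b) - (1 + \<i> * (a - b))"] by simp
  ultimately have "\<bar>a - b\<bar> / 2 \<le> norm (iexp (a - b) - 1)" by simp
  also have "\<dots> = norm (iexp b * (iexp (a - b) - 1))" by (simp add: norm_mult)
  also have "iexp b * (iexp (a - b) - 1) = iexp a - iexp b"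
    by (simp add: algebra_simps exp_add[symmetric])
  finally show ?thesis .
qed

lemma iexp_diff_le: "norm (iexp a - iexp b) \<le> \<bar>a - b\<bar>"
proof -
  have "iexp a - iexp b = iexp b * (iexp (a - b) - 1)"
    by (simp add: algebra_simps exp_add[symmetric])
  then have "norm (iexp a - iexp b) = norm (iexp (a - b) - 1)" by (simp add: norm_mult)
  then show ?thesis using iexp_approx1[of "a - b" 0] by simp
qed

text \<open>On \<open>{0..h}\<close> the exponential factor is at least
  \<open>exp (- 1) \<ge> 1 / 3\<close>. In this way a resolvent bound with parameter
  \<open>1 / h\<close> controls integrals over times up to \<open>h\<close>.\<close>

lemma indicator_le_erlang_density:
  fixes h s :: real
  assumes h: "0 < h"
  shows "indicator {0..h} s \<le> ennreal (3 * h) * ennreal (erlang_density 0 (1/h) s)"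
proof -
  have "indicator {0..h} s \<le> 3 * h * erlang_density 0 (1/h) s"
  proof (cases "s \<in> {0..h}")
    case True
    then have "exp (s / h) \<le> 3"
      using h exp_le order_trans[of "exp (s/h)" "exp 1" 3] by simp
    then have "1 \<le> 3 * exp (- s / h)" by (simp add: exp_minus field_simps)
    then show ?thesis using True h by (simp add: erlang_density_def)
  qed (use h in simp)
  then have "ennreal (indicator {0..h} s) \<le> ennreal (3 * h * erlang_density 0 (1/h) s)" by (rule ennreal_leI)
  also have "\<dots> = ennreal (3 * h) * ennreal (erlang_density 0 (1/h) s)"
    using h by (intro ennreal_mult) auto
  finally show ?thesis by (simp add: ennreal_indicator)
qed

text \<open>All that the analytic part uses of the diffusion. \<open>potential_bound\<close> is
  consistent with parabolic scaling and takes a real bound \<open>A\<close> for the weighted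
  integral, so that its root is a real power. In \<open>stay\<close> the constants may depend on
  \<kappa>, but \<open>c\<close> is the same for all centres and all small radii; large \<kappa> is
  needed to cover many clock readings.\<close>

locale elliptic_semigroup = markov_semigroup K
  for K :: "real \<Rightarrow> 'a::euclidean_space \<Rightarrow> 'a measure" +
  fixes p N \<mu> :: real
  assumes pos: "0 < p" "0 < N" "0 < \<mu>"
    and potential_bound: "0 < \<kappa> \<Longrightarrow> f \<in> borel_measurable borel \<Longrightarrow> (\<And>y. 0 \<le> f y) \<Longrightarrow> 0 \<le> A \<Longrightarrow>
      (\<integral>\<^sup>+y. ennreal (exp (- (p * \<mu> * sqrt \<kappa> * dist y x)) * f y powr p) \<partial>lborel) \<le> ennreal A \<Longrightarrow>
      (\<integral>\<^sup>+s. erlang_density 0 \<kappa> s * (\<integral>\<^sup>+y. ennreal (f y) \<partial>K s x) \<partial>lborel)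
        \<le> ennreal (N * \<kappa> powr (DIM('a) / (2 * p)) * A powr (1 / p))"
    and stay: "0 < \<kappa> \<Longrightarrow> \<exists>c>0. \<exists>r\<^sub>0>0. \<forall>r s x. 0 < r \<and> r \<le> r\<^sub>0 \<and> 0 \<le> s \<and> s \<le> \<kappa> * r\<^sup>2 \<longrightarrow>
      c \<le> measure (K s x) (ball x r)"
begin

section \<open>Occupation of sets over short times\<close>

text \<open>The exponential weight is simply bounded by \<open>1\<close>. The right side is written
  so as to compare the volume of \<Gamma> with that of a ball of radius \<surd>h: the occupation
  time is \<open>h\<close> times a power of this ratio, up to a constant.\<close>

lemma occupation_le:
  assumes h: "0 < h" and [measurable]: "\<Gamma> \<in> sets borel" and fin: "emeasure lborel \<Gamma> < \<infinity>"
  shows "(\<integral>\<^sup>+s. indicator {0..h} s * emeasure (K s x) \<Gamma> \<partial>lborel)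
    \<le> ennreal (3 * N * h * (measure lborel \<Gamma> / h powr (DIM('a) / 2)) powr (1 / p))"
proof -
  have "(\<integral>\<^sup>+s. indicator {0..h} s * emeasure (K s x) \<Gamma> \<partial>lborel)
     \<le> (\<integral>\<^sup>+s. ennreal (3 * h) * (erlang_density 0 (1/h) s * (\<integral>\<^sup>+y. ennreal (indicator \<Gamma> y) \<partial>K s x)) \<partial>lborel)"
  proof (rule nn_integral_mono)
    fix s
    have "indicator {0..h} s * emeasure (K s x) \<Gamma>
       \<le> ennreal (3 * h) * ennreal (erlang_density 0 (1/h) s) * emeasure (K s x) \<Gamma>"
      by (rule mult_right_mono[OF indicator_le_erlang_density[OF h]]) simp
    then show "indicator {0..h} s * emeasure (K s x) \<Gamma> \<le>
      ennreal (3 * h) * (erlang_density 0 (1/h) s * (\<integral>\<^sup>+y. ennreal (indicator \<Gamma> y) \<partial>K s x))"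
      by (simp add: ennreal_indicator mult.assoc)
  qed
  also have "\<dots> = ennreal (3 * h) * (\<integral>\<^sup>+s. erlang_density 0 (1/h) s * (\<integral>\<^sup>+y. ennreal (indicator \<Gamma> y) \<partial>K s x) \<partial>lborel)"
    by (rule nn_integral_cmult) measurable
  also have "\<dots> \<le> ennreal (3 * h) * ennreal (N * (1/h) powr (DIM('a) / (2 * p)) * measure lborel \<Gamma> powr (1 / p))"
  proof (intro mult_left_mono potential_bound)
    have "(\<integral>\<^sup>+y. ennreal (exp (- (p * \<mu> * sqrt (1/h) * dist y x)) * indicator \<Gamma> y powr p) \<partial>lborel)
      \<le> (\<integral>\<^sup>+y. indicator \<Gamma> y \<partial>lborel)"
      using pos h by (intro nn_integral_mono) (auto split: split_indicator intro!: ennreal_leI simp: ennreal_le_1)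
    also have "\<dots> = emeasure lborel \<Gamma>" by simp
    also have "\<dots> = ennreal (measure lborel \<Gamma>)"
      using fin by (simp add: emeasure_eq_ennreal_measure)
    finally show "(\<integral>\<^sup>+y. ennreal (exp (- (p * \<mu> * sqrt (1/h) * dist y x)) * indicator \<Gamma> y powr p) \<partial>lborel)
      \<le> ennreal (measure lborel \<Gamma>)" .
  qed (use h in auto)
  also have "\<dots> = ennreal (3 * h * (N * (1/h) powr (DIM('a) / (2 * p)) * measure lborel \<Gamma> powr (1 / p)))"
    using h pos by (intro ennreal_mult[symmetric]) auto
  also have "3 * h * (N * (1/h) powr (DIM('a) / (2 * p)) * measure lborel \<Gamma> powr (1 / p))
     = 3 * N * h * (measure lborel \<Gamma> / h powr (DIM('a) / 2)) powr (1 / p)"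
    using h pos by (simp add: powr_divide powr_powr)
  finally show ?thesis .
qed

text \<open>At time \<open>t\<close> the process is in \<open>ball x r\<close> with probability
  \<open>m \<ge> c\<^sub>1\<close>. From any point of this ball it is within \<open>2 * r\<close> of
  \<open>x\<close> at each later time up to \<open>h\<close> with probability at least
  \<open>c\<^sub>2\<close>, and the event of being outside \<open>A\<close> costs at most half of
  this. The resulting occupation of \<open>A \<inter> ball x (2 * r)\<close> is compared with
  \<open>occupation_le\<close>, applied only to starting points in \<open>ball x r\<close>, so that
  the factor \<open>m\<close> cancels. The conclusion is therefore free of
  \<open>c\<^sub>1\<close>.\<close>

lemma return_occupation:
  assumes c: "0 < c\<^sub>1" "c\<^sub>1 \<le> measure (K t x) (ball x r)" and t: "0 \<le> t" and h: "0 < h"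
    and c2: "\<And>s y. 0 \<le> s \<Longrightarrow> s \<le> h \<Longrightarrow> c\<^sub>2 \<le> measure (K s y) (ball y r)"
    and [measurable]: "A \<in> sets borel"
    and \<epsilon>: "2 * \<epsilon> \<le> c\<^sub>1 * c\<^sub>2"
    and A: "\<And>s. t \<le> s \<Longrightarrow> s \<le> t + h \<Longrightarrow> measure (K s x) (- A) \<le> \<epsilon>"
  shows "c\<^sub>2 / 2 \<le> 3 * N * (measure lborel (A \<inter> ball x (2 * r)) / h powr (DIM('a) / 2)) powr (1 / p)"
proof -
  define \<Gamma> where "\<Gamma> = A \<inter> ball x (2 * r)"
  define Q where "Q = 3 * N * (measure lborel \<Gamma> / h powr (DIM('a) / 2)) powr (1 / p)"
  define m where "m = measure (K t x) (ball x r)"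
  have [measurable]: "\<Gamma> \<in> sets borel" by (simp add: \<Gamma>_def)
  have Q: "0 \<le> Q" using pos by (simp add: Q_def)
  have fin: "emeasure lborel \<Gamma> < \<infinity>"
    unfolding \<Gamma>_def using emeasure_lborel_ball_finite[of x "2*r"]
    by (metis emeasure_mono inf_le2 infinity_ennreal_def order_le_less_trans sets_lborel borel_open open_ball)
  interpret P: pair_sigma_finite lborel "K t x" ..
  have lower: "c\<^sub>2 / 2 * m \<le> (\<integral>y. indicator (ball x r) y * measure (K s y) \<Gamma> \<partial>K t x)" if s: "0 \<le> s" "s \<le> h" for s
  proof -
    have [measurable]: "(\<lambda>y. measure (K s y) B) \<in> borel_measurable borel" if "B \<in> sets borel" for B
      using measurable_compose[OF measurable_prob_algebraD[OF kernel] measurable_measure_subprob_algebra[OF that]] .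
    have i1: "integrable (K t x) (\<lambda>y. indicator B y * measure (K s y) D)"
      if "B \<in> sets borel" "D \<in> sets borel" for B D
      using that by (intro integrable_kernel_bounded[where B=1]) (auto simp: indicator_def)
    have i2: "integrable (K t x) (\<lambda>y. measure (K s y) D)" if "D \<in> sets borel" for D
      using that by (intro integrable_kernel_bounded[where B=1]) auto
    have i3: "integrable (K t x) (indicator (ball x r) :: _ \<Rightarrow> real)"
      by (intro integrable_kernel_bounded[where B=1]) (auto intro!: borel_measurable_indicator split: split_indicator)
    have "c\<^sub>2 * m - \<epsilon> \<le> c\<^sub>2 * m - measure (K (t + s) x) (- A)"
      using A[of "t+s"] s by simp
    also have "measure (K (t + s) x) (- A) = (\<integral>w. indicator (- A) w \<partial>K (t + s) x)" by simp
    also have "\<dots> = (\<integral>y. (\<integral>w. indicator (- A) w \<partial>K s y) \<partial>K t x)"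
      by (rule integral_chapman_real[where B=1]) (use t s in auto)
    also have "\<dots> = (\<integral>y. measure (K s y) (- A) \<partial>K t x)" by simp
    also have "c\<^sub>2 * m = (\<integral>y. c\<^sub>2 * indicator (ball x r) y \<partial>K t x)" by (simp add: m_def)
    also have "(\<integral>y. c\<^sub>2 * indicator (ball x r) y \<partial>K t x) - (\<integral>y. measure (K s y) (- A) \<partial>K t x)
      = (\<integral>y. c\<^sub>2 * indicator (ball x r) y - measure (K s y) (- A) \<partial>K t x)"
      by (rule Bochner_Integration.integral_diff[symmetric]) (auto intro!: i2 i3)
    also have "\<dots> \<le> (\<integral>y. indicator (ball x r) y * measure (K s y) \<Gamma> \<partial>K t x)"
    proof (rule integral_mono)
      show "integrable (K t x) (\<lambda>y. c\<^sub>2 * indicator (ball x r) y - measure (K s y) (- A))"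
        by (auto intro!: Bochner_Integration.integrable_diff i2 i3)
      show "integrable (K t x) (\<lambda>y. indicator (ball x r) y * measure (K s y) \<Gamma>)" by (rule i1) auto
      fix y
      show "c\<^sub>2 * indicator (ball x r) y - measure (K s y) (- A) \<le> indicator (ball x r) y * measure (K s y) \<Gamma>"
      proof (cases "y \<in> ball x r")
        case True
        have "ball y r \<subseteq> \<Gamma> \<union> - A"
          using True dist_triangle2 unfolding \<Gamma>_def
          by (auto simp: dist_commute) (smt (verit) dist_commute dist_triangle)
        then have "measure (K s y) (ball y r) \<le> measure (K s y) (\<Gamma> \<union> - A)"
          by (intro kernel.finite_measure_mono) auto
        also have "\<dots> \<le> measure (K s y) \<Gamma> + measure (K s y) (- A)"
          by (rule measure_Un_le) auto
        finally show ?thesis using c2[OF s, of y] True by simp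
      qed simp
    qed
    finally have "c\<^sub>2 * m - \<epsilon> \<le> (\<integral>y. indicator (ball x r) y * measure (K s y) \<Gamma> \<partial>K t x)"
      by (simp add: m_def)
    \<comment> \<open>Since \<open>m \<ge> c\<^sub>1\<close>, the loss \<epsilon> is at most half of
      \<open>c\<^sub>2 * m\<close>. A negative \<open>c\<^sub>2\<close> is impossible because
      \<epsilon> bounds a probability.\<close>
    moreover have "c\<^sub>2 * m - \<epsilon> \<ge> c\<^sub>2 / 2 * m"
    proof (cases "0 \<le> c\<^sub>2")
      case True
      then have "c\<^sub>1 * c\<^sub>2 \<le> m * c\<^sub>2" using c by (intro mult_right_mono) (auto simp: m_def)
      then show ?thesis using \<epsilon> by (simp add: mult_ac)
    next
      case False
      have "0 \<le> measure (K t x) (- A)" by simp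
      also have "\<dots> \<le> \<epsilon>" using A[of t] h by simp
      finally show ?thesis using \<epsilon> False c mult_pos_neg[of c\<^sub>1 c\<^sub>2] by linarith
    qed
    ultimately show ?thesis by linarith
  qed
  have mm: "0 < m" using c by (simp add: m_def)
  have "ennreal (h * (c\<^sub>2 / 2 * m)) = ennreal (c\<^sub>2 / 2 * m) * ennreal h"
    using h by (subst ennreal_mult''[symmetric]) (auto simp: mult.commute)
  also have "\<dots> = (\<integral>\<^sup>+s. ennreal (c\<^sub>2 / 2 * m) * indicator {0..h} s \<partial>lborel)"
    using h by (subst nn_integral_cmult_indicator) auto
  also have "\<dots> \<le> (\<integral>\<^sup>+s. (\<integral>\<^sup>+y. indicator (ball x r) y * (indicator {0..h} s * emeasure (K s y) \<Gamma>) \<partial>K t x) \<partial>lborel)"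
  proof (rule nn_integral_mono)
    fix s
    show "ennreal (c\<^sub>2 / 2 * m) * indicator {0..h} s \<le> (\<integral>\<^sup>+y. indicator (ball x r) y * (indicator {0..h} s * emeasure (K s y) \<Gamma>) \<partial>K t x)"
    proof (cases "s \<in> {0..h}")
      case True
      have [measurable]: "(\<lambda>y. measure (K s y) \<Gamma>) \<in> borel_measurable borel"
        by (rule measurable_compose[OF measurable_prob_algebraD[OF kernel] measurable_measure_subprob_algebra]) simp
      have "ennreal (c\<^sub>2 / 2 * m) \<le> ennreal (\<integral>y. indicator (ball x r) y * measure (K s y) \<Gamma> \<partial>K t x)"
        using lower[of s] True by (intro ennreal_leI) auto
      also have "\<dots> = (\<integral>\<^sup>+y. ennreal (indicator (ball x r) y * measure (K s y) \<Gamma>) \<partial>K t x)"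
        by (intro nn_integral_eq_integral[symmetric] integrable_kernel_bounded[where B=1]) (auto simp: indicator_def)
      also have "\<dots> = (\<integral>\<^sup>+y. indicator (ball x r) y * (indicator {0..h} s * emeasure (K s y) \<Gamma>) \<partial>K t x)"
        using True by (intro nn_integral_cong) (auto simp: indicator_def kernel.emeasure_eq_measure)
      finally show ?thesis using True by simp
    qed simp
  qed
  also have "\<dots> = (\<integral>\<^sup>+y. (\<integral>\<^sup>+s. indicator (ball x r) y * (indicator {0..h} s * emeasure (K s y) \<Gamma>) \<partial>lborel) \<partial>K t x)"
  proof (rule P.Fubini'[symmetric])
    have "(\<lambda>z. emeasure (K (fst z) (snd z)) \<Gamma>) \<in> borel_measurable (lborel \<Otimes>\<^sub>M K t x)"
      by measurable
    moreover have "(\<lambda>z. indicator (ball x r) (snd z) :: ennreal) \<in> borel_measurable (lborel \<Otimes>\<^sub>M K t x)"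
      by (rule measurable_compose[OF measurable_snd]) (auto intro!: borel_measurable_indicator)
    moreover have "(\<lambda>z. indicator {0..h} (fst z) :: ennreal) \<in> borel_measurable (lborel \<Otimes>\<^sub>M K t x)"
      by (rule measurable_compose[OF measurable_fst]) (auto intro!: borel_measurable_indicator)
    ultimately show "(\<lambda>(s, y). indicator (ball x r) y * (indicator {0..h} s * emeasure (K s y) \<Gamma>)) \<in> borel_measurable (lborel \<Otimes>\<^sub>M K t x)"
      unfolding case_prod_beta' by (intro borel_measurable_times_ennreal)
  qed
  also have "\<dots> = (\<integral>\<^sup>+y. indicator (ball x r) y * (\<integral>\<^sup>+s. indicator {0..h} s * emeasure (K s y) \<Gamma> \<partial>lborel) \<partial>K t x)"
    by (intro nn_integral_cong nn_integral_cmult) measurable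
  also have "\<dots> \<le> (\<integral>\<^sup>+y. ennreal (h * Q) * indicator (ball x r) y \<partial>K t x)"
    using occupation_le[OF h _ fin] 
    by (intro nn_integral_mono) (auto simp: Q_def mult_ac split: split_indicator)
  also have "\<dots> = ennreal (h * Q) * emeasure (K t x) (ball x r)"
    by (rule nn_integral_cmult_indicator) simp
  also have "\<dots> = ennreal (h * Q * m)"
    using Q h by (simp add: m_def kernel.emeasure_eq_measure ennreal_mult)
  finally have "h * (c\<^sub>2 / 2 * m) \<le> h * Q * m"
    using Q h mm by (subst (asm) ennreal_le_iff) auto
  then have "c\<^sub>2 / 2 \<le> Q" using h mm by simp
  then show ?thesis by (simp add: Q_def \<Gamma>_def)
qed

text \<open>
  The sets \<open>A k\<close> are to be read as ``the clock shows \<open>16 k h\<close>''. By \<open>return_occupation\<close> each of them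
  fills a fixed proportion of a ball of radius \<open>2\<surd>h\<close>, so that there cannot be many disjoint ones.
\<close>

lemma no_clock:
  obtains m :: nat and \<epsilon> h\<^sub>0 :: real where "0 < m" "0 < \<epsilon>" "0 < h\<^sub>0"
    "\<And>h x A. 0 < h \<Longrightarrow> h \<le> h\<^sub>0 \<Longrightarrow> (\<And>k. k < m \<Longrightarrow> A k \<in> sets borel) \<Longrightarrow> disjoint_family_on A {..<m} \<Longrightarrow>
      (\<And>k s. k < m \<Longrightarrow> 16 * real k * h \<le> s \<Longrightarrow> s \<le> 16 * real k * h + h \<Longrightarrow> measure (K s x) (- A k) \<le> \<epsilon>) \<Longrightarrow> False"
proof -
  define D where "D = DIM('a)"
  define \<omega> where "\<omega> = unit_ball_vol (real D) * 2 ^ D"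
  obtain c\<^sub>2 r\<^sub>2 where c2: "0 < c\<^sub>2" "0 < r\<^sub>2"
    "\<And>r s x. 0 < r \<Longrightarrow> r \<le> r\<^sub>2 \<Longrightarrow> 0 \<le> s \<Longrightarrow> s \<le> 1 * r\<^sup>2 \<Longrightarrow> c\<^sub>2 \<le> measure (K s x) (ball x r)"
    using stay[of 1] by (metis zero_less_one)
  define c\<^sub>3 where "c\<^sub>3 = (c\<^sub>2 / (6 * N)) powr p"
  have c3: "0 < c\<^sub>3" using c2 pos by (simp add: c\<^sub>3_def)
  \<comment> \<open>The proportion \<open>c\<^sub>3\<close> comes from the staying probability over
    times up to \<open>r\<^sup>2\<close> alone, so \<open>m\<close> is fixed here, before the
    staying probability \<open>c\<^sub>1\<close> over times up to \<open>16 * m * r\<^sup>2\<close>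
    is chosen. More than \<open>\<omega> / c\<^sub>3\<close> disjoint sets of volume
    \<open>c\<^sub>3 * r ^ D\<close> do not fit into \<open>ball x (2 * r)\<close>, whose volume is
    \<open>\<omega> * r ^ D\<close>.\<close>
  obtain m :: nat where m: "\<omega> / c\<^sub>3 < real m" using reals_Archimedean2 by blast
  have \<omega>: "0 < \<omega>" by (simp add: \<omega>_def)
  have m0: "0 < m" using m \<omega> c3 by (metis divide_pos_pos less_trans of_nat_0_less_iff)
  obtain c\<^sub>1 r\<^sub>1 where c1: "0 < c\<^sub>1" "0 < r\<^sub>1"
    "\<And>r s x. 0 < r \<Longrightarrow> r \<le> r\<^sub>1 \<Longrightarrow> 0 \<le> s \<Longrightarrow> s \<le> (16 * real m) * r\<^sup>2 \<Longrightarrow> c\<^sub>1 \<le> measure (K s x) (ball x r)"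
    using stay[of "16 * real m"] m0 by (metis of_nat_0_less_iff zero_less_mult_iff zero_less_numeral)
  define r\<^sub>0 where "r\<^sub>0 = min r\<^sub>1 r\<^sub>2"
  show thesis
  proof (rule that[of m "c\<^sub>1 * c\<^sub>2 / 2" "r\<^sub>0\<^sup>2"])
    show "0 < m" by fact
    show "0 < c\<^sub>1 * c\<^sub>2 / 2" "0 < r\<^sub>0\<^sup>2" using c1 c2 by (auto simp: r\<^sub>0_def)
    fix h x A
    assume h: "0 < h" "h \<le> r\<^sub>0\<^sup>2" and Am: "\<And>k. k < m \<Longrightarrow> A k \<in> sets borel" and disj: "disjoint_family_on A {..<m}"
      and A: "\<And>k s. k < m \<Longrightarrow> 16 * real k * h \<le> s \<Longrightarrow> s \<le> 16 * real k * h + h \<Longrightarrow> measure (K s x) (- A k) \<le> c\<^sub>1 * c\<^sub>2 / 2"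
    define r where "r = sqrt h"
    have r: "0 < r" "r \<le> r\<^sub>1" "r \<le> r\<^sub>2" "r\<^sup>2 = h"
    proof -
      show "0 < r" "r\<^sup>2 = h" using h by (auto simp: r_def)
      have "r \<le> r\<^sub>0" using h c1 c2 real_sqrt_le_mono[OF h(2)] by (simp add: r_def r\<^sub>0_def)
      then show "r \<le> r\<^sub>1" "r \<le> r\<^sub>2" by (auto simp: r\<^sub>0_def)
    qed
    have hd: "h powr (real D / 2) = r ^ D"
      using h by (simp add: r_def powr_half_sqrt[symmetric] powr_powr powr_realpow[symmetric])
    have fin: "emeasure lborel (A k \<inter> ball x (2 * r)) < \<infinity>" if "k < m" for k
      using emeasure_lborel_ball_finite[of x "2*r"]
      by (metis emeasure_mono inf_le2 infinity_ennreal_def order_le_less_trans sets_lborel borel_open open_ball)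
    have large: "c\<^sub>3 * r ^ D \<le> measure lborel (A k \<inter> ball x (2 * r))" if k: "k < m" for k
    proof -
      have "16 * real k * h \<le> (16 * real m) * r\<^sup>2"
        using k h r by simp
      then have "c\<^sub>1 \<le> measure (K (16 * real k * h) x) (ball x r)"
        using h r by (intro c1(3)) auto
      from return_occupation[OF c1(1) this _ h(1), of c\<^sub>2 "A k" "c\<^sub>1 * c\<^sub>2 / 2"]
      have "c\<^sub>2 / 2 \<le> 3 * N * (measure lborel (A k \<inter> ball x (2 * r)) / h powr (real DIM('a) / 2)) powr (1 / p)"
        using c2(3)[OF r(1,3)] r(4) Am[OF k] A[OF k] h by auto
      then have "c\<^sub>2 / (6 * N) \<le> (measure lborel (A k \<inter> ball x (2 * r)) / r ^ D) powr (1 / p)"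
        using pos hd by (simp add: field_simps D_def)
      then have "c\<^sub>3 \<le> ((measure lborel (A k \<inter> ball x (2 * r)) / r ^ D) powr (1 / p)) powr p"
        unfolding c\<^sub>3_def using pos c2 by (intro powr_mono2) auto
      also have "\<dots> = measure lborel (A k \<inter> ball x (2 * r)) / r ^ D"
        using pos r by (simp add: powr_powr)
      finally show ?thesis using r by (simp add: field_simps)
    qed
    have "real m * (c\<^sub>3 * r ^ D) = (\<Sum>k<m. c\<^sub>3 * r ^ D)" by simp
    also have "\<dots> \<le> (\<Sum>k<m. measure lborel (A k \<inter> ball x (2 * r)))"
      by (rule sum_mono) (use large in auto)
    also have "\<dots> = measure lborel (\<Union>k<m. A k \<inter> ball x (2 * r))"
    proof (rule measure_finite_Union[symmetric])
      show "disjoint_family_on (\<lambda>k. A k \<inter> ball x (2 * r)) {..<m}"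
        using disj by (fastforce simp: disjoint_family_on_def)
    qed (use Am fin in \<open>auto simp: less_top\<close>)
    also have "\<dots> \<le> measure lborel (ball x (2 * r))"
      using Am emeasure_lborel_ball_finite[of x "2*r"]
      by (intro measure_mono_fmeasurable) (auto simp: fmeasurable_def intro!: sets.finite_UN)
    also have "\<dots> = \<omega> * r ^ D"
      using content_ball[of "2 * r" x] r by (simp add: \<omega>_def D_def power_mult_distrib)
    finally have "real m * c\<^sub>3 \<le> \<omega>" using r by simp
    then show False using m c3 by (simp add: field_simps)
  qed
qed

text \<open>
  The weight \<open>\<surd>v\<close> is tied to quadratic estimates: \<open>|g| \<le> \<surd>v\<close> controls the second moment in \<open>clock\<close>.
  The best constant \<open>c\<close> in \<open>|u| \<le> c \<surd>v\<close> is found by descent: as long as \<open>c\<close> exceeds a multiple of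
  \<open>l / |\<eta>|\<close>, it can be improved by a factor \<open>1 - \<epsilon>\<close>.
\<close>

lemma transform_0_decay:
  obtains C l\<^sub>0 where "0 < C" "0 < l\<^sub>0"
    "\<And>l \<eta> v g x. l\<^sub>0 \<le> l \<Longrightarrow> excessive l v \<Longrightarrow> g \<in> borel_measurable borel \<Longrightarrow>
      (\<And>y. norm (g y) \<le> sqrt (v y)) \<Longrightarrow> norm (transform 0 l \<eta> g x) \<le> C * l / sqrt (l\<^sup>2 + \<eta>\<^sup>2) * sqrt (v x)"
proof -
  obtain m :: nat and \<epsilon>\<^sub>0 h\<^sub>0 :: real where m: "0 < m" and \<epsilon>0: "0 < \<epsilon>\<^sub>0" and h0: "0 < h\<^sub>0" and
    no_clock: "\<And>h x A. 0 < h \<Longrightarrow> h \<le> h\<^sub>0 \<Longrightarrow> (\<And>k. k < m \<Longrightarrow> A k \<in> sets borel) \<Longrightarrow> disjoint_family_on A {..<m} \<Longrightarrow>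
      (\<And>k s. k < m \<Longrightarrow> 16 * real k * h \<le> s \<Longrightarrow> s \<le> 16 * real k * h + h \<Longrightarrow> measure (K s x) (- A k) \<le> \<epsilon>\<^sub>0) \<Longrightarrow> False"
    using no_clock by blast
  \<comment> \<open>\<open>3072 = 12 * 16\<^sup>2\<close> is the constant of Chebyshev's inequality
    below: the mean square is at most \<open>12 * \<epsilon> * (c * V)\<^sup>2\<close> and the
    deviation is \<open>c * V / (16 * m)\<close>. The bound \<open>1/4\<close> keeps the modulus at
    \<open>x\<close> above three quarters of \<open>c * V\<close>.\<close>
  define \<epsilon> where "\<epsilon> = min (1/4) (\<epsilon>\<^sub>0 / (3072 * (real m)\<^sup>2))"
  have \<epsilon>: "0 < \<epsilon>" "\<epsilon> \<le> 1/4" "3072 * (real m)\<^sup>2 * \<epsilon> \<le> \<epsilon>\<^sub>0"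
    using m \<epsilon>0 by (auto simp: \<epsilon>_def min_def field_simps)
  \<comment> \<open>In the regime considered \<open>\<bar>\<eta>\<bar>\<close> is at least
    \<open>l\<^sub>0\<close>, so that the time unit \<open>h\<close> chosen below is at most
    \<open>h\<^sub>0\<close>.\<close>
  define l\<^sub>0 where "l\<^sub>0 = 1 / (16 * real m * h\<^sub>0)"
  have l0: "0 < l\<^sub>0" using m h0 by (simp add: l\<^sub>0_def)
  have improve: "norm (transform 0 l \<eta> g x) \<le> (1 - \<epsilon>) * c * sqrt (v x)"
    if l: "l\<^sub>0 \<le> l" "2 * l \<le> \<bar>\<eta>\<bar>" and v: "excessive l v" and g[measurable]: "g \<in> borel_measurable borel"
      and gv: "\<And>y. norm (g y) \<le> sqrt (v y)" and c: "0 < c" "2 * l \<le> c * \<epsilon> * \<bar>\<eta>\<bar>"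
      and u: "\<And>y. norm (transform 0 l \<eta> g y) \<le> c * sqrt (v y)" for l \<eta> v g c x
  proof (rule ccontr)
    define w where "w = transform 0 l \<eta> g"
    define V where "V = sqrt (v x)"
    have [measurable]: "w \<in> borel_measurable borel" by (simp add: w_def)
    have lpos: "0 < l" using l l0 by linarith
    then have \<eta>: "0 < \<bar>\<eta>\<bar>" using l by linarith
    assume "\<not> norm (transform 0 l \<eta> g x) \<le> (1 - \<epsilon>) * c * sqrt (v x)"
    then have wx: "(1 - \<epsilon>) * c * V < norm (w x)" by (simp add: w_def V_def)
    have wx': "norm (w x) \<le> c * V" using u[of x] by (simp add: w_def V_def)
    have "V \<ge> 0" using v by (auto simp: V_def excessive_def)
    moreover have "V \<noteq> 0" using wx wx' by auto
    ultimately have V: "0 < V" by simp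
    have vx: "v x = V\<^sup>2" using v by (auto simp: V_def excessive_def)
    have cV: "0 < c * V" using c V by simp
    have wx34: "3 / 4 * (c * V) < norm (w x)"
    proof -
      have "3 / 4 * (c * V) \<le> (1 - \<epsilon>) * (c * V)" using \<epsilon> cV by (intro mult_right_mono) auto
      then show ?thesis using wx by simp
    qed
    \<comment> \<open>One clock interval \<open>16 * h\<close> advances the phase by
      \<open>1 / m\<close>. The readings \<open>k < m\<close> thus stay within one radian and differ
      by at least \<open>1 / m\<close>, while within a window of length \<open>h\<close> the phase
      moves by at most \<open>1 / (16 * m)\<close>.\<close>
    define h where "h = 1 / (16 * real m * \<bar>\<eta>\<bar>)"
    have h: "0 < h" "h \<le> h\<^sub>0"
    proof -
      show "0 < h" using m \<eta> by (simp add: h_def)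
      have "1 / (16 * real m * h\<^sub>0) \<le> \<bar>\<eta>\<bar>" using l l0 unfolding l\<^sub>0_def by linarith
      then show "h \<le> h\<^sub>0" using m h0 \<eta> by (simp add: h_def field_simps)
    qed
    have \<eta>h: "\<bar>\<eta>\<bar> * h = 1 / (16 * real m)" using \<eta> by (simp add: h_def)
    \<comment> \<open>Different readings are at distance at least \<open>1 / (2 * m)\<close> times
      \<open>3 / 4 * (c * V)\<close>, which is more than twice the tolerance
      \<open>c * V / (8 * m)\<close>; hence the sets are disjoint.\<close>
    define A where "A k = {y. norm (w y - iexp (\<eta> * (16 * real k * h)) * w x) \<le> c * V / (8 * real m)}" for k :: nat
    show False
    proof (rule no_clock[OF h, of A x])
      show "A k \<in> sets borel" for k
        unfolding A_def by measurable
      show "disjoint_family_on A {..<m}"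
        unfolding disjoint_family_on_def
      proof safe
        fix j k y assume jk: "j < m" "k < m" "j \<noteq> k" and y: "y \<in> A j" "y \<in> A k"
        define a b where "a = \<eta> * (16 * real j * h)" "b = \<eta> * (16 * real k * h)"
        have "a - b = (\<eta> * h) * (16 * (real j - real k))" by (simp add: a_b_def algebra_simps)
        then have ab: "\<bar>a - b\<bar> = \<bar>real j - real k\<bar> / real m"
        proof -
          have "\<bar>16 * (real j - real k)\<bar> = 16 * \<bar>real j - real k\<bar>" by (simp only: abs_mult)
          moreover have "\<bar>\<eta> * h\<bar> = 1 / (16 * real m)" using \<eta>h h by (simp add: abs_mult)
          ultimately show ?thesis
            unfolding \<open>a - b = _\<close> abs_mult[of "\<eta> * h"] by simp
        qed
        have "1 \<le> \<bar>real j - real k\<bar>" "\<bar>real j - real k\<bar> \<le> real m"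
          using jk by linarith+
        then have ab1: "\<bar>a - b\<bar> \<le> 1" "1 / real m \<le> \<bar>a - b\<bar>"
          using m unfolding ab by (auto simp: field_simps)
        have "norm ((iexp a - iexp b) * w x) = norm ((w y - iexp b * w x) - (w y - iexp a * w x))"
          by (simp add: algebra_simps)
        also have "\<dots> \<le> norm (w y - iexp b * w x) + norm (w y - iexp a * w x)"
          by (rule norm_triangle_ineq4)
        also have "\<dots> \<le> c * V / (8 * real m) + c * V / (8 * real m)"
          using y by (intro add_mono) (auto simp: A_def a_b_def)
        finally have 1: "norm (iexp a - iexp b) * norm (w x) \<le> c * V / (4 * real m)"
          by (simp add: norm_mult mult.commute[of V c])
        have "1 / (2 * real m) * (3 / 4 * (c * V)) \<le> norm (iexp a - iexp b) * norm (w x)"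
        proof (rule mult_mono)
          show "1 / (2 * real m) \<le> norm (iexp a - iexp b)"
            using iexp_diff_ge[OF ab1(1)] ab1(2) by (simp add: field_simps)
        qed (use wx34 cV in auto)
        then have "1 / (2 * real m) * (3 / 4 * (c * V)) \<le> c * V / (4 * real m)"
          using 1 by linarith
        then show "y \<in> {}" using cV m by (simp add: field_simps)
      qed
      show "measure (K s x) (- A k) \<le> \<epsilon>\<^sub>0"
        if k: "k < m" and s: "16 * real k * h \<le> s" "s \<le> 16 * real k * h + h" for k s
      proof -
        have s0: "0 \<le> s" using s h by (meson order_trans zero_le_mult_iff of_nat_0_le_iff less_imp_le zero_le_numeral)
        have "\<bar>\<eta>\<bar> * s \<le> 16 * real k * (\<bar>\<eta>\<bar> * h) + \<bar>\<eta>\<bar> * h"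
          using mult_left_mono[OF s(2), of "\<bar>\<eta>\<bar>"] by (simp add: algebra_simps)
        also have "\<dots> \<le> 2"
          unfolding \<eta>h using k m by (simp add: field_simps)
        finally have \<eta>s: "\<bar>\<eta>\<bar> * s \<le> 2" .
        have ls1: "l * s \<le> 1" using mult_right_mono[OF l(2) s0] \<eta>s by simp
        have ls2: "l * s \<le> c * \<epsilon>"
        proof -
          have "2 * (l * s) \<le> c * \<epsilon> * (\<bar>\<eta>\<bar> * s)" using mult_right_mono[OF c(2) s0] by (simp add: mult_ac)
          also have "\<dots> \<le> c * \<epsilon> * 2" using \<eta>s c \<epsilon> by (intro mult_left_mono) auto
          finally show ?thesis by simp
        qed
        obtain B where B: "\<And>y. norm (g y) \<le> B"
          using bounded_of_le_sqrt_excessive[OF v, of g 1] gv by auto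
        have wB: "norm (w y) \<le> B" for y
          unfolding w_def by (rule norm_transform_le[OF g B lpos])
        define q where "q = c * V / (16 * real m)"
        have q: "0 < q" using cV m by (simp add: q_def)
        have int: "integrable (K s x) (\<lambda>y. (norm (w y - iexp (\<eta> * s) * w x))\<^sup>2)"
        proof (rule integrable_kernel_bounded[where B="(2 * B)\<^sup>2"])
          fix y
          have "norm (w y - iexp (\<eta> * s) * w x) \<le> norm (w y) + norm (iexp (\<eta> * s) * w x)"
            by (rule norm_triangle_ineq4)
          also have "\<dots> \<le> 2 * B" using wB[of x] wB[of y] by (simp add: norm_mult)
          finally have "(norm (w y - iexp (\<eta> * s) * w x))\<^sup>2 \<le> (2 * B)\<^sup>2" by (intro power_mono) auto
          then show "norm ((norm (w y - iexp (\<eta> * s) * w x))\<^sup>2) \<le> (2 * B)\<^sup>2" by simp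
        qed measurable
        \<comment> \<open>Of the tolerance \<open>c * V / (8 * m)\<close>, one half may be used up
          by the motion of the phase since the start of the window. The other half \<open>q\<close>
          must be a deviation from the clock at time \<open>s\<close> itself.\<close>
        have sub: "- A k \<subseteq> {y \<in> space (K s x). q\<^sup>2 \<le> (norm (w y - iexp (\<eta> * s) * w x))\<^sup>2}"
        proof
          fix y assume "y \<in> - A k"
          then have "c * V / (8 * real m) < norm (w y - iexp (\<eta> * (16 * real k * h)) * w x)"
            by (simp add: A_def)
          also have "\<dots> = norm ((w y - iexp (\<eta> * s) * w x) + (iexp (\<eta> * s) - iexp (\<eta> * (16 * real k * h))) * w x)"
            by (simp add: algebra_simps)
          also have "\<dots> \<le> norm (w y - iexp (\<eta> * s) * w x) + norm ((iexp (\<eta> * s) - iexp (\<eta> * (16 * real k * h))) * w x)"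
            by (rule norm_triangle_ineq)
          also have "norm ((iexp (\<eta> * s) - iexp (\<eta> * (16 * real k * h))) * w x) \<le> 1 / (16 * real m) * (c * V)"
            unfolding norm_mult
          proof (rule mult_mono)
            have "norm (iexp (\<eta> * s) - iexp (\<eta> * (16 * real k * h))) \<le> \<bar>\<eta> * s - \<eta> * (16 * real k * h)\<bar>"
              by (rule iexp_diff_le)
            also have "\<dots> = \<bar>\<eta>\<bar> * (s - 16 * real k * h)"
              using s by (simp add: right_diff_distrib[symmetric] abs_mult)
            also have "\<dots> \<le> \<bar>\<eta>\<bar> * h" using s by (intro mult_left_mono) auto
            finally show "norm (iexp (\<eta> * s) - iexp (\<eta> * (16 * real k * h))) \<le> 1 / (16 * real m)"
              using \<eta>h by simp
          qed (use wx' m in auto)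
          also have "1 / (16 * real m) * (c * V) = q" by (simp add: q_def)
          finally have "q \<le> norm (w y - iexp (\<eta> * s) * w x)"
            by (simp add: q_def field_simps)
          then show "y \<in> {y \<in> space (K s x). q\<^sup>2 \<le> (norm (w y - iexp (\<eta> * s) * w x))\<^sup>2}"
            using q by (auto intro!: power_mono)
        qed
        have "measure (K s x) (- A k) \<le> measure (K s x) {y \<in> space (K s x). q\<^sup>2 \<le> (norm (w y - iexp (\<eta> * s) * w x))\<^sup>2}"
          by (rule kernel.finite_measure_mono[OF sub]) measurable
        also have "\<dots> \<le> (\<integral>y. (norm (w y - iexp (\<eta> * s) * w x))\<^sup>2 \<partial>K s x) / q\<^sup>2"
          by (rule integral_Markov_inequality_measure[OF int, where A="{}"]) (use q in auto)
        also have "\<dots> \<le> (6 * (\<epsilon> + \<epsilon>) * c\<^sup>2 * v x) / q\<^sup>2"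
          unfolding w_def using wx \<epsilon>
          by (intro divide_right_mono clock[OF v g lpos gv u c(1) s0 ls1 ls2]) (auto simp: V_def w_def)
        also have "\<dots> = 3072 * (real m)\<^sup>2 * \<epsilon>"
          using cV m c V by (simp add: q_def vx power_divide power_mult_distrib field_simps)
        also have "\<dots> \<le> \<epsilon>\<^sub>0" by (rule \<epsilon>)
        finally show ?thesis .
      qed
    qed
  qed
  \<comment> \<open>\<open>4 / \<epsilon>\<close> serves for
    \<open>\<bar>\<eta>\<bar> \<ge> 2 * l\<close>, where \<open>sqrt (l\<^sup>2 + \<eta>\<^sup>2)
    \<le> 2 * \<bar>\<eta>\<bar>\<close>. The summand \<open>6\<close> serves for the other
    frequencies, where the initial constant \<open>2\<close> is used and the root is at most
    \<open>3 * l\<close>.\<close>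
  define C where "C = 4 / \<epsilon> + 6"
  show thesis
  proof (rule that[of C l\<^sub>0])
    show "0 < C" "0 < l\<^sub>0" using \<epsilon> l0 by (auto simp: C_def add_pos_pos)
    fix l \<eta> v x and g :: "'a \<Rightarrow> complex"
    assume l: "l\<^sub>0 \<le> l" and v: "excessive l v" and g[measurable]: "g \<in> borel_measurable borel"
      and gv: "\<And>y. norm (g y) \<le> sqrt (v y)"
    have lpos: "0 < l" using l l0 by linarith
    have v0: "0 \<le> v y" for y using v by (auto simp: excessive_def)
    have two: "norm (transform 0 l \<eta> g y) \<le> 2 * sqrt (v y)" for y
      by (rule transform_0_le_sqrt_excessive[OF v g lpos gv])
    have sqrt_pos: "0 < sqrt (l\<^sup>2 + \<eta>\<^sup>2)" using lpos by (simp add: add_pos_nonneg)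
    have key: "norm (transform 0 l \<eta> g x) \<le> c * sqrt (v x)" if "2 * l \<le> \<bar>\<eta>\<bar>" "c = 2 * l / (\<epsilon> * \<bar>\<eta>\<bar>)" for c
    proof -
      have \<eta>: "0 < \<bar>\<eta>\<bar>" using that lpos by linarith
      have c: "0 < c" using that \<epsilon> lpos \<eta> by simp
      define S where "S = {b. 0 \<le> b \<and> (\<forall>y. norm (transform 0 l \<eta> g y) \<le> b * sqrt (v y))}"
      have S2: "2 \<in> S" using two by (simp add: S_def)
      have Sne: "S \<noteq> {}" using S2 by blast
      have bdd: "bdd_below S" by (rule bdd_belowI[of _ 0]) (simp add: S_def)
      \<comment> \<open>The infimum of the admissible constants is itself admissible; where
        \<open>v\<close> vanishes this holds because the transform vanishes too. If it exceeded
        \<open>c\<close>, one improvement would give a smaller admissible constant.\<close>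
      define b where "b = Inf S"
      have b0: "0 \<le> b" unfolding b_def by (rule cInf_greatest[OF Sne]) (auto simp: S_def)
      have bS: "norm (transform 0 l \<eta> g y) \<le> b * sqrt (v y)" for y
      proof (cases "v y = 0")
        case True then show ?thesis using two[of y] by simp
      next
        case False
        then have "0 < sqrt (v y)" using v0[of y] by (simp add: less_le)
        have "norm (transform 0 l \<eta> g y) / sqrt (v y) \<le> b"
          unfolding b_def
          by (rule cInf_greatest[OF Sne]) (use \<open>0 < sqrt (v y)\<close> in \<open>auto simp: S_def divide_le_eq\<close>)
        then show ?thesis using \<open>0 < sqrt (v y)\<close> by (simp add: divide_le_eq)
      qed
      have "b \<le> c"
      proof (rule ccontr)
        assume "\<not> b \<le> c"
        then have bc: "c < b" "0 < b" using c by auto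
        have "2 * l = c * \<epsilon> * \<bar>\<eta>\<bar>" using that \<epsilon> \<eta> by (simp add: field_simps)
        also have "\<dots> \<le> b * \<epsilon> * \<bar>\<eta>\<bar>" using bc \<epsilon> by (intro mult_right_mono) auto
        finally have "(1 - \<epsilon>) * b \<in> S"
          using improve[OF l that(1) v g gv bc(2) _ bS] \<epsilon> bc by (auto simp: S_def)
        then have "b \<le> (1 - \<epsilon>) * b" unfolding b_def by (rule cInf_lower[OF _ bdd])
        moreover have "0 < \<epsilon> * b" using bc \<epsilon> by simp
        ultimately show False by (simp add: algebra_simps)
      qed
      then have "b * sqrt (v x) \<le> c * sqrt (v x)" using v0[of x] by (intro mult_right_mono) auto
      then show ?thesis using bS[of x] by linarith
    qed
    show "norm (transform 0 l \<eta> g x) \<le> C * l / sqrt (l\<^sup>2 + \<eta>\<^sup>2) * sqrt (v x)"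
    proof (cases "2 * l \<le> \<bar>\<eta>\<bar>")
      case True
      have \<eta>: "0 < \<bar>\<eta>\<bar>" using True lpos by linarith
      have "l\<^sup>2 \<le> \<bar>\<eta>\<bar>\<^sup>2" using True lpos by (intro power_mono) auto
      moreover have "0 \<le> \<eta>\<^sup>2" by simp
      ultimately have "l\<^sup>2 + \<eta>\<^sup>2 \<le> (2 * \<bar>\<eta>\<bar>)\<^sup>2"
      proof -
        have "(2 * \<bar>\<eta>\<bar>)\<^sup>2 = 4 * \<eta>\<^sup>2" by (simp add: power_mult_distrib)
        moreover have "l\<^sup>2 \<le> \<eta>\<^sup>2" using \<open>l\<^sup>2 \<le> \<bar>\<eta>\<bar>\<^sup>2\<close> by simp
        ultimately show ?thesis using \<open>0 \<le> \<eta>\<^sup>2\<close> by linarith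
      qed
      then have s: "sqrt (l\<^sup>2 + \<eta>\<^sup>2) \<le> 2 * \<bar>\<eta>\<bar>" by (simp add: real_le_lsqrt)
      have "2 * l / (\<epsilon> * \<bar>\<eta>\<bar>) = 4 / \<epsilon> * l / (2 * \<bar>\<eta>\<bar>)" by simp
      also have "\<dots> \<le> C * l / sqrt (l\<^sup>2 + \<eta>\<^sup>2)"
        using s sqrt_pos lpos \<epsilon> by (intro frac_le mult_right_mono) (auto simp: C_def)
      finally have "2 * l / (\<epsilon> * \<bar>\<eta>\<bar>) * sqrt (v x) \<le> C * l / sqrt (l\<^sup>2 + \<eta>\<^sup>2) * sqrt (v x)"
        using v0[of x] by (intro mult_right_mono) auto
      then show ?thesis using key[OF True refl] by linarith
    next
      case False
      then have "\<bar>\<eta>\<bar>\<^sup>2 \<le> (2 * l)\<^sup>2" by (intro power_mono) auto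
      moreover have "0 \<le> l\<^sup>2" by simp
      ultimately have "l\<^sup>2 + \<eta>\<^sup>2 \<le> (3 * l)\<^sup>2"
      proof -
        have "(3 * l)\<^sup>2 = 9 * l\<^sup>2" "(2 * l)\<^sup>2 = 4 * l\<^sup>2" by (simp_all add: power_mult_distrib)
        moreover have "\<eta>\<^sup>2 \<le> (2 * l)\<^sup>2" using \<open>\<bar>\<eta>\<bar>\<^sup>2 \<le> (2 * l)\<^sup>2\<close> by simp
        ultimately show ?thesis using \<open>0 \<le> l\<^sup>2\<close> by linarith
      qed
      then have s: "sqrt (l\<^sup>2 + \<eta>\<^sup>2) \<le> 3 * l" using lpos by (simp add: real_le_lsqrt)
      have "2 = 6 * l / (3 * l)" using lpos by simp
      also have "\<dots> \<le> C * l / sqrt (l\<^sup>2 + \<eta>\<^sup>2)"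
        using s sqrt_pos lpos \<epsilon> by (intro frac_le mult_right_mono) (auto simp: C_def)
      finally have "2 * sqrt (v x) \<le> C * l / sqrt (l\<^sup>2 + \<eta>\<^sup>2) * sqrt (v x)"
        using v0[of x] by (intro mult_right_mono) auto
      then show ?thesis using two[of x] by linarith
    qed
  qed
qed

end


section \<open>Estimates at fixed times\<close>

lemma interval_integral_Cauchy_kernel:
  fixes l T :: real
  assumes "0 < l" "0 \<le> T"
  shows "(LBINT t=-T..T. l\<^sup>2 / (l\<^sup>2 + t\<^sup>2)) = 2 * l * arctan (T / l)"
proof -
  have pos: "0 < l\<^sup>2 + t\<^sup>2" for t using assms by (simp add: add_pos_nonneg)
  then have nz: "l\<^sup>2 + t\<^sup>2 \<noteq> 0" for t by (metis less_irrefl)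
  have mm: "min (- T) T = - T" "max (- T) T = T" using assms by auto
  have "(LBINT t=-T..T. l\<^sup>2 / (l\<^sup>2 + t\<^sup>2)) = l * arctan (T / l) - l * arctan (- T / l)"
  proof (rule interval_integral_FTC_finite[where F="\<lambda>t. l * arctan (t / l)" and a="-T" and b=T])
    show "continuous_on {min (- T) T..max (- T) T} (\<lambda>t. l\<^sup>2 / (l\<^sup>2 + t\<^sup>2))"
      by (intro continuous_intros ballI nz)
    fix t assume "min (- T) T \<le> t" "t \<le> max (- T) T"
    have "((\<lambda>t. l * arctan (t / l)) has_real_derivative (l * (inverse (1 + (t / l)\<^sup>2) * (1 / l)))) (at t within {min (- T) T..max (- T) T})"
      by (intro DERIV_cmult DERIV_chain2[OF DERIV_arctan] DERIV_cdivide DERIV_ident)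
    also have "l * (inverse (1 + (t / l)\<^sup>2) * (1 / l)) = inverse (1 + (t / l)\<^sup>2)" using assms by simp
    also have "1 + (t / l)\<^sup>2 = (l\<^sup>2 + t\<^sup>2) / l\<^sup>2" using assms by (simp add: power_divide add_divide_distrib)
    also have "inverse ((l\<^sup>2 + t\<^sup>2) / l\<^sup>2) = l\<^sup>2 / (l\<^sup>2 + t\<^sup>2)" by simp
    finally show "((\<lambda>t. l * arctan (t / l)) has_vector_derivative l\<^sup>2 / (l\<^sup>2 + t\<^sup>2)) (at t within {min (- T) T..max (- T) T})"
      by (simp add: has_real_derivative_iff_has_vector_derivative)
  qed
  then show ?thesis by (simp add: arctan_minus)
qed

text \<open>Formally \<open>h t\<close> is at most the integral of the majorant over \<eta> divided
  by \<open>2 * pi\<close>, that is \<open>B * l * pi / (2 * pi)\<close>. To make this rigorous,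
  \<open>h\<close> is normalised to a probability density. Levy's inversion formula then bounds the
  mass of \<open>{t<..t+\<delta>}\<close> by a multiple of \<delta>, and continuity at
  \<open>t\<close> turns averages into the value.\<close>

lemma Fourier_inversion_bound:
  fixes h :: "real \<Rightarrow> real"
  assumes h: "integrable lborel h" "\<And>s. 0 \<le> h s" and cont: "isCont h t" and l: "0 < l" and B: "0 \<le> B"
    and fourier: "\<And>\<eta>. norm (\<integral>s. h s *\<^sub>R iexp (- (\<eta> * s)) \<partial>lborel) \<le> B * (l\<^sup>2 / (l\<^sup>2 + \<eta>\<^sup>2))"
  shows "h t \<le> B * l / 2"
proof -
  define Z where "Z = (\<integral>s. h s \<partial>lborel)"
  have [measurable]: "h \<in> borel_measurable borel" using h(1) by auto
  have Z0: "0 \<le> Z" unfolding Z_def using h by (intro integral_nonneg_AE) auto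
  have hZ: "(\<integral>\<^sup>+s. ennreal (h s) \<partial>lborel) = ennreal Z"
    unfolding Z_def using h by (intro nn_integral_eq_integral) auto
  have avg: "(\<integral>s. indicator {t<..t+\<delta>} s * h s \<partial>lborel) \<le> \<delta> * (B * l / 2)" if \<delta>: "0 < \<delta>" for \<delta>
  proof (cases "Z = 0")
    case True
    then have "AE s in lborel. ennreal (h s) = 0"
      using hZ nn_integral_0_iff_AE[of "\<lambda>s. ennreal (h s)" lborel] by simp
    then have "AE s in lborel. h s = 0"
      by (rule eventually_mono) (simp add: ennreal_eq_0_iff order_antisym h(2))
    then have "AE s in lborel. indicator {t<..t+\<delta>} s * h s = 0"
      by (rule eventually_mono) simp
    then have "(\<integral>s. indicator {t<..t+\<delta>} s * h s \<partial>lborel) = 0"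
      by (rule integral_eq_zero_AE)
    then show ?thesis using B l \<delta> by simp
  next
    case False
    then have Z: "0 < Z" using Z0 by simp
    define M where "M = density lborel (\<lambda>s. ennreal (h s / Z))"
    have hZpos: "0 \<le> h s / Z" for s using h Z by simp
    have "emeasure M (space M) = (\<integral>\<^sup>+s. ennreal (h s / Z) \<partial>lborel)"
      by (simp add: M_def emeasure_density)
    also have "\<dots> = (\<integral>\<^sup>+s. ennreal (1 / Z) * ennreal (h s) \<partial>lborel)"
      using Z h(2) by (intro nn_integral_cong) (subst ennreal_mult[symmetric], auto)
    also have "\<dots> = ennreal (1 / Z) * ennreal Z"
      by (subst nn_integral_cmult) (measurable, simp only: hZ)
    also have "\<dots> = 1" using Z by (subst ennreal_mult[symmetric]) auto
    finally interpret M: prob_space M by (rule prob_spaceI)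
    interpret M: real_distribution M
      by unfold_locales (simp_all add: M_def)
    have atom: "measure M {a} = 0" for a
    proof -
      have "emeasure M {a} = 0"
        unfolding M_def
        by (subst emeasure_density) (simp_all add: nn_integral_indicator_singleton)
      then show ?thesis by (simp add: measure_def)
    qed
    have char: "norm (char M \<eta>) \<le> B / Z * (l\<^sup>2 / (l\<^sup>2 + \<eta>\<^sup>2))" for \<eta>
    proof -
      have "char M \<eta> = (\<integral>s. (h s / Z) *\<^sub>R iexp (\<eta> * s) \<partial>lborel)"
        unfolding char_def M_def by (rule integral_density) (use hZpos in auto)
      also have "\<dots> = (\<integral>s. (1 / Z) *\<^sub>R (h s *\<^sub>R iexp (- ((- \<eta>) * s))) \<partial>lborel)"
        by (intro Bochner_Integration.integral_cong) auto
      also have "\<dots> = (1 / Z) *\<^sub>R (\<integral>s. h s *\<^sub>R iexp (- ((- \<eta>) * s)) \<partial>lborel)"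
        by (rule integral_scaleR_right)
      finally have "norm (char M \<eta>) = (1 / Z) * norm (\<integral>s. h s *\<^sub>R iexp (- ((- \<eta>) * s)) \<partial>lborel)"
        using Z by simp
      also have "\<dots> \<le> (1 / Z) * (B * (l\<^sup>2 / (l\<^sup>2 + (- \<eta>)\<^sup>2)))"
        using Z by (intro mult_left_mono fourier) auto
      finally show ?thesis by simp
    qed
    have bound: "norm (1 / (2 * pi) * (CLBINT s=-real T..real T. (iexp (- (s * t)) - iexp (- (s * (t + \<delta>)))) / (\<i> * s) * char M s)) \<le> \<delta> * (B * l / 2) / Z"
      for T :: nat
    proof -
      define F where "F s = (iexp (- (s * t)) - iexp (- (s * (t + \<delta>)))) / (\<i> * s) * char M s" for s :: real
      define A where "A = einterval (ereal (- real T)) (ereal (real T))"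
      define C where "C = \<delta> * (B / Z)"
      have C: "0 \<le> C" using \<delta> B Z by (simp add: C_def)
      have F: "norm (F s) \<le> C * (l\<^sup>2 / (l\<^sup>2 + s\<^sup>2))" for s
      proof (cases "s = 0")
        case False
        have "norm ((iexp (- (s * t)) - iexp (- (s * (t + \<delta>)))) / (\<i> * s)) \<le> \<delta>"
          using Levy_Inversion_aux2[of "- (t + \<delta>)" "- t" s, unfolded mult_minus_right] False \<delta> by linarith
        then have "norm (F s) \<le> \<delta> * (B / Z * (l\<^sup>2 / (l\<^sup>2 + s\<^sup>2)))"
          unfolding F_def by (subst norm_mult, intro mult_mono char) (use \<delta> in simp_all)
        then show ?thesis by (simp add: C_def)
      qed (use C in \<open>simp add: F_def\<close>)
      have "interval_lebesgue_integrable lborel (ereal (- real T)) (ereal (real T)) (\<lambda>s. C * (l\<^sup>2 / (l\<^sup>2 + s\<^sup>2)))"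
      proof (rule interval_integrable_continuous_on)
        have "l\<^sup>2 + s\<^sup>2 \<noteq> 0" for s using l by (simp add: add_nonneg_eq_0_iff)
        then show "continuous_on {- real T..real T} (\<lambda>s. C * (l\<^sup>2 / (l\<^sup>2 + s\<^sup>2)))"
          by (intro continuous_intros) auto
      qed simp
      then have iG: "set_integrable lborel A (\<lambda>s. C * (l\<^sup>2 / (l\<^sup>2 + s\<^sup>2)))"
        by (simp add: interval_lebesgue_integrable_def A_def)
      have "norm (LINT s:A|lborel. F s) \<le> (LINT s:A|lborel. C * (l\<^sup>2 / (l\<^sup>2 + s\<^sup>2)))"
      proof (cases "set_integrable lborel A F")
        case True
        show ?thesis unfolding set_lebesgue_integral_def
          by (rule Bochner_Integration.integral_norm_bound_integral)
             (use True iG F C in \<open>auto simp: set_integrable_def indicator_def\<close>)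
      next
        \<comment> \<open>A function that is not integrable has integral \<open>0\<close>, so the
          bound is trivial here.\<close>
        case False
        then have "(LINT s:A|lborel. F s) = 0"
          unfolding set_lebesgue_integral_def set_integrable_def by (rule not_integrable_integral_eq)
        then show ?thesis using C l unfolding set_lebesgue_integral_def
          by (auto intro!: integral_nonneg_AE AE_I2)
      qed
      also have "\<dots> = (LBINT s=-real T..real T. C * (l\<^sup>2 / (l\<^sup>2 + s\<^sup>2)))"
        by (simp add: interval_lebesgue_integral_def A_def)
      also have "\<dots> = C * (2 * l * arctan (real T / l))"
        using interval_integral_Cauchy_kernel[OF l of_nat_0_le_iff[of T]]
        by (simp only: interval_lebesgue_integral_mult_right)
      also have "\<dots> \<le> C * (2 * l * (pi / 2))"
        using C l arctan_ubound[of "real T / l"] by (intro mult_left_mono) auto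
      finally have "norm (LINT s:A|lborel. F s) \<le> C * l * pi" by simp
      then have "norm (LINT s:A|lborel. F s) / (2 * pi) \<le> C * l * pi / (2 * pi)"
        by (intro divide_right_mono) auto
      also have "\<dots> = \<delta> * (B * l / 2) / Z" by (simp add: C_def)
      also have "norm (LINT s:A|lborel. F s) / (2 * pi) = norm (1 / (2 * pi) * (CLBINT s=-real T..real T. F s))"
        by (simp add: norm_mult norm_divide interval_lebesgue_integral_def A_def)
      finally show ?thesis unfolding F_def .
    qed
    have lim: "(\<lambda>T::nat. 1 / (2 * pi) * (CLBINT s=-real T..real T. (iexp (- (s * t)) - iexp (- (s * (t + \<delta>)))) / (\<i> * s) * char M s))
        \<longlonglongrightarrow> complex_of_real (measure M {t<..t+\<delta>})"
      using M.Levy_Inversion[of t "t + \<delta>", OF _ atom atom] \<delta>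
      by (simp only: of_int_minus of_int_of_nat_eq le_add_same_cancel1 less_imp_le)
    have "norm (complex_of_real (measure M {t<..t+\<delta>})) \<le> \<delta> * (B * l / 2) / Z"
      by (rule LIMSEQ_le_const2[OF tendsto_norm[OF lim]]) (intro exI allI impI bound)
    then have M: "measure M {t<..t+\<delta>} \<le> \<delta> * (B * l / 2) / Z" by simp
    have "measure M {t<..t+\<delta>} = (\<integral>s. indicator {t<..t+\<delta>} s \<partial>M)" by (simp add: M_def)
    also have "\<dots> = (\<integral>s. (h s / Z) *\<^sub>R indicator {t<..t+\<delta>} s \<partial>lborel)"
      unfolding M_def by (rule integral_density) (use hZpos in auto)
    also have "\<dots> = (\<integral>s. (1 / Z) * (indicator {t<..t+\<delta>} s * h s) \<partial>lborel)"
      by (intro Bochner_Integration.integral_cong) auto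
    also have "\<dots> = (1 / Z) * (\<integral>s. indicator {t<..t+\<delta>} s * h s \<partial>lborel)"
      by (rule integral_mult_right_zero)
    finally show ?thesis using M Z by (simp add: field_simps)
  qed
  show ?thesis
  proof (rule field_le_epsilon)
    fix e :: real assume "0 < e"
    then obtain d where d: "0 < d" "\<And>s. dist s t < d \<Longrightarrow> dist (h s) (h t) < e"
      using cont unfolding continuous_at_eps_delta by blast
    define \<delta> where "\<delta> = d / 2"
    have \<delta>: "0 < \<delta>" using d by (simp add: \<delta>_def)
    have "(h t - e) * \<delta> = (\<integral>s. indicator {t<..t+\<delta>} s * (h t - e) \<partial>lborel)" using \<delta> by simp
    also have "\<dots> \<le> (\<integral>s. indicator {t<..t+\<delta>} s * h s \<partial>lborel)"
    proof (rule integral_mono)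
      show "integrable lborel (\<lambda>s. indicator {t<..t+\<delta>} s * (h t - e))"
        using \<delta> by (intro integrable_mult_left integrable_real_indicator) auto
      show "integrable lborel (\<lambda>s. indicator {t<..t+\<delta>} s * h s)"
        using integrable_mult_indicator[OF _ h(1), of "{t<..t+\<delta>}"] by simp
      fix s
      show "indicator {t<..t+\<delta>} s * (h t - e) \<le> indicator {t<..t+\<delta>} s * h s"
        using d(2)[of s] \<delta> d(1) by (auto simp: indicator_def \<delta>_def dist_real_def)
    qed
    also have "\<dots> \<le> \<delta> * (B * l / 2)" by (rule avg[OF \<delta>])
    finally have "h t - e \<le> B * l / 2" using \<delta> by (simp add: mult.commute)
    then show "h t \<le> B * l / 2 + e" by simp
  qed
qed

section \<open>Integrals of exponential weights\<close>

text \<open>Half of the exponent absorbs the polynomial, through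
  \<open>(1 + x / D) ^ D \<le> exp x\<close> at \<open>x = c * k / 2\<close>. The factor
  \<open>M\<close> brings \<open>k + 1\<close> into this form, and the other half leaves a geometric
  series.\<close>

lemma summable_power_times_exp:
  fixes c :: real
  assumes c: "0 < c"
  shows "summable (\<lambda>k. exp (- (c * real k)) * (real k + 1) ^ D)"
proof (cases "D = 0")
  case True
  have "summable (\<lambda>k. exp (- c) ^ k)" using c by (intro summable_geometric) simp
  then show ?thesis using True by (simp add: exp_of_nat_mult[symmetric] mult.commute)
next
  case False
  define M where "M = max 1 (2 * real D / c)"
  show ?thesis
  proof (rule summable_comparison_test'[where N=0])
    have "summable (\<lambda>k. M ^ D * exp (- (c / 2)) ^ k)"
      using c by (intro summable_mult summable_geometric) simp
    then show "summable (\<lambda>k. M ^ D * exp (- (c / 2 * real k)))"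
      by (simp add: exp_of_nat_mult[symmetric] mult.commute)
    fix k :: nat
    have "real k = 2 * real D / c * (c * real k / 2 / real D)" using c False by simp
    also have "\<dots> \<le> M * (c * real k / 2 / real D)"
      using c by (intro mult_right_mono) (auto simp: M_def)
    finally have "real k + 1 \<le> M * (1 + c * real k / 2 / real D)"
      by (simp add: algebra_simps M_def)
    then have "(real k + 1) ^ D \<le> (M * (1 + c * real k / 2 / real D)) ^ D" by (intro power_mono) auto
    also have "\<dots> \<le> M ^ D * exp (c * real k / 2)"
      unfolding power_mult_distrib using c
      by (intro mult_left_mono exp_ge_one_plus_x_over_n_power_n) (use False in \<open>auto simp: M_def intro: order_trans[of _ 0]\<close>)
    finally have "exp (- (c * real k)) * (real k + 1) ^ D \<le> exp (- (c * real k)) * (M ^ D * exp (c * real k / 2))"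
      by (intro mult_left_mono) auto
    also have "\<dots> = M ^ D * exp (- (c / 2 * real k))" by (simp add: exp_add[symmetric])
    finally show "norm (exp (- (c * real k)) * (real k + 1) ^ D) \<le> M ^ D * exp (- (c / 2 * real k))"
      by simp
  qed
qed

lemma nn_integral_exp_norm_finite:
  assumes c: "0 < c"
  shows "(\<integral>\<^sup>+y. ennreal (exp (- (c * norm (y :: 'a::euclidean_space)))) \<partial>lborel) < \<infinity>"
proof -
  define \<omega> where "\<omega> = unit_ball_vol (real DIM('a))"
  define f where "f k = (\<lambda>y::'a. ennreal (exp (- (c * real k))) * indicator (ball 0 (real k + 1)) y)" for k :: nat
  have [measurable]: "f k \<in> borel_measurable lborel" for k
    unfolding f_def by (intro borel_measurable_times_ennreal borel_measurable_indicator) auto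
  have "(\<integral>\<^sup>+y. ennreal (exp (- (c * norm (y :: 'a)))) \<partial>lborel) \<le> (\<integral>\<^sup>+y. (\<Sum>k. f k y) \<partial>lborel)"
  proof (rule nn_integral_mono)
    fix y :: 'a
    define k where "k = nat \<lfloor>norm y\<rfloor>"
    have k: "real k \<le> norm y" "norm y < real k + 1" by (auto simp: k_def)
    then have "ennreal (exp (- (c * norm y))) \<le> f k y"
      using c by (auto intro!: ennreal_leI simp: f_def)
    also have "f k y = sum (\<lambda>k. f k y) {k}" by simp
    also have "\<dots> \<le> (\<Sum>k. f k y)" by (rule sum_le_suminf) auto
    finally show "ennreal (exp (- (c * norm y))) \<le> (\<Sum>k. f k y)" .
  qed
  also have "\<dots> = (\<Sum>k. \<integral>\<^sup>+y. f k y \<partial>lborel)"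
    by (rule nn_integral_suminf) simp
  also have "\<dots> = (\<Sum>k. ennreal (\<omega> * (exp (- (c * real k)) * (real k + 1) ^ DIM('a))))"
  proof (rule suminf_cong)
    fix k
    have "(\<integral>\<^sup>+y. f k y \<partial>lborel) = ennreal (exp (- (c * real k))) * ennreal (\<omega> * (real k + 1) ^ DIM('a))"
      unfolding f_def \<omega>_def
      by (subst nn_integral_cmult_indicator, simp, subst emeasure_ball, simp_all only: of_nat_0_le_iff add_nonneg_nonneg zero_le_one)
    also have "\<dots> = ennreal (exp (- (c * real k)) * (\<omega> * (real k + 1) ^ DIM('a)))"
      by (rule ennreal_mult[symmetric]) (auto simp: \<omega>_def)
    also have "\<dots> = ennreal (\<omega> * (exp (- (c * real k)) * (real k + 1) ^ DIM('a)))"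
      by (rule arg_cong[where f=ennreal], rule mult.left_commute)
    finally show "(\<integral>\<^sup>+y. f k y \<partial>lborel) = ennreal (\<omega> * (exp (- (c * real k)) * (real k + 1) ^ DIM('a)))" .
  qed
  also have "\<dots> < \<infinity>"
  proof -
    have "summable (\<lambda>k. \<omega> * (exp (- (c * real k)) * (real k + 1) ^ DIM('a)))"
      by (intro summable_mult summable_power_times_exp c)
    then have "(\<Sum>k. ennreal (\<omega> * (exp (- (c * real k)) * (real k + 1) ^ DIM('a)))) \<noteq> top"
      by (rule ennreal_suminf_neq_top) (simp add: \<omega>_def)
    then show ?thesis unfolding infinity_ennreal_def less_top .
  qed
  finally show ?thesis .
qed

lemma nn_integral_exp_dist:
  fixes x :: "'a::euclidean_space"
  assumes r: "0 < r"
  shows "(\<integral>\<^sup>+y. ennreal (exp (- (c * r * dist y x))) \<partial>lborel)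
    = ennreal (r powr - real DIM('a)) * (\<integral>\<^sup>+y. ennreal (exp (- (c * norm (y :: 'a)))) \<partial>lborel)"
proof -
  have "(\<integral>\<^sup>+y. ennreal (exp (- (c * r * dist y x))) \<partial>lborel)
    = (\<integral>\<^sup>+y. ennreal (exp (- (c * r * dist y x))) \<partial>density (distr lborel borel (\<lambda>y. x + (1 / r) *\<^sub>R y)) (\<lambda>_. ennreal (\<bar>1 / r\<bar> ^ DIM('a))))"
    by (rule arg_cong[where f="\<lambda>M. \<integral>\<^sup>+y. ennreal (exp (- (c * r * dist y x))) \<partial>M", OF lborel_affine]) (use r in simp)
  also have "\<dots> = (\<integral>\<^sup>+y. ennreal (\<bar>1 / r\<bar> ^ DIM('a)) * ennreal (exp (- (c * r * dist (x + (1 / r) *\<^sub>R y) x))) \<partial>(lborel :: 'a measure))"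
    by (subst nn_integral_density, measurable, subst nn_integral_distr, measurable)
  also have "\<dots> = (\<integral>\<^sup>+y. ennreal (r powr - real DIM('a)) * ennreal (exp (- (c * norm y))) \<partial>(lborel :: 'a measure))"
    using r by (intro nn_integral_cong arg_cong2[where f="times"] arg_cong[where f=ennreal])
      (auto simp: dist_norm powr_minus powr_realpow power_divide divide_simps)
  also have "\<dots> = ennreal (r powr - real DIM('a)) * (\<integral>\<^sup>+y. ennreal (exp (- (c * norm y))) \<partial>(lborel :: 'a measure))"
    by (rule nn_integral_cmult) measurable
  finally show ?thesis .
qed

section \<open>Powers of the resolvent and real potentials\<close>

context markov_semigroup
begin

lemma transform_scale:
  "transform k l \<eta> (\<lambda>y. c * g y) x = c * transform k l \<eta> g x"
proof -
  have "transform k l \<eta> (\<lambda>y. c * g y) x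
    = (\<integral>s. c * (erlang_density k l s *\<^sub>R (iexp (- (\<eta> * s)) * (\<integral>y. g y \<partial>K s x))) \<partial>lborel)"
    unfolding transform_def by (intro Bochner_Integration.integral_cong) (auto simp: mult_ac)
  then show ?thesis unfolding transform_def by (simp only: integral_mult_right_zero)
qed

text \<open>Gamma densities of the same rate convolve to \<open>erlang_density (Suc k) l\<close>,
  and \<open>iexp\<close> is multiplicative in time. In terms of the total time \<sigma>,
  Chapman-Kolmogorov leaves a factor \<open>F \<sigma>\<close> that is weighted by this
  convolution.\<close>

lemma transform_Suc:
  assumes [measurable]: "g \<in> borel_measurable borel" and B: "\<And>y. norm (g y) \<le> B" and l: "0 < l"
  shows "transform 0 l \<eta> (transform k l \<eta> g) x = transform (Suc k) l \<eta> g x"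
proof -
  define e where "e j = erlang_density j l" for j
  have [measurable]: "e j \<in> borel_measurable borel" for j by (simp add: e_def)
  have e0: "0 \<le> e j s" for j s using l by (simp add: e_def)
  have e_int: "integrable lborel (e j)" "(\<integral>s. e j s \<partial>lborel) = 1" for j
    using integrable_erlang_density[OF l] by (auto simp: e_def)
  define F where "F \<sigma> = iexp (- (\<eta> * \<sigma>)) * (\<integral>y. g y \<partial>K \<sigma> x)" for \<sigma>
  have [measurable]: "F \<in> borel_measurable borel" unfolding F_def by measurable
  have B0: "0 \<le> B" using B[of undefined] norm_ge_zero order_trans by blast
  have F: "norm (F \<sigma>) \<le> B" for \<sigma>
    using norm_integral_kernel_le[OF _ B] by (simp add: F_def norm_mult)
  define H where "H = (\<lambda>(s, \<sigma>). (e 0 s * e k (\<sigma> - s)) *\<^sub>R F \<sigma>)"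
  have [measurable]: "H \<in> borel_measurable (lborel \<Otimes>\<^sub>M lborel)"
    unfolding H_def by measurable
  have shift: "integrable lborel (\<lambda>\<sigma>. e k (\<sigma> - s))" "(\<integral>\<sigma>. e k (\<sigma> - s) \<partial>lborel) = 1" for s
    using lborel_integrable_real_affine[OF e_int(1)[of k], of 1 "-s"]
      lborel_integral_real_affine[of 1 "e k" "-s"] e_int[of k] by auto
  have iH: "integrable (lborel \<Otimes>\<^sub>M lborel) H"
  proof (rule lborel_pair.Fubini_integrable)
    have bnd: "norm (H (s, \<sigma>)) \<le> (e 0 s * B) * e k (\<sigma> - s)" for s \<sigma>
      using F[of \<sigma>] e0 mult_left_mono[OF F[of \<sigma>], of "e 0 s * e k (\<sigma> - s)"] by (simp add: H_def mult_ac abs_mult)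
    have i: "integrable lborel (\<lambda>\<sigma>. H (s, \<sigma>))" for s
      by (rule Bochner_Integration.integrable_bound[of _ "\<lambda>\<sigma>. (e 0 s * B) * e k (\<sigma> - s)"])
         (use shift bnd order_trans[OF bnd abs_ge_self] in auto)
    then show "AE s in lborel. integrable lborel (\<lambda>\<sigma>. H (s, \<sigma>))" by simp
    show "integrable lborel (\<lambda>s. \<integral>\<sigma>. norm (H (s, \<sigma>)) \<partial>lborel)"
    proof (rule Bochner_Integration.integrable_bound)
      show "integrable lborel (\<lambda>s. B * e 0 s)" using e_int by simp
      show "AE s in lborel. norm (\<integral>\<sigma>. norm (H (s, \<sigma>)) \<partial>lborel) \<le> norm (B * e 0 s)"
      proof (rule AE_I2)
        fix s
        have "(\<integral>\<sigma>. norm (H (s, \<sigma>)) \<partial>lborel) \<le> (\<integral>\<sigma>. (e 0 s * B) * e k (\<sigma> - s) \<partial>lborel)"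
          by (rule integral_mono) (use i shift bnd in auto)
        also have "\<dots> = e 0 s * B" using shift(2)[of s] by simp
        finally show "norm (\<integral>\<sigma>. norm (H (s, \<sigma>)) \<partial>lborel) \<le> norm (B * e 0 s)"
          using e0 B0 by (simp add: mult.commute)
      qed
    qed measurable
  qed measurable
  have conv: "integrable lborel (\<lambda>s. e 0 s * e k (\<sigma> - s))" "(\<integral>s. e 0 s * e k (\<sigma> - s) \<partial>lborel) = e (Suc k) \<sigma>" for \<sigma>
  proof -
    have "(\<integral>\<^sup>+s. ennreal (e k (\<sigma> - s)) * ennreal (e 0 s) \<partial>lborel) = ennreal (e (Suc k) \<sigma>)"
      using fun_cong[OF convolution_erlang_density[OF l, of k 0], of \<sigma>] by (simp add: e_def)
    then have "(\<integral>\<^sup>+s. ennreal (e 0 s * e k (\<sigma> - s)) \<partial>lborel) = ennreal (e (Suc k) \<sigma>)"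
      using e0 by (simp add: ennreal_mult mult.commute)
    then show "integrable lborel (\<lambda>s. e 0 s * e k (\<sigma> - s))" "(\<integral>s. e 0 s * e k (\<sigma> - s) \<partial>lborel) = e (Suc k) \<sigma>"
      using e0 by (subst (asm) nn_integral_eq_integrable; auto)+
  qed
  have "transform 0 l \<eta> (transform k l \<eta> g) x = (\<integral>s. (\<integral>\<sigma>. H (s, \<sigma>) \<partial>lborel) \<partial>lborel)"
    unfolding transform_def[of 0]
  proof (rule Bochner_Integration.integral_cong[OF refl])
    fix s
    show "erlang_density 0 l s *\<^sub>R (iexp (- (\<eta> * s)) * (\<integral>y. transform k l \<eta> g y \<partial>K s x)) = (\<integral>\<sigma>. H (s, \<sigma>) \<partial>lborel)"
    proof (cases "0 \<le> s")
      case True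
      have "(\<integral>\<sigma>. H (s, \<sigma>) \<partial>lborel) = (\<integral>r. H (s, s + 1 * r) \<partial>lborel)"
        by (subst lborel_integral_real_affine[where c=1 and t=s]) auto
      also have "\<dots> = (\<integral>r. (e 0 s *\<^sub>R iexp (- (\<eta> * s))) * (e k r *\<^sub>R (iexp (- (\<eta> * r)) * (\<integral>y. g y \<partial>K (s + r) x))) \<partial>lborel)"
      proof (rule Bochner_Integration.integral_cong[OF refl])
        fix r
        have "iexp (- (\<eta> * (s + r))) = iexp (- (\<eta> * s)) * iexp (- (\<eta> * r))"
          by (simp add: exp_add[symmetric] algebra_simps)
        then show "H (s, s + 1 * r) = (e 0 s *\<^sub>R iexp (- (\<eta> * s))) * (e k r *\<^sub>R (iexp (- (\<eta> * r)) * (\<integral>y. g y \<partial>K (s + r) x)))"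
          by (simp add: H_def F_def mult_ac)
      qed
      also have "\<dots> = (e 0 s *\<^sub>R iexp (- (\<eta> * s))) * (\<integral>r. e k r *\<^sub>R (iexp (- (\<eta> * r)) * (\<integral>y. g y \<partial>K (s + r) x)) \<partial>lborel)"
        by (rule integral_mult_right_zero)
      also have "\<dots> = e 0 s *\<^sub>R (iexp (- (\<eta> * s)) * (\<integral>y. transform k l \<eta> g y \<partial>K s x))"
        unfolding kernel_transform[OF assms(1) B l True] by (simp add: e_def)
      finally show ?thesis by (simp add: e_def)
    qed (simp add: H_def e_def erlang_density_def)
  qed
  also have "\<dots> = (\<integral>\<sigma>. (\<integral>s. H (s, \<sigma>) \<partial>lborel) \<partial>lborel)"
    using lborel_pair.Fubini_integral[of "\<lambda>s \<sigma>. H (s, \<sigma>)"] iH by simp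
  also have "\<dots> = (\<integral>\<sigma>. e (Suc k) \<sigma> *\<^sub>R F \<sigma> \<partial>lborel)"
    using conv by (simp add: H_def)
  also have "\<dots> = transform (Suc k) l \<eta> g x" by (simp add: transform_def F_def e_def)
  finally show ?thesis .
qed

text \<open>This is \<open>l\<close> times the resolvent at frequency \<open>0\<close>, kept real
  valued because it also serves as an excessive weight.\<close>

definition potential :: "real \<Rightarrow> ('a \<Rightarrow> real) \<Rightarrow> 'a \<Rightarrow> real" where
  "potential l f x = (\<integral>s. erlang_density 0 l s * (\<integral>y. f y \<partial>K s x) \<partial>lborel)"

lemma potential_eq_transform:
  "complex_of_real (potential l f x) = transform 0 l 0 (\<lambda>y. complex_of_real (f y)) x"
  unfolding potential_def transform_def
  by (simp add: scaleR_conv_of_real of_real_mult[symmetric] del: of_real_mult)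

lemma integrable_potential:
  assumes [measurable]: "f \<in> borel_measurable borel" and B: "\<And>y. \<bar>f y\<bar> \<le> B" and l: "0 < l"
  shows "integrable lborel (\<lambda>s. erlang_density k l s * (\<integral>y. f y \<partial>K s x))"
proof -
  have "integrable lborel (\<lambda>s. erlang_density k l s *\<^sub>R (iexp (- (0 * s)) * (\<integral>y. complex_of_real (f y) \<partial>K s x)))"
    by (rule transform_integrable[where B=B]) (use B l in auto)
  then have "integrable lborel (\<lambda>s. complex_of_real (erlang_density k l s * (\<integral>y. f y \<partial>K s x)))"
    by (simp add: scaleR_conv_of_real)
  then show ?thesis by (simp only: complex_of_real_integrable_eq)
qed

lemma potential_measurable[measurable (raw)]:
  assumes [measurable]: "f \<in> borel_measurable borel"
  shows "potential l f \<in> borel_measurable borel"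
proof -
  have "(\<lambda>x. Re (transform 0 l 0 (\<lambda>y. complex_of_real (f y)) x)) \<in> borel_measurable borel" by measurable
  then show ?thesis by (simp add: potential_eq_transform[symmetric])
qed

lemma potential_nonneg:
  assumes "\<And>y. 0 \<le> f y" "0 < l" shows "0 \<le> potential l f x"
  unfolding potential_def using assms by (intro integral_nonneg_AE AE_I2 mult_nonneg_nonneg) auto

lemma potential_le:
  assumes [measurable]: "f \<in> borel_measurable borel" and B: "\<And>y. \<bar>f y\<bar> \<le> B" and l: "0 < l"
  shows "\<bar>potential l f x\<bar> \<le> B"
  using norm_transform_le[of "\<lambda>y. complex_of_real (f y)" B l 0 0 x] assms
  by (simp add: potential_eq_transform[symmetric])

text \<open>Applying \<open>K t\<close> loses the part of the time integral before \<open>t\<close>,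
  which is nonnegative here.\<close>

lemma excessive_potential:
  assumes f[measurable]: "f \<in> borel_measurable borel" and f0: "\<And>y. 0 \<le> f y" and B: "\<And>y. f y \<le> B" and l: "0 < l"
  shows "excessive l (potential l f)"
  unfolding excessive_def
proof (intro conjI allI impI)
  show "potential l f \<in> borel_measurable borel" by measurable
  have B': "\<bar>f y\<bar> \<le> B" for y using B f0 by simp
  show "bounded (range (potential l f))"
    by (rule boundedI[where B=B]) (use potential_le[OF f B' l] in auto)
  show "0 \<le> potential l f y" for y by (rule potential_nonneg[OF f0 l])
  fix t x assume t: "0 \<le> (t::real)"
  define I where "I = (\<integral>s. (indicator {..<t} s * erlang_density 0 l s) * (\<integral>y. f y \<partial>K s x) \<partial>lborel)"
  have I0: "0 \<le> I" unfolding I_def using f0 l by (intro integral_nonneg_AE AE_I2 mult_nonneg_nonneg) auto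
  have "complex_of_real (\<integral>y. potential l f y \<partial>K t x) = (\<integral>y. transform 0 l 0 (\<lambda>y. complex_of_real (f y)) y \<partial>K t x)"
    by (simp add: potential_eq_transform[symmetric])
  also have "\<dots> = complex_of_real (exp (l * t) * (potential l f x - I))"
    by (subst kernel_transform_0[where B=B])
       (use B' l t in \<open>simp_all add: potential_eq_transform[symmetric] I_def scaleR_conv_of_real of_real_mult[symmetric] of_real_diff[symmetric] del: of_real_mult of_real_diff\<close>)
  finally have "(\<integral>y. potential l f y \<partial>K t x) = exp (l * t) * (potential l f x - I)"
    by (simp only: of_real_eq_iff)
  then show "(\<integral>y. potential l f y \<partial>K t x) \<le> exp (l * t) * potential l f x"
    using I0 by simp
qed

lemma ennreal_potential:
  assumes f[measurable]: "f \<in> borel_measurable borel" and f0: "\<And>y. 0 \<le> f y" and B: "\<And>y. f y \<le> B" and l: "0 < l"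
  shows "ennreal (potential l f x) = (\<integral>\<^sup>+s. erlang_density 0 l s * (\<integral>\<^sup>+y. ennreal (f y) \<partial>K s x) \<partial>lborel)"
proof -
  have B': "\<bar>f y\<bar> \<le> B" for y using B f0 by simp
  have "ennreal (potential l f x) = (\<integral>\<^sup>+s. ennreal (erlang_density 0 l s * (\<integral>y. f y \<partial>K s x)) \<partial>lborel)"
    unfolding potential_def using f0 l
    by (intro nn_integral_eq_integral[symmetric] integrable_potential[OF f B' l] AE_I2 mult_nonneg_nonneg) auto
  also have "\<dots> = (\<integral>\<^sup>+s. erlang_density 0 l s * (\<integral>\<^sup>+y. ennreal (f y) \<partial>K s x) \<partial>lborel)"
  proof (rule nn_integral_cong)
    fix s
    have "(\<integral>\<^sup>+y. ennreal (f y) \<partial>K s x) = ennreal (\<integral>y. f y \<partial>K s x)"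
      using f0 B' by (intro nn_integral_eq_integral integrable_kernel_bounded[where B=B]) auto
    then show "ennreal (erlang_density 0 l s * (\<integral>y. f y \<partial>K s x)) = erlang_density 0 l s * (\<integral>\<^sup>+y. ennreal (f y) \<partial>K s x)"
      using f0 l by (simp add: ennreal_mult)
  qed
  finally show ?thesis .
qed

lemma norm_transform_0_le_potential:
  assumes f[measurable]: "f \<in> borel_measurable borel" and f0: "\<And>y. 0 \<le> f y" and B: "\<And>y. f y \<le> B" and l: "0 < l"
  shows "norm (transform 0 l \<eta> (\<lambda>y. complex_of_real (f y)) x) \<le> potential l f x"
  unfolding potential_def
proof (rule norm_transform_le_integral)
  have B': "\<bar>f y\<bar> \<le> B" for y using B f0 by simp
  show "norm (complex_of_real (f y)) \<le> B" for y using B' by simp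
  show "norm (\<integral>y. complex_of_real (f y) \<partial>K s x) \<le> (\<integral>y. f y \<partial>K s x)" for s
    using f0 by (simp add: integral_nonneg_AE)
  show "integrable lborel (\<lambda>s. erlang_density 0 l s * (\<integral>y. f y \<partial>K s x))"
    by (rule integrable_potential[OF f B' l])
qed (use l in auto)

text \<open>Jensen's inequality is applied twice, in space under \<open>K s x\<close> and in time
  under the exponential law. A weight \<open>w\<close> of arbitrary form is thereby replaced by the
  square root of an excessive function, as the decay estimate requires.\<close>

lemma norm_transform_0_le_sqrt_potential:
  assumes g[measurable]: "g \<in> borel_measurable borel" and w[measurable]: "w \<in> borel_measurable borel"
    and gw: "\<And>y. norm (g y) \<le> w y" and B: "\<And>y. w y \<le> B" and l: "0 < l"
  shows "norm (transform 0 l \<eta> g x) \<le> sqrt (potential l (\<lambda>y. (w y)\<^sup>2) x)"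
proof -
  define e where "e = erlang_density 0 l"
  define h where "h s = sqrt (\<integral>y. (w y)\<^sup>2 \<partial>K s x)" for s
  have [measurable]: "e \<in> borel_measurable borel" by (simp add: e_def)
  have [measurable]: "h \<in> borel_measurable borel" unfolding h_def by measurable
  have w0: "0 \<le> w y" for y using gw[of y] norm_ge_zero order_trans by blast
  have B0: "0 \<le> B" using w0 B order_trans by blast
  have w2: "(w y)\<^sup>2 \<le> B\<^sup>2" for y using w0 B by (intro power_mono)
  have hB: "0 \<le> h s" "h s \<le> B" for s
  proof -
    show "0 \<le> h s" by (auto simp: h_def intro!: integral_nonneg_AE)
    have "(\<integral>y. (w y)\<^sup>2 \<partial>K s x) \<le> B\<^sup>2"
      using norm_integral_kernel_le[of "\<lambda>y. (w y)\<^sup>2" "B\<^sup>2" s x] w2 by auto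
    then show "h s \<le> B" unfolding h_def using B0 by (rule real_le_lsqrt[rotated])
  qed
  interpret E: prob_space "density lborel (\<lambda>s. ennreal (e s))"
    unfolding e_def by (rule prob_space_erlang_density[OF l])
  have e0: "0 \<le> e s" for s using l by (simp add: e_def)
  have ei: "integrable lborel e" using integrable_erlang_density[OF l] by (simp add: e_def)
  have i1: "integrable lborel (\<lambda>s. e s * h s)"
    by (rule Bochner_Integration.integrable_bound[of _ "\<lambda>s. e s * B"])
       (use ei hB e0 B0 in \<open>auto intro!: mult_left_mono\<close>)
  have h2: "(h s)\<^sup>2 = (\<integral>y. (w y)\<^sup>2 \<partial>K s x)" for s
    unfolding h_def by (intro real_sqrt_pow2 integral_nonneg_AE) auto
  have "norm (transform 0 l \<eta> g x) \<le> (\<integral>s. e s * h s \<partial>lborel)"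
    unfolding e_def
  proof (rule norm_transform_le_integral)
    show "norm (g y) \<le> B" for y using gw B order_trans by blast
    show "integrable lborel (\<lambda>s. erlang_density 0 l s * h s)" using i1 by (simp add: e_def)
    fix s
    have iw: "integrable (K s x) w" by (rule integrable_kernel_bounded[where B=B]) (use w0 B in auto)
    have iw2: "integrable (K s x) (\<lambda>y. (w y)\<^sup>2)" by (rule integrable_kernel_bounded[where B="B\<^sup>2"]) (use w2 in auto)
    have ig: "integrable (K s x) g" by (rule integrable_kernel_bounded[where B=B]) (use gw B order_trans in \<open>auto, blast\<close>)
    have "norm (\<integral>y. g y \<partial>K s x) \<le> (\<integral>y. norm (g y) \<partial>K s x)" by (rule integral_norm_bound)
    also have "\<dots> \<le> (\<integral>y. w y \<partial>K s x)" by (rule integral_mono) (use iw ig gw in auto)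
    also have "\<dots> \<le> h s"
      unfolding h_def by (rule real_le_rsqrt, rule kernel.square_integral_le[OF iw iw2])
    finally show "norm (\<integral>y. g y \<partial>K s x) \<le> h s" .
  qed (use l in auto)
  also have "\<dots> \<le> sqrt (\<integral>s. e s * (h s)\<^sup>2 \<partial>lborel)"
  proof (rule real_le_rsqrt)
    have h2B: "(h s)\<^sup>2 \<le> B\<^sup>2" for s using hB by (intro power_mono)
    have "(\<integral>s. h s \<partial>density lborel (\<lambda>s. ennreal (e s)))\<^sup>2 \<le> (\<integral>s. (h s)\<^sup>2 \<partial>density lborel (\<lambda>s. ennreal (e s)))"
      by (intro E.square_integral_le E.integrable_const_bound[of h B] E.integrable_const_bound[of _ "B\<^sup>2"])
         (use hB h2B in auto)
    then show "(\<integral>s. e s * h s \<partial>lborel)\<^sup>2 \<le> (\<integral>s. e s * (h s)\<^sup>2 \<partial>lborel)"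
      using e0 by (simp add: integral_density)
  qed
  also have "\<dots> = sqrt (potential l (\<lambda>y. (w y)\<^sup>2) x)"
    by (simp add: h2 potential_def e_def)
  finally show ?thesis .
qed

end

context elliptic_semigroup
begin

text \<open>
  The excessive majorant is the potential of the square of the truncated weight \<open>e\<^bsup>\<gamma> \<surd>l |y - x|\<^esup>\<close>. One
  application of the potential bound turns \<open>f\<close> into a function below this weight, and two applications of
  \<open>transform_0_decay\<close> give the decay \<open>l\<^sup>2 / (l\<^sup>2 + \<eta>\<^sup>2)\<close> needed for Fourier inversion.
\<close>

lemma fixed_time_continuous:
  obtains C l\<^sub>0 \<gamma> where "0 < C" "0 < l\<^sub>0" "0 < \<gamma>"
    "\<And>l x f A. l\<^sub>0 \<le> l \<Longrightarrow> continuous_on UNIV f \<Longrightarrow> bounded (range f) \<Longrightarrow> (\<And>y. 0 \<le> f y) \<Longrightarrow> 0 < A \<Longrightarrow>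
      (\<integral>\<^sup>+y. ennreal (exp (- (p * \<gamma> * sqrt l * dist y x)) * f y powr p) \<partial>lborel) \<le> ennreal A \<Longrightarrow>
      (\<integral>y. f y \<partial>K (1 / l) x) \<le> C * l powr (DIM('a) / (2 * p)) * A powr (1 / p)"
proof -
  obtain C\<^sub>0 l\<^sub>0 where C0: "0 < C\<^sub>0" and l0: "0 < l\<^sub>0" and decay:
    "\<And>l \<eta> v g x. l\<^sub>0 \<le> l \<Longrightarrow> excessive l v \<Longrightarrow> g \<in> borel_measurable borel \<Longrightarrow>
      (\<And>y. norm (g y) \<le> sqrt (v y)) \<Longrightarrow> norm (transform 0 l \<eta> g x) \<le> C\<^sub>0 * l / sqrt (l\<^sup>2 + \<eta>\<^sup>2) * sqrt (v x)"
    using transform_0_decay by blast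
  \<comment> \<open>The weight enters squared, as
    \<open>exp (2 * \<gamma> * sqrt l * dist y x)\<close>. With this \<gamma>, half of the decay
    rate \<mu> of the potential bound survives in the estimate of \<open>v x\<close>.\<close>
  define \<gamma> where "\<gamma> = \<mu> / 4"
  have \<gamma>: "0 < \<gamma>" using pos by (simp add: \<gamma>_def)
  define I where "I = enn2real (\<integral>\<^sup>+y. ennreal (exp (- (p * \<mu> / 2 * norm (y :: 'a)))) \<partial>lborel) + 1"
  have I: "0 < I" "(\<integral>\<^sup>+y. ennreal (exp (- (p * \<mu> / 2 * norm (y :: 'a)))) \<partial>lborel) \<le> ennreal I"
  proof -
    show "0 < I" by (simp add: I_def add_nonneg_pos)
    have "(\<integral>\<^sup>+y. ennreal (exp (- (p * \<mu> / 2 * norm (y :: 'a)))) \<partial>lborel) < \<infinity>"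
      using pos by (intro nn_integral_exp_norm_finite) auto
    then show "(\<integral>\<^sup>+y. ennreal (exp (- (p * \<mu> / 2 * norm (y :: 'a)))) \<partial>lborel) \<le> ennreal I"
      unfolding I_def by (subst ennreal_enn2real[symmetric]) (auto intro!: ennreal_leI)
  qed
  \<comment> \<open>A bound for \<open>v\<close> at the centre \<open>x\<close>. The integral of the
    remaining weight scales like \<open>l powr (- DIM('a) / 2)\<close> and cancels the power of
    \<open>l\<close> in the potential bound, so \<open>V\<close> does not depend on
    \<open>l\<close>.\<close>
  define V where "V = N * I powr (1 / p)"
  have V: "0 < V" using pos I by (simp add: V_def)
  define C where "C = 9 * N * C\<^sub>0\<^sup>2 * sqrt V"
  show thesis
  proof (rule that[of C l\<^sub>0 \<gamma>])
    show "0 < C" "0 < l\<^sub>0" "0 < \<gamma>" using pos C0 V l0 \<gamma> by (auto simp: C_def)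
    fix l x A and f :: "'a \<Rightarrow> real"
    assume l: "l\<^sub>0 \<le> l" and fc: "continuous_on UNIV f" and fb: "bounded (range f)" and f0: "\<And>y. 0 \<le> f y" and A: "0 < A"
      and fA: "(\<integral>\<^sup>+y. ennreal (exp (- (p * \<gamma> * sqrt l * dist y x)) * f y powr p) \<partial>lborel) \<le> ennreal A"
    have lpos: "0 < l" using l l0 by simp
    define q where "q = real DIM('a) / (2 * p)"
    define c where "c = N * l powr q * A powr (1 / p)"
    have c: "0 < c" using pos lpos A by (simp add: c_def)
    have fm[measurable]: "f \<in> borel_measurable borel" by (rule borel_measurable_continuous_onI[OF fc])
    obtain B where B: "\<And>y. f y \<le> B"
      using fb by (fastforce simp: bounded_iff abs_le_iff)
    \<comment> \<open>Truncation at \<open>b\<close> makes the weight bounded, as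
      \<open>excessive\<close> requires, and costs nothing, because the potential of
      \<open>f\<close> is at most \<open>B = c * b\<close>.\<close>
    define b where "b = B / c"
    define w where "w y = min (exp (\<gamma> * sqrt l * dist y x)) b" for y
    have [measurable]: "w \<in> borel_measurable borel" unfolding w_def by measurable
    have wb: "w y \<le> b" for y by (simp add: w_def)
    have fB': "\<bar>f y\<bar> \<le> B" for y using f0 B by simp
    have U: "potential l f y \<le> c * w y" for y
    proof -
      define W where "W = exp (\<gamma> * sqrt l * dist y x)"
      have W: "0 < W" by (simp add: W_def)
      have "potential l f y \<le> B" using potential_le[OF fm fB' lpos, of y] by simp
      then have 1: "potential l f y \<le> c * b" using c by (simp add: b_def)
      have "ennreal (potential l f y) \<le> ennreal (N * l powr (DIM('a) / (2 * p)) * (A * W powr p) powr (1 / p))"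
        unfolding ennreal_potential[OF fm f0 B lpos]
      proof (rule potential_bound[OF lpos fm f0])
        show "0 \<le> A * W powr p" using A W by simp
        have "(\<integral>\<^sup>+z. ennreal (exp (- (p * \<mu> * sqrt l * dist z y)) * f z powr p) \<partial>lborel)
          \<le> (\<integral>\<^sup>+z. ennreal (W powr p) * ennreal (exp (- (p * \<gamma> * sqrt l * dist z x)) * f z powr p) \<partial>lborel)"
        proof (rule nn_integral_mono)
          fix z
          \<comment> \<open>Recentring the weight from \<open>y\<close> to \<open>x\<close> costs
            the factor \<open>W powr p\<close>; it is possible since
            \<open>\<gamma> \<le> \<mu>\<close>.\<close>
          have "dist z x \<le> dist z y + dist y x" by (rule dist_triangle)
          then have "(p * \<gamma> * sqrt l) * dist z x \<le> (p * \<gamma> * sqrt l) * (dist z y + dist y x)"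
            using pos \<gamma> lpos by (intro mult_left_mono) auto
          also have "(p * \<gamma> * sqrt l) * (dist z y + dist y x) \<le> p * \<mu> * sqrt l * dist z y + p * \<gamma> * sqrt l * dist y x"
          proof -
            have "(p * sqrt l * dist z y) * \<gamma> \<le> (p * sqrt l * dist z y) * \<mu>"
              using pos lpos by (intro mult_left_mono) (auto simp: \<gamma>_def)
            then show ?thesis by (simp add: algebra_simps)
          qed
          finally have "exp (- (p * \<mu> * sqrt l * dist z y)) \<le> exp (p * (\<gamma> * sqrt l * dist y x) + - (p * \<gamma> * sqrt l * dist z x))"
            by simp
          also have "\<dots> = W powr p * exp (- (p * \<gamma> * sqrt l * dist z x))"
            by (simp only: exp_add W_def powr_def ln_exp exp_not_eq_zero if_False)
          finally have "exp (- (p * \<mu> * sqrt l * dist z y)) * f z powr p \<le> W powr p * exp (- (p * \<gamma> * sqrt l * dist z x)) * f z powr p"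
            by (intro mult_right_mono) auto
          then have "ennreal (exp (- (p * \<mu> * sqrt l * dist z y)) * f z powr p) \<le> ennreal (W powr p * (exp (- (p * \<gamma> * sqrt l * dist z x)) * f z powr p))"
            by (intro ennreal_leI) (simp add: mult.assoc)
          also have "\<dots> = ennreal (W powr p) * ennreal (exp (- (p * \<gamma> * sqrt l * dist z x)) * f z powr p)"
            by (rule ennreal_mult) auto
          finally show "ennreal (exp (- (p * \<mu> * sqrt l * dist z y)) * f z powr p) \<le> \<dots>" .
        qed
        also have "\<dots> = ennreal (W powr p) * (\<integral>\<^sup>+z. ennreal (exp (- (p * \<gamma> * sqrt l * dist z x)) * f z powr p) \<partial>lborel)"
          by (rule nn_integral_cmult) measurable
        also have "\<dots> \<le> ennreal (W powr p) * ennreal A"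
          by (intro mult_left_mono fA) auto
        also have "\<dots> = ennreal (A * W powr p)" using A by (simp add: ennreal_mult'' mult.commute)
        finally show "(\<integral>\<^sup>+z. ennreal (exp (- (p * \<mu> * sqrt l * dist z y)) * f z powr p) \<partial>lborel) \<le> ennreal (A * W powr p)" .
      qed
      also have "N * l powr (DIM('a) / (2 * p)) * (A * W powr p) powr (1 / p) = c * W"
        using A W pos by (simp add: c_def q_def powr_mult powr_powr)
      finally have "potential l f y \<le> c * W"
        using c W by (subst (asm) ennreal_le_iff) auto
      then show ?thesis using 1 c by (auto simp: w_def W_def min_def)
    qed
    define w2 where "w2 y = (w y)\<^sup>2" for y
    define v where "v = potential l w2"
    have b0: "0 \<le> b" using B[of x] f0[of x] c by (simp add: b_def)
    have w0: "0 \<le> w y" for y using b0 by (simp add: w_def)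
    have [measurable]: "w2 \<in> borel_measurable borel" unfolding w2_def by measurable
    have w2: "0 \<le> w2 y" "w2 y \<le> b\<^sup>2" for y using wb w0 by (auto simp: w2_def intro: power_mono)
    have v: "excessive l v" unfolding v_def by (rule excessive_potential[OF _ w2 lpos]) simp
    have vx: "v x \<le> V"
    proof -
      have "ennreal (v x) \<le> ennreal (N * l powr (DIM('a) / (2 * p)) * (sqrt l powr - real DIM('a) * I) powr (1 / p))"
        unfolding v_def ennreal_potential[OF \<open>w2 \<in> _\<close> w2 lpos]
      proof (rule potential_bound[OF lpos])
        show "0 \<le> sqrt l powr - real DIM('a) * I" using I by simp
        have "(\<integral>\<^sup>+y. ennreal (exp (- (p * \<mu> * sqrt l * dist y x)) * w2 y powr p) \<partial>lborel)
          \<le> (\<integral>\<^sup>+y. ennreal (exp (- (p * \<mu> / 2 * sqrt l * dist y x))) \<partial>lborel)"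
        proof (intro nn_integral_mono ennreal_leI)
          fix y
          have "w2 y \<le> (exp (\<gamma> * sqrt l * dist y x))\<^sup>2"
            unfolding w2_def by (rule power_mono[OF _ w0]) (simp add: w_def)
          also have "\<dots> = exp (\<mu> / 2 * sqrt l * dist y x)"
            by (simp add: power2_eq_square exp_add[symmetric] \<gamma>_def)
          finally have "w2 y powr p \<le> exp (\<mu> / 2 * sqrt l * dist y x) powr p"
            using pos w2 by (intro powr_mono2) auto
          then have "exp (- (p * \<mu> * sqrt l * dist y x)) * w2 y powr p \<le> exp (- (p * \<mu> * sqrt l * dist y x)) * exp (\<mu> / 2 * sqrt l * dist y x) powr p"
            by (intro mult_left_mono) auto
          also have "\<dots> = exp (- (p * \<mu> / 2 * sqrt l * dist y x))"
            by (simp add: powr_def exp_add[symmetric] field_simps)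
          finally show "exp (- (p * \<mu> * sqrt l * dist y x)) * w2 y powr p \<le> exp (- (p * \<mu> / 2 * sqrt l * dist y x))" .
        qed
        also have "\<dots> = ennreal (sqrt l powr - real DIM('a)) * (\<integral>\<^sup>+y. ennreal (exp (- (p * \<mu> / 2 * norm (y :: 'a)))) \<partial>lborel)"
          by (rule nn_integral_exp_dist) (use lpos in simp)
        also have "\<dots> \<le> ennreal (sqrt l powr - real DIM('a)) * ennreal I"
          by (intro mult_left_mono I) auto
        also have "\<dots> = ennreal (sqrt l powr - real DIM('a) * I)"
          using I by (simp add: ennreal_mult)
        finally show "(\<integral>\<^sup>+y. ennreal (exp (- (p * \<mu> * sqrt l * dist y x)) * w2 y powr p) \<partial>lborel) \<le> ennreal (sqrt l powr - real DIM('a) * I)" .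
      qed (use w2 in auto)
      also have "N * l powr (DIM('a) / (2 * p)) * (sqrt l powr - real DIM('a) * I) powr (1 / p) = V"
      proof -
        have "(sqrt l powr - real DIM('a)) powr (1 / p) = l powr (- (DIM('a) / (2 * p)))"
          using lpos by (simp add: powr_half_sqrt[symmetric] powr_powr)
        then have "l powr (DIM('a) / (2 * p)) * (sqrt l powr - real DIM('a) * I) powr (1 / p) = (l powr (DIM('a) / (2 * p)) * l powr (- (DIM('a) / (2 * p)))) * I powr (1 / p)"
          using I by (simp add: powr_mult)
        also have "l powr (DIM('a) / (2 * p)) * l powr (- (DIM('a) / (2 * p))) = 1"
          using lpos by (simp add: powr_add[symmetric])
        finally show ?thesis by (simp add: V_def)
      qed
      finally show ?thesis using V by (subst (asm) ennreal_le_iff) auto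
    qed
    define ff where "ff y = complex_of_real (f y)" for y
    have [measurable]: "ff \<in> borel_measurable borel" unfolding ff_def by measurable
    have ffB: "norm (ff y) \<le> B" for y using fB' by (simp add: ff_def)
    \<comment> \<open>Of the four resolvents, the first takes \<open>f\<close> below
      \<open>c * w\<close>, the second takes functions below \<open>w\<close> to functions below
      \<surd>v, and the last two contribute a factor \<open>D\<close> each. The functions are
      renormalised in between so that the hypotheses of \<open>decay\<close> hold exactly.\<close>
    have t3: "norm (transform 3 l \<eta> ff x) \<le> (c * C\<^sub>0\<^sup>2 * sqrt V) * (l\<^sup>2 / (l\<^sup>2 + \<eta>\<^sup>2))" for \<eta>
    proof -
      define D where "D = C\<^sub>0 * l / sqrt (l\<^sup>2 + \<eta>\<^sup>2)"
      have D: "0 < D" using C0 lpos by (simp add: D_def add_pos_nonneg)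
      define g0 where "g0 y = complex_of_real (1 / c) * transform 0 l \<eta> ff y" for y
      define g1 where "g1 = transform 0 l \<eta> g0"
      define g2 where "g2 y = complex_of_real (1 / D) * transform 0 l \<eta> g1 y" for y
      have [measurable]: "g0 \<in> borel_measurable borel" unfolding g0_def by measurable
      have [measurable]: "g1 \<in> borel_measurable borel" unfolding g1_def by measurable
      have [measurable]: "g2 \<in> borel_measurable borel" unfolding g2_def by measurable
      have "norm (transform 0 l \<eta> ff y) \<le> c * w y" for y
        using norm_transform_0_le_potential[OF fm f0 B lpos, where \<eta>=\<eta> and x=y] U[of y] by (simp add: ff_def[abs_def])
      then have g0w: "norm (g0 y) \<le> w y" for y
        using c by (simp add: g0_def norm_mult norm_divide field_simps)
      have g1v: "norm (g1 y) \<le> sqrt (v y)" for y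
        using norm_transform_0_le_sqrt_potential[OF _ _ g0w wb lpos, where \<eta>=\<eta> and x=y] by (simp add: g1_def v_def w2_def[abs_def])
      have Tg1: "norm (transform 0 l \<eta> g1 y) \<le> D * sqrt (v y)" for y
        unfolding D_def by (rule decay[OF l v _ g1v]) simp
      then have g2v: "norm (g2 y) \<le> sqrt (v y)" for y
        using D Tg1[of y] by (simp add: g2_def norm_mult norm_divide field_simps)
      have Tg2: "norm (transform 0 l \<eta> g2 x) \<le> D * sqrt (v x)"
        unfolding D_def by (rule decay[OF l v _ g2v]) simp
      have e1: "transform 1 l \<eta> ff = (\<lambda>y. complex_of_real c * g1 y)"
      proof
        fix y
        have "transform 1 l \<eta> ff y = transform 0 l \<eta> (transform 0 l \<eta> ff) y"
          using transform_Suc[OF _ ffB lpos, where k=0] by simp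
        also have "transform 0 l \<eta> ff = (\<lambda>y. complex_of_real c * g0 y)"
          using c by (auto simp: g0_def)
        finally show "transform 1 l \<eta> ff y = complex_of_real c * g1 y"
          by (simp add: transform_scale g1_def)
      qed
      have e2: "transform 2 l \<eta> ff = (\<lambda>y. complex_of_real (c * D) * g2 y)"
      proof
        fix y
        have "transform 2 l \<eta> ff y = transform 0 l \<eta> (transform 1 l \<eta> ff) y"
          using transform_Suc[OF _ ffB lpos, where k=1] by (simp add: numeral_2_eq_2)
        also have "\<dots> = complex_of_real c * transform 0 l \<eta> g1 y"
          unfolding e1 by (rule transform_scale)
        finally show "transform 2 l \<eta> ff y = complex_of_real (c * D) * g2 y"
          using D by (simp add: g2_def)
      qed
      have "transform 3 l \<eta> ff x = transform 0 l \<eta> (transform 2 l \<eta> ff) x"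
        using transform_Suc[OF _ ffB lpos, where k=2] by (simp add: numeral_3_eq_3 numeral_2_eq_2)
      also have "\<dots> = complex_of_real (c * D) * transform 0 l \<eta> g2 x"
        unfolding e2 by (rule transform_scale)
      finally have "norm (transform 3 l \<eta> ff x) = c * D * norm (transform 0 l \<eta> g2 x)"
        using c D by (simp add: norm_mult)
      also have "\<dots> \<le> c * D * (D * sqrt V)"
        using Tg2 c D vx by (intro mult_left_mono) (auto intro: order_trans[OF Tg2] mult_left_mono)
      also have "\<dots> = c * sqrt V * D\<^sup>2" by (simp add: power2_eq_square)
      also have "D\<^sup>2 = C\<^sub>0\<^sup>2 * (l\<^sup>2 / (l\<^sup>2 + \<eta>\<^sup>2))"
        by (simp add: D_def power_divide power_mult_distrib add_nonneg_nonneg)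
      finally show ?thesis by (simp add: mult_ac)
    qed
    define \<phi> where "\<phi> s = (\<integral>y. f y \<partial>K s x)" for s
    define h where "h s = erlang_density 3 l s * \<phi> s" for s
    have \<phi>c: "continuous_on UNIV \<phi>" unfolding \<phi>_def by (rule weakly_continuous[OF fc fb])
    have "h (1 / l) \<le> (c * C\<^sub>0\<^sup>2 * sqrt V) * l / 2"
    proof (rule Fourier_inversion_bound[where h=h])
      show "integrable lborel h" unfolding h_def \<phi>_def by (rule integrable_potential[OF fm fB' lpos])
      show "0 \<le> h s" for s
        unfolding h_def \<phi>_def using f0 lpos by (intro mult_nonneg_nonneg integral_nonneg_AE) auto
      show "0 \<le> c * C\<^sub>0\<^sup>2 * sqrt V" using c V by simp
      have "continuous_on {0<..} (\<lambda>s. l ^ 4 * s ^ 3 * exp (- l * s) / fact 3 * \<phi> s)"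
        by (intro continuous_intros continuous_on_subset[OF \<phi>c]) auto
      then have "continuous_on {0<..} h"
        by (rule continuous_on_cong[THEN iffD1, OF refl, rotated]) (simp add: h_def erlang_density_def eval_nat_numeral)
      then show "isCont h (1 / l)"
        using lpos by (subst (asm) continuous_on_eq_continuous_at) auto
      show "norm (\<integral>s. h s *\<^sub>R iexp (- (\<eta> * s)) \<partial>lborel) \<le> (c * C\<^sub>0\<^sup>2 * sqrt V) * (l\<^sup>2 / (l\<^sup>2 + \<eta>\<^sup>2))" for \<eta>
      proof -
        have "(\<integral>s. h s *\<^sub>R iexp (- (\<eta> * s)) \<partial>lborel) = transform 3 l \<eta> ff x"
          unfolding transform_def
          by (intro Bochner_Integration.integral_cong) (auto simp: h_def \<phi>_def ff_def[abs_def] scaleR_conv_of_real)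
        then show ?thesis using t3[of \<eta>] by simp
      qed
    qed (rule lpos)
    \<comment> \<open>At \<open>1 / l\<close> the Gamma density of index \<open>3\<close> equals
      \<open>l / 6 * exp (- 1)\<close>. Against the factor \<open>l / 2\<close> of the inversion
      bound this leaves \<open>3 * exp 1 \<le> 9\<close>.\<close>
    moreover have "h (1 / l) = l / 6 * exp (- 1) * \<phi> (1 / l)"
      using lpos by (simp add: h_def erlang_density_def eval_nat_numeral)
    ultimately have "l * (exp (- 1) * \<phi> (1 / l)) \<le> l * (3 * (c * C\<^sub>0\<^sup>2 * sqrt V))" by (simp add: algebra_simps)
    then have "exp (- 1) * \<phi> (1 / l) \<le> 3 * (c * C\<^sub>0\<^sup>2 * sqrt V)" using lpos by simp
    then have "exp 1 * (exp (- 1) * \<phi> (1 / l)) \<le> exp 1 * (3 * (c * C\<^sub>0\<^sup>2 * sqrt V))"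
      by (intro mult_left_mono) auto
    also have "\<dots> \<le> 3 * (3 * (c * C\<^sub>0\<^sup>2 * sqrt V))"
      using exp_le c V by (intro mult_right_mono) auto
    also have "exp 1 * (exp (- 1) * \<phi> (1 / l)) = \<phi> (1 / l)" by (simp add: exp_minus)
    finally have "\<phi> (1 / l) \<le> 9 * (c * C\<^sub>0\<^sup>2 * sqrt V)" by simp
    then show "(\<integral>y. f y \<partial>K (1 / l) x) \<le> C * l powr (DIM('a) / (2 * p)) * A powr (1 / p)"
      by (simp add: \<phi>_def C_def c_def q_def mult_ac)
  qed
qed

end

section \<open>From continuous to Borel functions\<close>

text \<open>A measurable function is an almost everywhere limit of continuous ones. Clipping to
  \<open>{- B..B}\<close> and multiplying by a continuous cutoff that is \<open>1\<close> on
  \<open>ball x R\<close> and \<open>0\<close> outside \<open>ball x (R + 1)\<close> preserve the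
  limit, since \<open>f\<close> already obeys these restrictions.\<close>

lemma bounded_support_approximation:
  fixes f :: "'a::euclidean_space \<Rightarrow> real"
  assumes f: "f \<in> borel_measurable borel" and B: "\<And>y. \<bar>f y\<bar> \<le> B" and supp: "\<And>y. y \<notin> ball x R \<Longrightarrow> f y = 0"
  obtains g where "\<And>n::nat. continuous_on UNIV (g n)" "\<And>n y. \<bar>g n y\<bar> \<le> B"
    "\<And>n y. y \<notin> ball x (R + 1) \<Longrightarrow> g n y = 0" "AE y in lborel. (\<lambda>n. g n y) \<longlonglongrightarrow> f y"
proof -
  have "f measurable_on UNIV"
    using f by (intro lebesgue_measurable_imp_measurable_on_real) (auto intro: measurable_completion)
  then obtain N g where N: "negligible N" and gc: "\<And>n. continuous_on UNIV (g n)"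
    and lim: "\<And>y. y \<notin> N \<Longrightarrow> (\<lambda>n. g n y) \<longlonglongrightarrow> f y"
    unfolding measurable_on_def by auto
  define c where "c y = max 0 (min 1 (R + 1 - dist y x))" for y
  have c: "0 \<le> c y" "c y \<le> 1" for y by (auto simp: c_def)
  have B0: "0 \<le> B" using B[of x] by simp
  show thesis
  proof (rule that[of "\<lambda>n y. max (- B) (min B (g n y)) * c y"])
    show "continuous_on UNIV (\<lambda>y. max (- B) (min B (g n y)) * c y)" for n
      unfolding c_def by (intro continuous_intros gc)
    show "\<bar>max (- B) (min B (g n y)) * c y\<bar> \<le> B" for n y
    proof -
      have "\<bar>max (- B) (min B (g n y))\<bar> * \<bar>c y\<bar> \<le> B * 1"
        using c[of y] B0 by (intro mult_mono) auto
      then show ?thesis by (simp add: abs_mult)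
    qed
    show "max (- B) (min B (g n y)) * c y = 0" if "y \<notin> ball x (R + 1)" for n y
      using that by (simp add: c_def dist_commute)
    have "N \<in> null_sets (completion lborel)" using N by (simp add: negligible_iff_null_sets)
    then obtain N' where N': "N' \<in> null_sets lborel" "N \<subseteq> N'"
      by (auto simp: null_sets_completion_iff2)
    show "AE y in lborel. (\<lambda>n. max (- B) (min B (g n y)) * c y) \<longlonglongrightarrow> f y"
    proof (rule AE_I'[OF N'(1)])
      show "{y \<in> space lborel. \<not> (\<lambda>n. max (- B) (min B (g n y)) * c y) \<longlonglongrightarrow> f y} \<subseteq> N'"
      proof (rule ccontr)
        assume "\<not> ?thesis"
        then obtain y where y: "\<not> (\<lambda>n. max (- B) (min B (g n y)) * c y) \<longlonglongrightarrow> f y" "y \<notin> N'" by auto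
        then have "(\<lambda>n. g n y) \<longlonglongrightarrow> f y" using lim N'(2) by auto
        then have "(\<lambda>n. max (- B) (min B (g n y)) * c y) \<longlonglongrightarrow> max (- B) (min B (f y)) * c y"
          by (intro tendsto_intros)
        also have "max (- B) (min B (f y)) * c y = f y"
        proof (cases "y \<in> ball x R")
          case True
          then have "c y = 1" by (simp add: c_def dist_commute)
          then show ?thesis using B[of y] by (simp add: abs_le_iff min_def max_def)
        qed (use supp B0 in simp)
        finally show False using y by simp
      qed
    qed
  qed
qed

context elliptic_semigroup
begin

text \<open>Continuous functions approximate \<open>f\<close> only almost everywhere for Lebesgue
  measure, so the laws are first shown to be absolutely continuous. Dominated convergence then
  covers bounded functions with bounded support, and exhaustion by balls removes the restriction on
  the support.\<close>

lemma fixed_time_Lp: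
  obtains C l\<^sub>0 \<gamma> where "0 < C" "0 < l\<^sub>0" "0 < \<gamma>"
    "\<And>l x f B. l\<^sub>0 \<le> l \<Longrightarrow> f \<in> borel_measurable borel \<Longrightarrow> (\<And>y. 0 \<le> f y) \<Longrightarrow> (\<And>y. f y \<le> B) \<Longrightarrow>
      ennreal ((\<integral>y. f y \<partial>K (1 / l) x) powr p) \<le> ennreal (C * l powr (DIM('a) / 2)) *
        (\<integral>\<^sup>+y. ennreal (exp (- (p * \<gamma> * sqrt l * dist y x)) * f y powr p) \<partial>lborel)"
proof -
  obtain C l\<^sub>0 \<gamma> where C: "0 < C" and l0: "0 < l\<^sub>0" and \<gamma>: "0 < \<gamma>" and bound:
    "\<And>l x f A. l\<^sub>0 \<le> l \<Longrightarrow> continuous_on UNIV f \<Longrightarrow> bounded (range f) \<Longrightarrow> (\<And>y. 0 \<le> f y) \<Longrightarrow> 0 < A \<Longrightarrow>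
      (\<integral>\<^sup>+y. ennreal (exp (- (p * \<gamma> * sqrt l * dist y x)) * f y powr p) \<partial>lborel) \<le> ennreal A \<Longrightarrow>
      (\<integral>y. f y \<partial>K (1 / l) x) \<le> C * l powr (DIM('a) / (2 * p)) * A powr (1 / p)"
    using fixed_time_continuous by blast
  \<comment> \<open>A null set lies in an open set \<open>U\<close> of small Lebesgue measure. The
    bound for continuous functions, applied to functions increasing to the indicator of
    \<open>U\<close>, makes the mass of \<open>U\<close> under the law small.\<close>
  have AE_kernel: "AE y in K (1 / l) x. Q y" if l: "l\<^sub>0 \<le> l" and Q: "AE y in lborel. Q y" for l x Q
  proof -
    obtain N where N: "N \<in> null_sets lborel" "{y. \<not> Q y} \<subseteq> N"
      using Q by (auto simp: eventually_ae_filter)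
    have lpos: "0 < l" using l l0 by simp
    define M where "M = C * l powr (DIM('a) / (2 * p))"
    have M: "0 < M" using C lpos by (simp add: M_def)
    have "measure (K (1 / l) x) N \<le> e" if e: "0 < e" for e
    proof -
      define A where "A = (e / M) powr p"
      have A: "0 < A" using e M by (simp add: A_def)
      obtain U where U: "open U" "N \<subseteq> U" "emeasure lborel (U - N) < A"
        using outer_regular_lborel[OF _ A, of N] N by (auto simp: null_sets_def)
      have "emeasure lborel U = emeasure lborel (U - N)"
        using N U by (intro emeasure_Diff_null_set[symmetric]) auto
      then have UA: "emeasure lborel U < ennreal A" using U by simp
      have Un: "U \<noteq> UNIV" using UA by auto
      have "emeasure (K (1 / l) x) N \<le> emeasure (K (1 / l) x) U"
        using U by (intro emeasure_mono) auto
      also have "\<dots> = (SUP n. ennreal (\<integral>y. min 1 (real n * infdist y (-U)) \<partial>K (1 / l) x))"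
        by (rule emeasure_open_SUP_continuous[OF U(1) Un prob_space_kernel]) simp
      also have "\<dots> \<le> ennreal e"
      proof (rule SUP_least)
        fix n :: nat
        have "(\<integral>y. min 1 (real n * infdist y (-U)) \<partial>K (1 / l) x) \<le> M * A powr (1 / p)"
          unfolding M_def
        proof (rule bound[OF l _ _ _ A])
          show "continuous_on UNIV (\<lambda>y. min 1 (real n * infdist y (-U)))" by (intro continuous_intros)
          show "bounded (range (\<lambda>y. min 1 (real n * infdist y (-U))))"
            by (rule boundedI[where B=1]) (auto simp: infdist_nonneg)
          show "0 \<le> min 1 (real n * infdist y (-U))" for y by (simp add: infdist_nonneg)
          have "(\<integral>\<^sup>+y. ennreal (exp (- (p * \<gamma> * sqrt l * dist y x)) * min 1 (real n * infdist y (-U)) powr p) \<partial>lborel)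
            \<le> (\<integral>\<^sup>+y. indicator U y \<partial>lborel)"
          proof (rule nn_integral_mono)
            fix y
            show "ennreal (exp (- (p * \<gamma> * sqrt l * dist y x)) * min 1 (real n * infdist y (-U)) powr p) \<le> indicator U y"
            proof (cases "y \<in> U")
              case True
              have "exp (- (p * \<gamma> * sqrt l * dist y x)) * min 1 (real n * infdist y (-U)) powr p \<le> 1 * 1"
                using pos \<gamma> lpos by (intro mult_mono powr_le1) (auto simp: infdist_nonneg)
              then show ?thesis using True by (simp add: ennreal_le_1)
            next
              case False
              then have "infdist y (- U) = 0" by simp
              then show ?thesis using False by simp
            qed
          qed
          also have "\<dots> \<le> ennreal A" using UA U by (simp add: less_imp_le)
          finally show "(\<integral>\<^sup>+y. ennreal (exp (- (p * \<gamma> * sqrt l * dist y x)) * min 1 (real n * infdist y (-U)) powr p) \<partial>lborel) \<le> ennreal A" .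
        qed
        also have "M * A powr (1 / p) = e" using M e pos by (simp add: A_def powr_powr)
        finally show "ennreal (\<integral>y. min 1 (real n * infdist y (-U)) \<partial>K (1 / l) x) \<le> ennreal e"
          by (rule ennreal_leI)
      qed
      finally show ?thesis using e by (simp add: kernel.emeasure_eq_measure)
    qed
    then have "measure (K (1 / l) x) N \<le> 0" by (rule field_le_epsilon) simp
    then have "N \<in> null_sets (K (1 / l) x)"
      using N by (auto simp: null_sets_def kernel.emeasure_eq_measure measure_le_0_iff)
    then show ?thesis by (rule AE_I') (use N in auto)
  qed
  have compact_supp: "(\<integral>y. f y \<partial>K (1 / l) x) powr p \<le> C powr p * l powr (DIM('a) / 2) * a"
    if l: "l\<^sub>0 \<le> l" and f[measurable]: "f \<in> borel_measurable borel" and f0: "\<And>y. 0 \<le> f y" and B: "\<And>y. f y \<le> B"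
      and supp: "\<And>y. y \<notin> ball x R \<Longrightarrow> f y = 0" and a: "0 \<le> a"
      and fa: "(\<integral>\<^sup>+y. ennreal (exp (- (p * \<gamma> * sqrt l * dist y x)) * f y powr p) \<partial>lborel) \<le> ennreal a"
    for l f B x R a
  proof -
    have lpos: "0 < l" using l l0 by simp
    have B0: "0 \<le> B" using f0[of x] B[of x] by simp
    have fB: "\<bar>f y\<bar> \<le> B" for y using f0 B by simp
    obtain g' where g': "\<And>n::nat. continuous_on UNIV (g' n)" "\<And>n y. \<bar>g' n y\<bar> \<le> B"
      "\<And>n y. y \<notin> ball x (R + 1) \<Longrightarrow> g' n y = 0" "AE y in lborel. (\<lambda>n. g' n y) \<longlonglongrightarrow> f y"
      by (rule bounded_support_approximation[where x=x and R=R and B=B and f=f, OF f])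
         (rule fB, erule supp, rule that)
    define g where "g n y = max 0 (g' n y)" for n y
    have gc: "continuous_on UNIV (g n)" for n unfolding g_def by (intro continuous_intros g')
    have gm[measurable]: "g n \<in> borel_measurable borel" for n by (rule borel_measurable_continuous_onI[OF gc])
    have g0: "0 \<le> g n y" "g n y \<le> B" for n y using g'(2)[of n y] B0 by (auto simp: g_def)
    have gs: "g n y = 0" if "y \<notin> ball x (R + 1)" for n y using g'(3)[OF that] by (simp add: g_def)
    have glim: "AE y in lborel. (\<lambda>n. g n y) \<longlonglongrightarrow> f y"
      using g'(4)
    proof eventually_elim
      case (elim y)
      have "(\<lambda>n. max 0 (g' n y)) \<longlonglongrightarrow> max 0 (f y)" by (intro tendsto_intros elim)
      then show ?case using f0[of y] by (simp add: g_def)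
    qed
    define E where "E y = exp (- (p * \<gamma> * sqrt l * dist y x))" for y
    have E: "0 < E y" "E y \<le> 1" for y using pos \<gamma> lpos by (auto simp: E_def)
    have [measurable]: "E \<in> borel_measurable borel" unfolding E_def by measurable
    have lim1: "(\<lambda>n. \<integral>\<^sup>+y. ennreal (E y * g n y powr p) \<partial>lborel) \<longlonglongrightarrow> (\<integral>\<^sup>+y. ennreal (E y * f y powr p) \<partial>lborel)"
    proof (rule nn_integral_dominated_convergence[where w="\<lambda>y. ennreal (B powr p) * indicator (ball x (R + 1)) y"])
      show "AE y in lborel. ennreal (E y * g n y powr p) \<le> ennreal (B powr p) * indicator (ball x (R + 1)) y" for n
      proof (rule AE_I2)
        fix y
        show "ennreal (E y * g n y powr p) \<le> ennreal (B powr p) * indicator (ball x (R + 1)) y"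
        proof (cases "y \<in> ball x (R + 1)")
          case True
          have "E y * g n y powr p \<le> 1 * B powr p"
            using E[of y] g0[of n y] pos by (intro mult_mono powr_mono2) (auto simp: less_imp_le)
          then show ?thesis using True by (simp add: ennreal_leI)
        qed (simp add: gs)
      qed
      show "(\<integral>\<^sup>+y. ennreal (B powr p) * indicator (ball x (R + 1)) y \<partial>lborel) < \<infinity>"
        by (subst nn_integral_cmult_indicator) (use emeasure_lborel_ball_finite[of x "R + 1"] in \<open>auto simp: ennreal_mult_less_top\<close>)
      show "(\<lambda>y. ennreal (B powr p) * indicator (ball x (R + 1)) y) \<in> borel_measurable lborel"
        by (intro borel_measurable_times_ennreal borel_measurable_const borel_measurable_indicator) simp
      show "AE y in lborel. (\<lambda>n. ennreal (E y * g n y powr p)) \<longlonglongrightarrow> ennreal (E y * f y powr p)"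
        using glim
      proof eventually_elim
        case (elim y)
        have "(\<lambda>n. g n y powr p) \<longlonglongrightarrow> f y powr p"
          by (rule tendsto_powr'[OF elim tendsto_const]) (use pos g0 in auto)
        then show ?case by (intro tendsto_ennrealI tendsto_mult tendsto_const)
      qed
      show "(\<lambda>y. ennreal (E y * g n y powr p)) \<in> borel_measurable lborel" for n by measurable
      show "(\<lambda>y. ennreal (E y * f y powr p)) \<in> borel_measurable lborel" by measurable
    qed
    have lim2: "(\<lambda>n. \<integral>y. g n y \<partial>K (1 / l) x) \<longlonglongrightarrow> (\<integral>y. f y \<partial>K (1 / l) x)"
    proof (rule integral_dominated_convergence[where w="\<lambda>_. B"])
      show "AE y in K (1 / l) x. (\<lambda>n. g n y) \<longlonglongrightarrow> f y" by (rule AE_kernel[OF l glim])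
    qed (use g0 in auto)
    \<comment> \<open>The slack \<open>e\<close> makes the bound for the limit strict, hence valid
      for the approximations from some index on, and keeps it positive when
      \<open>a = 0\<close>.\<close>
    have "(\<integral>y. f y \<partial>K (1 / l) x) powr p \<le> C powr p * l powr (DIM('a) / 2) * (a + e)" if e: "0 < e" for e
    proof -
      have "(\<integral>\<^sup>+y. ennreal (E y * f y powr p) \<partial>lborel) < ennreal (a + e)"
        using fa e a unfolding E_def by (intro le_less_trans[OF fa]) (simp add: ennreal_lessI)
      from order_tendstoD(2)[OF lim1 this]
      have ev: "\<forall>\<^sub>F n in sequentially. (\<integral>y. g n y \<partial>K (1 / l) x) \<le> C * l powr (DIM('a) / (2 * p)) * (a + e) powr (1 / p)"
      proof eventually_elim
        case (elim n)
        show ?case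
        proof (rule bound[OF l gc])
          show "bounded (range (g n))" by (rule boundedI[where B=B]) (use g0 in auto)
          show "(\<integral>\<^sup>+y. ennreal (exp (- (p * \<gamma> * sqrt l * dist y x)) * g n y powr p) \<partial>lborel) \<le> ennreal (a + e)"
            using elim by (simp add: E_def less_imp_le)
        qed (use g0 a e in auto)
      qed
      have le: "(\<integral>y. f y \<partial>K (1 / l) x) \<le> C * l powr (DIM('a) / (2 * p)) * (a + e) powr (1 / p)"
        by (rule tendsto_upperbound[OF lim2 ev]) simp
      have "0 \<le> (\<integral>y. f y \<partial>K (1 / l) x)" using f0 by (intro integral_nonneg_AE) auto
      then have "(\<integral>y. f y \<partial>K (1 / l) x) powr p \<le> (C * l powr (DIM('a) / (2 * p)) * (a + e) powr (1 / p)) powr p"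
        using le pos by (intro powr_mono2) auto
      also have "\<dots> = C powr p * l powr (DIM('a) / 2) * (a + e)"
        using pos C a e by (simp add: powr_mult powr_powr)
      finally show ?thesis .
    qed
    then have "((\<integral>y. f y \<partial>K (1 / l) x) powr p) / (C powr p * l powr (DIM('a) / 2)) \<le> a + e" if "0 < e" for e
      using that C lpos by (simp add: divide_le_eq mult.commute)
    then have "((\<integral>y. f y \<partial>K (1 / l) x) powr p) / (C powr p * l powr (DIM('a) / 2)) \<le> a"
      by (rule field_le_epsilon)
    then show ?thesis using C lpos by (simp add: divide_le_eq mult.commute)
  qed
  show thesis
  proof (rule that[of "C powr p" l\<^sub>0 \<gamma>])
    show "0 < C powr p" "0 < l\<^sub>0" "0 < \<gamma>" using C l0 \<gamma> by auto
    fix l B and x :: 'a and f :: "'a \<Rightarrow> real"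
    assume l: "l\<^sub>0 \<le> l" and f[measurable]: "f \<in> borel_measurable borel" and f0: "\<And>y. 0 \<le> f y" and B: "\<And>y. f y \<le> B"
    have lpos: "0 < l" using l l0 by simp
    define E where "E y = exp (- (p * \<gamma> * sqrt l * dist y x))" for y
    define J where "J = (\<integral>\<^sup>+y. ennreal (E y * f y powr p) \<partial>lborel)"
    have B0: "0 \<le> B" using f0[of x] B[of x] by simp
    show "ennreal ((\<integral>y. f y \<partial>K (1 / l) x) powr p) \<le> ennreal (C powr p * l powr (DIM('a) / 2)) *
        (\<integral>\<^sup>+y. ennreal (exp (- (p * \<gamma> * sqrt l * dist y x)) * f y powr p) \<partial>lborel)"
    proof (cases "J = \<infinity>")
      case True
      then show ?thesis using C lpos unfolding J_def E_def by (simp add: ennreal_mult_top)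
    next
      case False
      define a where "a = enn2real J"
      have Ja: "J = ennreal a" using False by (simp add: a_def less_top)
      define fn where "fn n y = f y * indicator (ball x (real n)) y" for n y
      have [measurable]: "fn n \<in> borel_measurable borel" for n
        unfolding fn_def by (intro borel_measurable_times borel_measurable_indicator f) simp
      have fn: "0 \<le> fn n y" "fn n y \<le> f y" for n y using f0 by (auto simp: fn_def indicator_def)
      have le: "(\<integral>y. fn n y \<partial>K (1 / l) x) powr p \<le> C powr p * l powr (DIM('a) / 2) * a" for n
      proof (rule compact_supp[OF l])
        show "fn n y = 0" if "y \<notin> ball x (real n)" for y using that by (simp add: fn_def)
        show "fn n y \<le> B" for y using fn(2)[of n y] B[of y] by linarith
        show "0 \<le> a" by (simp add: a_def)
        have "(\<integral>\<^sup>+y. ennreal (E y * fn n y powr p) \<partial>lborel) \<le> J"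
          unfolding J_def using fn pos
          by (intro nn_integral_mono ennreal_leI mult_left_mono powr_mono2) (auto simp: E_def)
        then show "(\<integral>\<^sup>+y. ennreal (exp (- (p * \<gamma> * sqrt l * dist y x)) * fn n y powr p) \<partial>lborel) \<le> ennreal a"
          by (simp add: E_def Ja)
      qed (use fn in auto)
      have lim: "(\<lambda>n. \<integral>y. fn n y \<partial>K (1 / l) x) \<longlonglongrightarrow> (\<integral>y. f y \<partial>K (1 / l) x)"
      proof (rule integral_dominated_convergence[where w="\<lambda>_. B"])
        show "AE y in K (1 / l) x. (\<lambda>n. fn n y) \<longlonglongrightarrow> f y"
        proof (rule AE_I2)
          fix y
          obtain m :: nat where "dist x y < real m" using reals_Archimedean2 by blast
          then have "\<forall>\<^sub>F n in sequentially. fn n y = f y"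
            by (intro eventually_sequentiallyI[of m]) (auto simp: fn_def)
          then show "(\<lambda>n. fn n y) \<longlonglongrightarrow> f y" by (rule tendsto_eventually)
        qed
        show "AE y in K (1 / l) x. norm (fn n y) \<le> B" for n
          using fn order_trans[OF fn(2) B] by (intro AE_I2) auto
      qed auto
      have "(\<lambda>n. (\<integral>y. fn n y \<partial>K (1 / l) x) powr p) \<longlonglongrightarrow> (\<integral>y. f y \<partial>K (1 / l) x) powr p"
        by (rule tendsto_powr'[OF lim tendsto_const]) (use pos fn in \<open>auto intro!: integral_nonneg_AE always_eventually\<close>)
      then have "(\<integral>y. f y \<partial>K (1 / l) x) powr p \<le> C powr p * l powr (DIM('a) / 2) * a"
        by (rule LIMSEQ_le_const2) (use le in auto)
      then have "ennreal ((\<integral>y. f y \<partial>K (1 / l) x) powr p) \<le> ennreal (C powr p * l powr (DIM('a) / 2) * a)"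
        by (rule ennreal_leI)
      also have "\<dots> = ennreal (C powr p * l powr (DIM('a) / 2)) * J"
        using Ja by (simp add: ennreal_mult a_def)
      finally show ?thesis by (simp add: J_def E_def)
    qed
  qed
qed

end


section \<open>Bounds in $L_p$ and strong continuity\<close>

context elliptic_semigroup
begin

text \<open>The pointwise bound already concerns the \<open>p\<close>-th power, so integrating in
  \<open>x\<close> and exchanging the integrals involves no convexity in \<open>p\<close>. The
  weight integrates to a multiple of \<open>l powr (- DIM('a) / 2)\<close>, which cancels the factor
  in \<open>fixed_time_Lp\<close>.\<close>

lemma Lp_bound_small_time:
  obtains C t\<^sub>0 where "0 < C" "0 < t\<^sub>0"
    "\<And>t f B. 0 < t \<Longrightarrow> t \<le> t\<^sub>0 \<Longrightarrow> f \<in> borel_measurable borel \<Longrightarrow> (\<And>y. 0 \<le> f y) \<Longrightarrow> (\<And>y. f y \<le> B) \<Longrightarrow>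
      (\<integral>\<^sup>+x. ennreal ((\<integral>y. f y \<partial>K t x) powr p) \<partial>lborel) \<le> ennreal C * (\<integral>\<^sup>+y. ennreal (f y powr p) \<partial>lborel)"
proof -
  obtain C l\<^sub>0 \<gamma> where C: "0 < C" and l0: "0 < l\<^sub>0" and \<gamma>: "0 < \<gamma>" and bound:
    "\<And>l x f B. l\<^sub>0 \<le> l \<Longrightarrow> f \<in> borel_measurable borel \<Longrightarrow> (\<And>y. 0 \<le> f y) \<Longrightarrow> (\<And>y. f y \<le> B) \<Longrightarrow>
      ennreal ((\<integral>y. f y \<partial>K (1 / l) x) powr p) \<le> ennreal (C * l powr (DIM('a) / 2)) *
        (\<integral>\<^sup>+y. ennreal (exp (- (p * \<gamma> * sqrt l * dist y x)) * f y powr p) \<partial>lborel)"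
    using fixed_time_Lp by blast
  define I where "I = enn2real (\<integral>\<^sup>+y. ennreal (exp (- (p * \<gamma> * norm (y :: 'a)))) \<partial>lborel) + 1"
  have I: "0 < I" "(\<integral>\<^sup>+y. ennreal (exp (- (p * \<gamma> * norm (y :: 'a)))) \<partial>lborel) \<le> ennreal I"
  proof -
    show "0 < I" by (simp add: I_def add_nonneg_pos)
    have "(\<integral>\<^sup>+y. ennreal (exp (- (p * \<gamma> * norm (y :: 'a)))) \<partial>lborel) < \<infinity>"
      using pos \<gamma> by (intro nn_integral_exp_norm_finite) auto
    then show "(\<integral>\<^sup>+y. ennreal (exp (- (p * \<gamma> * norm (y :: 'a)))) \<partial>lborel) \<le> ennreal I"
      unfolding I_def by (subst ennreal_enn2real[symmetric]) (auto intro!: ennreal_leI)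
  qed
  show thesis
  proof (rule that[of "C * I" "1 / l\<^sub>0"])
    show "0 < C * I" "0 < 1 / l\<^sub>0" using C I l0 by auto
    fix t B and f :: "'a \<Rightarrow> real"
    assume t: "0 < t" "t \<le> 1 / l\<^sub>0" and f[measurable]: "f \<in> borel_measurable borel" and f0: "\<And>y. 0 \<le> f y" and B: "\<And>y. f y \<le> B"
    define l where "l = 1 / t"
    have l: "l\<^sub>0 \<le> l" "0 < l" "1 / l = t" using t l0 by (auto simp: l_def field_simps)
    define E where "E y x = exp (- (p * \<gamma> * sqrt l * dist y x))" for y x :: 'a
    have E0: "0 < E y x" for y x by (simp add: E_def)
    have [measurable]: "(\<lambda>z. E (snd z) (fst z)) \<in> borel_measurable (borel \<Otimes>\<^sub>M borel)"
      "E y \<in> borel_measurable borel" "(\<lambda>y. E y x) \<in> borel_measurable borel" for y x unfolding E_def by measurable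
    have "(\<integral>\<^sup>+x. ennreal ((\<integral>y. f y \<partial>K t x) powr p) \<partial>lborel) \<le>
      (\<integral>\<^sup>+x. ennreal (C * l powr (DIM('a) / 2)) * (\<integral>\<^sup>+y. ennreal (E y x * f y powr p) \<partial>lborel) \<partial>lborel)"
      using bound[OF l(1) f f0 B] l by (intro nn_integral_mono) (simp add: E_def)
    also have "\<dots> = ennreal (C * l powr (DIM('a) / 2)) * (\<integral>\<^sup>+x. (\<integral>\<^sup>+y. ennreal (E y x * f y powr p) \<partial>lborel) \<partial>lborel)"
      by (rule nn_integral_cmult) measurable
    also have "(\<integral>\<^sup>+x. (\<integral>\<^sup>+y. ennreal (E y x * f y powr p) \<partial>lborel) \<partial>lborel)
        = (\<integral>\<^sup>+y. (\<integral>\<^sup>+x. ennreal (E y x * f y powr p) \<partial>lborel) \<partial>lborel)"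
      by (rule lborel_pair.Fubini'[symmetric]) (simp add: case_prod_beta')
    also have "\<dots> = (\<integral>\<^sup>+y. ennreal (f y powr p) * (\<integral>\<^sup>+x. ennreal (E y x) \<partial>lborel) \<partial>lborel)"
    proof (rule nn_integral_cong)
      fix y
      have "(\<integral>\<^sup>+x. ennreal (E y x * f y powr p) \<partial>lborel) = (\<integral>\<^sup>+x. ennreal (f y powr p) * ennreal (E y x) \<partial>lborel)"
        using E0 by (intro nn_integral_cong) (simp add: ennreal_mult' less_imp_le mult.commute)
      also have "\<dots> = ennreal (f y powr p) * (\<integral>\<^sup>+x. ennreal (E y x) \<partial>lborel)"
        by (rule nn_integral_cmult) measurable
      finally show "(\<integral>\<^sup>+x. ennreal (E y x * f y powr p) \<partial>lborel) = ennreal (f y powr p) * (\<integral>\<^sup>+x. ennreal (E y x) \<partial>lborel)" .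
    qed
    also have "\<dots> \<le> (\<integral>\<^sup>+y. ennreal (f y powr p) * ennreal (l powr (- (DIM('a) / 2)) * I) \<partial>lborel)"
    proof (intro nn_integral_mono mult_left_mono)
      fix y :: 'a
      have "(\<integral>\<^sup>+x. ennreal (E y x) \<partial>lborel) = ennreal (sqrt l powr - real DIM('a)) * (\<integral>\<^sup>+y. ennreal (exp (- (p * \<gamma> * norm (y :: 'a)))) \<partial>lborel)"
        unfolding E_def dist_commute[of y] using l by (intro nn_integral_exp_dist) simp
      also have "\<dots> \<le> ennreal (sqrt l powr - real DIM('a)) * ennreal I"
        by (intro mult_left_mono I) auto
      also have "sqrt l powr - real DIM('a) = l powr (- (DIM('a) / 2))"
        using l by (simp add: powr_half_sqrt[symmetric] powr_powr)
      finally show "(\<integral>\<^sup>+x. ennreal (E y x) \<partial>lborel) \<le> ennreal (l powr (- (DIM('a) / 2)) * I)"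
        using I by (simp add: ennreal_mult)
    qed simp
    also have "\<dots> = (\<integral>\<^sup>+y. ennreal (f y powr p) \<partial>lborel) * ennreal (l powr (- (DIM('a) / 2)) * I)"
      by (rule nn_integral_multc) measurable
    finally have "(\<integral>\<^sup>+x. ennreal ((\<integral>y. f y \<partial>K t x) powr p) \<partial>lborel) \<le>
      ennreal (C * l powr (DIM('a) / 2)) * ((\<integral>\<^sup>+y. ennreal (f y powr p) \<partial>lborel) * ennreal (l powr (- (DIM('a) / 2)) * I))"
      by (simp add: mult_left_mono)
    also have "\<dots> = (ennreal (C * l powr (DIM('a) / 2)) * ennreal (l powr (- (DIM('a) / 2)) * I)) * (\<integral>\<^sup>+y. ennreal (f y powr p) \<partial>lborel)"
      by (simp only: mult_ac)
    also have "ennreal (C * l powr (DIM('a) / 2)) * ennreal (l powr (- (DIM('a) / 2)) * I) = ennreal (C * I)"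
    proof -
      have "C * l powr (DIM('a) / 2) * (l powr (- (DIM('a) / 2)) * I) = C * I * (l powr (DIM('a) / 2) * l powr (- (DIM('a) / 2)))"
        by (simp only: mult_ac)
      also have "l powr (DIM('a) / 2) * l powr (- (DIM('a) / 2)) = 1"
        using l by (simp add: powr_add[symmetric])
      finally show ?thesis using C I by (subst ennreal_mult[symmetric]) auto
    qed
    finally show "(\<integral>\<^sup>+x. ennreal ((\<integral>y. f y \<partial>K t x) powr p) \<partial>lborel) \<le> ennreal (C * I) * (\<integral>\<^sup>+y. ennreal (f y powr p) \<partial>lborel)" .
  qed
qed

text \<open>Time is divided into steps of length \<open>t\<^sub>0\<close>, one of which is split off
  by Chapman-Kolmogorov in each induction step. The maximum in the constant also covers the times
  already treated.\<close>

lemma Lp_bound: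
  obtains C where "0 < C"
    "\<And>t f B. 0 < t \<Longrightarrow> t \<le> T \<Longrightarrow> f \<in> borel_measurable borel \<Longrightarrow> (\<And>y. 0 \<le> f y) \<Longrightarrow> (\<And>y. f y \<le> B) \<Longrightarrow>
      (\<integral>\<^sup>+x. ennreal ((\<integral>y. f y \<partial>K t x) powr p) \<partial>lborel) \<le> ennreal C * (\<integral>\<^sup>+y. ennreal (f y powr p) \<partial>lborel)"
proof -
  obtain C t\<^sub>0 where C: "0 < C" and t0: "0 < t\<^sub>0" and small:
    "\<And>t f B. 0 < t \<Longrightarrow> t \<le> t\<^sub>0 \<Longrightarrow> f \<in> borel_measurable borel \<Longrightarrow> (\<And>y. 0 \<le> f y) \<Longrightarrow> (\<And>y. f y \<le> B) \<Longrightarrow>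
      (\<integral>\<^sup>+x. ennreal ((\<integral>y. f y \<partial>K t x) powr p) \<partial>lborel) \<le> ennreal C * (\<integral>\<^sup>+y. ennreal (f y powr p) \<partial>lborel)"
    using Lp_bound_small_time by blast
  have "\<exists>C>0. \<forall>t f B. 0 < t \<longrightarrow> t \<le> (real n + 1) * t\<^sub>0 \<longrightarrow> f \<in> borel_measurable borel \<longrightarrow> (\<forall>y. 0 \<le> f y) \<longrightarrow> (\<forall>y. f y \<le> B) \<longrightarrow>
      (\<integral>\<^sup>+x. ennreal ((\<integral>y. f y \<partial>K t x) powr p) \<partial>lborel) \<le> ennreal C * (\<integral>\<^sup>+y. ennreal (f y powr p) \<partial>lborel)" for n :: nat
  proof (induction n)
    case 0
    show ?case using C small by (intro exI[of _ C]) auto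
  next
    case (Suc n)
    then obtain D where D: "0 < D" and IH: "\<And>t f B. 0 < t \<Longrightarrow> t \<le> (real n + 1) * t\<^sub>0 \<Longrightarrow> f \<in> borel_measurable borel \<Longrightarrow>
      (\<And>y. 0 \<le> f y) \<Longrightarrow> (\<And>y. f y \<le> B) \<Longrightarrow>
      (\<integral>\<^sup>+x. ennreal ((\<integral>y. f y \<partial>K t x) powr p) \<partial>lborel) \<le> ennreal D * (\<integral>\<^sup>+y. ennreal (f y powr p) \<partial>lborel)"
      by blast
    show ?case
    proof (intro exI[of _ "max (C * D) D"] conjI allI impI)
      show "0 < max (C * D) D" using D by simp
      fix t B and f :: "'a \<Rightarrow> real"
      assume t: "0 < t" "t \<le> (real (Suc n) + 1) * t\<^sub>0" and f[measurable]: "f \<in> borel_measurable borel"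
        and f0: "\<forall>y. 0 \<le> f y" and B: "\<forall>y. f y \<le> B"
      have fB: "\<bar>f y\<bar> \<le> B" for y using f0 B by simp
      show "(\<integral>\<^sup>+x. ennreal ((\<integral>y. f y \<partial>K t x) powr p) \<partial>lborel) \<le> ennreal (max (C * D) D) * (\<integral>\<^sup>+y. ennreal (f y powr p) \<partial>lborel)"
      proof (cases "t \<le> (real n + 1) * t\<^sub>0")
        case True
        have "(\<integral>\<^sup>+x. ennreal ((\<integral>y. f y \<partial>K t x) powr p) \<partial>lborel) \<le> ennreal D * (\<integral>\<^sup>+y. ennreal (f y powr p) \<partial>lborel)"
          using IH[OF t(1) True f] f0 B by blast
        also have "\<dots> \<le> ennreal (max (C * D) D) * (\<integral>\<^sup>+y. ennreal (f y powr p) \<partial>lborel)"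
          by (intro mult_right_mono ennreal_leI) auto
        finally show ?thesis .
      next
        case False
        have e: "(real n + 1) * t\<^sub>0 = real n * t\<^sub>0 + t\<^sub>0" "(real (Suc n) + 1) * t\<^sub>0 = real n * t\<^sub>0 + 2 * t\<^sub>0"
          by (simp_all add: algebra_simps)
        have "0 \<le> real n * t\<^sub>0" using t0 by simp
        then have s: "0 < t - t\<^sub>0" "t - t\<^sub>0 \<le> (real n + 1) * t\<^sub>0" using t False unfolding e by linarith+
        define g where "g y = (\<integral>w. f w \<partial>K (t - t\<^sub>0) y)" for y
        have [measurable]: "g \<in> borel_measurable borel"
          unfolding g_def by (rule integral_kernel_measurable) measurable
        have g: "0 \<le> g y" "g y \<le> B" for y
        proof -
          show "0 \<le> g y" unfolding g_def using f0 by (intro integral_nonneg_AE) auto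
          show "g y \<le> B" using norm_integral_kernel_le[of f B "t - t\<^sub>0" y] fB by (simp add: g_def)
        qed
        have "(\<integral>\<^sup>+x. ennreal ((\<integral>y. f y \<partial>K t x) powr p) \<partial>lborel) = (\<integral>\<^sup>+x. ennreal ((\<integral>y. g y \<partial>K t\<^sub>0 x) powr p) \<partial>lborel)"
        proof (rule nn_integral_cong)
          fix x
          have "(\<integral>y. f y \<partial>K t x) = (\<integral>y. g y \<partial>K t\<^sub>0 x)"
            using integral_chapman_real[OF f fB, of t\<^sub>0 "t - t\<^sub>0" x] s t0 by (simp add: g_def)
          then show "ennreal ((\<integral>y. f y \<partial>K t x) powr p) = ennreal ((\<integral>y. g y \<partial>K t\<^sub>0 x) powr p)" by simp
        qed
        also have "\<dots> \<le> ennreal C * (\<integral>\<^sup>+y. ennreal (g y powr p) \<partial>lborel)"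
          by (rule small[OF t0 order_refl _ g]) simp
        also have "\<dots> \<le> ennreal C * (ennreal D * (\<integral>\<^sup>+y. ennreal (f y powr p) \<partial>lborel))"
          unfolding g_def using IH[OF s f] f0 B by (intro mult_left_mono) auto
        also have "\<dots> = ennreal (C * D) * (\<integral>\<^sup>+y. ennreal (f y powr p) \<partial>lborel)"
          using C D by (simp add: ennreal_mult mult.assoc)
        also have "\<dots> \<le> ennreal (max (C * D) D) * (\<integral>\<^sup>+y. ennreal (f y powr p) \<partial>lborel)"
          by (intro mult_right_mono ennreal_leI) auto
        finally show ?thesis .
      qed
    qed
  qed
  note * = this
  obtain n :: nat where "T / t\<^sub>0 < real n" using reals_Archimedean2 by blast
  then have n: "T \<le> (real n + 1) * t\<^sub>0" using t0 by (simp add: field_simps)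
  show thesis
  proof -
    obtain D where "0 < D" and D: "\<And>t f B. 0 < t \<Longrightarrow> t \<le> (real n + 1) * t\<^sub>0 \<Longrightarrow> f \<in> borel_measurable borel \<Longrightarrow>
      (\<And>y. 0 \<le> f y) \<Longrightarrow> (\<And>y. f y \<le> B) \<Longrightarrow>
      (\<integral>\<^sup>+x. ennreal ((\<integral>y. f y \<partial>K t x) powr p) \<partial>lborel) \<le> ennreal D * (\<integral>\<^sup>+y. ennreal (f y powr p) \<partial>lborel)"
      using *[of n] by blast
    show thesis by (rule that[OF \<open>0 < D\<close>], rule D) (use n in auto)
  qed
qed

text \<open>The truncations \<open>min \<bar>f y\<bar> (real n)\<close> satisfy the bound uniformly
  in \<open>n\<close>. By monotone convergence the limit \<open>S\<close> of the \<open>p\<close>-th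
  powers has finite integral, hence is finite almost everywhere, and finiteness at \<open>x\<close>
  gives integrability of \<open>f\<close> under \<open>K t x\<close>.\<close>

lemma Lp_bound_unbounded:
  assumes C: "0 < C" and bound: "\<And>f B. f \<in> borel_measurable borel \<Longrightarrow> (\<And>y. 0 \<le> f y) \<Longrightarrow> (\<And>y. f y \<le> B) \<Longrightarrow>
      (\<integral>\<^sup>+x. ennreal ((\<integral>y. f y \<partial>K t x) powr p) \<partial>lborel) \<le> ennreal C * (\<integral>\<^sup>+y. ennreal (f y powr p) \<partial>lborel)"
    and f[measurable]: "f \<in> borel_measurable borel" and fin: "(\<integral>\<^sup>+y. ennreal (\<bar>f y\<bar> powr p) \<partial>lborel) < \<infinity>"
  shows "AE x in lborel. integrable (K t x) f"
    and "(\<integral>\<^sup>+x. ennreal ((\<integral>y. \<bar>f y\<bar> \<partial>K t x) powr p) \<partial>lborel) \<le> ennreal C * (\<integral>\<^sup>+y. ennreal (\<bar>f y\<bar> powr p) \<partial>lborel)"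
proof -
  define J where "J = (\<integral>\<^sup>+y. ennreal (\<bar>f y\<bar> powr p) \<partial>lborel)"
  define fn where "fn n y = min \<bar>f y\<bar> (real n)" for n y
  define u where "u n x = (\<integral>y. fn n y \<partial>K t x)" for n x
  have [measurable]: "fn n \<in> borel_measurable borel" for n unfolding fn_def by measurable
  have [measurable]: "u n \<in> borel_measurable borel" for n
    unfolding u_def by (rule integral_kernel_measurable) measurable
  have fn: "0 \<le> fn n y" "fn n y \<le> real n" "fn n y \<le> \<bar>f y\<bar>" for n y by (auto simp: fn_def)
  have ifn: "integrable (K t x) (fn n)" for n x
    by (rule integrable_kernel_bounded[where B="real n"]) (use fn in auto)
  have fn_lim: "(\<lambda>n. fn n y) \<longlonglongrightarrow> \<bar>f y\<bar>" for y
  proof -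
    obtain m :: nat where "\<bar>f y\<bar> < real m" using reals_Archimedean2 by blast
    then have "\<forall>\<^sub>F n in sequentially. fn n y = \<bar>f y\<bar>"
      by (intro eventually_sequentiallyI[of m]) (auto simp: fn_def)
    then show ?thesis by (rule tendsto_eventually)
  qed
  have u0: "0 \<le> u n x" for n x unfolding u_def using fn by (intro integral_nonneg_AE) auto
  have u_mono: "u n x \<le> u (Suc n) x" for n x
    unfolding u_def by (rule integral_mono[OF ifn ifn]) (auto simp: fn_def)
  define S where "S x = (SUP n. ennreal (u n x powr p))" for x
  have "(\<integral>\<^sup>+x. S x \<partial>lborel) = (SUP n. \<integral>\<^sup>+x. ennreal (u n x powr p) \<partial>lborel)"
    unfolding S_def
  proof (rule nn_integral_monotone_convergence_SUP)
    show "incseq (\<lambda>n x. ennreal (u n x powr p))"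
      using u0 u_mono pos by (intro incseq_SucI le_funI ennreal_leI powr_mono2) auto
  qed measurable
  also have "\<dots> \<le> ennreal C * J"
  proof (rule SUP_least)
    fix n
    have "(\<integral>\<^sup>+x. ennreal (u n x powr p) \<partial>lborel) \<le> ennreal C * (\<integral>\<^sup>+y. ennreal (fn n y powr p) \<partial>lborel)"
      unfolding u_def by (rule bound) (use fn in auto)
    also have "\<dots> \<le> ennreal C * J"
      unfolding J_def using fn pos by (intro mult_left_mono nn_integral_mono ennreal_leI powr_mono2) auto
    finally show "(\<integral>\<^sup>+x. ennreal (u n x powr p) \<partial>lborel) \<le> ennreal C * J" .
  qed
  finally have SJ: "(\<integral>\<^sup>+x. S x \<partial>lborel) \<le> ennreal C * J" .
  have [measurable]: "S \<in> borel_measurable borel" unfolding S_def by measurable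
  have "ennreal C * J < \<infinity>" using fin by (simp add: J_def ennreal_mult_less_top)
  then have "(\<integral>\<^sup>+x. S x \<partial>lborel) \<noteq> \<infinity>" using SJ by (metis leD)
  then have "AE x in lborel. S x \<noteq> \<infinity>" by (intro nn_integral_PInf_AE) auto
  then show "AE x in lborel. integrable (K t x) f"
  proof eventually_elim
    case (elim x)
    define s where "s = enn2real (S x)"
    have "u n x \<le> s powr (1 / p)" for n
    proof -
      have "ennreal (u n x powr p) \<le> S x" unfolding S_def by (rule SUP_upper) simp
      also have "S x = ennreal s" using elim by (simp add: s_def less_top)
      finally have "u n x powr p \<le> s" by (simp add: s_def)
      then have "(u n x powr p) powr (1 / p) \<le> s powr (1 / p)" using pos by (intro powr_mono2) auto
      then show ?thesis using pos u0 by (simp add: powr_powr)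
    qed
    then have "(\<integral>\<^sup>+y. ennreal (fn n y) \<partial>K t x) \<le> ennreal (s powr (1 / p))" for n
      using fn by (subst nn_integral_eq_integral[OF ifn]) (auto simp: u_def intro!: ennreal_leI)
    then have "(SUP n. \<integral>\<^sup>+y. ennreal (fn n y) \<partial>K t x) \<le> ennreal (s powr (1 / p))" by (rule SUP_least)
    moreover have "(SUP n. \<integral>\<^sup>+y. ennreal (fn n y) \<partial>K t x) = (\<integral>\<^sup>+y. (SUP n. ennreal (fn n y)) \<partial>K t x)"
    proof (rule nn_integral_monotone_convergence_SUP[symmetric])
      show "incseq (\<lambda>n y. ennreal (fn n y))"
        by (intro incseq_SucI le_funI ennreal_leI) (auto simp: fn_def)
    qed measurable
    moreover have "ennreal \<bar>f y\<bar> \<le> (SUP n. ennreal (fn n y))" for y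
      by (rule LIMSEQ_le_const2[OF tendsto_ennrealI[OF fn_lim]]) (auto intro!: SUP_upper)
    then have "(\<integral>\<^sup>+y. ennreal \<bar>f y\<bar> \<partial>K t x) \<le> (\<integral>\<^sup>+y. (SUP n. ennreal (fn n y)) \<partial>K t x)"
      by (intro nn_integral_mono)
    ultimately have "(\<integral>\<^sup>+y. ennreal \<bar>f y\<bar> \<partial>K t x) \<le> ennreal (s powr (1 / p))" by simp
    then have "(\<integral>\<^sup>+y. ennreal (norm (f y)) \<partial>K t x) < \<infinity>" by (simp add: le_less_trans[OF _ ennreal_less_top])
    then show ?case by (intro integrableI_bounded) auto
  qed
  \<comment> \<open>At exceptional \<open>x\<close> the integral is \<open>0\<close> by convention,
    so the bound holds at every \<open>x\<close>.\<close>
  have "ennreal ((\<integral>y. \<bar>f y\<bar> \<partial>K t x) powr p) \<le> S x" for x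
  proof (cases "integrable (K t x) (\<lambda>y. \<bar>f y\<bar>)")
    case True
    have "(\<lambda>n. u n x) \<longlonglongrightarrow> (\<integral>y. \<bar>f y\<bar> \<partial>K t x)"
      unfolding u_def
    proof (rule integral_dominated_convergence[OF _ _ True])
      show "AE y in K t x. (\<lambda>n. fn n y) \<longlonglongrightarrow> \<bar>f y\<bar>" by (intro AE_I2 fn_lim)
    qed (use fn in auto)
    then have "(\<lambda>n. u n x powr p) \<longlonglongrightarrow> (\<integral>y. \<bar>f y\<bar> \<partial>K t x) powr p"
      using pos u0 by (intro tendsto_powr'[OF _ tendsto_const]) auto
    then have "(\<lambda>n. ennreal (u n x powr p)) \<longlonglongrightarrow> ennreal ((\<integral>y. \<bar>f y\<bar> \<partial>K t x) powr p)"
      by (rule tendsto_ennrealI)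
    then show ?thesis by (rule LIMSEQ_le_const2) (auto simp: S_def intro!: SUP_upper)
  qed (simp add: not_integrable_integral_eq)
  then have "(\<integral>\<^sup>+x. ennreal ((\<integral>y. \<bar>f y\<bar> \<partial>K t x) powr p) \<partial>lborel) \<le> (\<integral>\<^sup>+x. S x \<partial>lborel)"
    by (rule nn_integral_mono)
  then show "(\<integral>\<^sup>+x. ennreal ((\<integral>y. \<bar>f y\<bar> \<partial>K t x) powr p) \<partial>lborel) \<le> ennreal C * (\<integral>\<^sup>+y. ennreal (\<bar>f y\<bar> powr p) \<partial>lborel)"
    using SJ unfolding J_def by (rule order_trans)
qed

end

text \<open>In dimension one the exponent \<open>p > d/2\<close> may be below 1, so that Minkowski's inequality is not available.\<close>

lemma powr_add_le:
  fixes a b p :: real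
  assumes "0 \<le> a" "0 \<le> b" "0 < p"
  shows "(a + b) powr p \<le> 2 powr p * (a powr p + b powr p)"
proof -
  have "(a + b) powr p \<le> (2 * max a b) powr p" using assms by (intro powr_mono2) auto
  also have "\<dots> = 2 powr p * (max a b) powr p" by (simp add: powr_mult)
  also have "\<dots> \<le> 2 powr p * (a powr p + b powr p)"
    by (intro mult_left_mono) (auto simp: max_def)
  finally show ?thesis .
qed

lemma nn_integral_powr_add_le:
  fixes a b :: "'a \<Rightarrow> real"
  assumes p: "0 < p" and [measurable]: "a \<in> borel_measurable M" "b \<in> borel_measurable M"
    and le: "AE x in M. \<bar>c x\<bar> \<le> \<bar>a x\<bar> + \<bar>b x\<bar>"
  shows "(\<integral>\<^sup>+x. ennreal (\<bar>c x\<bar> powr p) \<partial>M)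
    \<le> ennreal (2 powr p) * ((\<integral>\<^sup>+x. ennreal (\<bar>a x\<bar> powr p) \<partial>M) + (\<integral>\<^sup>+x. ennreal (\<bar>b x\<bar> powr p) \<partial>M))"
proof -
  have "(\<integral>\<^sup>+x. ennreal (\<bar>c x\<bar> powr p) \<partial>M)
    \<le> (\<integral>\<^sup>+x. ennreal (2 powr p) * (ennreal (\<bar>a x\<bar> powr p) + ennreal (\<bar>b x\<bar> powr p)) \<partial>M)"
  proof (rule nn_integral_mono_AE, rule eventually_mono[OF le])
    fix x assume "\<bar>c x\<bar> \<le> \<bar>a x\<bar> + \<bar>b x\<bar>"
    then have "\<bar>c x\<bar> powr p \<le> (\<bar>a x\<bar> + \<bar>b x\<bar>) powr p" using p by (intro powr_mono2) auto
    also have "\<dots> \<le> 2 powr p * (\<bar>a x\<bar> powr p + \<bar>b x\<bar> powr p)" using p by (intro powr_add_le) auto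
    finally have "ennreal (\<bar>c x\<bar> powr p) \<le> ennreal (2 powr p * (\<bar>a x\<bar> powr p + \<bar>b x\<bar> powr p))"
      by (rule ennreal_leI)
    then show "ennreal (\<bar>c x\<bar> powr p) \<le> ennreal (2 powr p) * (ennreal (\<bar>a x\<bar> powr p) + ennreal (\<bar>b x\<bar> powr p))"
      by (simp add: ennreal_mult)
  qed
  also have "\<dots> = ennreal (2 powr p) * ((\<integral>\<^sup>+x. ennreal (\<bar>a x\<bar> powr p) \<partial>M) + (\<integral>\<^sup>+x. ennreal (\<bar>b x\<bar> powr p) \<partial>M))"
    by (simp add: nn_integral_cmult nn_integral_add)
  finally show ?thesis .
qed

section \<open>Density of continuous functions with compact support\<close>

lemma Lp_approximation:
  fixes f :: "'a::euclidean_space \<Rightarrow> real"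
  assumes p: "0 < p" and f[measurable]: "f \<in> borel_measurable borel"
    and fin: "(\<integral>\<^sup>+y. ennreal (\<bar>f y\<bar> powr p) \<partial>lborel) < \<infinity>" and \<epsilon>: "0 < \<epsilon>"
  obtains g B M where "continuous_on UNIV g" "\<And>y. \<bar>g y\<bar> \<le> B" "0 \<le> M" "\<And>y. y \<notin> ball 0 M \<Longrightarrow> g y = 0"
    "(\<integral>\<^sup>+y. ennreal (\<bar>f y - g y\<bar> powr p) \<partial>lborel) \<le> ennreal \<epsilon>"
proof -
  \<comment> \<open>Each of the two approximations gets half of \<epsilon>, divided by the constant
    \<open>2 powr p\<close> of the quasi-triangle inequality.\<close>
  define q where "q = \<epsilon> / (2 * 2 powr p)"
  have q: "0 < q" using \<epsilon> by (simp add: q_def)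
  define fn where "fn n y = (if \<bar>f y\<bar> \<le> real n \<and> norm y < real n then f y else 0)" for n y
  have [measurable]: "fn n \<in> borel_measurable borel" for n unfolding fn_def by measurable
  have "(\<lambda>n. \<integral>\<^sup>+y. ennreal (\<bar>f y - fn n y\<bar> powr p) \<partial>lborel) \<longlonglongrightarrow> (\<integral>\<^sup>+y. 0 \<partial>(lborel :: 'a measure))"
  proof (rule nn_integral_dominated_convergence[where w="\<lambda>y. ennreal (\<bar>f y\<bar> powr p)", OF _ _ _ _ fin])
    show "AE y in lborel. (\<lambda>n. ennreal (\<bar>f y - fn n y\<bar> powr p)) \<longlonglongrightarrow> 0"
    proof (rule AE_I2)
      fix y :: 'a
      obtain m :: nat where m: "max \<bar>f y\<bar> (norm y) < real m" using reals_Archimedean2 by blast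
      then have "\<forall>\<^sub>F n in sequentially. ennreal (\<bar>f y - fn n y\<bar> powr p) = 0"
        by (intro eventually_sequentiallyI[of m]) (auto simp: fn_def)
      then show "(\<lambda>n. ennreal (\<bar>f y - fn n y\<bar> powr p)) \<longlonglongrightarrow> 0" by (rule tendsto_eventually)
    qed
    show "AE y in lborel. ennreal (\<bar>f y - fn n y\<bar> powr p) \<le> ennreal (\<bar>f y\<bar> powr p)" for n
      by (intro AE_I2 ennreal_leI) (auto simp: fn_def)
  qed measurable
  then have "\<forall>\<^sub>F n in sequentially. (\<integral>\<^sup>+y. ennreal (\<bar>f y - fn n y\<bar> powr p) \<partial>lborel) < ennreal q"
    using q by (intro order_tendstoD(2)) auto
  then obtain n where n: "(\<integral>\<^sup>+y. ennreal (\<bar>f y - fn n y\<bar> powr p) \<partial>lborel) < ennreal q"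
    by (auto simp: eventually_sequentially)
  define R where "R = real n"
  have fnR: "\<bar>fn n y\<bar> \<le> R" "y \<notin> ball 0 R \<Longrightarrow> fn n y = 0" for y by (auto simp: fn_def R_def)
  obtain g where g: "\<And>k::nat. continuous_on UNIV (g k)" "\<And>k y. \<bar>g k y\<bar> \<le> R"
    "\<And>k y. y \<notin> ball 0 (R + 1) \<Longrightarrow> g k y = 0" "AE y in lborel. (\<lambda>k. g k y) \<longlonglongrightarrow> fn n y"
    by (rule bounded_support_approximation[where x=0 and R=R and B=R and f="fn n"])
       (simp, rule fnR, erule fnR, rule that)
  have [measurable]: "g k \<in> borel_measurable borel" for k by (rule borel_measurable_continuous_onI[OF g(1)])
  have "(\<lambda>k. \<integral>\<^sup>+y. ennreal (\<bar>fn n y - g k y\<bar> powr p) \<partial>lborel) \<longlonglongrightarrow> (\<integral>\<^sup>+y. 0 \<partial>(lborel :: 'a measure))"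
  proof (rule nn_integral_dominated_convergence[where w="\<lambda>y. ennreal ((2 * R) powr p) * indicator (ball 0 (R + 1)) y"])
    show "AE y in lborel. (\<lambda>k. ennreal (\<bar>fn n y - g k y\<bar> powr p)) \<longlonglongrightarrow> 0"
      using g(4)
    proof eventually_elim
      case (elim y)
      have "(\<lambda>k. \<bar>fn n y - g k y\<bar>) \<longlonglongrightarrow> \<bar>fn n y - fn n y\<bar>" by (intro tendsto_intros elim)
      then have "(\<lambda>k. \<bar>fn n y - g k y\<bar> powr p) \<longlonglongrightarrow> \<bar>fn n y - fn n y\<bar> powr p"
        by (rule tendsto_powr'[OF _ tendsto_const]) (use p in auto)
      from tendsto_ennrealI[OF this] show ?case by simp
    qed
    show "AE y in lborel. ennreal (\<bar>fn n y - g k y\<bar> powr p) \<le> ennreal ((2 * R) powr p) * indicator (ball 0 (R + 1)) y" for k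
    proof (rule AE_I2)
      fix y
      show "ennreal (\<bar>fn n y - g k y\<bar> powr p) \<le> ennreal ((2 * R) powr p) * indicator (ball 0 (R + 1)) y"
      proof (cases "y \<in> ball 0 (R + 1)")
        case True
        have "\<bar>fn n y - g k y\<bar> \<le> 2 * R" using fnR(1)[of y] g(2)[of k y] by linarith
        then have "ennreal (\<bar>fn n y - g k y\<bar> powr p) \<le> ennreal ((2 * R) powr p)"
          using p by (intro ennreal_leI powr_mono2) auto
        then show ?thesis using True by simp
      next
        case False
        then have "y \<notin> ball 0 R" by auto
        then show ?thesis using fnR(2) g(3)[OF False] by simp
      qed
    qed
    show "(\<integral>\<^sup>+y. ennreal ((2 * R) powr p) * indicator (ball 0 (R + 1)) y \<partial>(lborel :: 'a measure)) < \<infinity>"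
      by (subst nn_integral_cmult_indicator) (use emeasure_lborel_ball_finite[of "0::'a" "R + 1"] in \<open>auto simp: ennreal_mult_less_top\<close>)
    show "(\<lambda>y::'a. ennreal ((2 * R) powr p) * indicator (ball 0 (R + 1)) y) \<in> borel_measurable lborel"
      by (intro borel_measurable_times_ennreal borel_measurable_const borel_measurable_indicator) simp
  qed measurable
  then have "\<forall>\<^sub>F k in sequentially. (\<integral>\<^sup>+y. ennreal (\<bar>fn n y - g k y\<bar> powr p) \<partial>lborel) < ennreal q"
    using q by (intro order_tendstoD(2)) auto
  then obtain k where k: "(\<integral>\<^sup>+y. ennreal (\<bar>fn n y - g k y\<bar> powr p) \<partial>lborel) < ennreal q"
    by (auto simp: eventually_sequentially)
  show thesis
  proof (rule that[of "g k" R "R + 1"])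
    have "(\<integral>\<^sup>+y. ennreal (\<bar>f y - g k y\<bar> powr p) \<partial>lborel) \<le> ennreal (2 powr p) *
      ((\<integral>\<^sup>+y. ennreal (\<bar>f y - fn n y\<bar> powr p) \<partial>lborel) + (\<integral>\<^sup>+y. ennreal (\<bar>fn n y - g k y\<bar> powr p) \<partial>lborel))"
      by (rule nn_integral_powr_add_le[OF p]) auto
    also have "\<dots> \<le> ennreal (2 powr p) * (ennreal q + ennreal q)"
      by (intro mult_left_mono add_mono less_imp_le[OF n] less_imp_le[OF k]) auto
    also have "ennreal q + ennreal q = ennreal (q + q)" using q by (subst ennreal_plus) auto
    also have "ennreal (2 powr p) * ennreal (q + q) = ennreal (2 powr p * (q + q))"
      using q by (intro ennreal_mult[symmetric]) auto
    also have "2 powr p * (q + q) = \<epsilon>" by (simp add: q_def)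
    finally show "(\<integral>\<^sup>+y. ennreal (\<bar>f y - g k y\<bar> powr p) \<partial>lborel) \<le> ennreal \<epsilon>" .
    show "0 \<le> R + 1" by (simp add: R_def)
  qed (use g in auto)
qed

section \<open>Convergence as time tends to zero\<close>

context elliptic_semigroup
begin

text \<open>Pointwise convergence is weak continuity at time \<open>0\<close>; what has to be found
  is a majorant integrable in \<open>x\<close>. Away from the support of \<open>g\<close> it comes
  from the exponential weight in \<open>fixed_time_Lp\<close>, which beats the growing factor
  \<open>l powr (DIM('a) / 2)\<close> once the distance to \<open>ball 0 M\<close> is at least
  \<open>1\<close>.\<close>

lemma strong_continuity_compact_support:
  assumes gc: "continuous_on UNIV g" and B: "\<And>y. \<bar>g y\<bar> \<le> B" and M: "0 \<le> M" and supp: "\<And>y. y \<notin> ball 0 M \<Longrightarrow> g y = 0"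
  shows "((\<lambda>t. \<integral>\<^sup>+x. ennreal (\<bar>(\<integral>y. g y \<partial>K t x) - g x\<bar> powr p) \<partial>lborel) \<longlongrightarrow> 0) (at_right 0)"
proof -
  obtain C l\<^sub>0 \<gamma> where C: "0 < C" and l0: "0 < l\<^sub>0" and \<gamma>: "0 < \<gamma>" and bound:
    "\<And>l x f B. l\<^sub>0 \<le> l \<Longrightarrow> f \<in> borel_measurable borel \<Longrightarrow> (\<And>y. 0 \<le> f y) \<Longrightarrow> (\<And>y. f y \<le> B) \<Longrightarrow>
      ennreal ((\<integral>y. f y \<partial>K (1 / l) x) powr p) \<le> ennreal (C * l powr (DIM('a) / 2)) *
        (\<integral>\<^sup>+y. ennreal (exp (- (p * \<gamma> * sqrt l * dist y x)) * f y powr p) \<partial>lborel)"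
    using fixed_time_Lp by blast
  have gm[measurable]: "g \<in> borel_measurable borel" by (rule borel_measurable_continuous_onI[OF gc])
  have B0: "0 \<le> B" using B[of 0] by simp
  define a where "a = p * \<gamma>"
  have a: "0 < a" using pos \<gamma> by (simp add: a_def)
  define \<omega> where "\<omega> = measure lborel (ball (0::'a) M)"
  \<comment> \<open>A bound for \<open>s ^ DIM('a) * exp (- (a * s / 2))\<close>, from
    \<open>(1 + x / n) ^ n \<le> exp x\<close>.\<close>
  define Q where "Q = (2 * real DIM('a) / a) ^ DIM('a)"
  define D where "D = C * B powr p * \<omega> * Q * exp (a * M / 2)"
  have D0: "0 \<le> D" using C a by (simp add: D_def \<omega>_def Q_def)
  have pow: "s ^ DIM('a) * exp (- (a * s / 2)) \<le> Q" if s: "0 \<le> s" for s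
  proof -
    have "(a * s / 2 / real DIM('a)) ^ DIM('a) \<le> (1 + a * s / 2 / real DIM('a)) ^ DIM('a)"
      using a s by (intro power_mono) auto
    also have "\<dots> \<le> exp (a * s / 2)"
      using a s by (intro exp_ge_one_plus_x_over_n_power_n) (auto intro: order_trans[of _ 0])
    finally have le: "Q * (a * s / 2 / real DIM('a)) ^ DIM('a) \<le> Q * exp (a * s / 2)"
      using a by (intro mult_left_mono) (auto simp: Q_def)
    have "Q * (a * s / 2 / real DIM('a)) ^ DIM('a) = s ^ DIM('a)"
      using a unfolding Q_def power_mult_distrib[symmetric] by simp
    then have "s ^ DIM('a) * exp (- (a * s / 2)) \<le> Q * exp (a * s / 2) * exp (- (a * s / 2))"
      using le by (intro mult_right_mono) auto
    also have "\<dots> = Q" by (simp only: mult.assoc exp_add[symmetric]) simp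
    finally show ?thesis .
  qed
  have decay: "\<bar>\<integral>y. g y \<partial>K t x\<bar> powr p \<le> D * exp (- (a / 2 * norm x))"
    if t: "0 < t" "t \<le> min (1 / l\<^sub>0) 1" and x: "M + 1 \<le> norm x" for t x
  proof -
    define l where "l = 1 / t"
    have l: "l\<^sub>0 \<le> l" "1 \<le> l" "1 / l = t" using t l0 by (auto simp: l_def field_simps)
    define s where "s = sqrt l"
    define \<rho> where "\<rho> = norm x - M"
    have s: "1 \<le> s" "l powr (DIM('a) / 2) = s ^ DIM('a)" 
    proof -
      show "1 \<le> s" using l by (simp add: s_def)
      show "l powr (DIM('a) / 2) = s ^ DIM('a)"
        using l by (simp add: s_def powr_half_sqrt[symmetric] powr_powr powr_realpow[symmetric])
    qed
    have \<rho>: "1 \<le> \<rho>" using x by (simp add: \<rho>_def)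
    have "\<bar>\<integral>y. g y \<partial>K t x\<bar> \<le> (\<integral>y. \<bar>g y\<bar> \<partial>K t x)" by (rule integral_abs_bound)
    then have "ennreal (\<bar>\<integral>y. g y \<partial>K t x\<bar> powr p) \<le> ennreal ((\<integral>y. \<bar>g y\<bar> \<partial>K t x) powr p)"
      using pos by (intro ennreal_leI powr_mono2) auto
    also have "\<dots> \<le> ennreal (C * l powr (DIM('a) / 2)) * (\<integral>\<^sup>+y. ennreal (exp (- (p * \<gamma> * sqrt l * dist y x)) * \<bar>g y\<bar> powr p) \<partial>lborel)"
      unfolding l(3)[symmetric] by (rule bound[OF l(1)]) (use B in auto)
    also have "\<dots> \<le> ennreal (C * l powr (DIM('a) / 2)) * (\<integral>\<^sup>+y. ennreal (exp (- (a * s * \<rho>)) * B powr p) * indicator (ball 0 M) y \<partial>(lborel :: 'a measure))"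
    proof (intro mult_left_mono nn_integral_mono)
      fix y :: 'a
      show "ennreal (exp (- (p * \<gamma> * sqrt l * dist y x)) * \<bar>g y\<bar> powr p) \<le> ennreal (exp (- (a * s * \<rho>)) * B powr p) * indicator (ball 0 M) y"
      proof (cases "y \<in> ball 0 M")
        case True
        have "norm x \<le> norm y + dist y x" using norm_triangle_sub[of x y] by (simp add: dist_norm norm_minus_commute)
        then have "\<rho> \<le> dist y x" using True by (simp add: \<rho>_def)
        then have "exp (- (a * s * dist y x)) * \<bar>g y\<bar> powr p \<le> exp (- (a * s * \<rho>)) * B powr p"
          using a s B pos by (intro mult_mono powr_mono2) auto
        then show ?thesis using True by (simp add: a_def s_def ennreal_leI)
      qed (simp add: supp)
    qed simp
    also have "(\<integral>\<^sup>+y. ennreal (exp (- (a * s * \<rho>)) * B powr p) * indicator (ball 0 M) y \<partial>(lborel :: 'a measure)) = ennreal (exp (- (a * s * \<rho>)) * B powr p) * ennreal \<omega>"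
      unfolding \<omega>_def using emeasure_lborel_ball_finite[of "0::'a" M]
      by (subst nn_integral_cmult_indicator) (auto simp: emeasure_eq_ennreal_measure)
    also have "ennreal (C * l powr (DIM('a) / 2)) * (ennreal (exp (- (a * s * \<rho>)) * B powr p) * ennreal \<omega>)
      = ennreal (C * s ^ DIM('a) * (exp (- (a * s * \<rho>)) * B powr p * \<omega>))"
      unfolding s(2) using C s by (simp add: ennreal_mult \<omega>_def)
    finally have le: "\<bar>\<integral>y. g y \<partial>K t x\<bar> powr p \<le> C * s ^ DIM('a) * (exp (- (a * s * \<rho>)) * B powr p * \<omega>)"
      using C s by (subst (asm) ennreal_le_iff) (auto simp: \<omega>_def)
    \<comment> \<open>For \<open>s\<close> and \<rho> at least \<open>1\<close> the product
      dominates the mean of the two, so the exponent splits: one half absorbs the power of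
      \<open>s\<close>, the other gives a decay in \<open>x\<close> independent of
      \<open>t\<close>.\<close>
    have "s \<le> s * \<rho>" "\<rho> \<le> s * \<rho>" using s \<rho> mult_left_mono[OF \<rho>, of s] mult_right_mono[OF s(1), of \<rho>] by auto
    then have "a * (s + \<rho>) \<le> a * (2 * (s * \<rho>))" using a by (intro mult_left_mono) auto
    then have "exp (- (a * s * \<rho>)) \<le> exp (- (a * s / 2) + - (a * \<rho> / 2))"
      by (simp add: algebra_simps)
    also have "\<dots> = exp (- (a * s / 2)) * exp (- (a * \<rho> / 2))" by (rule exp_add)
    finally have "s ^ DIM('a) * exp (- (a * s * \<rho>)) \<le> s ^ DIM('a) * (exp (- (a * s / 2)) * exp (- (a * \<rho> / 2)))"
      using s by (intro mult_left_mono) auto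
    also have "\<dots> = (s ^ DIM('a) * exp (- (a * s / 2))) * exp (- (a * \<rho> / 2))" by (simp only: mult.assoc)
    also have "\<dots> \<le> Q * exp (- (a * \<rho> / 2))" using pow[of s] s by (intro mult_right_mono) auto
    finally have "(C * B powr p * \<omega>) * (s ^ DIM('a) * exp (- (a * s * \<rho>))) \<le> (C * B powr p * \<omega>) * (Q * exp (- (a * \<rho> / 2)))"
      using C by (intro mult_left_mono) (auto simp: \<omega>_def)
    also have "exp (- (a * \<rho> / 2)) = exp (a * M / 2) * exp (- (a / 2 * norm x))"
      unfolding exp_add[symmetric] by (simp add: \<rho>_def algebra_simps diff_divide_distrib)
    finally show ?thesis using le by (simp add: D_def mult_ac)
  qed
  define w where "w x = ennreal ((2 * B) powr p) * indicator (ball 0 (M + 1)) x + ennreal D * ennreal (exp (- (a / 2 * norm x)))" for x :: 'a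
  have wm1: "(\<lambda>x::'a. ennreal ((2 * B) powr p) * indicator (ball 0 (M + 1)) x) \<in> borel_measurable lborel"
    by (intro borel_measurable_times_ennreal borel_measurable_const borel_measurable_indicator) simp
  have wm2: "(\<lambda>x::'a. ennreal D * ennreal (exp (- (a / 2 * norm x)))) \<in> borel_measurable lborel" by measurable
  have wm: "w \<in> borel_measurable lborel" unfolding w_def by (intro borel_measurable_add wm1 wm2)
  have wfin: "(\<integral>\<^sup>+x. w x \<partial>lborel) < \<infinity>"
  proof -
    have "(\<integral>\<^sup>+x. w x \<partial>lborel) = (\<integral>\<^sup>+x. ennreal ((2 * B) powr p) * indicator (ball (0::'a) (M + 1)) x \<partial>lborel) + (\<integral>\<^sup>+x. ennreal D * ennreal (exp (- (a / 2 * norm x))) \<partial>(lborel :: 'a measure))"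
      unfolding w_def by (rule nn_integral_add[OF wm1 wm2])
    also have "(\<integral>\<^sup>+x. ennreal ((2 * B) powr p) * indicator (ball (0::'a) (M + 1)) x \<partial>lborel) = ennreal ((2 * B) powr p) * emeasure lborel (ball (0::'a) (M + 1))"
      by (rule nn_integral_cmult_indicator) simp
    also have "(\<integral>\<^sup>+x. ennreal D * ennreal (exp (- (a / 2 * norm x))) \<partial>(lborel :: 'a measure)) = ennreal D * (\<integral>\<^sup>+x. ennreal (exp (- (a / 2 * norm x))) \<partial>(lborel :: 'a measure))"
      by (rule nn_integral_cmult) measurable
    also have "ennreal ((2 * B) powr p) * emeasure lborel (ball (0::'a) (M + 1)) + ennreal D * (\<integral>\<^sup>+x. ennreal (exp (- (a / 2 * norm x))) \<partial>(lborel :: 'a measure)) < \<infinity>"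
      using nn_integral_exp_norm_finite[of "a / 2", where ?'a='a] emeasure_lborel_ball_finite[of "0::'a" "M + 1"] a
      by (simp add: ennreal_mult_less_top)
    finally show ?thesis .
  qed
  have gK: "\<bar>\<integral>y. g y \<partial>K t x\<bar> \<le> B" for t x using norm_integral_kernel_le[of g B t x] B by simp
  show ?thesis
  proof (rule tendsto_at_right_sequentially[of 0 "min (1 / l\<^sub>0) 1"])
    show "0 < min (1 / l\<^sub>0) 1" using l0 by simp
    fix S :: "nat \<Rightarrow> real"
    assume S: "\<And>n. 0 < S n" "\<And>n. S n < min (1 / l\<^sub>0) 1" "S \<longlonglongrightarrow> 0"
    have "(\<lambda>n. \<integral>\<^sup>+x. ennreal (\<bar>(\<integral>y. g y \<partial>K (S n) x) - g x\<bar> powr p) \<partial>lborel) \<longlonglongrightarrow> (\<integral>\<^sup>+x. 0 \<partial>(lborel :: 'a measure))"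
    proof (rule nn_integral_dominated_convergence[OF _ _ wm _ wfin])
      show "(\<lambda>x. ennreal (\<bar>(\<integral>y. g y \<partial>K (S n) x) - g x\<bar> powr p)) \<in> borel_measurable lborel" for n
      proof -
        define F where "F = (\<lambda>x. \<integral>y. g y \<partial>K (S n) x)"
        have [measurable]: "F \<in> borel_measurable borel"
          unfolding F_def by (rule integral_kernel_measurable) measurable
        have "(\<lambda>x. ennreal (\<bar>F x - g x\<bar> powr p)) \<in> borel_measurable lborel" by measurable
        then show ?thesis by (simp add: F_def)
      qed
      show "AE x in lborel. ennreal (\<bar>(\<integral>y. g y \<partial>K (S n) x) - g x\<bar> powr p) \<le> w x" for n
      proof (rule AE_I2)
        fix x :: 'a
        show "ennreal (\<bar>(\<integral>y. g y \<partial>K (S n) x) - g x\<bar> powr p) \<le> w x"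
        proof (cases "norm x < M + 1")
          case True
          have "\<bar>(\<integral>y. g y \<partial>K (S n) x) - g x\<bar> \<le> 2 * B" using gK[of "S n" x] B[of x] by linarith
          then have "ennreal (\<bar>(\<integral>y. g y \<partial>K (S n) x) - g x\<bar> powr p) \<le> ennreal ((2 * B) powr p)"
            using pos by (intro ennreal_leI powr_mono2) auto
          also have "\<dots> \<le> w x" using True by (simp add: w_def)
          finally show ?thesis .
        next
          case False
          then have "g x = 0" by (intro supp) simp
          then have "ennreal (\<bar>(\<integral>y. g y \<partial>K (S n) x) - g x\<bar> powr p) \<le> ennreal (D * exp (- (a / 2 * norm x)))"
            using decay[of "S n" x] S(1,2)[of n] False by (intro ennreal_leI) auto
          also have "\<dots> \<le> w x" using D0 False by (simp add: w_def ennreal_mult)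
          finally show ?thesis .
        qed
      qed
      show "AE x in lborel. (\<lambda>n. ennreal (\<bar>(\<integral>y. g y \<partial>K (S n) x) - g x\<bar> powr p)) \<longlonglongrightarrow> 0"
      proof (rule AE_I2)
        fix x :: 'a
        have "bounded (range g)" by (rule boundedI[where B=B]) (use B in auto)
        then have "isCont (\<lambda>t. \<integral>y. g y \<partial>K t x) 0"
          using weakly_continuous[OF gc] by (simp add: continuous_on_eq_continuous_at)
        from isCont_tendsto_compose[OF this S(3)]
        have "(\<lambda>n. \<integral>y. g y \<partial>K (S n) x) \<longlonglongrightarrow> g x"
          by (simp add: initial integral_return)
        then have "(\<lambda>n. \<bar>(\<integral>y. g y \<partial>K (S n) x) - g x\<bar>) \<longlonglongrightarrow> \<bar>g x - g x\<bar>" by (intro tendsto_intros)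
        then have "(\<lambda>n. \<bar>(\<integral>y. g y \<partial>K (S n) x) - g x\<bar> powr p) \<longlonglongrightarrow> \<bar>g x - g x\<bar> powr p"
          by (rule tendsto_powr'[OF _ tendsto_const]) (use pos in auto)
        from tendsto_ennrealI[OF this] show "(\<lambda>n. ennreal (\<bar>(\<integral>y. g y \<partial>K (S n) x) - g x\<bar> powr p)) \<longlonglongrightarrow> 0" by simp
      qed
    qed simp
    then show "(\<lambda>n. \<integral>\<^sup>+x. ennreal (\<bar>(\<integral>y. g y \<partial>K (S n) x) - g x\<bar> powr p) \<partial>lborel) \<longlonglongrightarrow> 0" by simp
  qed
qed

theorem strong_continuity:
  assumes f[measurable]: "f \<in> borel_measurable borel" and fin: "(\<integral>\<^sup>+y. ennreal (\<bar>f y\<bar> powr p) \<partial>lborel) < \<infinity>"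
  shows "0 < t \<Longrightarrow> AE x in lborel. integrable (K t x) f"
    and "((\<lambda>t. \<integral>\<^sup>+x. ennreal (\<bar>(\<integral>y. f y \<partial>K t x) - f x\<bar> powr p) \<partial>lborel) \<longlongrightarrow> 0) (at_right 0)"
proof -
  show "AE x in lborel. integrable (K t x) f" if "0 < t"
  proof -
    obtain C where C: "0 < C" "\<And>s f B. 0 < s \<Longrightarrow> s \<le> t \<Longrightarrow> f \<in> borel_measurable borel \<Longrightarrow> (\<And>y. 0 \<le> f y) \<Longrightarrow> (\<And>y. f y \<le> B) \<Longrightarrow>
      (\<integral>\<^sup>+x. ennreal ((\<integral>y. f y \<partial>K s x) powr p) \<partial>lborel) \<le> ennreal C * (\<integral>\<^sup>+y. ennreal (f y powr p) \<partial>lborel)"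
      using Lp_bound[of t] by blast
    show ?thesis by (rule Lp_bound_unbounded(1)[OF C(1) _ f fin]) (rule C(2)[OF that order_refl])
  qed
next
  obtain C where C: "0 < C" and bound: "\<And>t f B. 0 < t \<Longrightarrow> t \<le> 1 \<Longrightarrow> f \<in> borel_measurable borel \<Longrightarrow> (\<And>y. 0 \<le> f y) \<Longrightarrow> (\<And>y. f y \<le> B) \<Longrightarrow>
      (\<integral>\<^sup>+x. ennreal ((\<integral>y. f y \<partial>K t x) powr p) \<partial>lborel) \<le> ennreal C * (\<integral>\<^sup>+y. ennreal (f y powr p) \<partial>lborel)"
    using Lp_bound[of 1] by blast
  define c where "c = 2 powr p"
  have c: "0 < c" by (simp add: c_def)
  show "((\<lambda>t. \<integral>\<^sup>+x. ennreal (\<bar>(\<integral>y. f y \<partial>K t x) - f x\<bar> powr p) \<partial>lborel) \<longlongrightarrow> 0) (at_right 0)"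
  proof (rule order_tendstoI)
    fix e0 :: ennreal assume "0 < e0"
    then obtain e :: real where e: "0 < e" "ennreal e \<le> e0"
      by (cases e0) (auto intro: that[of 1])
    \<comment> \<open>The quasi-triangle inequality is used twice, for three differences, so the
      total error is \<open>c * (C + c) * \<epsilon> + c * c * q\<close>. Both terms are made at
      most \<open>e / 4\<close>.\<close>
    define \<epsilon> where "\<epsilon> = e / (2 * c * (C + c) + 1) / 2"
    have den: "0 < 2 * c * (C + c) + 1" using c C by (simp add: add_pos_pos)
    have \<epsilon>: "0 < \<epsilon>" using e den by (simp add: \<epsilon>_def)
    obtain g B M where gc: "continuous_on UNIV g" and B: "\<And>y. \<bar>g y\<bar> \<le> B" and M: "0 \<le> M" "\<And>y. y \<notin> ball 0 M \<Longrightarrow> g y = 0"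
      and fg: "(\<integral>\<^sup>+y. ennreal (\<bar>f y - g y\<bar> powr p) \<partial>lborel) \<le> ennreal \<epsilon>"
      by (rule Lp_approximation[OF pos(1) f fin \<epsilon>]) (rule that)
    have [measurable]: "g \<in> borel_measurable borel" by (rule borel_measurable_continuous_onI[OF gc])
    define G where "G t = (\<integral>\<^sup>+x. ennreal (\<bar>(\<integral>y. g y \<partial>K t x) - g x\<bar> powr p) \<partial>lborel)" for t
    define q where "q = e / (4 * c * c)"
    have q: "0 < q" using e c by (simp add: q_def)
    have "(G \<longlongrightarrow> 0) (at_right 0)" unfolding G_def by (rule strong_continuity_compact_support[OF gc B M])
    then have "\<forall>\<^sub>F t in at_right 0. G t < ennreal q" using q by (intro order_tendstoD(2)) auto
    moreover have "\<forall>\<^sub>F t in at_right 0. t \<in> {0<..<1::real}" by (rule eventually_at_right_real) simp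
    ultimately show "\<forall>\<^sub>F t in at_right 0. (\<integral>\<^sup>+x. ennreal (\<bar>(\<integral>y. f y \<partial>K t x) - f x\<bar> powr p) \<partial>lborel) < e0"
    proof eventually_elim
      case (elim t)
      have fin': "(\<integral>\<^sup>+y. ennreal (\<bar>f y - g y\<bar> powr p) \<partial>lborel) < \<infinity>"
        using fg by (simp add: le_less_trans[OF _ ennreal_less_top])
      have bt: "\<And>f B. f \<in> borel_measurable borel \<Longrightarrow> (\<And>y. 0 \<le> f y) \<Longrightarrow> (\<And>y. f y \<le> B) \<Longrightarrow>
        (\<integral>\<^sup>+x. ennreal ((\<integral>y. f y \<partial>K t x) powr p) \<partial>lborel) \<le> ennreal C * (\<integral>\<^sup>+y. ennreal (f y powr p) \<partial>lborel)"
        using bound[of t] elim by auto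
      have [measurable]: "(\<lambda>x. \<integral>y. h y \<partial>K t x) \<in> borel_measurable borel" if "h \<in> borel_measurable borel" for h :: "'a \<Rightarrow> real"
        by (rule integral_kernel_measurable) (use that in measurable)
      have hm: "(\<lambda>y. f y - g y) \<in> borel_measurable borel" by measurable
      \<comment> \<open>Integrability of \<open>f - g\<close> is what allows the integral of
        \<open>f\<close> to be split; without it that integral could be a default value unrelated to
        the one of \<open>g\<close>.\<close>
      have h1: "AE x in lborel. integrable (K t x) (\<lambda>y. f y - g y)"
        by (rule Lp_bound_unbounded(1)[OF C _ hm fin']) (rule bt)
      have h2: "(\<integral>\<^sup>+x. ennreal ((\<integral>y. \<bar>f y - g y\<bar> \<partial>K t x) powr p) \<partial>lborel) \<le> ennreal C * (\<integral>\<^sup>+y. ennreal (\<bar>f y - g y\<bar> powr p) \<partial>lborel)"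
        by (rule Lp_bound_unbounded(2)[OF C _ hm fin']) (rule bt)
      have ig: "integrable (K t x) g" for x by (rule integrable_kernel_bounded[where B=B]) (use B in auto)
      have "(\<integral>\<^sup>+x. ennreal (\<bar>(\<integral>y. f y \<partial>K t x) - f x\<bar> powr p) \<partial>lborel) \<le> ennreal c *
         ((\<integral>\<^sup>+x. ennreal (\<bar>\<integral>y. \<bar>f y - g y\<bar> \<partial>K t x\<bar> powr p) \<partial>lborel) + (\<integral>\<^sup>+x. ennreal (\<bar>\<bar>(\<integral>y. g y \<partial>K t x) - g x\<bar> + \<bar>f x - g x\<bar>\<bar> powr p) \<partial>lborel))"
        unfolding c_def
      proof (rule nn_integral_powr_add_le[OF pos(1)])
        show "AE x in lborel. \<bar>(\<integral>y. f y \<partial>K t x) - f x\<bar> \<le> \<bar>\<integral>y. \<bar>f y - g y\<bar> \<partial>K t x\<bar> + \<bar>\<bar>(\<integral>y. g y \<partial>K t x) - g x\<bar> + \<bar>f x - g x\<bar>\<bar>"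
          using h1
        proof eventually_elim
          case (elim x)
          have "(\<integral>y. f y \<partial>K t x) = (\<integral>y. (f y - g y) + g y \<partial>K t x)" by simp
          also have "\<dots> = (\<integral>y. f y - g y \<partial>K t x) + (\<integral>y. g y \<partial>K t x)"
            by (rule Bochner_Integration.integral_add[OF elim ig])
          finally have "(\<integral>y. f y \<partial>K t x) - f x = (\<integral>y. f y - g y \<partial>K t x) + ((\<integral>y. g y \<partial>K t x) - g x) - (f x - g x)" by simp
          moreover have "\<bar>\<integral>y. f y - g y \<partial>K t x\<bar> \<le> (\<integral>y. \<bar>f y - g y\<bar> \<partial>K t x)" by (rule integral_abs_bound)
          ultimately show ?case by linarith
        qed
      qed measurable
      also have "\<dots> \<le> ennreal c * (ennreal C * ennreal \<epsilon> + ennreal c * (ennreal q + ennreal \<epsilon>))"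
      proof (intro mult_left_mono add_mono)
        have "(\<integral>\<^sup>+x. ennreal (\<bar>\<integral>y. \<bar>f y - g y\<bar> \<partial>K t x\<bar> powr p) \<partial>lborel) \<le> ennreal C * (\<integral>\<^sup>+y. ennreal (\<bar>f y - g y\<bar> powr p) \<partial>lborel)"
          using h2 by simp
        also have "\<dots> \<le> ennreal C * ennreal \<epsilon>" by (rule mult_left_mono[OF fg]) simp
        finally show "(\<integral>\<^sup>+x. ennreal (\<bar>\<integral>y. \<bar>f y - g y\<bar> \<partial>K t x\<bar> powr p) \<partial>lborel) \<le> ennreal C * ennreal \<epsilon>" .
        have "(\<integral>\<^sup>+x. ennreal (\<bar>\<bar>(\<integral>y. g y \<partial>K t x) - g x\<bar> + \<bar>f x - g x\<bar>\<bar> powr p) \<partial>lborel)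
          \<le> ennreal c * ((\<integral>\<^sup>+x. ennreal (\<bar>(\<integral>y. g y \<partial>K t x) - g x\<bar> powr p) \<partial>lborel) + (\<integral>\<^sup>+x. ennreal (\<bar>f x - g x\<bar> powr p) \<partial>lborel))"
          unfolding c_def by (rule nn_integral_powr_add_le[OF pos(1)]) auto
        also have "\<dots> \<le> ennreal c * (ennreal q + ennreal \<epsilon>)"
          using elim fg unfolding G_def by (intro mult_left_mono add_mono) auto
        finally show "(\<integral>\<^sup>+x. ennreal (\<bar>\<bar>(\<integral>y. g y \<partial>K t x) - g x\<bar> + \<bar>f x - g x\<bar>\<bar> powr p) \<partial>lborel) \<le> ennreal c * (ennreal q + ennreal \<epsilon>)" .
      qed auto
      also have "\<dots> = ennreal (c * (C * \<epsilon> + c * (q + \<epsilon>)))"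
        using c C q \<epsilon> by (simp add: ennreal_mult)
      also have "c * (C * \<epsilon> + c * (q + \<epsilon>)) < e"
      proof -
        have "c * (C * \<epsilon> + c * (q + \<epsilon>)) = c * (C + c) * \<epsilon> + c * c * q" by (simp add: algebra_simps)
        also have "c * c * q = e / 4" using c by (simp add: q_def)
        also have "c * (C + c) * \<epsilon> \<le> e / 4"
          using c C e den by (simp add: \<epsilon>_def field_simps add_pos_pos)
        finally show ?thesis using e by simp
      qed
      then have "ennreal (c * (C * \<epsilon> + c * (q + \<epsilon>))) < ennreal e" using e by (simp add: ennreal_lessI)
      finally show ?case using e by (meson less_le_trans)
    qed
  qed simp
qed

end


section \<open>Bump functions\<close>

text \<open>The minimum \<open>m\<close> of the quadratic form over the unit sphere is attained.
  Moving from the minimiser \<open>v\<close> by \<open>t\<close> along the gradient \<open>g\<close>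
  changes \<open>B\<close> to first order by \<open>2 * t * (g \<bullet> g)\<close>, which would
  make \<open>B\<close> negative for small negative \<open>t\<close> unless
  \<open>g = 0\<close>.\<close>

lemma symmetric_matrix_min_eigenvector:
  fixes A :: "real^'n::finite^'n"
  assumes sym: "transpose A = A"
  obtains m v where "v \<noteq> 0" "A *v v = m *\<^sub>R v" "\<And>w. m * (norm w)\<^sup>2 \<le> w \<bullet> (A *v w)"
proof -
  have cont: "continuous_on (sphere 0 1) (\<lambda>w. w \<bullet> (A *v w))"
    by (intro continuous_intros matrix_vector_mult_linear_continuous_on)
  have ne: "sphere (0::real^'n) 1 \<noteq> {}" by simp
  obtain v where v: "v \<in> sphere 0 1" and min: "\<And>w. w \<in> sphere 0 1 \<Longrightarrow> v \<bullet> (A *v v) \<le> w \<bullet> (A *v w)"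
    using continuous_attains_inf[OF compact_sphere ne cont] by blast
  define m where "m = v \<bullet> (A *v v)"
  define B where "B w = w \<bullet> (A *v w) - m * (norm w)\<^sup>2" for w
  have B: "0 \<le> B w" for w
  proof (cases "w = 0")
    case False
    define u where "u = (1 / norm w) *\<^sub>R w"
    have "u \<in> sphere 0 1" using False by (simp add: u_def)
    then have "m \<le> u \<bullet> (A *v u)" unfolding m_def by (rule min)
    also have "u \<bullet> (A *v u) = (w \<bullet> (A *v w)) / (norm w)\<^sup>2"
      by (simp add: u_def matrix_vector_mult_scaleR power2_eq_square)
    finally show ?thesis using False by (simp add: B_def field_simps)
  qed (simp add: B_def)
  define g where "g = A *v v - m *\<^sub>R v"
  have swap: "x \<bullet> (A *v y) = y \<bullet> (A *v x)" for x y
    using dot_lmul_matrix[of x A y] sym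
    by (metis inner_commute matrix_transpose_mul transpose_matrix_vector vector_transpose_matrix)
  have vv: "v \<bullet> v = 1" using v by (simp add: dot_square_norm)
  have exp: "B (v + t *\<^sub>R g) = 2 * t * (g \<bullet> g) + t\<^sup>2 * B g" for t
  proof -
    have 1: "(v + t *\<^sub>R g) \<bullet> (A *v (v + t *\<^sub>R g)) = m + 2 * t * (g \<bullet> (A *v v)) + t\<^sup>2 * (g \<bullet> (A *v g))"
      using swap[of v g]
      by (simp add: matrix_vector_right_distrib matrix_vector_mult_scaleR inner_add_left inner_add_right m_def power2_eq_square algebra_simps)
    have 2: "(norm (v + t *\<^sub>R g))\<^sup>2 = 1 + 2 * t * (g \<bullet> v) + t\<^sup>2 * (norm g)\<^sup>2"
      unfolding power2_norm_eq_inner using vv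
      by (simp add: inner_add_left inner_add_right inner_commute power2_eq_square algebra_simps)
    have "g \<bullet> g = g \<bullet> (A *v v) - m * (g \<bullet> v)" by (simp add: g_def inner_diff_right)
    moreover have "B (v + t *\<^sub>R g) = 2 * t * (g \<bullet> (A *v v) - m * (g \<bullet> v)) + t\<^sup>2 * B g"
      unfolding B_def 1 2 by (simp add: algebra_simps)
    ultimately show ?thesis by simp
  qed
  have "g = 0"
  proof (rule ccontr)
    assume "g \<noteq> 0"
    then have G: "0 < g \<bullet> g" by simp
    \<comment> \<open>With this step length the quadratic term is at most half of the linear
      one.\<close>
    define e where "e = (g \<bullet> g) / (B g + 1)"
    have e: "0 < e" using G B[of g] by (simp add: e_def)
    have "e * B g \<le> g \<bullet> g" using G B[of g] by (simp add: e_def field_simps)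
    then have "e * (e * B g) \<le> e * (g \<bullet> g)" using e by (intro mult_left_mono) auto
    moreover have "0 \<le> 2 * (- e) * (g \<bullet> g) + (- e)\<^sup>2 * B g" using B exp[of "- e"] by metis
    ultimately have "e * (g \<bullet> g) \<le> 0" by (simp add: power2_eq_square)
    then show False using e G by (simp add: mult_le_0_iff)
  qed
  show thesis
  proof (rule that[of v m])
    show "v \<noteq> 0" using vv by auto
    show "A *v v = m *\<^sub>R v" using \<open>g = 0\<close> by (simp add: g_def)
    show "m * (norm w)\<^sup>2 \<le> w \<bullet> (A *v w)" for w using B[of w] by (simp add: B_def)
  qed
qed

text \<open>The matrix class is described through eigenvalues, so an eigenvector realising the
  extremal value of the form has to be produced. The upper bound is the lower one for
  \<open>- A\<close>.\<close>

lemma sym_eigenvalues_in_bounds: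
  assumes "A \<in> sym_eigenvalues_in \<delta>"
  shows "\<delta> * (norm w)\<^sup>2 \<le> w \<bullet> (A *v w)" "w \<bullet> (A *v w) \<le> (norm w)\<^sup>2 / \<delta>"
proof -
  have sym: "transpose A = A" and ev: "\<And>\<mu> v. v \<noteq> 0 \<Longrightarrow> A *v v = \<mu> *\<^sub>R v \<Longrightarrow> \<delta> \<le> \<mu> \<and> \<mu> \<le> 1 / \<delta>"
    using assms by (auto simp: sym_eigenvalues_in_def)
  obtain m v where m: "v \<noteq> 0" "A *v v = m *\<^sub>R v" "\<And>w. m * (norm w)\<^sup>2 \<le> w \<bullet> (A *v w)"
    by (rule symmetric_matrix_min_eigenvector[OF sym]) (rule that)
  have "\<delta> * (norm w)\<^sup>2 \<le> m * (norm w)\<^sup>2" using ev[OF m(1,2)] by (intro mult_right_mono) auto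
  then show "\<delta> * (norm w)\<^sup>2 \<le> w \<bullet> (A *v w)" using m(3)[of w] by linarith
  have sym': "transpose (- A) = - A" using sym by (simp add: transpose_def vec_eq_iff)
  obtain m' v' where m': "v' \<noteq> 0" "(- A) *v v' = m' *\<^sub>R v'" "\<And>w. m' * (norm w)\<^sup>2 \<le> w \<bullet> ((- A) *v w)"
    by (rule symmetric_matrix_min_eigenvector[OF sym']) (rule that)
  have neg: "(- A) *v w = - (A *v w)" for w
    by (simp add: matrix_vector_mult_def vec_eq_iff sum_negf)
  have "A *v v' = (- m') *\<^sub>R v'" using m'(2) by (simp add: neg) (metis minus_equation_iff)
  then have "- m' \<le> 1 / \<delta>" using ev[OF m'(1)] by blast
  then have "(- m') * (norm w)\<^sup>2 \<le> 1 / \<delta> * (norm w)\<^sup>2" by (intro mult_right_mono) auto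
  moreover have "w \<bullet> (A *v w) \<le> - m' * (norm w)\<^sup>2" using m'(3)[of w] by (simp add: neg)
  ultimately show "w \<bullet> (A *v w) \<le> (norm w)\<^sup>2 / \<delta>" by simp
qed

lemma sym_eigenvalues_in_diagonal:
  assumes "A \<in> sym_eigenvalues_in \<delta>"
  shows "\<delta> \<le> A $ i $ i" "A $ i $ i \<le> 1 / \<delta>"
proof -
  have "axis i 1 \<bullet> (A *v axis i 1) = A $ i $ i"
    by (simp add: matrix_vector_mul_component inner_axis' inner_axis)
  then show "\<delta> \<le> A $ i $ i" "A $ i $ i \<le> 1 / \<delta>"
    using sym_eigenvalues_in_bounds[OF assms, of "axis i 1"] by auto
qed

section \<open>Derivatives of the bump and the operator acting on it\<close>

text \<open>Only the kink at \<open>0\<close> needs an argument: there the difference quotient is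
  \<open>max 0 h ^ (n + 1)\<close>, which tends to \<open>0\<close> because the exponent is
  positive.\<close>

lemma has_real_derivative_pos_part_power:
  fixes s :: real
  shows "((\<lambda>s. max 0 s ^ (n + 2)) has_real_derivative (real n + 2) * max 0 s ^ (n + 1)) (at s)"
proof -
  consider "s < 0" | "s > 0" | "s = 0" by linarith
  then show ?thesis
  proof cases
    case 1
    have "((\<lambda>s. 0 :: real) has_real_derivative 0) (at s)" by simp
    then have "((\<lambda>s. max 0 s ^ (n + 2)) has_real_derivative 0) (at s)"
      by (rule has_field_derivative_transform_within_open[of _ _ _ "{..<0}"]) (use 1 in auto)
    then show ?thesis using 1 by simp
  next
    case 2
    have "((\<lambda>s. s ^ (n + 2)) has_real_derivative (real n + 2) * s ^ (n + 1)) (at s)"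
      using DERIV_pow[of "n + 2" s UNIV] by (simp add: add.commute)
    then have "((\<lambda>s. max 0 s ^ (n + 2)) has_real_derivative (real n + 2) * s ^ (n + 1)) (at s)"
      by (rule has_field_derivative_transform_within_open[of _ _ _ "{0<..}"]) (use 2 in auto)
    then show ?thesis using 2 by simp
  next
    case 3
    have "((\<lambda>h. max 0 h ^ (n + 1)) \<longlongrightarrow> 0) (at (0::real))"
      by (auto intro!: tendsto_eq_intros)
    then have "((\<lambda>h. (max 0 h ^ (n + 2) - max 0 0 ^ (n + 2)) / h) \<longlongrightarrow> 0) (at (0::real))"
      by (rule Lim_transform_eventually) (auto simp: max_def eventually_at_filter)
    then show ?thesis using 3 by (simp add: DERIV_def)
  qed
qed

text \<open>
  The power 3 makes the bump twice continuously differentiable. Lower powers appear in its derivatives.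
\<close>

definition bump :: "nat \<Rightarrow> real^'n::finite \<Rightarrow> real \<Rightarrow> real^'n \<Rightarrow> real" where
  "bump k x r y = max 0 (1 - (norm (y - x))\<^sup>2 / r\<^sup>2) ^ k"

lemma bump_has_derivative:
  assumes "0 < r"
  shows "(bump (n + 2) x r has_derivative (\<lambda>h. (real n + 2) * bump (n + 1) x r y * (- 2 * ((y - x) \<bullet> h) / r\<^sup>2))) (at y)"
proof -
  have 1: "((\<lambda>y. 1 - (norm (y - x))\<^sup>2 / r\<^sup>2) has_derivative (\<lambda>h. - 2 * ((y - x) \<bullet> h) / r\<^sup>2)) (at y)"
  proof -
    have "((\<lambda>y. 1 - inverse (r\<^sup>2) * ((y - x) \<bullet> (y - x))) has_derivative (\<lambda>h. - (inverse (r\<^sup>2) * (2 * ((y - x) \<bullet> h))))) (at y)"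
      by (auto intro!: derivative_eq_intros simp: inner_commute algebra_simps)
    then show ?thesis by (simp add: power2_norm_eq_inner divide_inverse mult_ac)
  qed
  have 2: "((\<lambda>s. max 0 s ^ (n + 2)) has_derivative (\<lambda>h. h * ((real n + 2) * max 0 (1 - (norm (y - x))\<^sup>2 / r\<^sup>2) ^ (n + 1)))) (at (1 - (norm (y - x))\<^sup>2 / r\<^sup>2))"
    using has_real_derivative_pos_part_power by (simp add: has_field_derivative_def mult_commute_abs)
  have "bump (n + 2) x r = (\<lambda>y. max 0 (1 - (norm (y - x))\<^sup>2 / r\<^sup>2) ^ (n + 2))" by (simp add: bump_def fun_eq_iff)
  then show ?thesis
    using has_derivative_compose[OF 1 2] by (simp add: bump_def mult_ac)
qed

lemma partial_D_eqI: "(u has_derivative u') (at y) \<Longrightarrow> partial_D i u y = u' (axis i 1)"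
  unfolding partial_D_def by (metis frechet_derivative_at)

lemma bump_derivatives:
  assumes r: "0 < r"
  shows "partial_D i (bump 3 x r) y = - 6 * bump 2 x r y * (y - x) $ i / r\<^sup>2"
    and "partial_D i (partial_D j (bump 3 x r)) y =
      24 * bump 1 x r y * (y - x) $ i * (y - x) $ j / r ^ 4 - (if i = j then 6 * bump 2 x r y / r\<^sup>2 else 0)"
    and "bump 3 x r differentiable_on UNIV" "partial_D i (bump 3 x r) differentiable_on UNIV"
proof -
  have d3: "(bump 3 x r has_derivative (\<lambda>h. 3 * bump 2 x r y * (- 2 * ((y - x) \<bullet> h) / r\<^sup>2))) (at y)" for y
    using bump_has_derivative[OF r, of 1 x y] by (simp add: eval_nat_numeral)
  have d2: "(bump 2 x r has_derivative (\<lambda>h. 2 * bump 1 x r y * (- 2 * ((y - x) \<bullet> h) / r\<^sup>2))) (at y)" for y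
    using bump_has_derivative[OF r, of 0 x y] by (simp add: eval_nat_numeral)
  have p1: "partial_D i (bump 3 x r) y = - 6 * bump 2 x r y * (y - x) $ i / r\<^sup>2" for i y
    unfolding partial_D_eqI[OF d3] using r by (simp add: inner_axis field_simps)
  show "partial_D i (bump 3 x r) y = - 6 * bump 2 x r y * (y - x) $ i / r\<^sup>2" by (rule p1)
  have p1': "partial_D i (bump 3 x r) = (\<lambda>y. - 6 / r\<^sup>2 * (bump 2 x r y * ((y - x) $ i)))" for i
    by (rule ext) (simp add: p1)
  have dd: "(partial_D j (bump 3 x r) has_derivative (\<lambda>h. - 6 / r\<^sup>2 * (bump 2 x r y * h $ j + (2 * bump 1 x r y * (- 2 * ((y - x) \<bullet> h) / r\<^sup>2)) * (y - x) $ j))) (at y)" for j y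
    unfolding p1'
  proof (intro has_derivative_mult_right has_derivative_mult[OF d2])
    show "((\<lambda>y. (y - x) $ j) has_derivative (\<lambda>h. h $ j)) (at y)"
      by (auto intro!: derivative_eq_intros bounded_linear.has_derivative[OF bounded_linear_vec_nth])
  qed
  show "partial_D i (partial_D j (bump 3 x r)) y =
      24 * bump 1 x r y * (y - x) $ i * (y - x) $ j / r ^ 4 - (if i = j then 6 * bump 2 x r y / r\<^sup>2 else 0)"
  proof -
    have e1: "(y - x) \<bullet> axis i 1 = (y - x) $ i" by (simp only: inner_axis) simp
    have e2: "axis i (1::real) $ j = (if i = j then 1 else 0)" by (simp add: axis_def)
    show ?thesis
      unfolding partial_D_eqI[OF dd] e1 e2 using r
      by (simp add: power2_eq_square power4_eq_xxxx field_simps del: vector_minus_component)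
  qed
  show "bump 3 x r differentiable_on UNIV"
    using d3 by (auto simp: differentiable_on_def differentiable_def)
  show "partial_D i (bump 3 x r) differentiable_on UNIV"
    using dd by (auto simp: differentiable_on_def differentiable_def)
qed

lemma continuous_on_bump: "continuous_on UNIV (bump k x r)"
proof (cases "r = 0")
  case False
  then show ?thesis unfolding bump_def[abs_def] by (intro continuous_intros) auto
qed (simp add: bump_def[abs_def])

lemma bump_bounds:
  assumes "0 < r"
  shows "0 \<le> bump k x r y" "bump k x r y \<le> 1" "y \<notin> ball x r \<Longrightarrow> 0 < k \<Longrightarrow> bump k x r y = 0" "bump k x r x = 1"
proof -
  show "0 \<le> bump k x r y" "bump k x r y \<le> 1" "bump k x r x = 1"
    by (auto simp: bump_def intro: power_le_one)
  assume y: "y \<notin> ball x r" and "0 < k"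
  have "r\<^sup>2 \<le> (norm (y - x))\<^sup>2" using assms y by (intro power_mono) (auto simp: dist_norm norm_minus_commute)
  then show "bump k x r y = 0" using assms \<open>0 < k\<close> by (simp add: bump_def)
qed

lemma C2_compact_support_bump:
  assumes r: "0 < r"
  shows "C2_compact_support (bump 3 x r)"
  unfolding C2_compact_support_def
proof (intro conjI allI)
  show "bump 3 x r differentiable_on UNIV" "\<And>i. partial_D i (bump 3 x r) differentiable_on UNIV"
    by (rule bump_derivatives[OF r])+
  show "continuous_on UNIV (partial_D i (partial_D j (bump 3 x r)))" for i j
  proof -
    have "partial_D i (partial_D j (bump 3 x r)) = (\<lambda>y. 24 * bump 1 x r y * (y - x) $ i * (y - x) $ j / r ^ 4 - (if i = j then 6 * bump 2 x r y / r\<^sup>2 else 0))"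
      by (rule ext) (rule bump_derivatives[OF r])
    then show ?thesis
      using r by (cases "i = j") (auto intro!: continuous_intros continuous_on_bump)
  qed
  have "y \<in> ball x r" if "bump 3 x r y \<noteq> 0" for y using bump_bounds(3)[OF r, of y x 3] that by auto
  then have "{y. bump 3 x r y \<noteq> 0} \<subseteq> cball x r" by (auto simp: less_imp_le)
  then have "closure {y. bump 3 x r y \<noteq> 0} \<subseteq> cball x r" by (rule closure_minimal) simp
  then show "compact (closure {y. bump 3 x r y \<noteq> 0})"
    by (meson bounded_cball bounded_subset closed_closure compact_eq_bounded_closed)
qed

lemma diffusion_operator_bump:
  fixes a :: "real^'n::finite \<Rightarrow> real^'n^'n"
  assumes r: "0 < r"
  shows "diffusion_operator a b (bump 3 x r) y =
    12 * bump 1 x r y * ((y - x) \<bullet> (a y *v (y - x))) / r ^ 4 - 3 * bump 2 x r y * (\<Sum>i\<in>UNIV. a y $ i $ i) / r\<^sup>2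
    - 6 * bump 2 x r y * (b y \<bullet> (y - x)) / r\<^sup>2"
proof -
  define z where "z = y - x"
  have 1: "(\<Sum>i\<in>UNIV. \<Sum>j\<in>UNIV. a y $ i $ j * partial_D i (partial_D j (bump 3 x r)) y)
    = 24 * bump 1 x r y / r ^ 4 * (\<Sum>i\<in>UNIV. \<Sum>j\<in>UNIV. z $ i * (a y $ i $ j * z $ j)) - 6 * bump 2 x r y / r\<^sup>2 * (\<Sum>i\<in>UNIV. a y $ i $ i)"
    unfolding bump_derivatives(2)[OF r] z_def[symmetric] right_diff_distrib sum_subtractf
    by (simp add: sum_distrib_left sum_divide_distrib if_distrib[of "times _"] mult_ac cong: if_cong)
  have "(\<Sum>i\<in>UNIV. \<Sum>j\<in>UNIV. z $ i * (a y $ i $ j * z $ j)) = z \<bullet> (a y *v z)"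
    by (simp add: inner_vec_def matrix_vector_mult_def sum_distrib_left)
  moreover have "(\<Sum>i\<in>UNIV. b y $ i * partial_D i (bump 3 x r) y) = - 6 * bump 2 x r y / r\<^sup>2 * (b y \<bullet> z)"
    unfolding bump_derivatives(1)[OF r] z_def[symmetric] inner_vec_def
    by (simp add: sum_distrib_left sum_divide_distrib sum_negf mult_ac)
  ultimately show ?thesis
    unfolding diffusion_operator_def 1 z_def[symmetric] by (simp add: algebra_simps)
qed

text \<open>With \<open>s = 1 - |y - x|\<^sup>2 / r\<^sup>2\<close> inside the ball, ellipticity
  bounds \<open>r\<^sup>2\<close> times the second order part below by
  \<open>12 * s * \<delta> * (1 - s) - 3 * s\<^sup>2 * D\<close>, which is positive near the
  boundary of the ball. After adding \<open>K * s ^ 3\<close> and dividing by \<open>s\<close> there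
  remains the quadratic \<open>K * s\<^sup>2 - (12 * \<delta> + 3 * D) * s + 12 * \<delta>\<close>,
  and \<open>K\<close> is the value at which its discriminant vanishes. The second, cruder bound is
  for integrability.\<close>

lemma diffusion_operator_bump_bounds:
  fixes a :: "real^'n::finite \<Rightarrow> real^'n^'n"
  assumes r: "0 < r" and \<delta>: "0 < \<delta>" and a: "a y \<in> sym_eigenvalues_in \<delta>"
    and D: "D = real CARD('n) / \<delta>" and K: "K = (12 * \<delta> + 3 * D)\<^sup>2 / (48 * \<delta>)"
  shows "- K / r\<^sup>2 * bump 3 x r y - 6 / r * (norm (b y) * indicator (ball x r) y) \<le> diffusion_operator a b (bump 3 x r) y"
    and "\<bar>diffusion_operator a b (bump 3 x r) y\<bar> \<le> (12 / \<delta> + 3 * D) / r\<^sup>2 + 6 / r * norm (b y)"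
proof -
  define z where "z = y - x"
  define q where "q = (norm z)\<^sup>2 / r\<^sup>2"
  define s where "s = max 0 (1 - q)"
  define tr where "tr = (\<Sum>i\<in>UNIV. a y $ i $ i)"
  have q0: "0 \<le> q" by (simp add: q_def)
  have s: "0 \<le> s" "s \<le> 1" using q0 by (auto simp: s_def)
  have bs: "bump k x r y = s ^ k" for k by (simp add: bump_def s_def q_def z_def)
  have tr: "0 \<le> tr" "tr \<le> D"
  proof -
    show "0 \<le> tr" unfolding tr_def using sym_eigenvalues_in_diagonal(1)[OF a] \<delta> by (intro sum_nonneg) (meson less_imp_le order_trans)
    have "tr \<le> (\<Sum>i\<in>(UNIV::'n set). 1 / \<delta>)" unfolding tr_def by (intro sum_mono sym_eigenvalues_in_diagonal(2)[OF a])
    then show "tr \<le> D" by (simp add: D)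
  qed
  define Q where "Q = z \<bullet> (a y *v z) / r\<^sup>2"
  have Q: "\<delta> * q \<le> Q" "Q \<le> q / \<delta>"
    using sym_eigenvalues_in_bounds[OF a, of z] r by (auto simp: Q_def q_def divide_right_mono field_simps)
  define \<beta> where "\<beta> = b y \<bullet> z / r"
  have op: "diffusion_operator a b (bump 3 x r) y = (12 * s * Q - 3 * s\<^sup>2 * tr) / r\<^sup>2 - 6 / r * (s\<^sup>2 * \<beta>)"
    unfolding diffusion_operator_bump[OF r] bs z_def[symmetric] tr_def[symmetric] Q_def \<beta>_def using r
    by (simp add: field_simps power2_eq_square power4_eq_xxxx)
  have \<beta>: "\<bar>s\<^sup>2 * \<beta>\<bar> \<le> norm (b y) * indicator (ball x r) y"
  proof (cases "y \<in> ball x r")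
    case True
    then have zr: "norm z \<le> r" by (simp add: z_def dist_norm norm_minus_commute)
    have "\<bar>b y \<bullet> z\<bar> \<le> norm (b y) * r"
      using Cauchy_Schwarz_ineq2[of "b y" z] zr by (meson mult_left_mono norm_ge_zero order_trans)
    then have "\<bar>\<beta>\<bar> \<le> norm (b y)" using r by (simp add: \<beta>_def abs_divide divide_le_eq)
    moreover have "s\<^sup>2 \<le> 1" using s by (simp add: power_le_one)
    ultimately have "s\<^sup>2 * \<bar>\<beta>\<bar> \<le> 1 * norm (b y)" by (intro mult_mono) auto
    then show ?thesis using True by (simp add: abs_mult)
  next
    case False
    then have "s ^ 2 = 0" using bump_bounds(3)[OF r False, of 2] bs[of 2] by simp
    then show ?thesis using False by simp
  qed
  have main: "- K * s ^ 3 \<le> 12 * s * Q - 3 * s\<^sup>2 * tr"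
  proof (cases "s = 0")
    case False
    then have s1: "s = 1 - q" using s(1) by (auto simp: s_def)
    have pos: "0 < 12 * \<delta> + 3 * D" using \<delta> by (simp add: D add_pos_pos)
    then have Kpos: "0 < K" using \<delta> by (simp add: K)
    have "0 \<le> (K * s - (12 * \<delta> + 3 * D) / 2)\<^sup>2 / K" using Kpos by simp
    also have "\<dots> = K * s\<^sup>2 - (12 * \<delta> + 3 * D) * s + (12 * \<delta> + 3 * D)\<^sup>2 / (4 * K)"
      using Kpos by (simp add: power2_eq_square field_simps)
    also have "(12 * \<delta> + 3 * D)\<^sup>2 / (4 * K) = 12 * \<delta>"
      using pos \<delta> by (simp add: K)
    finally have "0 \<le> s * (K * s\<^sup>2 - (12 * \<delta> + 3 * D) * s + 12 * \<delta>)" using s by simp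
    also have "\<dots> = K * s ^ 3 + 12 * s * (\<delta> * q) - 3 * s\<^sup>2 * D"
      by (simp add: s1 power2_eq_square power3_eq_cube algebra_simps)
    also have "\<dots> \<le> K * s ^ 3 + 12 * s * Q - 3 * s\<^sup>2 * tr"
      using mult_left_mono[OF Q(1), of "12 * s"] mult_left_mono[OF tr(2), of "3 * s\<^sup>2"] s by simp
    finally show ?thesis by simp
  qed simp
  have "- K / r\<^sup>2 * bump 3 x r y - 6 / r * (norm (b y) * indicator (ball x r) y)
    \<le> (- K * s ^ 3) / r\<^sup>2 - 6 / r * (s\<^sup>2 * \<beta>)"
    unfolding bs using \<beta> r by (simp add: mult_left_mono divide_right_mono abs_le_iff)
  also have "\<dots> \<le> (12 * s * Q - 3 * s\<^sup>2 * tr) / r\<^sup>2 - 6 / r * (s\<^sup>2 * \<beta>)"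
    using main r by (intro diff_right_mono divide_right_mono) auto
  finally show "- K / r\<^sup>2 * bump 3 x r y - 6 / r * (norm (b y) * indicator (ball x r) y) \<le> diffusion_operator a b (bump 3 x r) y"
    unfolding op .
  have "\<bar>12 * s * Q - 3 * s\<^sup>2 * tr\<bar> \<le> 12 / \<delta> + 3 * D"
  proof -
    have sQ: "0 \<le> s * Q" "s * Q \<le> 1 / \<delta>"
    proof -
      have Q0: "0 \<le> Q" using Q(1) q0 \<delta> by (meson less_imp_le mult_nonneg_nonneg order_trans)
      then show "0 \<le> s * Q" using s by simp
      show "s * Q \<le> 1 / \<delta>"
      proof (cases "s = 0")
        case False
        then have "q \<le> 1" using s(1) by (auto simp: s_def)
        then have "Q \<le> 1 / \<delta>" using Q(2) \<delta> by (meson divide_right_mono less_imp_le order_trans)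
        then have "s * Q \<le> 1 * (1 / \<delta>)" using s Q0 by (intro mult_mono) auto
        then show ?thesis by simp
      qed (use \<delta> in simp)
    qed
    have st: "0 \<le> s\<^sup>2 * tr" "s\<^sup>2 * tr \<le> D"
    proof -
      show "0 \<le> s\<^sup>2 * tr" using tr by simp
      have "s\<^sup>2 * tr \<le> 1 * D" using s tr by (intro mult_mono) (auto simp: power_le_one)
      then show "s\<^sup>2 * tr \<le> D" by simp
    qed
    have "12 * s * Q - 3 * s\<^sup>2 * tr = 12 * (s * Q) - 3 * (s\<^sup>2 * tr)" by simp
    moreover have "12 / \<delta> = 12 * (1 / \<delta>)" by simp
    moreover have "0 \<le> 1 / \<delta>" using \<delta> by simp
    ultimately show ?thesis using sQ st by linarith
  qed
  then have "\<bar>(12 * s * Q - 3 * s\<^sup>2 * tr) / r\<^sup>2\<bar> \<le> (12 / \<delta> + 3 * D) / r\<^sup>2"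
    using r by (simp add: abs_divide divide_right_mono)
  moreover have "\<bar>6 / r * (s\<^sup>2 * \<beta>)\<bar> \<le> 6 / r * norm (b y)"
  proof -
    have "norm (b y) * indicator (ball x r) y \<le> norm (b y) * 1"
      by (intro mult_left_mono) (auto simp: indicator_def)
    then have "\<bar>s\<^sup>2 * \<beta>\<bar> \<le> norm (b y)" using \<beta> by linarith
    then have "6 / r * \<bar>s\<^sup>2 * \<beta>\<bar> \<le> 6 / r * norm (b y)" using r by (intro mult_left_mono) auto
    then show ?thesis using r by (simp add: abs_mult)
  qed
  ultimately show "\<bar>diffusion_operator a b (bump 3 x r) y\<bar> \<le> (12 / \<delta> + 3 * D) / r\<^sup>2 + 6 / r * norm (b y)"
    unfolding op by linarith
qed


section \<open>Laws of a continuous Markov process\<close>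

context continuous_markov_process
begin

text \<open>Nothing is assumed about \<open>X t\<close> for \<open>t < 0\<close>, so that negative times are replaced by \<open>0\<close>.\<close>

definition law :: "real \<Rightarrow> real^'n \<Rightarrow> (real^'n) measure" where
  "law t x = distr (P x) borel (X (max 0 t))"

sublocale P: prob_space "P x" for x by (rule prob_space_P)

lemma X_measurable: "0 \<le> t \<Longrightarrow> X t \<in> borel_measurable (P x)"
  by (rule measurable_from_subalg[OF subalgebra_M adapted])

lemma X_measurable_pair: "(\<lambda>(t, \<omega>). X (max 0 t) \<omega>) \<in> borel_measurable (borel \<Otimes>\<^sub>M P x)"
proof (rule measurable_pair_of_continuous_in_time)
  show "X (max 0 t) \<in> borel_measurable (P x)" for t by (rule X_measurable) simp
  fix \<omega> assume "\<omega> \<in> space (P x)"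
  then have "continuous_on {0..} (\<lambda>t. X t \<omega>)" by (rule continuous_paths)
  moreover have "continuous_on UNIV (\<lambda>t. max 0 t :: real)" by (intro continuous_intros)
  ultimately show "continuous_on UNIV (\<lambda>t. X (max 0 t) \<omega>)"
    by (rule continuous_on_compose2) auto
qed

lemma nn_integral_law:
  assumes "f \<in> borel_measurable borel" "0 \<le> t"
  shows "(\<integral>\<^sup>+y. f y \<partial>law t x) = (\<integral>\<^sup>+\<omega>. f (X t \<omega>) \<partial>P x)"
  using assms by (simp add: law_def nn_integral_distr X_measurable)

lemma integral_law:
  fixes f :: "real^'n \<Rightarrow> 'b::{banach, second_countable_topology}"
  assumes "f \<in> borel_measurable borel" "0 \<le> t"
  shows "(\<integral>y. f y \<partial>law t x) = (\<integral>\<omega>. f (X t \<omega>) \<partial>P x)"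
  using assms by (simp add: law_def integral_distr X_measurable)

lemma integrable_law:
  fixes f :: "real^'n \<Rightarrow> 'b::{banach, second_countable_topology}"
  assumes "f \<in> borel_measurable borel" "0 \<le> t"
  shows "integrable (law t x) f \<longleftrightarrow> integrable (P x) (\<lambda>\<omega>. f (X t \<omega>))"
  using assms by (simp add: law_def integrable_distr_eq X_measurable)

lemma emeasure_law:
  assumes "\<Gamma> \<in> sets borel" "0 \<le> t"
  shows "emeasure (law t x) \<Gamma> = ennreal (measure (P x) {\<omega> \<in> space (P x). X t \<omega> \<in> \<Gamma>})"
proof -
  have "emeasure (law t x) \<Gamma> = emeasure (P x) (X t -` \<Gamma> \<inter> space (P x))"
    using assms by (simp add: law_def emeasure_distr X_measurable)
  also have "X t -` \<Gamma> \<inter> space (P x) = {\<omega> \<in> space (P x). X t \<omega> \<in> \<Gamma>}" by auto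
  finally show ?thesis by (simp add: P.emeasure_eq_measure)
qed

lemma law_kernel: "law t \<in> borel \<rightarrow>\<^sub>M prob_algebra borel"
proof (rule measurable_prob_algebraI)
  show pr: "prob_space (law t x)" for x
    unfolding law_def by (rule P.prob_space_distr) (rule X_measurable, simp)
  have eq: "law t = law (max 0 t)" by (simp add: law_def fun_eq_iff)
  show "law t \<in> borel \<rightarrow>\<^sub>M subprob_algebra borel"
  proof (rule measurable_subprob_algebra)
    show "subprob_space (law t x)" for x by (rule prob_space_imp_subprob_space[OF pr])
    show "sets (law t x) = sets borel" for x by (simp add: law_def)
    fix \<Gamma> :: "(real^'n) set" assume \<Gamma>: "\<Gamma> \<in> sets borel"
    have [measurable]: "(\<lambda>x. measure (P x) {\<omega> \<in> space (P x). X (max 0 t) \<omega> \<in> \<Gamma>}) \<in> borel_measurable borel"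
      by (rule measurable_transition[OF _ \<Gamma>]) simp
    have "(\<lambda>x. ennreal (measure (P x) {\<omega> \<in> space (P x). X (max 0 t) \<omega> \<in> \<Gamma>})) \<in> borel_measurable borel"
      by measurable
    then show "(\<lambda>x. emeasure (law t x) \<Gamma>) \<in> borel_measurable borel"
      unfolding eq by (simp add: emeasure_law[OF \<Gamma>])
  qed
qed

text \<open>Integrating the Markov property over all of \<open>P x\<close> turns the conditional
  probability into a plain one.\<close>

lemma law_chapman:
  assumes s: "0 \<le> s" and t: "0 \<le> t"
  shows "law (s + t) x = law s x \<bind> law t"
proof (rule measure_eqI)
  have N: "law t \<in> law s x \<rightarrow>\<^sub>M subprob_algebra borel"
    using measurable_prob_algebraD[OF law_kernel[of t]] by (simp add: law_def cong: measurable_cong_sets)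
  have sp: "space (law s x) \<noteq> {}" by (simp add: law_def)
  show "sets (law (s + t) x) = sets (law s x \<bind> law t)"
    using sets_bind[of "law s x" "law t" borel] sp by (simp add: law_def)
  fix \<Gamma> assume "\<Gamma> \<in> sets (law (s + t) x)"
  then have \<Gamma>: "\<Gamma> \<in> sets borel" by (simp add: law_def)
  define q where "q y = measure (P y) {\<omega> \<in> space (P y). X t \<omega> \<in> \<Gamma>}" for y
  have [measurable]: "q \<in> borel_measurable borel" unfolding q_def by (rule measurable_transition[OF t \<Gamma>])
  interpret fin: sigma_finite_subalgebra "P x" "M s"
  proof -
    interpret finite_measure_subalgebra "P x" "M s"
      by unfold_locales (rule subalgebra_M[OF s])
    show "sigma_finite_subalgebra (P x) (M s)" by unfold_locales
  qed
  have [measurable]: "X (s + t) \<in> borel_measurable (P x)" "X s \<in> borel_measurable (P x)"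
    using s t by (auto intro: X_measurable)
  have qX: "(\<lambda>\<omega>. q (X s \<omega>)) \<in> borel_measurable (P x)"
    by (rule measurable_compose[OF X_measurable[OF s]]) measurable
  have q01: "0 \<le> q y" "q y \<le> 1" for y by (auto simp: q_def)
  have ind[measurable]: "(\<lambda>\<omega>. indicator \<Gamma> (X (s + t) \<omega>) :: real) \<in> borel_measurable (P x)"
    by (rule measurable_compose[OF _ borel_measurable_indicator[OF \<Gamma>]]) simp
  have "(\<integral>\<omega>. q (X s \<omega>) \<partial>P x) = (\<integral>\<omega>. real_cond_exp (P x) (M s) (\<lambda>\<omega>'. indicator \<Gamma> (X (s + t) \<omega>')) \<omega> \<partial>P x)"
  proof (rule integral_cong_AE)
    show "(\<lambda>\<omega>. q (X s \<omega>)) \<in> borel_measurable (P x)" by (rule qX)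
    show "AE \<omega> in P x. q (X s \<omega>) = real_cond_exp (P x) (M s) (\<lambda>\<omega>'. indicator \<Gamma> (X (s + t) \<omega>')) \<omega>"
      using markov[OF s t \<Gamma>, of x] by (simp add: q_def eq_commute)
  qed simp
  also have "\<dots> = (\<integral>\<omega>. indicator \<Gamma> (X (s + t) \<omega>) \<partial>P x)"
    by (rule fin.real_cond_exp_int(2)) (rule P.integrable_const_bound[where B=1, OF _ ind], simp)
  also have "\<dots> = (\<integral>y. indicator \<Gamma> y \<partial>law (s + t) x)"
    by (rule integral_law[symmetric]) (use s t \<Gamma> in auto)
  also have "\<dots> = measure (law (s + t) x) \<Gamma>" using \<Gamma> by (simp add: law_def)
  finally have q: "(\<integral>\<omega>. q (X s \<omega>) \<partial>P x) = measure (law (s + t) x) \<Gamma>" .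
  interpret L: prob_space "law (s + t) x"
    using law_kernel[of "s + t", THEN measurable_space, of x] by (simp add: space_prob_algebra)
  have "emeasure (law s x \<bind> law t) \<Gamma> = (\<integral>\<^sup>+y. emeasure (law t y) \<Gamma> \<partial>law s x)"
    by (rule emeasure_bind[OF sp N \<Gamma>])
  also have "\<dots> = (\<integral>\<^sup>+y. ennreal (q y) \<partial>law s x)" by (simp add: emeasure_law[OF \<Gamma> t] q_def)
  also have "\<dots> = (\<integral>\<^sup>+\<omega>. ennreal (q (X s \<omega>)) \<partial>P x)" by (rule nn_integral_law[OF _ s]) measurable
  also have "\<dots> = ennreal (\<integral>\<omega>. q (X s \<omega>) \<partial>P x)"
    by (intro nn_integral_eq_integral P.integrable_const_bound[where B=1] qX) (use q01 in auto)
  also have "\<dots> = emeasure (law (s + t) x) \<Gamma>" by (simp add: q L.emeasure_eq_measure)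
  finally show "emeasure (law (s + t) x) \<Gamma> = emeasure (law s x \<bind> law t) \<Gamma>" ..
qed

lemma law_initial: "law 0 x = return borel x"
proof -
  have "law 0 x = distr (P x) borel (\<lambda>_. x)"
    unfolding law_def by (rule distr_cong_AE) (use start[of x] X_measurable[of 0 x] in auto)
  then show ?thesis by (simp add: P.distr_const)
qed

lemma law_weakly_continuous:
  fixes f :: "real^'n \<Rightarrow> real"
  assumes fc: "continuous_on UNIV f" and fb: "bounded (range f)"
  shows "continuous_on UNIV (\<lambda>t. \<integral>y. f y \<partial>law t x)"
proof -
  have fm[measurable]: "f \<in> borel_measurable borel" by (rule borel_measurable_continuous_onI[OF fc])
  obtain B where B: "\<And>y. norm (f y) \<le> B" using fb by (auto simp: bounded_iff)
  have eq: "(\<integral>y. f y \<partial>law t x) = (\<integral>\<omega>. f (X (max 0 t) \<omega>) \<partial>P x)" for t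
    using integral_law[OF fm, of "max 0 t" x] by (simp add: law_def)
  have [measurable]: "X (max 0 t) \<in> borel_measurable (P x)" for t by (rule X_measurable) simp
  show ?thesis
    unfolding eq continuous_on_sequentially
  proof (intro allI ballI impI, unfold comp_def)
    fix u :: "nat \<Rightarrow> real" and t assume "(\<forall>n. u n \<in> UNIV) \<and> u \<longlonglongrightarrow> t"
    then have u: "u \<longlonglongrightarrow> t" by simp
    show "(\<lambda>n. \<integral>\<omega>. f (X (max 0 (u n)) \<omega>) \<partial>P x) \<longlonglongrightarrow> (\<integral>\<omega>. f (X (max 0 t) \<omega>) \<partial>P x)"
    proof (rule integral_dominated_convergence[where w="\<lambda>_. B"])
      show "AE \<omega> in P x. (\<lambda>n. f (X (max 0 (u n)) \<omega>)) \<longlonglongrightarrow> f (X (max 0 t) \<omega>)"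
      proof (rule AE_I2)
        fix \<omega> assume "\<omega> \<in> space (P x)"
        then have "continuous_on {0..} (\<lambda>t. X t \<omega>)" by (rule continuous_paths)
        moreover have "(\<lambda>n. max 0 (u n)) \<longlonglongrightarrow> max 0 t" by (intro tendsto_intros u)
        ultimately have "(\<lambda>n. X (max 0 (u n)) \<omega>) \<longlonglongrightarrow> X (max 0 t) \<omega>"
          unfolding continuous_on_sequentially by (auto simp: comp_def)
        then show "(\<lambda>n. f (X (max 0 (u n)) \<omega>)) \<longlonglongrightarrow> f (X (max 0 t) \<omega>)"
          using fc unfolding continuous_on_sequentially by (auto simp: comp_def)
      qed
    qed (use B in auto)
  qed
qed

sublocale semigroup: markov_semigroup law
  by unfold_locales (rule law_kernel law_chapman law_initial law_weakly_continuous; assumption)+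

lemma nn_integral_time_law:
  assumes f[measurable]: "(\<lambda>(s, y). f s y) \<in> borel_measurable (borel \<Otimes>\<^sub>M borel)" and f0: "\<And>s y. s < 0 \<Longrightarrow> f s y = 0"
  shows "(\<integral>\<^sup>+\<omega>. (\<integral>\<^sup>+s. f s (X s \<omega>) \<partial>lborel) \<partial>P x) = (\<integral>\<^sup>+s. (\<integral>\<^sup>+y. f s y \<partial>law s x) \<partial>lborel)"
proof -
  interpret pair_sigma_finite lborel "P x" ..
  \<comment> \<open>Times before \<open>0\<close> carry no weight, so \<open>X\<close> may be
    evaluated at \<open>max 0 s\<close>, which is jointly measurable.\<close>
  have fX: "f s (X s \<omega>) = f s (X (max 0 s) \<omega>)" for s \<omega> using f0 by (cases "s < 0") auto
  have m: "(\<lambda>z. f (fst z) (X (max 0 (fst z)) (snd z))) \<in> borel_measurable (lborel \<Otimes>\<^sub>M P x)"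
  proof -
    have "(\<lambda>z. X (max 0 (fst z)) (snd z)) \<in> borel_measurable (lborel \<Otimes>\<^sub>M P x)"
      using X_measurable_pair[of x] by (simp add: case_prod_beta' cong: measurable_cong_sets)
    then have "(\<lambda>z. (fst z, X (max 0 (fst z)) (snd z))) \<in> lborel \<Otimes>\<^sub>M P x \<rightarrow>\<^sub>M borel \<Otimes>\<^sub>M borel"
      by (intro measurable_Pair) auto
    from measurable_compose[OF this f] show ?thesis by (simp add: case_prod_beta')
  qed
  have "(\<integral>\<^sup>+\<omega>. (\<integral>\<^sup>+s. f s (X s \<omega>) \<partial>lborel) \<partial>P x) = (\<integral>\<^sup>+\<omega>. (\<integral>\<^sup>+s. f s (X (max 0 s) \<omega>) \<partial>lborel) \<partial>P x)"
    by (subst fX) simp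
  also have "\<dots> = (\<integral>\<^sup>+s. (\<integral>\<^sup>+\<omega>. f s (X (max 0 s) \<omega>) \<partial>P x) \<partial>lborel)"
    by (rule Fubini') (use m in \<open>simp add: case_prod_beta'\<close>)
  also have "\<dots> = (\<integral>\<^sup>+s. (\<integral>\<^sup>+y. f s y \<partial>law s x) \<partial>lborel)"
  proof (rule nn_integral_cong)
    fix s :: real
    have [measurable]: "f s \<in> borel_measurable borel" using measurable_compose[OF measurable_Pair1' f, of s] by simp
    show "(\<integral>\<^sup>+\<omega>. f s (X (max 0 s) \<omega>) \<partial>P x) = (\<integral>\<^sup>+y. f s y \<partial>law s x)"
      using nn_integral_law[of "f s" "max 0 s" x] by (simp add: law_def)
  qed
  finally show ?thesis .
qed

end


section \<open>Quasi-diffusions near their starting point\<close>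

text \<open>
  Dynkin's formula yields the inequality between times \<open>s\<close> and \<open>t\<close>, without any regularity of the drift
  term; hence the integrated form with an error term \<open>E\<close>.
\<close>

lemma backward_Gronwall:
  fixes \<psi> :: "real \<Rightarrow> real"
  assumes t: "0 \<le> t" and k: "0 < k" and cont: "continuous_on {0..t} \<psi>"
    and le: "\<And>s. 0 \<le> s \<Longrightarrow> s \<le> t \<Longrightarrow> \<psi> s \<le> \<psi> t + k * integral {s..t} \<psi> + E"
  shows "exp (- k * t) * \<psi> 0 \<le> \<psi> t + E"
proof -
  define B where "B = \<psi> t + E"
  define \<Phi> where "\<Phi> s = integral {s..t} \<psi>" for s
  \<comment> \<open>The hypothesis says that the derivative of \<open>G\<close> is nonnegative.
    Comparing the endpoints, where \<open>\<Phi> t = 0\<close>, bounds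
    \<open>k * \<Phi> 0 + B\<close> by \<open>exp (k * t) * B\<close>.\<close>
  define G where "G s = exp (k * s) * (k * \<Phi> s + B)" for s
  have int: "\<psi> integrable_on {0..t}" by (rule integrable_continuous_real[OF cont])
  have \<Phi>: "\<Phi> s = \<Phi> 0 - integral {0..s} \<psi>" if "s \<in> {0..t}" for s
    using Henstock_Kurzweil_Integration.integral_combine[OF _ _ int, of s] that by (simp add: \<Phi>_def)
  have d\<Phi>: "(\<Phi> has_real_derivative - \<psi> s) (at s within {0..t})" if s: "s \<in> {0..t}" for s
  proof -
    have "((\<lambda>u. integral {0..u} \<psi>) has_real_derivative \<psi> s) (at s within {0..t})"
      by (rule integral_has_real_derivative[OF cont s])
    then have "((\<lambda>u. \<Phi> 0 - integral {0..u} \<psi>) has_real_derivative 0 - \<psi> s) (at s within {0..t})"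
      by (intro DERIV_diff DERIV_const)
    then have "(\<Phi> has_real_derivative 0 - \<psi> s) (at s within {0..t})"
      by (rule has_field_derivative_transform_within[OF _ zero_less_one s]) (rule \<Phi>[symmetric])
    then show ?thesis by simp
  qed
  have dG: "(G has_real_derivative exp (k * s) * (k * (k * \<Phi> s + B - \<psi> s))) (at s within {0..t})" if s: "s \<in> {0..t}" for s
  proof -
    have "((\<lambda>s. exp (k * s) * (k * \<Phi> s + B)) has_real_derivative (exp (k * s) * k) * (k * \<Phi> s + B) + (k * - \<psi> s) * exp (k * s)) (at s within {0..t})"
      by (auto intro!: derivative_eq_intros d\<Phi>[OF s])
    moreover have "(exp (k * s) * k) * (k * \<Phi> s + B) + (k * - \<psi> s) * exp (k * s) = exp (k * s) * (k * (k * \<Phi> s + B - \<psi> s))"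
      by (simp add: algebra_simps)
    ultimately show ?thesis by (simp add: G_def[abs_def])
  qed
  have "G 0 \<le> G t"
  proof (cases "t = 0")
    case False
    then have "0 < t" using t by simp
    then obtain s where s: "s \<in> {0<..<t}" "G t - G 0 = exp (k * s) * (k * (k * \<Phi> s + B - \<psi> s)) * (t - 0)"
      using mvt_simple[OF _ dG[unfolded has_field_derivative_def]] by (metis atLeastAtMost_iff)
    have "\<psi> s \<le> B + k * \<Phi> s" using le[of s] s(1) by (simp add: B_def \<Phi>_def)
    then have "0 \<le> exp (k * s) * (k * (k * \<Phi> s + B - \<psi> s)) * (t - 0)" using k t by simp
    then show ?thesis using s(2) by linarith
  qed simp
  then have "k * \<Phi> 0 + B \<le> exp (k * t) * B" by (simp add: G_def \<Phi>_def)
  moreover have "\<psi> 0 \<le> B + k * \<Phi> 0" using le[of 0] t by (simp add: B_def \<Phi>_def)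
  ultimately have "\<psi> 0 \<le> exp (k * t) * B" by linarith
  then have "exp (- k * t) * \<psi> 0 \<le> exp (- k * t) * (exp (k * t) * B)" by (intro mult_left_mono) auto
  also have "\<dots> = B" by (simp add: mult.assoc[symmetric] exp_add[symmetric])
  finally show ?thesis by (simp add: B_def)
qed

lemma diffusion_operator_measurable:
  fixes a :: "real^'n::finite \<Rightarrow> real^'n^'n"
  assumes a: "a \<in> borel_measurable borel" and b: "b \<in> borel_measurable borel" and u: "C2_compact_support u"
  shows "diffusion_operator a b u \<in> borel_measurable borel"
proof -
  have "continuous_on UNIV (partial_D i u)" "continuous_on UNIV (partial_D i (partial_D j u))" for i j
    using u by (auto simp: C2_compact_support_def intro: differentiable_imp_continuous_on)
  then have [measurable]: "partial_D i u \<in> borel_measurable borel" "partial_D i (partial_D j u) \<in> borel_measurable borel" for i j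
    by (auto intro: borel_measurable_continuous_onI)
  have [measurable]: "(\<lambda>x. a x $ i $ j) \<in> borel_measurable borel" for i j
    by (rule measurable_compose[OF a]) (intro borel_measurable_continuous_onI continuous_intros)
  have [measurable]: "(\<lambda>x. b x $ i) \<in> borel_measurable borel" for i
    by (rule measurable_compose[OF b]) (intro borel_measurable_continuous_onI continuous_intros)
  show ?thesis unfolding diffusion_operator_def[abs_def] by measurable
qed

text \<open>Dynkin's formula writes the mean \<psi> of the bump \<phi> at time \<open>t\<close> as
  \<open>1\<close> plus the time integral of the mean of \<open>L\<close>. The lower bound for
  \<open>L\<close> turns this into a backward Gronwall inequality with rate
  \<open>k / r\<^sup>2\<close>, the drift over all of \<open>{0..T}\<close> being the error term.
  Finally \<phi> is below the indicator of the ball.\<close>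

lemma bump_lower_bound:
  fixes a :: "real^'n::finite \<Rightarrow> real^'n^'n"
  assumes qd: "quasi_diffusion a b X M P" and a: "a \<in> borel_measurable borel" "\<And>x. a x \<in> sym_eigenvalues_in \<delta>"
    and b[measurable]: "b \<in> borel_measurable borel" and \<delta>: "0 < \<delta>" and r: "0 < r" and T: "0 \<le> T" and F: "0 \<le> F"
    and drift: "(\<integral>\<^sup>+s. indicator {0..T} s * (\<integral>\<^sup>+y. ennreal (norm (b y) * indicator (ball x r) y) \<partial>continuous_markov_process.law X P s x) \<partial>lborel) \<le> ennreal F"
    and k: "k = (12 * \<delta> + 3 * (real CARD('n) / \<delta>))\<^sup>2 / (48 * \<delta>)" and t: "0 \<le> t" "t \<le> T"
  shows "exp (- (k / r\<^sup>2) * t) - 6 / r * F \<le> measure (continuous_markov_process.law X P t x) (ball x r)"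
proof -
  interpret continuous_markov_process X M P using qd by (simp add: quasi_diffusion_def)
  define \<phi> where "\<phi> = bump 3 x r"
  define L where "L = diffusion_operator a b \<phi>"
  define c1 where "c1 = (12 / \<delta> + 3 * (real CARD('n) / \<delta>)) / r\<^sup>2"
  have c1: "0 \<le> c1" using \<delta> by (simp add: c1_def)
  have C2: "C2_compact_support \<phi>" unfolding \<phi>_def by (rule C2_compact_support_bump[OF r])
  have Lm[measurable]: "L \<in> borel_measurable borel" unfolding L_def by (rule diffusion_operator_measurable[OF a(1) b C2])
  have L_lower: "- (k / r\<^sup>2) * \<phi> y - 6 / r * (norm (b y) * indicator (ball x r) y) \<le> L y" for y
    using diffusion_operator_bump_bounds(1)[where a=a and b=b and x=x and y=y, OF r \<delta> a(2) refl k] by (simp add: L_def \<phi>_def)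
  have L_bound: "\<bar>L y\<bar> \<le> c1 + 6 / r * norm (b y)" for y
    using diffusion_operator_bump_bounds(2)[where a=a and b=b and x=x and y=y, OF r \<delta> a(2) refl k] by (simp add: L_def \<phi>_def c1_def)
  have \<phi>c: "continuous_on UNIV \<phi>" unfolding \<phi>_def by (rule continuous_on_bump)
  have \<phi>m[measurable]: "\<phi> \<in> borel_measurable borel" by (rule borel_measurable_continuous_onI[OF \<phi>c])
  have \<phi>01: "0 \<le> \<phi> y" "\<phi> y \<le> 1" for y using bump_bounds[OF r] by (auto simp: \<phi>_def)
  define \<psi> where "\<psi> s = (\<integral>y. \<phi> y \<partial>law s x)" for s
  have \<psi>c: "continuous_on UNIV \<psi>"
    unfolding \<psi>_def by (rule law_weakly_continuous[OF \<phi>c]) (rule boundedI[where B=1], use \<phi>01 in auto)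
  have \<psi>01: "0 \<le> \<psi> s" for s unfolding \<psi>_def using \<phi>01 by (intro integral_nonneg_AE) auto
  \<comment> \<open>Evaluating \<open>X\<close> at \<open>max 0 s\<close> makes the integrand
    jointly measurable; the indicator hides the change at negative times.\<close>
  define H where "H t = (\<lambda>(s, \<omega>). indicator {0..t} s *\<^sub>R L (X (max 0 s) \<omega>))" for t
  define \<theta> where "\<theta> s = (\<integral>y. L y \<partial>law s x)" for s
  have pairX: "(\<lambda>z. X (max 0 (fst z)) (snd z)) \<in> borel_measurable (lborel \<Otimes>\<^sub>M P x)"
    using X_measurable_pair[of x] by (simp add: case_prod_beta' cong: measurable_cong_sets)
  have indm: "(\<lambda>z. indicator {0..t} (fst z) :: real) \<in> borel_measurable (lborel \<Otimes>\<^sub>M P x)" for t :: real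
    by (rule measurable_compose[OF measurable_fst]) simp
  have Hm: "H t \<in> borel_measurable (lborel \<Otimes>\<^sub>M P x)" for t
    unfolding H_def case_prod_beta'
    by (intro borel_measurable_scaleR indm measurable_compose[OF pairX Lm])
  interpret PX: pair_sigma_finite lborel "P x" ..
  have bfin: "(\<integral>\<^sup>+\<omega>. (\<integral>\<^sup>+s. ennreal (norm (b (X s \<omega>))) * indicator {0..t} s \<partial>lborel) \<partial>P x) < \<infinity>" if "0 \<le> t" for t
    using qd that by (simp add: quasi_diffusion_def)
  have Hi: "integrable (lborel \<Otimes>\<^sub>M P x) (H t)" if t: "0 \<le> t" for t
  proof (rule integrableI_bounded[OF Hm])
    have "(\<integral>\<^sup>+z. ennreal (norm (H t z)) \<partial>(lborel \<Otimes>\<^sub>M P x)) = (\<integral>\<^sup>+\<omega>. (\<integral>\<^sup>+s. ennreal (norm (H t (s, \<omega>))) \<partial>lborel) \<partial>P x)"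
      by (rule PX.nn_integral_snd[symmetric]) (use Hm in measurable)
    also have "\<dots> \<le> (\<integral>\<^sup>+\<omega>. ennreal (c1 * t) + ennreal (6 / r) * (\<integral>\<^sup>+s. ennreal (norm (b (X s \<omega>))) * indicator {0..t} s \<partial>lborel) \<partial>P x)"
    proof (rule nn_integral_mono)
      fix \<omega> assume \<omega>: "\<omega> \<in> space (P x)"
      have bm: "(\<lambda>s. ennreal (norm (b (X (max 0 s) \<omega>)))) \<in> borel_measurable lborel"
      proof -
        have "(\<lambda>s. X (max 0 s) \<omega>) \<in> borel_measurable borel"
          using measurable_compose[OF measurable_Pair2'[OF \<omega>] X_measurable_pair] by simp
        then have "(\<lambda>s. b (X (max 0 s) \<omega>)) \<in> borel_measurable borel" by (rule measurable_compose[OF _ b])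
        then show ?thesis by simp
      qed
      have eqb: "ennreal (norm (b (X s \<omega>))) * indicator {0..t} s = ennreal (norm (b (X (max 0 s) \<omega>))) * indicator {0..t} s" for s
        by (auto simp: indicator_def)
      have "(\<integral>\<^sup>+s. ennreal (norm (H t (s, \<omega>))) \<partial>lborel) \<le> (\<integral>\<^sup>+s. ennreal c1 * indicator {0..t} s + ennreal (6 / r) * (ennreal (norm (b (X (max 0 s) \<omega>))) * indicator {0..t} s) \<partial>lborel)"
      proof (rule nn_integral_mono)
        fix s
        show "ennreal (norm (H t (s, \<omega>))) \<le> ennreal c1 * indicator {0..t} s + ennreal (6 / r) * (ennreal (norm (b (X (max 0 s) \<omega>))) * indicator {0..t} s)"
        proof (cases "s \<in> {0..t}")
          case True
          have "ennreal \<bar>L (X (max 0 s) \<omega>)\<bar> \<le> ennreal (c1 + 6 / r * norm (b (X (max 0 s) \<omega>)))"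
            by (rule ennreal_leI[OF L_bound])
          also have "\<dots> = ennreal c1 + ennreal (6 / r) * ennreal (norm (b (X (max 0 s) \<omega>)))"
            using c1 r by (simp add: ennreal_mult[symmetric])
          finally show ?thesis using True by (simp add: H_def)
        qed (simp add: H_def)
      qed
      also have "\<dots> = (\<integral>\<^sup>+s. ennreal c1 * indicator {0..t} s \<partial>lborel) + (\<integral>\<^sup>+s. ennreal (6 / r) * (ennreal (norm (b (X (max 0 s) \<omega>))) * indicator {0..t} s) \<partial>lborel)"
        by (rule nn_integral_add) (use bm in measurable)
      also have "(\<integral>\<^sup>+s. ennreal (6 / r) * (ennreal (norm (b (X (max 0 s) \<omega>))) * indicator {0..t} s) \<partial>lborel) = ennreal (6 / r) * (\<integral>\<^sup>+s. ennreal (norm (b (X (max 0 s) \<omega>))) * indicator {0..t} s \<partial>lborel)"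
        by (rule nn_integral_cmult) (use bm in measurable)
      also have "(\<integral>\<^sup>+s. ennreal c1 * indicator {0..t} s \<partial>lborel) = ennreal (c1 * t)"
        using t c1 by (simp add: nn_integral_cmult_indicator ennreal_mult)
      finally show "(\<integral>\<^sup>+s. ennreal (norm (H t (s, \<omega>))) \<partial>lborel) \<le> ennreal (c1 * t) + ennreal (6 / r) * (\<integral>\<^sup>+s. ennreal (norm (b (X s \<omega>))) * indicator {0..t} s \<partial>lborel)"
        unfolding eqb .
    qed
    also have "\<dots> = ennreal (c1 * t) + ennreal (6 / r) * (\<integral>\<^sup>+\<omega>. (\<integral>\<^sup>+s. ennreal (norm (b (X s \<omega>))) * indicator {0..t} s \<partial>lborel) \<partial>P x)"
    proof -
      have "(\<lambda>z. ennreal (norm (b (X (max 0 (snd z)) (fst z)))) * indicator {0..t} (snd z)) \<in> borel_measurable (P x \<Otimes>\<^sub>M lborel)"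
      proof -
        have "(\<lambda>z. X (max 0 (snd z)) (fst z)) \<in> borel_measurable (P x \<Otimes>\<^sub>M lborel)"
          using measurable_compose[OF measurable_pair_swap' pairX] by (simp add: case_prod_beta')
        then have bX: "(\<lambda>z. b (X (max 0 (snd z)) (fst z))) \<in> borel_measurable (P x \<Otimes>\<^sub>M lborel)"
          by (rule measurable_compose[OF _ b])
        show ?thesis
          by (intro borel_measurable_times_ennreal measurable_compose[OF bX, of "\<lambda>y. ennreal (norm y)"]
              measurable_compose[OF measurable_snd borel_measurable_indicator]) auto
      qed
      then have "(\<lambda>\<omega>. \<integral>\<^sup>+s. ennreal (norm (b (X (max 0 s) \<omega>))) * indicator {0..t} s \<partial>lborel) \<in> borel_measurable (P x)"
        by (intro sigma_finite_measure.borel_measurable_nn_integral) (auto intro: lborel.sigma_finite_measure_axioms simp: case_prod_beta')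
      moreover have "ennreal (norm (b (X s \<omega>))) * indicator {0..t} s = ennreal (norm (b (X (max 0 s) \<omega>))) * indicator {0..t} s" for s \<omega>
        by (auto simp: indicator_def)
      ultimately have m: "(\<lambda>\<omega>. \<integral>\<^sup>+s. ennreal (norm (b (X s \<omega>))) * indicator {0..t} s \<partial>lborel) \<in> borel_measurable (P x)" by simp
      show ?thesis
        using m by (subst nn_integral_add) (auto simp: nn_integral_cmult P.emeasure_space_1)
    qed
    also have "\<dots> < \<infinity>" using bfin[OF t] by (simp add: ennreal_mult_less_top)
    finally show "(\<integral>\<^sup>+z. ennreal (norm (H t z)) \<partial>(lborel \<Otimes>\<^sub>M P x)) < \<infinity>" .
  qed
  have inner: "(\<integral>\<omega>. H t (s, \<omega>) \<partial>P x) = indicator {0..t} s *\<^sub>R \<theta> s" for s t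
  proof (cases "0 \<le> s")
    case True
    then show ?thesis using integral_law[OF Lm True, of x] by (simp add: H_def \<theta>_def)
  qed (simp add: H_def)
  have \<theta>i: "integrable lborel (\<lambda>s. indicator {0..t} s *\<^sub>R \<theta> s)" if "0 \<le> t" for t
    using PX.integrable_fst'[OF Hi[OF that]] by (simp add: inner)
  have \<psi>_eq: "\<psi> t = 1 + (\<integral>s. indicator {0..t} s *\<^sub>R \<theta> s \<partial>lborel)" if t: "0 \<le> t" for t
  proof -
    have "(\<integral>\<omega>. (LINT s:{0..t}|lborel. L (X s \<omega>)) \<partial>P x) = (\<integral>\<omega>. (\<integral>s. H t (s, \<omega>) \<partial>lborel) \<partial>P x)"
      unfolding set_lebesgue_integral_def H_def
      by (intro Bochner_Integration.integral_cong refl) (auto simp: indicator_def)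
    also have "\<dots> = (\<integral>s. (\<integral>\<omega>. H t (s, \<omega>) \<partial>P x) \<partial>lborel)"
      using PX.Fubini_integral[of "\<lambda>s \<omega>. H t (s, \<omega>)"] Hi[OF t] by simp
    finally have "(\<integral>\<omega>. (LINT s:{0..t}|lborel. L (X s \<omega>)) \<partial>P x) = (\<integral>s. indicator {0..t} s *\<^sub>R \<theta> s \<partial>lborel)"
      by (simp add: inner)
    moreover have "\<phi> x = (\<integral>\<omega>. \<phi> (X t \<omega>) \<partial>P x) - (\<integral>\<omega>. (LINT s:{0..t}|lborel. L (X s \<omega>)) \<partial>P x)"
      using qd t C2 unfolding quasi_diffusion_def L_def by blast
    moreover have "\<phi> x = 1" using bump_bounds(4)[OF r] by (simp add: \<phi>_def)
    moreover have "\<psi> t = (\<integral>\<omega>. \<phi> (X t \<omega>) \<partial>P x)" unfolding \<psi>_def by (rule integral_law[OF \<phi>m t])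
    ultimately show ?thesis by simp
  qed
  define h where "h s = (\<integral>\<^sup>+y. ennreal (norm (b y) * indicator (ball x r) y) \<partial>law s x)" for s
  have nb: "(\<lambda>y. norm (b y)) \<in> borel_measurable borel" by measurable
  have bi[measurable]: "(\<lambda>y. norm (b y) * indicator (ball x r) y) \<in> borel_measurable borel"
    by (intro borel_measurable_times nb borel_measurable_indicator borel_open open_ball)
  have [measurable]: "h \<in> borel_measurable borel"
    unfolding h_def by (rule semigroup.nn_integral_kernel_measurable) measurable
  \<comment> \<open>The mean of \<open>|b|\<close> over the ball is known to be finite only for
    almost every \<open>s\<close>, which suffices since the inequality is integrated in
    time.\<close>
  have lower: "AE s in lborel. s \<in> {0..T} \<longrightarrow> - (k / r\<^sup>2) * \<psi> s - 6 / r * enn2real (h s) \<le> \<theta> s \<and> h s < \<infinity>"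
  proof -
    have "(\<integral>\<^sup>+s. indicator {0..T} s * h s \<partial>lborel) \<noteq> \<infinity>"
      using drift unfolding h_def[symmetric] by (auto simp: top_unique)
    then have 1: "AE s in lborel. indicator {0..T} s * h s \<noteq> \<infinity>" by (intro nn_integral_PInf_AE) auto
    have 2: "AE s in lborel. integrable (P x) (\<lambda>\<omega>. H T (s, \<omega>))" by (rule PX.AE_integrable_fst'[OF Hi[OF T]])
    show ?thesis using 1 2
    proof eventually_elim
      case (elim s)
      show ?case
      proof
        assume s: "s \<in> {0..T}"
        then have s0: "0 \<le> s" by simp
        have hs: "h s < \<infinity>" using elim(1) s by (simp add: less_top)
        have Li: "integrable (law s x) L" using elim(2) s integrable_law[OF Lm s0, of x] by (simp add: H_def)
        have bint: "integrable (law s x) (\<lambda>y. norm (b y) * indicator (ball x r) y)"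
          using hs bi by (intro integrableI_bounded) (auto simp: h_def law_def)
        have \<phi>i: "integrable (law s x) \<phi>"
          by (rule semigroup.integrable_kernel_bounded[where B=1]) (use \<phi>01 in auto)
        have hb: "enn2real (h s) = (\<integral>y. norm (b y) * indicator (ball x r) y \<partial>law s x)"
          unfolding h_def using bint by (subst nn_integral_eq_integral) (auto intro!: integral_nonneg_AE)
        have "- (k / r\<^sup>2) * \<psi> s - 6 / r * enn2real (h s) = (\<integral>y. - (k / r\<^sup>2) * \<phi> y - 6 / r * (norm (b y) * indicator (ball x r) y) \<partial>law s x)"
          unfolding hb \<psi>_def using \<phi>i bint by (subst Bochner_Integration.integral_diff) simp_all
        also have "\<dots> \<le> \<theta> s"
          unfolding \<theta>_def by (rule integral_mono[OF _ Li L_lower]) (use \<phi>i bint in simp)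
        finally show "- (k / r\<^sup>2) * \<psi> s - 6 / r * enn2real (h s) \<le> \<theta> s \<and> h s < \<infinity>" using hs by simp
      qed
    qed
  qed
  have hreal: "integrable lborel (\<lambda>s. indicator {0..T} s * enn2real (h s))" "(\<integral>s. indicator {0..T} s * enn2real (h s) \<partial>lborel) \<le> F"
  proof -
    have "(\<integral>\<^sup>+s. ennreal (indicator {0..T} s * enn2real (h s)) \<partial>lborel) \<le> (\<integral>\<^sup>+s. indicator {0..T} s * h s \<partial>lborel)"
      by (rule nn_integral_mono) (auto simp: indicator_def ennreal_enn2real_if)
    also have "\<dots> \<le> ennreal F" using drift unfolding h_def .
    finally have le: "(\<integral>\<^sup>+s. ennreal (indicator {0..T} s * enn2real (h s)) \<partial>lborel) \<le> ennreal F" .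
    then have "(\<integral>\<^sup>+s. ennreal (indicator {0..T} s * enn2real (h s)) \<partial>lborel) < \<infinity>" by (simp add: le_less_trans[OF _ ennreal_less_top])
    then show i: "integrable lborel (\<lambda>s. indicator {0..T} s * enn2real (h s))"
      by (intro integrableI_bounded) (auto simp: abs_mult)
    have "ennreal (\<integral>s. indicator {0..T} s * enn2real (h s) \<partial>lborel) \<le> ennreal F"
      using le nn_integral_eq_integral[OF i] by simp
    then show "(\<integral>s. indicator {0..T} s * enn2real (h s) \<partial>lborel) \<le> F" using F by simp
  qed
  have "exp (- (k / r\<^sup>2) * t) * \<psi> 0 \<le> \<psi> t + 6 / r * F"
  proof (rule backward_Gronwall[OF t(1)])
    show "0 < k / r\<^sup>2"
    proof -
      have "0 < 12 * \<delta> + 3 * (real CARD('n) / \<delta>)" using \<delta> by (simp add: add_pos_nonneg)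
      then show ?thesis using \<delta> r by (simp add: k)
    qed
    show "continuous_on {0..t} \<psi>" using \<psi>c by (rule continuous_on_subset) simp
    fix s assume s: "0 \<le> s" "s \<le> t"
    have \<psi>int: "integrable lborel (\<lambda>u. indicator {s..t} u *\<^sub>R \<psi> u)" "(\<integral>u. indicator {s..t} u *\<^sub>R \<psi> u \<partial>lborel) = integral {s..t} \<psi>"
    proof -
      have "set_integrable lborel {s..t} \<psi>"
        by (rule borel_integrable_atLeastAtMost') (rule continuous_on_subset[OF \<psi>c], simp)
      then show "integrable lborel (\<lambda>u. indicator {s..t} u *\<^sub>R \<psi> u)" "(\<integral>u. indicator {s..t} u *\<^sub>R \<psi> u \<partial>lborel) = integral {s..t} \<psi>"
        using set_borel_integral_eq_integral(2)[of "{s..t}" \<psi>] by (auto simp: set_integrable_def set_lebesgue_integral_def)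
    qed
    have "\<psi> s - \<psi> t = - ((\<integral>u. indicator {0..t} u *\<^sub>R \<theta> u \<partial>lborel) - (\<integral>u. indicator {0..s} u *\<^sub>R \<theta> u \<partial>lborel))"
      using \<psi>_eq[OF s(1)] \<psi>_eq[OF t(1)] by simp
    also have "\<dots> = - (\<integral>u. indicator {0..t} u *\<^sub>R \<theta> u - indicator {0..s} u *\<^sub>R \<theta> u \<partial>lborel)"
      using \<theta>i[OF s(1)] \<theta>i[OF t(1)] by simp
    also have "\<dots> \<le> - (\<integral>u. - (k / r\<^sup>2) * (indicator {s..t} u *\<^sub>R \<psi> u) - 6 / r * (indicator {0..T} u * enn2real (h u)) \<partial>lborel)"
    proof (rule le_imp_neg_le, rule integral_mono_AE)
      show "integrable lborel (\<lambda>u. - (k / r\<^sup>2) * (indicator {s..t} u *\<^sub>R \<psi> u) - 6 / r * (indicator {0..T} u * enn2real (h u)))"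
        using \<psi>int(1) hreal(1) by (intro Bochner_Integration.integrable_diff integrable_mult_right) auto
      show "integrable lborel (\<lambda>u. indicator {0..t} u *\<^sub>R \<theta> u - indicator {0..s} u *\<^sub>R \<theta> u)"
        using \<theta>i[OF s(1)] \<theta>i[OF t(1)] by (rule Bochner_Integration.integrable_diff[rotated])
      \<comment> \<open>The indicators of \<open>{0..t}\<close> and \<open>{0..s}\<close> differ by
        that of \<open>{s<..t}\<close>, whereas \<psi> is integrated over \<open>{s..t}\<close>; the
        single point \<open>u = s\<close> is discarded.\<close>
      have "AE u in lborel. u \<noteq> s" by (rule AE_lborel_singleton)
      with lower show "AE u in lborel. - (k / r\<^sup>2) * (indicator {s..t} u *\<^sub>R \<psi> u) - 6 / r * (indicator {0..T} u * enn2real (h u)) \<le> indicator {0..t} u *\<^sub>R \<theta> u - indicator {0..s} u *\<^sub>R \<theta> u"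
      proof eventually_elim
        case (elim u)
        consider "s < u \<and> u \<le> t" | "0 \<le> u \<and> u < s" | "\<not> (0 \<le> u \<and> u \<le> t)" using elim(2) s by linarith
        then show ?case
        proof cases
          case 1
          then show ?thesis using elim(1) s t by (simp add: indicator_def)
        next
          case 2
          then show ?thesis using s t r by (simp add: indicator_def)
        next
          case 3
          then show ?thesis using s t r by (auto simp: indicator_def)
        qed
      qed
    qed
    also have "\<dots> = (k / r\<^sup>2) * integral {s..t} \<psi> + 6 / r * (\<integral>u. indicator {0..T} u * enn2real (h u) \<partial>lborel)"
    proof (subst Bochner_Integration.integral_diff)
      show "integrable lborel (\<lambda>u. - (k / r\<^sup>2) * (indicator {s..t} u *\<^sub>R \<psi> u))" using \<psi>int(1) by (intro integrable_mult_right) auto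
      show "integrable lborel (\<lambda>u. 6 / r * (indicator {0..T} u * enn2real (h u)))" using hreal(1) by (intro integrable_mult_right) auto
      show "- ((\<integral>u. - (k / r\<^sup>2) * (indicator {s..t} u *\<^sub>R \<psi> u) \<partial>lborel) - (\<integral>u. 6 / r * (indicator {0..T} u * enn2real (h u)) \<partial>lborel))
         = (k / r\<^sup>2) * integral {s..t} \<psi> + 6 / r * (\<integral>u. indicator {0..T} u * enn2real (h u) \<partial>lborel)"
        unfolding integral_mult_right_zero \<psi>int(2) by simp
    qed
    also have "\<dots> \<le> (k / r\<^sup>2) * integral {s..t} \<psi> + 6 / r * F"
      using hreal(2) r by (intro add_left_mono mult_left_mono) auto
    finally show "\<psi> s \<le> \<psi> t + k / r\<^sup>2 * integral {s..t} \<psi> + 6 / r * F" by simp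
  qed
  moreover have "\<psi> 0 = 1" using \<psi>_eq[of 0]
  proof -
    have "\<psi> 0 = \<phi> x" unfolding \<psi>_def law_initial by (rule integral_return) auto
    then show ?thesis using bump_bounds(4)[OF r] by (simp add: \<phi>_def)
  qed
  moreover have "\<psi> t \<le> measure (law t x) (ball x r)"
  proof -
    have "\<psi> t \<le> (\<integral>y. indicator (ball x r) y \<partial>law t x)"
      unfolding \<psi>_def
    proof (rule integral_mono)
      show "integrable (law t x) \<phi>" by (rule semigroup.integrable_kernel_bounded[where B=1]) (use \<phi>01 in auto)
      show "integrable (law t x) (indicator (ball x r) :: _ \<Rightarrow> real)"
        by (rule semigroup.integrable_kernel_bounded[where B=1]) (auto intro!: borel_measurable_indicator)
      show "\<phi> y \<le> indicator (ball x r) y" for y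
        using bump_bounds(2)[OF r, of 3 x y] bump_bounds(3)[OF r, of y x 3] by (auto simp: \<phi>_def indicator_def)
    qed
    also have "\<dots> = measure (law t x) (ball x r)" by (simp add: law_def)
    finally show ?thesis .
  qed
  ultimately show ?thesis by simp
qed


section \<open>Translation and the resolvent estimate\<close>

text \<open>An equivalence for every \<open>D\<close> lets \<open>frechet_derivative\<close>, a
  choice among derivatives, make the same choice on both sides. Partial derivatives therefore
  commute with translations at every point, even where no derivative exists.\<close>

lemma has_derivative_translate_iff:
  fixes u :: "'a::real_normed_vector \<Rightarrow> 'b::real_normed_vector"
  shows "((\<lambda>y. u (y - z)) has_derivative D) (at x) \<longleftrightarrow> (u has_derivative D) (at (x - z))"
proof -
  have *: "((\<lambda>y. v (y - w)) has_derivative D) (at x)" if "(v has_derivative D) (at (x - w))"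
    for v :: "'a \<Rightarrow> 'b" and w x
  proof -
    have "((\<lambda>y. y - w) has_derivative (\<lambda>h. h)) (at x)" by (auto intro!: derivative_eq_intros)
    from has_derivative_compose[OF this that] show ?thesis by simp
  qed
  show ?thesis
  proof
    assume "((\<lambda>y. u (y - z)) has_derivative D) (at x)"
    then show "(u has_derivative D) (at (x - z))"
      using *[of "\<lambda>y. u (y - z)" "x - z" "- z"] by simp
  qed (rule *)
qed

lemma partial_D_translate:
  fixes u :: "real^'n::finite \<Rightarrow> real"
  shows "partial_D i (\<lambda>y. u (y - z)) x = partial_D i u (x - z)"
  unfolding partial_D_def frechet_derivative_def has_derivative_translate_iff ..

lemma differentiable_on_UNIV_translate:
  "u differentiable_on UNIV \<Longrightarrow> (\<lambda>y. u (y - z)) differentiable_on UNIV"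
  unfolding differentiable_on_def differentiable_def
  by (metis UNIV_I has_derivative_translate_iff)

lemma C2_compact_support_translate:
  fixes u :: "real^'n::finite \<Rightarrow> real"
  assumes "C2_compact_support u"
  shows "C2_compact_support (\<lambda>y. u (y - z))"
  unfolding C2_compact_support_def
proof (intro conjI allI)
  have eq: "partial_D i (\<lambda>y. v (y - z)) = (\<lambda>y. partial_D i v (y - z))" for i and v :: "real^'n \<Rightarrow> real"
    by (rule ext) (rule partial_D_translate)
  show "(\<lambda>y. u (y - z)) differentiable_on UNIV"
    using assms by (auto simp: C2_compact_support_def intro: differentiable_on_UNIV_translate)
  show "partial_D i (\<lambda>y. u (y - z)) differentiable_on UNIV" for i
    unfolding eq using assms by (auto simp: C2_compact_support_def intro: differentiable_on_UNIV_translate)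
  show "continuous_on UNIV (partial_D i (partial_D j (\<lambda>y. u (y - z))))" for i j
  proof -
    have c: "continuous_on UNIV (partial_D i (partial_D j u))"
      using assms unfolding C2_compact_support_def by blast
    have "continuous_on UNIV (\<lambda>y. y - z)" by (intro continuous_intros)
    then show ?thesis unfolding eq by (rule continuous_on_compose2[OF c _ subset_UNIV])
  qed
  have "{y. u (y - z) \<noteq> 0} = (+) z ` {y. u y \<noteq> 0}"
  proof (intro equalityI subsetI)
    fix y assume "y \<in> {y. u (y - z) \<noteq> 0}"
    then have "z + (y - z) \<in> (+) z ` {y. u y \<noteq> 0}" by (intro imageI) simp
    then show "y \<in> (+) z ` {y. u y \<noteq> 0}" by simp
  next
    fix y assume "y \<in> (+) z ` {y. u y \<noteq> 0}"
    then obtain w where "y = z + w" "u w \<noteq> 0" by blast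
    then show "y \<in> {y. u (y - z) \<noteq> 0}" by simp
  qed
  then have "closure {y. u (y - z) \<noteq> 0} = (+) z ` closure {y. u y \<noteq> 0}"
    by (simp add: closure_translation)
  then show "compact (closure {y. u (y - z) \<noteq> 0})"
    using assms by (simp add: C2_compact_support_def compact_translation)
qed

lemma diffusion_operator_translate:
  fixes u :: "real^'n::finite \<Rightarrow> real"
  shows "diffusion_operator a b (\<lambda>y. u (y - z)) x = diffusion_operator (\<lambda>y. a (y + z)) (\<lambda>y. b (y + z)) u (x - z)"
proof -
  have eq: "partial_D i (\<lambda>y. v (y - z)) = (\<lambda>y. partial_D i v (y - z))" for i and v :: "real^'n \<Rightarrow> real"
    by (rule ext) (rule partial_D_translate)
  show ?thesis unfolding diffusion_operator_def eq by simp
qed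

lemma continuous_markov_process_translate:
  fixes X :: "real \<Rightarrow> 'w \<Rightarrow> real^'n::finite"
  assumes "continuous_markov_process X M P"
  shows "continuous_markov_process (\<lambda>t \<omega>. X t \<omega> - z) M (\<lambda>x. P (x + z))"
proof -
  interpret continuous_markov_process X M P by fact
  have vim: "(\<lambda>y. y - z) -` \<Gamma> \<in> sets borel" if "\<Gamma> \<in> sets borel" for \<Gamma> :: "(real^'n) set"
    using measurable_sets[of "\<lambda>y. y - z" borel borel \<Gamma>] that by simp
  show ?thesis
  proof (rule continuous_markov_process.intro)
    fix x y :: "real^'n" and t s h :: real
    show "prob_space (P (x + z))" by (rule prob_space_P)
    show "sets (P (x + z)) = sets (P (y + z))" by (rule sets_P)
    show "0 \<le> t \<Longrightarrow> subalgebra (P (x + z)) (M t)" by (rule subalgebra_M)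
    show "0 \<le> s \<Longrightarrow> s \<le> t \<Longrightarrow> subalgebra (M t) (M s)" by (rule filtration_M)
    show "0 \<le> t \<Longrightarrow> (\<lambda>\<omega>. X t \<omega> - z) \<in> borel_measurable (M t)"
      by (intro borel_measurable_diff adapted borel_measurable_const)
    show "AE \<omega> in P (x + z). X 0 \<omega> - z = x"
      using start[of "x + z"] by eventually_elim simp
    show "0 \<le> t \<Longrightarrow> \<omega> \<in> space (P (x + z)) \<Longrightarrow> \<exists>\<omega>'\<in>space (P (x + z)). \<forall>s\<ge>0. X s \<omega>' - z = X (s + t) \<omega> - z" for \<omega>
      using shift[of t \<omega> "x + z"] by auto
    show "\<omega> \<in> space (P (x + z)) \<Longrightarrow> continuous_on {0..} (\<lambda>t. X t \<omega> - z)" for \<omega>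
      by (intro continuous_intros continuous_paths)
    fix \<Gamma> :: "(real^'n) set"
    assume \<Gamma>: "\<Gamma> \<in> sets borel"
    show "(\<lambda>x. measure (P (x + z)) {\<omega> \<in> space (P (x + z)). X t \<omega> - z \<in> \<Gamma>}) \<in> borel_measurable borel" if "0 \<le> t"
    proof -
      have "(\<lambda>x. measure (P x) {\<omega> \<in> space (P x). X t \<omega> \<in> (\<lambda>y. y - z) -` \<Gamma>}) \<in> borel_measurable borel"
        by (rule measurable_transition[OF that vim[OF \<Gamma>]])
      from measurable_compose[OF _ this, of "\<lambda>x. x + z" borel] show ?thesis by simp
    qed
    show "AE \<omega> in P (x + z). real_cond_exp (P (x + z)) (M s) (\<lambda>\<omega>'. indicator \<Gamma> (X (s + h) \<omega>' - z)) \<omega>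
        = measure (P (X s \<omega> - z + z)) {\<omega>' \<in> space (P (X s \<omega> - z + z)). X h \<omega>' - z \<in> \<Gamma>}" if "0 \<le> s" "0 \<le> h"
    proof -
      have "(\<lambda>\<omega>'. indicator ((\<lambda>y. y - z) -` \<Gamma>) (X (s + h) \<omega>')) = (\<lambda>\<omega>'. indicator \<Gamma> (X (s + h) \<omega>' - z) :: real)"
        by (auto simp: indicator_def)
      then show ?thesis using markov[OF that vim[OF \<Gamma>], of "x + z"] by simp
    qed
  qed
qed

text \<open>The known estimates concern paths started at \<open>0\<close>. Subtracting
  \<open>z\<close> from the paths and shifting the starting points gives a process of the same kind
  on the same sample space, with translated coefficients; its start at \<open>0\<close> is a start
  of the original process at \<open>z\<close>.\<close>

lemma quasi_diffusion_translate:
  fixes X :: "real \<Rightarrow> 'w \<Rightarrow> real^'n::finite"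
  assumes "quasi_diffusion a b X M P"
  shows "quasi_diffusion (\<lambda>y. a (y + z)) (\<lambda>y. b (y + z)) (\<lambda>t \<omega>. X t \<omega> - z) M (\<lambda>x. P (x + z))"
  unfolding quasi_diffusion_def
proof (intro conjI allI impI)
  show "continuous_markov_process (\<lambda>t \<omega>. X t \<omega> - z) M (\<lambda>x. P (x + z))"
    using assms by (intro continuous_markov_process_translate) (simp add: quasi_diffusion_def)
  fix x and t :: real assume t: "0 \<le> t"
  show "(\<integral>\<^sup>+\<omega>. (\<integral>\<^sup>+s\<in>{0..t}. ennreal (norm (b (X s \<omega> - z + z))) \<partial>lborel) \<partial>P (x + z)) < \<infinity>"
    using assms t by (simp add: quasi_diffusion_def)
  fix u :: "real^'n \<Rightarrow> real" assume u: "C2_compact_support u"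
  define v where "v = (\<lambda>y. u (y - z))"
  have v: "C2_compact_support v" unfolding v_def by (rule C2_compact_support_translate[OF u])
  have "v (x + z) = (\<integral>\<omega>. v (X t \<omega>) \<partial>P (x + z)) - (\<integral>\<omega>. (LINT s:{0..t}|lborel. diffusion_operator a b v (X s \<omega>)) \<partial>P (x + z))"
    using assms t v unfolding quasi_diffusion_def by blast
  then show "u x = (\<integral>\<omega>. u (X t \<omega> - z) \<partial>P (x + z))
     - (\<integral>\<omega>. (LINT s:{0..t}|lborel. diffusion_operator (\<lambda>y. a (y + z)) (\<lambda>y. b (y + z)) u (X s \<omega> - z)) \<partial>P (x + z))"
    unfolding v_def diffusion_operator_translate by simp
qed

lemma nn_integral_lborel_translate:
  fixes f :: "'a::euclidean_space \<Rightarrow> ennreal"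
  assumes "f \<in> borel_measurable borel"
  shows "(\<integral>\<^sup>+x. f (x + z) \<partial>lborel) = (\<integral>\<^sup>+x. f x \<partial>lborel)"
proof -
  have "(\<integral>\<^sup>+x. f x \<partial>lborel) = (\<integral>\<^sup>+x. f x \<partial>distr lborel borel ((+) z))"
    by (simp only: lborel_distr_plus)
  also have "\<dots> = (\<integral>\<^sup>+x. f (z + x) \<partial>lborel)" using assms by (intro nn_integral_distr) auto
  finally show ?thesis by (simp add: add.commute)
qed

lemma admissible_coefficients_translate:
  assumes "admissible_coefficients \<delta> \<beta> a b"
  shows "admissible_coefficients \<delta> \<beta> (\<lambda>y. a (y + z)) (\<lambda>y. b (y + z))"
proof -
  have [measurable]: "a \<in> borel_measurable borel" "b \<in> borel_measurable borel"
    using assms by (auto simp: admissible_coefficients_def)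
  have "(\<integral>\<^sup>+x. ennreal (norm (b (x + z)) powr q) \<partial>lborel) = (\<integral>\<^sup>+x. ennreal (norm (b x) powr q) \<partial>lborel)" for q
    by (rule nn_integral_lborel_translate) measurable
  then have "Lp_norm q UNIV (\<lambda>y. b (y + z)) = Lp_norm q UNIV b" for q
    by (simp add: Lp_norm_def)
  then show ?thesis using assms by (simp add: admissible_coefficients_def)
qed

lemma ennreal_powr_le:
  assumes "c \<le> ennreal A" "0 \<le> A" "0 < r"
  shows "ennreal_powr c r \<le> ennreal (A powr r)"
proof -
  have "c \<noteq> \<infinity>" using assms by (auto simp: top_unique)
  moreover have "enn2real c \<le> A" using assms by (auto intro: enn2real_leI)
  ultimately show ?thesis
    using assms by (auto simp: ennreal_powr_def intro!: ennreal_leI powr_mono2)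
qed

text \<open>For radius \<open>0\<close> the ball is empty, the occupation time is \<open>t\<close>
  itself, and the left side of the resolvent estimate becomes the resolvent at \<open>x\<close>.
  Normalising it by \<kappa> raises the power \<open>d / (2 * q) - 1\<close> of \<kappa> to
  \<open>d / (2 * q)\<close>. The weight measures distance from a ball of radius
  \<open>R\<^sub>0 / sqrt \<kappa>\<close>; replacing this ball by its centre costs
  \<open>exp (\<mu> * R\<^sub>0)\<close>.\<close>

lemma potential_bound_law:
  fixes X :: "real \<Rightarrow> 'w \<Rightarrow> real^'n::finite"
  assumes cmp: "continuous_markov_process X M P"
    and re: "resolvent_estimate q N \<mu> R\<^sub>0 (\<lambda>t \<omega>. X t \<omega> - x) (\<lambda>y. P (y + x))"
    and pos: "0 < q" "0 < N" "0 < \<mu>" "0 < R\<^sub>0" and \<kappa>: "0 < \<kappa>"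
    and f[measurable]: "f \<in> borel_measurable borel" and f0: "\<And>y. 0 \<le> f y" and A: "0 \<le> A"
    and fA: "(\<integral>\<^sup>+y. ennreal (exp (- (q * \<mu> * sqrt \<kappa> * dist y x)) * f y powr q) \<partial>lborel) \<le> ennreal A"
  shows "(\<integral>\<^sup>+s. erlang_density 0 \<kappa> s * (\<integral>\<^sup>+y. ennreal (f y) \<partial>continuous_markov_process.law X P s x) \<partial>lborel)
    \<le> ennreal (N * R\<^sub>0 powr (2 - real CARD('n) / q) * exp (\<mu> * R\<^sub>0) * \<kappa> powr (real CARD('n) / (2 * q)) * A powr (1 / q))"
proof -
  interpret continuous_markov_process X M P by fact
  define d where "d = real CARD('n)"
  define W where "W y = inverse (exp_weight \<mu> R\<^sub>0 0 \<kappa> y)" for y :: "real^'n"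
  define N' where "N' = N * R\<^sub>0 powr (2 - d / q)"
  have N': "0 < N'" using pos by (simp add: N'_def)
  have W: "0 \<le> W y" "W y \<le> exp (\<mu> * R\<^sub>0) * exp (- (\<mu> * sqrt \<kappa> * norm y))" for y
  proof -
    show "0 \<le> W y" by (simp add: W_def exp_weight_def)
    have "norm y - R\<^sub>0 / sqrt \<kappa> \<le> infdist y (ball 0 (R\<^sub>0 / sqrt \<kappa>))"
    proof -
      have ne: "ball 0 (R\<^sub>0 / sqrt \<kappa>) \<noteq> ({} :: (real^'n) set)"
        using centre_in_ball[of "0::real^'n" "R\<^sub>0 / sqrt \<kappa>"] divide_pos_pos[OF pos(4), of "sqrt \<kappa>"] \<kappa> by auto
      show ?thesis
        unfolding infdist_notempty[OF ne]
      proof (rule cINF_greatest[OF ne])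
        fix w :: "real^'n" assume "w \<in> ball 0 (R\<^sub>0 / sqrt \<kappa>)"
        then show "norm y - R\<^sub>0 / sqrt \<kappa> \<le> dist y w"
          using norm_triangle_sub[of y w] by (simp add: dist_norm)
      qed
    qed
    then have "sqrt \<kappa> * \<mu> * (norm y - R\<^sub>0 / sqrt \<kappa>) \<le> sqrt \<kappa> * \<mu> * infdist y (ball 0 (R\<^sub>0 / sqrt \<kappa>))"
      using pos \<kappa> by (intro mult_left_mono) auto
    moreover have "sqrt \<kappa> * \<mu> * (norm y - R\<^sub>0 / sqrt \<kappa>) = \<mu> * sqrt \<kappa> * norm y - \<mu> * R\<^sub>0"
      using \<kappa> by (simp add: field_simps)
    ultimately have "exp (- (sqrt \<kappa> * \<mu> * infdist y (ball 0 (R\<^sub>0 / sqrt \<kappa>)))) \<le> exp (\<mu> * R\<^sub>0 + - (\<mu> * sqrt \<kappa> * norm y))"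
      by simp
    also have "\<dots> = exp (\<mu> * R\<^sub>0) * exp (- (\<mu> * sqrt \<kappa> * norm y))" by (rule exp_add)
    finally show "W y \<le> exp (\<mu> * R\<^sub>0) * exp (- (\<mu> * sqrt \<kappa> * norm y))"
      by (simp add: W_def exp_weight_def exp_minus)
  qed
  have occ: "occupation_time (\<lambda>s. X s \<omega> - x) (- ball 0 0) t = t" if "0 \<le> t" for \<omega> t
    using that by (simp add: occupation_time_def set_lebesgue_integral_def)
  have "(\<integral>\<^sup>+\<omega>. (\<integral>\<^sup>+t\<in>{0..}. ennreal (exp (- \<kappa> * occupation_time (\<lambda>s. X s \<omega> - x) (- ball 0 0) t) * f (X t \<omega> - x + x)) \<partial>lborel) \<partial>P (0 + x))
      \<le> ennreal (N * (0 * sqrt \<kappa> + R\<^sub>0) powr (2 - real CARD('n) / q) * \<kappa> powr (real CARD('n) / (2 * q) - 1))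
         * Lp_norm q UNIV (\<lambda>y. inverse (exp_weight \<mu> R\<^sub>0 0 \<kappa> y) * f (y + x))"
  proof -
    have fm: "(\<lambda>y. f (y + x)) \<in> borel_measurable borel" by measurable
    show ?thesis
      using re[unfolded resolvent_estimate_def, rule_format, OF fm _ \<kappa> order_refl] f0 by simp
  qed
  also have "(\<integral>\<^sup>+\<omega>. (\<integral>\<^sup>+t\<in>{0..}. ennreal (exp (- \<kappa> * occupation_time (\<lambda>s. X s \<omega> - x) (- ball 0 0) t) * f (X t \<omega> - x + x)) \<partial>lborel) \<partial>P (0 + x))
     = (\<integral>\<^sup>+\<omega>. (\<integral>\<^sup>+t. ennreal (exp (- \<kappa> * t)) * indicator {0..} t * ennreal (f (X t \<omega>)) \<partial>lborel) \<partial>P x)"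
    using occ[unfolded ball_empty[OF order_refl] Compl_empty_eq]
    by (auto intro!: nn_integral_cong simp: ennreal_mult f0 split: split_indicator)
  also have "\<dots> = (\<integral>\<^sup>+s. (\<integral>\<^sup>+y. ennreal (exp (- \<kappa> * s)) * indicator {0..} s * ennreal (f y) \<partial>law s x) \<partial>lborel)"
    by (rule nn_integral_time_law) (auto simp: case_prod_beta')
  also have "\<dots> = (\<integral>\<^sup>+s. ennreal (1 / \<kappa>) * (erlang_density 0 \<kappa> s * (\<integral>\<^sup>+y. ennreal (f y) \<partial>law s x)) \<partial>lborel)"
  proof (rule nn_integral_cong)
    fix s
    have "(\<integral>\<^sup>+y. ennreal (exp (- \<kappa> * s)) * indicator {0..} s * ennreal (f y) \<partial>law s x)
      = ennreal (exp (- \<kappa> * s)) * indicator {0..} s * (\<integral>\<^sup>+y. ennreal (f y) \<partial>law s x)"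
      by (rule nn_integral_cmult) (simp add: law_def)
    moreover have "ennreal (exp (- \<kappa> * s)) * indicator {0..} s = ennreal (1 / \<kappa>) * ennreal (erlang_density 0 \<kappa> s)"
      using \<kappa> by (auto simp: erlang_density_def ennreal_mult[symmetric] indicator_def)
    ultimately show "(\<integral>\<^sup>+y. ennreal (exp (- \<kappa> * s)) * indicator {0..} s * ennreal (f y) \<partial>law s x)
      = ennreal (1 / \<kappa>) * (erlang_density 0 \<kappa> s * (\<integral>\<^sup>+y. ennreal (f y) \<partial>law s x))"
      by (simp only: mult.assoc)
  qed
  also have "\<dots> = ennreal (1 / \<kappa>) * (\<integral>\<^sup>+s. erlang_density 0 \<kappa> s * (\<integral>\<^sup>+y. ennreal (f y) \<partial>law s x) \<partial>lborel)"
  proof (rule nn_integral_cmult)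
    have "(\<lambda>s. \<integral>\<^sup>+y. ennreal (f y) \<partial>law s x) \<in> borel_measurable borel"
      by (rule semigroup.nn_integral_kernel_measurable) measurable
    then show "(\<lambda>s. ennreal (erlang_density 0 \<kappa> s) * (\<integral>\<^sup>+y. ennreal (f y) \<partial>law s x)) \<in> borel_measurable lborel"
      by (intro borel_measurable_times_ennreal) simp_all
  qed
  finally have 1: "ennreal (1 / \<kappa>) * (\<integral>\<^sup>+s. erlang_density 0 \<kappa> s * (\<integral>\<^sup>+y. ennreal (f y) \<partial>law s x) \<partial>lborel)
     \<le> ennreal (N' * \<kappa> powr (d / (2 * q) - 1)) * Lp_norm q UNIV (\<lambda>y. W y * f (y + x))"
    by (simp add: N'_def d_def W_def)
  have "Lp_norm q UNIV (\<lambda>y. W y * f (y + x)) \<le> ennreal ((exp (q * \<mu> * R\<^sub>0) * A) powr (1 / q))"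
    unfolding Lp_norm_def
  proof (rule ennreal_powr_le)
    have "(\<integral>\<^sup>+y\<in>UNIV. ennreal (norm (W y * f (y + x)) powr q) \<partial>lborel)
      \<le> (\<integral>\<^sup>+y. ennreal (exp (q * \<mu> * R\<^sub>0)) * ennreal (exp (- (q * \<mu> * sqrt \<kappa> * dist (y + x) x)) * f (y + x) powr q) \<partial>lborel)"
    proof (rule nn_integral_mono)
      fix y
      have "norm (W y * f (y + x)) powr q = W y powr q * f (y + x) powr q"
        using W f0 by (simp add: abs_mult powr_mult)
      also have "\<dots> \<le> (exp (\<mu> * R\<^sub>0) * exp (- (\<mu> * sqrt \<kappa> * norm y))) powr q * f (y + x) powr q"
        using W pos by (intro mult_right_mono powr_mono2) auto
      also have "(exp (\<mu> * R\<^sub>0) * exp (- (\<mu> * sqrt \<kappa> * norm y))) powr q = exp (q * \<mu> * R\<^sub>0) * exp (- (q * \<mu> * sqrt \<kappa> * dist (y + x) x))"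
        unfolding exp_add[symmetric] by (simp add: powr_def dist_norm algebra_simps)
      finally have "norm (W y * f (y + x)) powr q \<le> exp (q * \<mu> * R\<^sub>0) * (exp (- (q * \<mu> * sqrt \<kappa> * dist (y + x) x)) * f (y + x) powr q)"
        by (simp add: mult.assoc)
      then have "ennreal (norm (W y * f (y + x)) powr q) \<le> ennreal (exp (q * \<mu> * R\<^sub>0) * (exp (- (q * \<mu> * sqrt \<kappa> * dist (y + x) x)) * f (y + x) powr q))"
        by (rule ennreal_leI)
      then show "ennreal (norm (W y * f (y + x)) powr q) * indicator UNIV y \<le> ennreal (exp (q * \<mu> * R\<^sub>0)) * ennreal (exp (- (q * \<mu> * sqrt \<kappa> * dist (y + x) x)) * f (y + x) powr q)"
        by (simp add: ennreal_mult)
    qed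
    also have "\<dots> = ennreal (exp (q * \<mu> * R\<^sub>0)) * (\<integral>\<^sup>+y. ennreal (exp (- (q * \<mu> * sqrt \<kappa> * dist (y + x) x)) * f (y + x) powr q) \<partial>lborel)"
      by (rule nn_integral_cmult) measurable
    also have "(\<integral>\<^sup>+y. ennreal (exp (- (q * \<mu> * sqrt \<kappa> * dist (y + x) x)) * f (y + x) powr q) \<partial>lborel) = (\<integral>\<^sup>+y. ennreal (exp (- (q * \<mu> * sqrt \<kappa> * dist y x)) * f y powr q) \<partial>lborel)"
      by (rule nn_integral_lborel_translate[of "\<lambda>y. ennreal (exp (- (q * \<mu> * sqrt \<kappa> * dist y x)) * f y powr q)" x]) measurable
    also have "ennreal (exp (q * \<mu> * R\<^sub>0)) * \<dots> \<le> ennreal (exp (q * \<mu> * R\<^sub>0)) * ennreal A"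
      by (rule mult_left_mono[OF fA]) simp
    also have "\<dots> = ennreal (exp (q * \<mu> * R\<^sub>0) * A)" using A by (simp add: ennreal_mult)
    finally show "(\<integral>\<^sup>+y\<in>UNIV. ennreal (norm (W y * f (y + x)) powr q) \<partial>lborel) \<le> ennreal (exp (q * \<mu> * R\<^sub>0) * A)" .
  qed (use A pos in auto)
  also have "(exp (q * \<mu> * R\<^sub>0) * A) powr (1 / q) = exp (\<mu> * R\<^sub>0) * A powr (1 / q)"
    using A pos by (simp add: powr_mult) (simp add: powr_def)
  finally have 2: "Lp_norm q UNIV (\<lambda>y. W y * f (y + x)) \<le> ennreal (exp (\<mu> * R\<^sub>0) * A powr (1 / q))" .
  define I where "I = (\<integral>\<^sup>+s. erlang_density 0 \<kappa> s * (\<integral>\<^sup>+y. ennreal (f y) \<partial>law s x) \<partial>lborel)"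
  have "I = ennreal (\<kappa> * (1 / \<kappa>)) * I" using \<kappa> by simp
  also have "\<dots> = ennreal \<kappa> * (ennreal (1 / \<kappa>) * I)"
    using \<kappa> by (subst ennreal_mult) (auto simp: mult.assoc)
  also have "\<dots> \<le> ennreal \<kappa> * (ennreal (N' * \<kappa> powr (d / (2 * q) - 1)) * ennreal (exp (\<mu> * R\<^sub>0) * A powr (1 / q)))"
    unfolding I_def using order_trans[OF 1 mult_left_mono[OF 2]] by (intro mult_left_mono) auto
  also have "\<dots> = ennreal (\<kappa> * (N' * \<kappa> powr (d / (2 * q) - 1) * (exp (\<mu> * R\<^sub>0) * A powr (1 / q))))"
    using \<kappa> N' by (simp add: ennreal_mult)
  also have "\<kappa> * (N' * \<kappa> powr (d / (2 * q) - 1) * (exp (\<mu> * R\<^sub>0) * A powr (1 / q))) = N' * exp (\<mu> * R\<^sub>0) * (\<kappa> powr (d / (2 * q) - 1) * \<kappa>) * A powr (1 / q)"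
    by (simp only: mult_ac)
  also have "\<kappa> powr (d / (2 * q) - 1) * \<kappa> = \<kappa> powr (d / (2 * q))"
    using \<kappa> by (simp add: powr_diff)
  finally show ?thesis by (simp add: I_def N'_def d_def)
qed

section \<open>Smallness of the drift and the probability of staying\<close>

text \<open>The part of \<open>g\<close> above a height \<open>n\<close> has integral at most half
  of \<epsilon> over the whole space; the rest contributes at most \<open>n\<close> times the volume
  of the ball. Taking \<open>r\<^sub>0 \<le> 1\<close> allows the volume to be bounded by a multiple
  of \<open>r\<close> in every dimension.\<close>

lemma nn_integral_small_balls:
  fixes g :: "'a::euclidean_space \<Rightarrow> real"
  assumes g[measurable]: "g \<in> borel_measurable borel" and g0: "\<And>y. 0 \<le> g y"
    and fin: "(\<integral>\<^sup>+y. ennreal (g y) \<partial>lborel) < \<infinity>" and \<epsilon>: "0 < \<epsilon>"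
  obtains r\<^sub>0 where "0 < r\<^sub>0" "\<And>x r. 0 < r \<Longrightarrow> r \<le> r\<^sub>0 \<Longrightarrow> (\<integral>\<^sup>+y. ennreal (g y) * indicator (ball x r) y \<partial>lborel) \<le> ennreal \<epsilon>"
proof -
  define h where "h n y = ennreal (g y) * indicator {y. real n < g y} y" for n y
  have hm: "h n \<in> borel_measurable lborel" for n unfolding h_def by measurable
  have "(\<lambda>n. \<integral>\<^sup>+y. h n y \<partial>lborel) \<longlonglongrightarrow> (\<integral>\<^sup>+y. 0 \<partial>(lborel :: 'a measure))"
  proof (rule nn_integral_dominated_convergence[where w="\<lambda>y. ennreal (g y)"])
    show "AE y in (lborel :: 'a measure). h n y \<le> ennreal (g y)" for n
      by (auto simp: h_def split: split_indicator)
    have "(\<lambda>n. h n y) \<longlonglongrightarrow> 0" for y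
    proof (rule tendsto_eventually)
      have "\<forall>n\<ge>nat \<lceil>g y\<rceil>. h n y = 0"
      proof (intro allI impI)
        fix n assume "nat \<lceil>g y\<rceil> \<le> n"
        then have "g y \<le> real n" by linarith
        then show "h n y = 0" by (simp add: h_def)
      qed
      then show "\<forall>\<^sub>F n in sequentially. h n y = 0" unfolding eventually_sequentially by blast
    qed
    then show "AE y in (lborel :: 'a measure). (\<lambda>n. h n y) \<longlonglongrightarrow> 0" by simp
  qed (use hm fin in auto)
  then have "(\<lambda>n. \<integral>\<^sup>+y. h n y \<partial>lborel) \<longlonglongrightarrow> 0" by simp
  moreover have "0 < ennreal (\<epsilon> / 2)" using \<epsilon> by simp
  ultimately have "\<forall>\<^sub>F n in sequentially. (\<integral>\<^sup>+y. h n y \<partial>lborel) < ennreal (\<epsilon> / 2)"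
    by (rule order_tendstoD(2))
  then obtain n where n: "(\<integral>\<^sup>+y. h n y \<partial>lborel) < ennreal (\<epsilon> / 2)"
    unfolding eventually_sequentially by blast
  define V where "V = unit_ball_vol (DIM('a))"
  have V: "0 \<le> V" by (simp add: V_def)
  have nV: "0 < real n * V + 1" using V by (simp add: add_nonneg_pos)
  have half: "(real n * V + 1) * (\<epsilon> / (2 * (real n * V + 1))) = \<epsilon> / 2"
    using nV by (metis less_irrefl nonzero_mult_divide_mult_cancel_left times_divide_eq_right mult.commute)
  define r\<^sub>0 where "r\<^sub>0 = min 1 (\<epsilon> / (2 * (real n * V + 1)))"
  have "0 < r\<^sub>0" using \<epsilon> nV by (simp add: r\<^sub>0_def)
  moreover have "(\<integral>\<^sup>+y. ennreal (g y) * indicator (ball x r) y \<partial>lborel) \<le> ennreal \<epsilon>" if r: "0 < r" "r \<le> r\<^sub>0" for x r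
  proof -
    have "(\<integral>\<^sup>+y. ennreal (g y) * indicator (ball x r) y \<partial>lborel)
      \<le> (\<integral>\<^sup>+y. h n y + ennreal (real n) * indicator (ball x r) y \<partial>lborel)"
    proof (rule nn_integral_mono)
      fix y
      show "ennreal (g y) * indicator (ball x r) y \<le> h n y + ennreal (real n) * indicator (ball x r) y"
      proof (cases "real n < g y")
        case True
        then have "ennreal (g y) * indicator (ball x r) y \<le> h n y" by (auto simp: h_def split: split_indicator)
        then show ?thesis by (rule order_trans) simp
      next
        case False
        then have "ennreal (g y) \<le> ennreal (real n)" by (intro ennreal_leI) simp
        then show ?thesis by (rule order_trans[OF mult_right_mono]) simp_all
      qed
    qed
    also have "\<dots> = (\<integral>\<^sup>+y. h n y \<partial>lborel) + ennreal (real n) * emeasure lborel (ball x r)"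
    proof (subst nn_integral_add)
      show "(\<lambda>y. ennreal (real n) * indicator (ball x r) y) \<in> borel_measurable lborel"
        by (intro borel_measurable_times_ennreal borel_measurable_const borel_measurable_indicator) simp
    qed (use hm in \<open>simp_all add: nn_integral_cmult_indicator\<close>)
    also have "\<dots> \<le> ennreal (\<epsilon> / 2) + ennreal (\<epsilon> / 2)"
    proof (rule add_mono)
      have "r ^ DIM('a) \<le> r ^ 1" using r DIM_positive[where 'a='a]
        by (intro power_decreasing) (auto simp: r\<^sub>0_def Suc_leI)
      then have "real n * (V * r ^ DIM('a)) \<le> real n * V * r\<^sub>0"
        using r V by (simp add: mult.assoc mult_left_mono)
      also have "\<dots> \<le> (real n * V + 1) * r\<^sub>0" using \<open>0 < r\<^sub>0\<close> by (simp add: distrib_right)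
      also have "\<dots> \<le> (real n * V + 1) * (\<epsilon> / (2 * (real n * V + 1)))"
        using nV by (intro mult_left_mono) (auto simp: r\<^sub>0_def)
      also have "\<dots> = \<epsilon> / 2" by (rule half)
      finally have "ennreal (real n * (V * r ^ DIM('a))) \<le> ennreal (\<epsilon> / 2)" by (rule ennreal_leI)
      then show "ennreal (real n) * emeasure lborel (ball x r) \<le> ennreal (\<epsilon> / 2)"
        using r V by (simp add: emeasure_ball V_def[symmetric] ennreal_mult)
    qed (use n in simp)
    also have "\<dots> = ennreal \<epsilon>" using \<epsilon> by (simp add: ennreal_plus[symmetric] del: ennreal_plus)
    finally show ?thesis .
  qed
  ultimately show ?thesis by (rule that)
qed

text \<open>Over times up to \<open>T = \<kappa> * r\<^sup>2\<close> the potential bound with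
  exponent \<open>d\<close> makes the expected drift in the ball at most
  \<open>3 * C * sqrt \<kappa> * r * A powr (1 / d)\<close>, which is linear in \<open>r\<close>.
  This exactly compensates the factor \<open>6 / r\<close> of the bump, so shrinking the ball helps
  only through \<open>A\<close>, a bound for the integral of \<open>|b|^d\<close> over it.\<close>

lemma law_ball_lower_bound:
  fixes a :: "real^'n::finite \<Rightarrow> real^'n^'n"
  defines "d \<equiv> real CARD('n)"
  assumes qd: "quasi_diffusion a b X M P" and a: "a \<in> borel_measurable borel" "\<And>x. a x \<in> sym_eigenvalues_in \<delta>"
    and b[measurable]: "b \<in> borel_measurable borel" and \<delta>: "0 < \<delta>" and C: "0 < C" and \<kappa>: "0 < \<kappa>"
    and fin: "(\<integral>\<^sup>+y. ennreal (norm (b y) powr d) \<partial>lborel) < \<infinity>"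
    and pb: "\<And>l f A x. 0 < l \<Longrightarrow> f \<in> borel_measurable borel \<Longrightarrow> (\<And>y. 0 \<le> f y) \<Longrightarrow> 0 \<le> A \<Longrightarrow>
      (\<integral>\<^sup>+y. ennreal (f y powr d) \<partial>lborel) \<le> ennreal A \<Longrightarrow>
      (\<integral>\<^sup>+s. erlang_density 0 l s * (\<integral>\<^sup>+y. ennreal (f y) \<partial>continuous_markov_process.law X P s x) \<partial>lborel)
        \<le> ennreal (C * sqrt l * A powr (1 / d))"
  shows "\<exists>c>0. \<exists>r\<^sub>0>0. \<forall>r s x. 0 < r \<and> r \<le> r\<^sub>0 \<and> 0 \<le> s \<and> s \<le> \<kappa> * r\<^sup>2 \<longrightarrow>
      c \<le> measure (continuous_markov_process.law X P s x) (ball x r)"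
proof -
  interpret continuous_markov_process X M P using qd by (simp add: quasi_diffusion_def)
  define k where "k = (12 * \<delta> + 3 * (real CARD('n) / \<delta>))\<^sup>2 / (48 * \<delta>)"
  have k: "0 \<le> k" using \<delta> by (simp add: k_def)
  have d: "0 < d" by (simp add: d_def)
  define \<eta> where "\<eta> = exp (- (k * \<kappa>))"
  have \<eta>: "0 < \<eta>" by (simp add: \<eta>_def)
  \<comment> \<open>Chosen so that the drift costs half of \<eta>: it leads to
    \<open>F = r * \<eta> / 12\<close>. Here \<open>36 = 3 * 12\<close>, the \<open>3\<close> being
    that of \<open>indicator_le_erlang_density\<close>.\<close>
  define A where "A = (\<eta> / (36 * C * sqrt \<kappa>)) powr d"
  have A: "0 < A" using \<eta> C \<kappa> by (simp add: A_def)
  have A_root: "A powr (1 / d) = \<eta> / (36 * C * sqrt \<kappa>)"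
    using \<eta> C \<kappa> d by (simp add: A_def powr_powr)
  obtain r\<^sub>0 where r0: "0 < r\<^sub>0" and small: "\<And>x r. 0 < r \<Longrightarrow> r \<le> r\<^sub>0 \<Longrightarrow>
      (\<integral>\<^sup>+y. ennreal (norm (b y) powr d) * indicator (ball x r) y \<partial>lborel) \<le> ennreal A"
    by (rule nn_integral_small_balls[OF _ _ fin A]) (auto intro: that)
  have "\<eta> / 2 \<le> measure (law s x) (ball x r)" if r: "0 < r" "r \<le> r\<^sub>0" and s: "0 \<le> s" "s \<le> \<kappa> * r\<^sup>2" for r s x
  proof -
    define T where "T = \<kappa> * r\<^sup>2"
    have T: "0 < T" using \<kappa> r by (simp add: T_def)
    define F where "F = r * \<eta> / 12"
    have F: "0 \<le> F" using r \<eta> by (simp add: F_def)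
    define g where "g y = norm (b y) * indicator (ball x r) y" for y
    have gm[measurable]: "g \<in> borel_measurable borel" unfolding g_def
      by (intro borel_measurable_times borel_measurable_indicator) simp_all
    have drift: "(\<integral>\<^sup>+s. indicator {0..T} s * (\<integral>\<^sup>+y. ennreal (g y) \<partial>law s x) \<partial>lborel) \<le> ennreal F"
    proof -
      have "(\<integral>\<^sup>+s. indicator {0..T} s * (\<integral>\<^sup>+y. ennreal (g y) \<partial>law s x) \<partial>lborel)
        \<le> (\<integral>\<^sup>+s. ennreal (3 * T) * (erlang_density 0 (1/T) s * (\<integral>\<^sup>+y. ennreal (g y) \<partial>law s x)) \<partial>lborel)"
        using mult_right_mono[OF indicator_le_erlang_density[OF T]]
        by (intro nn_integral_mono) (simp only: mult.assoc[symmetric] zero_le)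
      also have "\<dots> = ennreal (3 * T) * (\<integral>\<^sup>+s. erlang_density 0 (1/T) s * (\<integral>\<^sup>+y. ennreal (g y) \<partial>law s x) \<partial>lborel)"
      proof (rule nn_integral_cmult)
        have "(\<lambda>s. \<integral>\<^sup>+y. ennreal (g y) \<partial>law s x) \<in> borel_measurable borel"
          by (rule semigroup.nn_integral_kernel_measurable) measurable
        then show "(\<lambda>s. ennreal (erlang_density 0 (1/T) s) * (\<integral>\<^sup>+y. ennreal (g y) \<partial>law s x)) \<in> borel_measurable lborel"
          by (intro borel_measurable_times_ennreal) simp_all
      qed
      also have "\<dots> \<le> ennreal (3 * T) * ennreal (C * sqrt (1/T) * A powr (1 / d))"
      proof (intro mult_left_mono pb)
        have "(\<integral>\<^sup>+y. ennreal (g y powr d) \<partial>lborel) = (\<integral>\<^sup>+y. ennreal (norm (b y) powr d) * indicator (ball x r) y \<partial>lborel)"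
          using d by (intro nn_integral_cong) (simp add: g_def split: split_indicator)
        then show "(\<integral>\<^sup>+y. ennreal (g y powr d) \<partial>lborel) \<le> ennreal A" using small[OF r] by simp
        show "g \<in> borel_measurable borel" by (rule gm)
        show "0 \<le> g y" for y by (simp add: g_def)
      qed (use T A in auto)
      also have "\<dots> = ennreal (3 * T * (C * sqrt (1/T) * A powr (1 / d)))"
        using T C by (intro ennreal_mult[symmetric]) auto
      also have "3 * T * (C * sqrt (1/T) * A powr (1 / d)) = F"
      proof -
        have "T * sqrt (1 / T) = sqrt T" using T by (simp add: real_sqrt_divide real_div_sqrt)
        also have "\<dots> = sqrt \<kappa> * r" using r by (simp add: T_def real_sqrt_mult)
        finally have *: "T * sqrt (1 / T) = sqrt \<kappa> * r" .
        have "3 * T * (C * sqrt (1/T) * A powr (1 / d)) = 3 * C * (T * sqrt (1/T)) * A powr (1 / d)" by simp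
        also have "\<dots> = 3 * C * (sqrt \<kappa> * r) * (\<eta> / (36 * C * sqrt \<kappa>))" unfolding * A_root ..
        also have "\<dots> = F" using C \<kappa> by (simp add: F_def)
        finally show ?thesis .
      qed
      finally show ?thesis .
    qed
    have "exp (- (k / r\<^sup>2) * s) - 6 / r * F \<le> measure (law s x) (ball x r)"
      using bump_lower_bound[OF qd a b \<delta> r(1) less_imp_le[OF T] F _ k_def s(1), of x] drift s
      by (simp add: g_def T_def)
    moreover have "\<eta> \<le> exp (- (k / r\<^sup>2) * s)"
    proof -
      have "k / r\<^sup>2 * s \<le> k / r\<^sup>2 * (\<kappa> * r\<^sup>2)" using s k by (intro mult_left_mono) auto
      also have "\<dots> = k * \<kappa>" using r by simp
      finally show ?thesis by (simp add: \<eta>_def)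
    qed
    moreover have "6 / r * F = \<eta> / 2" using r by (simp add: F_def)
    ultimately show ?thesis by linarith
  qed
  then have "\<forall>r s x. 0 < r \<and> r \<le> r\<^sub>0 \<and> 0 \<le> s \<and> s \<le> \<kappa> * r\<^sup>2 \<longrightarrow> \<eta> / 2 \<le> measure (law s x) (ball x r)"
    by blast
  with half_gt_zero[OF \<eta>] r0 show ?thesis by blast
qed

section \<open>Assembly and conclusion\<close>

text \<open>The resolvent estimate is used with two exponents: with \<open>p\<close> for the
  potential bound itself, and with the dimension \<open>d\<close>, admissible because
  \<open>d\<^sub>0 < d\<close>, for the drift, whose norm is controlled in
  \<open>L\<^sub>d\<close>.\<close>

lemma elliptic_semigroup_law:
  fixes a :: "real^'n::finite \<Rightarrow> real^'n^'n" and X :: "real \<Rightarrow> 'w \<Rightarrow> real^'n"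
  assumes \<delta>: "0 < \<delta>" and kr: "krylov_exponent TYPE('w) TYPE('n) \<delta> \<beta> d\<^sub>0"
    and ac: "admissible_coefficients \<delta> \<beta> a b" and qd: "quasi_diffusion a b X M P" and p: "d\<^sub>0 \<le> p"
  obtains N \<mu> where "elliptic_semigroup (continuous_markov_process.law X P) p N \<mu>"
proof -
  interpret continuous_markov_process X M P using qd by (simp add: quasi_diffusion_def)
  define d where "d = real CARD('n)"
  have d: "0 < d" by (simp add: d_def)
  have d0: "d / 2 < d\<^sub>0" "d\<^sub>0 < d" using kr by (auto simp: krylov_exponent_def d_def)
  have "\<exists>C \<mu>. 0 < C \<and> 0 < \<mu> \<and> (\<forall>\<kappa> f A x. 0 < \<kappa> \<longrightarrow> f \<in> borel_measurable borel \<longrightarrow> (\<forall>y. 0 \<le> f y) \<longrightarrow> 0 \<le> A \<longrightarrow>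
      (\<integral>\<^sup>+y. ennreal (exp (- (q * \<mu> * sqrt \<kappa> * dist y x)) * f y powr q) \<partial>lborel) \<le> ennreal A \<longrightarrow>
      (\<integral>\<^sup>+s. erlang_density 0 \<kappa> s * (\<integral>\<^sup>+y. ennreal (f y) \<partial>law s x) \<partial>lborel)
        \<le> ennreal (C * \<kappa> powr (d / (2 * q)) * A powr (1 / q)))" if q: "d\<^sub>0 \<le> q" for q
  proof -
    obtain N \<mu> R\<^sub>0 where N: "0 < N" and \<mu>: "0 < \<mu>" and R0: "2 \<le> R\<^sub>0" and re: "\<And>a b (X :: real \<Rightarrow> 'w \<Rightarrow> real^'n) M P.
          admissible_coefficients \<delta> \<beta> a b \<Longrightarrow> quasi_diffusion a b X M P \<Longrightarrow> resolvent_estimate q N \<mu> R\<^sub>0 X P"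
      using kr q unfolding krylov_exponent_def by blast
    define C where "C = N * R\<^sub>0 powr (2 - d / q) * exp (\<mu> * R\<^sub>0)"
    have C: "0 < C" using N R0 by (simp add: C_def)
    have "(\<integral>\<^sup>+s. erlang_density 0 \<kappa> s * (\<integral>\<^sup>+y. ennreal (f y) \<partial>law s x) \<partial>lborel)
        \<le> ennreal (C * \<kappa> powr (d / (2 * q)) * A powr (1 / q))"
      if "0 < \<kappa>" "f \<in> borel_measurable borel" "\<forall>y. 0 \<le> f y" "0 \<le> A"
        "(\<integral>\<^sup>+y. ennreal (exp (- (q * \<mu> * sqrt \<kappa> * dist y x)) * f y powr q) \<partial>lborel) \<le> ennreal A" for \<kappa> f A x
      unfolding C_def d_def
    proof (rule potential_bound_law)
      show "continuous_markov_process X M P" by (rule continuous_markov_process_axioms)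
      show "resolvent_estimate q N \<mu> R\<^sub>0 (\<lambda>t \<omega>. X t \<omega> - x) (\<lambda>y. P (y + x))"
        by (rule re[OF admissible_coefficients_translate[OF ac] quasi_diffusion_translate[OF qd]])
      show "0 < q" using d d0 q by linarith
      show "0 < R\<^sub>0" using R0 by linarith
    qed (use that N \<mu> in auto)
    with C \<mu> show ?thesis by blast
  qed
  note PB = this
  obtain N \<mu> where N: "0 < N" and \<mu>: "0 < \<mu>" and Np: "\<And>\<kappa> f A x. 0 < \<kappa> \<Longrightarrow> f \<in> borel_measurable borel \<Longrightarrow> (\<And>y. 0 \<le> f y) \<Longrightarrow> 0 \<le> A \<Longrightarrow>
      (\<integral>\<^sup>+y. ennreal (exp (- (p * \<mu> * sqrt \<kappa> * dist y x)) * f y powr p) \<partial>lborel) \<le> ennreal A \<Longrightarrow>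
      (\<integral>\<^sup>+s. erlang_density 0 \<kappa> s * (\<integral>\<^sup>+y. ennreal (f y) \<partial>law s x) \<partial>lborel)
        \<le> ennreal (N * \<kappa> powr (d / (2 * p)) * A powr (1 / p))"
    using PB[OF p] by blast
  obtain C \<nu> where C: "0 < C" and \<nu>: "0 < \<nu>" and Cd: "\<And>\<kappa> f A x. 0 < \<kappa> \<Longrightarrow> f \<in> borel_measurable borel \<Longrightarrow> (\<And>y. 0 \<le> f y) \<Longrightarrow> 0 \<le> A \<Longrightarrow>
      (\<integral>\<^sup>+y. ennreal (exp (- (d * \<nu> * sqrt \<kappa> * dist y x)) * f y powr d) \<partial>lborel) \<le> ennreal A \<Longrightarrow>
      (\<integral>\<^sup>+s. erlang_density 0 \<kappa> s * (\<integral>\<^sup>+y. ennreal (f y) \<partial>law s x) \<partial>lborel)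
        \<le> ennreal (C * \<kappa> powr (d / (2 * d)) * A powr (1 / d))"
    using PB[OF less_imp_le[OF d0(2)]] by blast
  have bm: "b \<in> borel_measurable borel" and a: "a \<in> borel_measurable borel" "\<And>x. a x \<in> sym_eigenvalues_in \<delta>"
    using ac by (auto simp: admissible_coefficients_def)
  have "(\<integral>\<^sup>+y. ennreal (norm (b y) powr d) \<partial>lborel) \<noteq> \<infinity>"
  proof
    assume "(\<integral>\<^sup>+y. ennreal (norm (b y) powr d) \<partial>lborel) = \<infinity>"
    then have "Lp_norm d UNIV b = \<infinity>" by (simp add: Lp_norm_def ennreal_powr_def)
    then show False using ac by (simp add: admissible_coefficients_def d_def top_unique)
  qed
  then have b_fin: "(\<integral>\<^sup>+y. ennreal (norm (b y) powr d) \<partial>lborel) < \<infinity>" by (simp add: less_top)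
  have "elliptic_semigroup law p N \<mu>"
  proof (intro elliptic_semigroup.intro elliptic_semigroup_axioms.intro)
    show "markov_semigroup law" by (rule semigroup.markov_semigroup_axioms)
    show "0 < p" using d d0 p by linarith
    show "\<exists>c>0. \<exists>r\<^sub>0>0. \<forall>r s x. 0 < r \<and> r \<le> r\<^sub>0 \<and> 0 \<le> s \<and> s \<le> \<kappa> * r\<^sup>2 \<longrightarrow> c \<le> measure (law s x) (ball x r)" if "0 < \<kappa>" for \<kappa>
    proof (rule law_ball_lower_bound[OF qd a bm \<delta> C that])
      show "(\<integral>\<^sup>+y. ennreal (norm (b y) powr real CARD('n)) \<partial>lborel) < \<infinity>" using b_fin by (simp add: d_def)
      fix l A :: real and f :: "real^'n \<Rightarrow> real" and x :: "real^'n"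
      assume l: "0 < l" and f: "f \<in> borel_measurable borel" "\<And>y. 0 \<le> f y" and A: "0 \<le> A"
        and fA: "(\<integral>\<^sup>+y. ennreal (f y powr real CARD('n)) \<partial>lborel) \<le> ennreal A"
      have "(\<integral>\<^sup>+y. ennreal (exp (- (d * \<nu> * sqrt l * dist y x)) * f y powr d) \<partial>lborel) \<le> (\<integral>\<^sup>+y. ennreal (f y powr d) \<partial>lborel)"
        using d \<nu> l by (intro nn_integral_mono ennreal_leI mult_left_le_one_le) auto
      also have "\<dots> \<le> ennreal A" using fA by (simp add: d_def)
      finally have "(\<integral>\<^sup>+y. ennreal (exp (- (d * \<nu> * sqrt l * dist y x)) * f y powr d) \<partial>lborel) \<le> ennreal A" .
      with l f A have "(\<integral>\<^sup>+s. erlang_density 0 l s * (\<integral>\<^sup>+y. ennreal (f y) \<partial>law s x) \<partial>lborel)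
        \<le> ennreal (C * l powr (d / (2 * d)) * A powr (1 / d))" by (rule Cd)
      moreover have "l powr (d / (2 * d)) = sqrt l" using d l by (simp add: powr_half_sqrt)
      ultimately show "(\<integral>\<^sup>+s. erlang_density 0 l s * (\<integral>\<^sup>+y. ennreal (f y) \<partial>law s x) \<partial>lborel)
        \<le> ennreal (C * sqrt l * A powr (1 / real CARD('n)))"
        by (simp only: d_def)
    qed
    show "(\<integral>\<^sup>+s. erlang_density 0 \<kappa> s * (\<integral>\<^sup>+y. ennreal (f y) \<partial>law s x) \<partial>lborel)
        \<le> ennreal (N * \<kappa> powr (DIM(real^'n) / (2 * p)) * A powr (1 / p))"
      if "0 < \<kappa>" "f \<in> borel_measurable borel" "\<And>y. 0 \<le> f y" "0 \<le> A"
        "(\<integral>\<^sup>+y. ennreal (exp (- (p * \<mu> * sqrt \<kappa> * dist y x)) * f y powr p) \<partial>lborel) \<le> ennreal A" for \<kappa> f A x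
      using Np[OF that] by (simp add: d_def)
  qed (fact N \<mu>)+
  then show ?thesis by (rule that)
qed

text \<open>Integrability is part of the conclusion because \<open>transition_op\<close> is an
  integral with default value \<open>0\<close>; it certifies that \<open>T\<^sub>t f\<close> is
  given almost everywhere by a convergent expectation.\<close>

theorem corollary4p11:
  fixes a :: "real^'n::finite \<Rightarrow> real^'n^'n"
    and b :: "real^'n \<Rightarrow> real^'n"
    and X :: "real \<Rightarrow> 'w \<Rightarrow> real^'n"
    and M :: "real \<Rightarrow> 'w measure"
    and P :: "real^'n \<Rightarrow> 'w measure"
    and f :: "real^'n \<Rightarrow> real"
    and \<delta> \<beta> d\<^sub>0 p :: real
  assumes "0 < \<delta>" and "\<delta> < 1" and "0 < \<beta>"
    and "krylov_exponent TYPE('w) TYPE('n) \<delta> \<beta> d\<^sub>0"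
    and "admissible_coefficients \<delta> \<beta> a b"
    and "quasi_diffusion a b X M P"
    and "d\<^sub>0 \<le> p"
    and "f \<in> borel_measurable borel" and "Lp_norm p UNIV f < \<infinity>"
  shows "(\<forall>t>0. AE x in lborel. integrable (P x) (\<lambda>\<omega>. f (X t \<omega>))) \<and>
    ((\<lambda>t. Lp_norm p UNIV (\<lambda>x. transition_op X P t f x - f x)) \<longlongrightarrow> 0) (at_right 0)"
proof -
  interpret continuous_markov_process X M P using assms by (simp add: quasi_diffusion_def)
  obtain N \<mu> where "elliptic_semigroup law p N \<mu>"
    by (rule elliptic_semigroup_law[OF assms(1,4-7)])
  then interpret elliptic_semigroup law p N \<mu> .
  have fin: "(\<integral>\<^sup>+y. ennreal (\<bar>f y\<bar> powr p) \<partial>lborel) < \<infinity>"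
  proof -
    have "(\<integral>\<^sup>+y. ennreal (\<bar>f y\<bar> powr p) \<partial>lborel) \<noteq> \<infinity>"
      using assms(9) by (auto simp: Lp_norm_def ennreal_powr_def)
    then show ?thesis by (simp add: less_top)
  qed
  have "((\<lambda>t. Lp_norm p UNIV (\<lambda>x. transition_op X P t f x - f x)) \<longlongrightarrow> 0) (at_right 0)"
  proof (rule order_tendstoI)
    fix e :: ennreal assume "0 < e"
    then obtain e' where e': "0 < e'" "e' < e" using dense by blast
    then have "e' < top" using less_le_trans[OF e'(2) top_greatest] by simp
    then obtain \<epsilon> where "e' = ennreal \<epsilon>" "0 \<le> \<epsilon>" by (cases e') auto
    with e' have \<epsilon>: "0 < \<epsilon>" "ennreal \<epsilon> < e" by auto
    \<comment> \<open>Strong continuity has been shown for the \<open>p\<close>-th power of the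
      norm, hence the threshold \<open>\<epsilon> powr p\<close>.\<close>
    have "\<forall>\<^sub>F t in at_right 0. (\<integral>\<^sup>+x. ennreal (\<bar>(\<integral>y. f y \<partial>law t x) - f x\<bar> powr p) \<partial>lborel) < ennreal (\<epsilon> powr p)"
      using \<epsilon> by (intro order_tendstoD(2)[OF strong_continuity(2)[OF assms(8) fin]]) simp
    moreover have "\<forall>\<^sub>F t in at_right 0. t \<in> {0<..<1::real}" by (rule eventually_at_right_real) simp
    ultimately show "\<forall>\<^sub>F t in at_right 0. Lp_norm p UNIV (\<lambda>x. transition_op X P t f x - f x) < e"
    proof eventually_elim
      case (elim t)
      have "transition_op X P t f x = (\<integral>y. f y \<partial>law t x)" for x
        using elim integral_law[OF assms(8), of t x] by (simp add: transition_op_def)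
      then have "(\<integral>\<^sup>+x\<in>UNIV. ennreal (norm (transition_op X P t f x - f x) powr p) \<partial>lborel) \<le> ennreal (\<epsilon> powr p)"
        using elim by simp
      then have "Lp_norm p UNIV (\<lambda>x. transition_op X P t f x - f x) \<le> ennreal ((\<epsilon> powr p) powr (1 / p))"
        unfolding Lp_norm_def using pos by (intro ennreal_powr_le) auto
      also have "(\<epsilon> powr p) powr (1 / p) = \<epsilon>" using \<epsilon> pos by (simp add: powr_powr)
      finally show ?case using \<epsilon>(2) by (rule le_less_trans)
    qed
  qed simp
  moreover have "AE x in lborel. integrable (P x) (\<lambda>\<omega>. f (X t \<omega>))" if "0 < t" for t
    using strong_continuity(1)[OF assms(8) fin that] that by (simp add: integrable_law[OF assms(8)])
  ultimately show ?thesis by blast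
qed

end
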